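(* Let $\delta$ be an ordinal of cardinality at most $\mathfrak c$ (the cardinality of the continuum), and let $(G_\alpha)_{\alpha\le\delta}$ be a chain of groups $$G_0\le G_1\le\cdots\le G_\alpha\le G_{\alpha+1}\le\cdots\le G_\delta$$ (each a subgroup of the subsequent ones) such that $G_\lambda=\bigcup_{\alpha<\lambda}G_\alpha$ for each limit ordinal $\lambda\le\delta$. Suppose that for each successor ordinal $\alpha+1\le\delta$ one of the following holds: (i) $G_{\alpha+1}=G_\alpha *_{C_\alpha}F_\alpha$, where $F_\alpha$ is a nontrivial subgroup of $G_\alpha$, and either $C_\alpha=\{1\}$ or $C_\alpha=C_{G_\alpha}(u)=C_{F_\alpha}(u)$ for some nontrivial $u\in F_\alpha$; (ii) $G_{\alpha+1}$ is an extension of a centralizer of $G_\alpha$. Suppose that the cardinality of $G_0$ is less than $\mathfrak c$. Then $G_\delta$ is a $BP$-group embeddable to $G_{\mathbb R}[[r]]$ if and only if $G_0$ is a $BP$-group embeddable to $G_{\mathbb R}[[r]]$.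
   Context: $G_{\mathbb R}[[r]]$ is the group of formal power series of the form $r+\sum_{i=1}^\infty c_i r^{i+1}$, $c_i\in\mathbb R$, under composition of series. A group $A$ is embeddable to a group $B$ if there is an injective homomorphism $A\to B$. $C_G(u)$ denotes the centralizer of an element $u$ in a group $G$. Commutator: $[a,b]=aba^{-1}b^{-1}$. $BP$-group (big powers condition): a tuple $u=(u_1,\dots,u_k)$, $k\in\mathbb N$, of nontrivial elements of a group $G$ is commutation-free if $[u_i,u_{i+1}]\ne 1$ for all $1\le i\le k-1$. It is independent if there is an integer $n=n(u)\in\mathbb N$ such that $u_1^{\alpha_1}\cdots u_k^{\alpha_k}\ne 1$ for any integers $\alpha_1,\dots,\alpha_k\ge n$. $G$ is a $BP$-group if every commutation-free tuple in $G$ is independent. An extension of a centralizer of a group $G$ is the group $\langle G,t\mid [c,t]=1,\ c\in C_G(u)\rangle$ for some nontrivial $u\in G$; it contains $G$ in the natural way. In (i), $G_\alpha*_{C_\alpha}F_\alpha$ is the free product of $G_\alpha$ and a (separate) copy of the group $F_\alpha$, amalgamated along $C_\alpha$ via the inclusions $C_\alpha\le G_\alpha$ and $C_\alpha\le F_\alpha$ (the ordinary free product if $C_\alpha=\{1\}$); $G_\alpha$ is included in $G_{\alpha+1}$ as the first factor. *)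

theory Defs
  imports
    "HOL-Algebra.Group"
    "HOL-Computational_Algebra.Formal_Power_Series"
    "HOL-Library.Equipollence"
begin

section \<open>The group of formal power series under composition\<close>

definition subst_group :: "real fps monoid" where
  "subst_group =
     \<lparr>carrier = {f. fps_nth f 0 = 0 \<and> fps_nth f 1 = 1},
      monoid.mult = (\<lambda>f g. f oo g),
      one = fps_X\<rparr>"

lemma subst_group_is_group: "group subst_group"
proof (rule groupI)
  fix f g assume "f \<in> carrier subst_group" "g \<in> carrier subst_group"
  then show "f \<otimes>\<^bsub>subst_group\<^esub> g \<in> carrier subst_group"
    by (simp add: subst_group_def fps_compose_nth)
next
  fix f g h assume "f \<in> carrier subst_group" "g \<in> carrier subst_group" "h \<in> carrier subst_group"
  then show "f \<otimes>\<^bsub>subst_group\<^esub> g \<otimes>\<^bsub>subst_group\<^esub> h = f \<otimes>\<^bsub>subst_group\<^esub> (g \<otimes>\<^bsub>subst_group\<^esub> h)"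
    by (simp add: subst_group_def fps_compose_assoc)
next
  fix f assume "f \<in> carrier subst_group"
  then have f0: "fps_nth f 0 = 0" and f1: "fps_nth f 1 = 1"
    by (simp_all add: subst_group_def)
  have inv: "fps_inv f oo f = fps_X"
    using f0 f1 by (intro fps_inv) auto
  have "fps_nth (fps_inv f) 0 = 0"
    by (simp add: fps_inv_def)
  moreover have "fps_nth (fps_inv f) 1 = 1"
    using f1 by (simp add: fps_inv_def)
  ultimately show "\<exists>g\<in>carrier subst_group. g \<otimes>\<^bsub>subst_group\<^esub> f = \<one>\<^bsub>subst_group\<^esub>"
    using inv by (intro bexI[of _ "fps_inv f"]) (auto simp: subst_group_def)
qed (auto simp: subst_group_def)

definition embeddable :: "('a, 'c) monoid_scheme \<Rightarrow> ('b, 'd) monoid_scheme \<Rightarrow> bool" where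
  "embeddable A B \<longleftrightarrow> (\<exists>h. h \<in> mon A B)"


section \<open>Centralizers and the big powers condition\<close>

definition centralizer :: "('a, 'b) monoid_scheme \<Rightarrow> 'a \<Rightarrow> 'a set" where
  "centralizer G u = {x \<in> carrier G. x \<otimes>\<^bsub>G\<^esub> u = u \<otimes>\<^bsub>G\<^esub> x}"

definition group_commutator :: "('a, 'b) monoid_scheme \<Rightarrow> 'a \<Rightarrow> 'a \<Rightarrow> 'a" where
  "group_commutator G a b = a \<otimes>\<^bsub>G\<^esub> b \<otimes>\<^bsub>G\<^esub> inv\<^bsub>G\<^esub> a \<otimes>\<^bsub>G\<^esub> inv\<^bsub>G\<^esub> b"

text \<open>A tuple has length at least 1; the empty product would be trivial.\<close>

definition nontrivial_tuple :: "('a, 'b) monoid_scheme \<Rightarrow> 'a list \<Rightarrow> bool" where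
  "nontrivial_tuple G us \<longleftrightarrow> us \<noteq> [] \<and> set us \<subseteq> carrier G - {\<one>\<^bsub>G\<^esub>}"

definition commutation_free :: "('a, 'b) monoid_scheme \<Rightarrow> 'a list \<Rightarrow> bool" where
  "commutation_free G us \<longleftrightarrow>
     (\<forall>i. Suc i < length us \<longrightarrow> group_commutator G (us ! i) (us ! Suc i) \<noteq> \<one>\<^bsub>G\<^esub>)"

definition power_product :: "('a, 'b) monoid_scheme \<Rightarrow> 'a list \<Rightarrow> int list \<Rightarrow> 'a" where
  "power_product G us as =
     foldr (\<lambda>(u, a) x. (u [^]\<^bsub>G\<^esub> a) \<otimes>\<^bsub>G\<^esub> x) (zip us as) \<one>\<^bsub>G\<^esub>"

definition independent_tuple :: "('a, 'b) monoid_scheme \<Rightarrow> 'a list \<Rightarrow> bool" where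
  "independent_tuple G us \<longleftrightarrow>
     (\<exists>n::nat. \<forall>as::int list. length as = length us \<longrightarrow> (\<forall>a\<in>set as. a \<ge> int n) \<longrightarrow>
        power_product G us as \<noteq> \<one>\<^bsub>G\<^esub>)"

definition BP_group :: "('a, 'b) monoid_scheme \<Rightarrow> bool" where
  "BP_group G \<longleftrightarrow> group G \<and>
     (\<forall>us. nontrivial_tuple G us \<longrightarrow> commutation_free G us \<longrightarrow> independent_tuple G us)"


section \<open>Groups given by generators and relations\<close>

text \<open>The letter \<open>(x, True)\<close> stands for the generator \<open>x\<close> and \<open>(x, False)\<close> for its inverse.
  A pair \<open>(u, v)\<close> of words in \<open>R\<close> is the relation \<open>u = v\<close>.\<close>

type_synonym 'x gword = "('x \<times> bool) list"

definition gwords :: "'x set \<Rightarrow> 'x gword set" where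
  "gwords X = {w. fst ` set w \<subseteq> X}"

inductive pres_eq :: "'x set \<Rightarrow> ('x gword \<times> 'x gword) set \<Rightarrow> 'x gword \<Rightarrow> 'x gword \<Rightarrow> bool"
  for X :: "'x set" and R :: "('x gword \<times> 'x gword) set" where
  refl: "u \<in> gwords X \<Longrightarrow> pres_eq X R u u"
| sym: "pres_eq X R u v \<Longrightarrow> pres_eq X R v u"
| trans: "pres_eq X R u v \<Longrightarrow> pres_eq X R v w \<Longrightarrow> pres_eq X R u w"
| append: "pres_eq X R u u' \<Longrightarrow> pres_eq X R v v' \<Longrightarrow> pres_eq X R (u @ v) (u' @ v')"
| cancel: "x \<in> X \<Longrightarrow> pres_eq X R [(x, b), (x, \<not> b)] []"
| rel: "(u, v) \<in> R \<Longrightarrow> u \<in> gwords X \<Longrightarrow> v \<in> gwords X \<Longrightarrow> pres_eq X R u v"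

definition pres_class :: "'x set \<Rightarrow> ('x gword \<times> 'x gword) set \<Rightarrow> 'x gword \<Rightarrow> 'x gword set" where
  "pres_class X R u = {v. pres_eq X R u v}"

definition presented_group ::
    "'x set \<Rightarrow> ('x gword \<times> 'x gword) set \<Rightarrow> 'x gword set monoid" where
  "presented_group X R =
     \<lparr>carrier = pres_class X R ` gwords X,
      monoid.mult = (\<lambda>A B. {w. \<exists>u\<in>A. \<exists>v\<in>B. pres_eq X R (u @ v) w}),
      one = pres_class X R []\<rparr>"

lemma pres_eq_gwords: "pres_eq X R u v \<Longrightarrow> u \<in> gwords X \<and> v \<in> gwords X"
  by (induction rule: pres_eq.induct) (auto simp: gwords_def)

lemma pres_class_eq_iff:
  "u \<in> gwords X \<Longrightarrow> pres_class X R u = pres_class X R v \<longleftrightarrow> pres_eq X R u v"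
  unfolding pres_class_def
  by (blast intro: pres_eq.refl pres_eq.sym pres_eq.trans)

lemma pres_class_mult:
  assumes "u \<in> gwords X" "v \<in> gwords X"
  shows "pres_class X R u \<otimes>\<^bsub>presented_group X R\<^esub> pres_class X R v = pres_class X R (u @ v)"
  using assms unfolding presented_group_def pres_class_def
  by (auto intro: pres_eq.intros)

lemma presented_group_is_group: "group (presented_group X R)"
proof -
  let ?P = "presented_group X R"
  have carr: "carrier ?P = pres_class X R ` gwords X" and one: "\<one>\<^bsub>?P\<^esub> = pres_class X R []"
    by (simp_all add: presented_group_def)
  have [simp]: "[] \<in> gwords X" and app: "\<And>u v. u \<in> gwords X \<Longrightarrow> v \<in> gwords X \<Longrightarrow> u @ v \<in> gwords X"
    by (auto simp: gwords_def)
  have linv: "\<exists>v\<in>gwords X. pres_eq X R (v @ u) []" if "u \<in> gwords X" for u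
    using that
  proof (induction u)
    case Nil
    then show ?case by (intro bexI[of _ "[]"]) (simp_all add: pres_eq.refl)
  next
    case (Cons a u)
    obtain x b where a: "a = (x, b)" by force
    with Cons.prems have x: "x \<in> X" and u: "u \<in> gwords X" by (auto simp: gwords_def)
    with Cons.IH obtain v where v: "v \<in> gwords X" "pres_eq X R (v @ u) []" by blast
    have xw: "[(x, \<not> b)] \<in> gwords X" using x by (simp add: gwords_def)
    have "pres_eq X R (v @ ([(x, \<not> b), (x, \<not> \<not> b)] @ u)) (v @ ([] @ u))"
      using x u v by (intro pres_eq.append pres_eq.cancel pres_eq.refl)
    then have "pres_eq X R ((v @ [(x, \<not> b)]) @ a # u) []"
      using v(2) a by (auto intro: pres_eq.trans)
    then show ?case using v(1) xw app by blast
  qed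
  show ?thesis
  proof (rule groupI)
    fix A assume "A \<in> carrier ?P"
    then obtain u where u: "u \<in> gwords X" "A = pres_class X R u" by (auto simp: carr)
    with linv obtain v where v: "v \<in> gwords X" "pres_eq X R (v @ u) []" by blast
    then have "pres_class X R v \<otimes>\<^bsub>?P\<^esub> A = \<one>\<^bsub>?P\<^esub>"
      using u app by (simp add: pres_class_mult one pres_class_eq_iff)
    then show "\<exists>B\<in>carrier ?P. B \<otimes>\<^bsub>?P\<^esub> A = \<one>\<^bsub>?P\<^esub>"
      using v by (auto simp: carr)
  qed (auto simp: carr one pres_class_mult app)
qed


section \<open>Amalgamated free products and extensions of centralizers\<close>

text \<open>The multiplication table of \<open>H\<close>, where \<open>\<iota> x\<close> is the generator that represents \<open>x\<close>.\<close>

definition table_rels ::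
    "('a \<Rightarrow> 'x) \<Rightarrow> ('a, 'b) monoid_scheme \<Rightarrow> ('x gword \<times> 'x gword) set" where
  "table_rels \<iota> H =
     {([(\<iota> x, True), (\<iota> y, True)], [(\<iota> (x \<otimes>\<^bsub>H\<^esub> y), True)]) | x y. x \<in> carrier H \<and> y \<in> carrier H}"

text \<open>The two factors are made disjoint by the sum type, so that \<open>F\<close> may be a subgroup of \<open>G\<close>.
  \<open>C\<close> is meant to be a common subgroup of \<open>G\<close> and \<open>F\<close>.\<close>

definition amalgam_gens :: "('a, 'b) monoid_scheme \<Rightarrow> ('a, 'c) monoid_scheme \<Rightarrow> ('a + 'a) set" where
  "amalgam_gens G F = carrier G <+> carrier F"

definition amalgam_rels ::
    "('a, 'b) monoid_scheme \<Rightarrow> ('a, 'c) monoid_scheme \<Rightarrow> 'a set \<Rightarrow>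
     (('a + 'a) gword \<times> ('a + 'a) gword) set" where
  "amalgam_rels G F C =
     table_rels Inl G \<union> table_rels Inr F \<union> {([(Inl c, True)], [(Inr c, True)]) | c. c \<in> C}"

definition amalgam ::
    "('a, 'b) monoid_scheme \<Rightarrow> ('a, 'c) monoid_scheme \<Rightarrow> 'a set \<Rightarrow> ('a + 'a) gword set monoid" where
  "amalgam G F C = presented_group (amalgam_gens G F) (amalgam_rels G F C)"

definition amalgam_incl ::
    "('a, 'b) monoid_scheme \<Rightarrow> ('a, 'c) monoid_scheme \<Rightarrow> 'a set \<Rightarrow> 'a \<Rightarrow> ('a + 'a) gword set" where
  "amalgam_incl G F C g = pres_class (amalgam_gens G F) (amalgam_rels G F C) [(Inl g, True)]"

text \<open>In the extension of a centralizer, \<open>Some g\<close> is the generator for \<open>g \<in> G\<close> and \<open>None\<close> is the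
  stable letter \<open>t\<close>.\<close>

definition centr_ext_gens :: "('a, 'b) monoid_scheme \<Rightarrow> 'a option set" where
  "centr_ext_gens G = insert None (Some ` carrier G)"

definition centr_ext_rels ::
    "('a, 'b) monoid_scheme \<Rightarrow> 'a \<Rightarrow> ('a option gword \<times> 'a option gword) set" where
  "centr_ext_rels G u =
     table_rels Some G \<union>
     {([(Some c, True), (None, True), (Some c, False), (None, False)], []) | c. c \<in> centralizer G u}"

definition centr_ext :: "('a, 'b) monoid_scheme \<Rightarrow> 'a \<Rightarrow> 'a option gword set monoid" where
  "centr_ext G u = presented_group (centr_ext_gens G) (centr_ext_rels G u)"

definition centr_ext_incl :: "('a, 'b) monoid_scheme \<Rightarrow> 'a \<Rightarrow> 'a \<Rightarrow> 'a option gword set" where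
  "centr_ext_incl G u g = pres_class (centr_ext_gens G) (centr_ext_rels G u) [(Some g, True)]"

text \<open>\<open>H = G *\<^sub>C F\<close> and \<open>H = \<langle>G, t | [c, t] = 1, c \<in> C\<^sub>G(u)\<rangle>\<close>, both for a group \<open>H\<close> that contains \<open>G\<close>:
  \<open>H\<close> is isomorphic to the constructed group by an isomorphism that is the identity on \<open>G\<close>.\<close>

definition is_amalgam ::
    "('a, 'b) monoid_scheme \<Rightarrow> ('a, 'c) monoid_scheme \<Rightarrow> ('a, 'd) monoid_scheme \<Rightarrow> 'a set \<Rightarrow> bool"
  where
  "is_amalgam H G F C \<longleftrightarrow>
     (\<exists>\<psi> \<in> iso (amalgam G F C) H. \<forall>g\<in>carrier G. \<psi> (amalgam_incl G F C g) = g)"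

definition is_centr_ext :: "('a, 'b) monoid_scheme \<Rightarrow> ('a, 'c) monoid_scheme \<Rightarrow> bool" where
  "is_centr_ext H G \<longleftrightarrow>
     (\<exists>u \<in> carrier G - {\<one>\<^bsub>G\<^esub>}.
        \<exists>\<psi> \<in> iso (centr_ext G u) H. \<forall>g\<in>carrier G. \<psi> (centr_ext_incl G u g) = g)"


section \<open>Chains of groups\<close>

definition is_subgroup_of :: "('a, 'b) monoid_scheme \<Rightarrow> ('a, 'c) monoid_scheme \<Rightarrow> bool" where
  "is_subgroup_of H G \<longleftrightarrow> group H \<and> group G \<and> carrier H \<subseteq> carrier G \<and>
     (\<forall>x\<in>carrier H. \<forall>y\<in>carrier H. x \<otimes>\<^bsub>H\<^esub> y = x \<otimes>\<^bsub>G\<^esub> y)"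

text \<open>Ordinals are the elements of a well-ordered type: an element \<open>\<delta>\<close> stands for the order type of
  \<open>{..<\<delta>}\<close>.\<close>

definition ord_zero :: "'i::wellorder" where
  "ord_zero = (LEAST \<alpha>. True)"

definition ord_succ :: "'i::wellorder \<Rightarrow> 'i \<Rightarrow> bool" where
  "ord_succ \<alpha> \<beta> \<longleftrightarrow> \<alpha> < \<beta> \<and> (\<forall>\<gamma>. \<alpha> < \<gamma> \<longrightarrow> \<beta> \<le> \<gamma>)"

definition ord_limit :: "'i::wellorder \<Rightarrow> bool" where
  "ord_limit \<beta> \<longleftrightarrow> \<beta> \<noteq> ord_zero \<and> (\<nexists>\<alpha>. ord_succ \<alpha> \<beta>)"

end

theory Submission
  imports Defs "HOL-Complex_Analysis.Complex_Analysis"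
begin

text \<open>The embeddings of the groups of the chain are built by transfinite recursion, each extending the
  previous ones. At most continuum many steps are needed, so one can reserve two real numbers for each
  step such that all of them are algebraically independent over the coefficients of \<open>G\<^sub>0\<close>; at
  every stage the coefficients used so far form a ring over which the next two numbers are transcendental.

  A nontrivial series \<open>u\<close> has iterates \<open>u\<^sup>s\<close> with real exponents, whose coefficients are
  polynomials in \<open>s\<close>. For an extension of a centralizer one sends the stable letter to
  \<open>u\<^sup>s\<close>, and for an amalgamated product one conjugates the second factor by \<open>u\<^sup>s\<close>,
  with \<open>s\<close> transcendental. If a word died, it would die for all integers in place of \<open>s\<close>,
  which the big powers condition excludes; the same specializations discriminate the new group by the
  old one, so it is again a BP-group. A free product over a nonabelian group becomes of this kind after
  one extension of a centralizer, since \<open>u\<^sup>s v\<close> then commutes with no nontrivial element of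
  the group.

  If \<open>G\<^sub>\<alpha>\<close> is abelian, its image is kept among the series \<open>r / (1 + l r)\<close>, and
  in a free product the second factor is rescaled by a parameter \<open>t\<close> and conjugated by
  \<open>r / (1 - s r\<^sup>2)\<close>. In the limit \<open>s = t / \<kappa>\<close>, \<open>t \<rightarrow> \<infinity>\<close>, the words become
  words in upper and lower unitriangular matrices over the polynomials in \<open>\<kappa>\<close>, where
  growth of traces gives both faithfulness and the big powers condition.\<close>

text \<open>A word that vanishes for one exponent n is not yet a relation between big powers: it is
  such a product times a fixed last factor, which disappears when two exponents are compared. That
  neighbours in the tuple do not commute rests on a fact about series: a conjugate of w that
  commutes with w is w itself, since conjugation keeps the leading coefficient, and this coefficient
  determines a series inside a centralizer.

  The free product over an abelian group resists this method. A group discriminated by an abelian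
  group is abelian, so the big powers condition has to come from matrices; and a centralizer
  extension of an abelian group is abelian, so it supplies no w with trivial centralizer.
  Faithfulness meets a further obstacle: a formal identity speaks about r near 0, whereas the limit
  to fractional linear maps is taken at bounded x = 1 / r. In that coordinate, for s > 0, the words
  are real-analytic on the whole line, and the identity theorem carries the relation from infinity
  to [0, 1].

  Two numbers are reserved per step because both kinds of free product consume two.\<close>

definition qsubring :: "real set \<Rightarrow> bool" where
  "qsubring S \<longleftrightarrow> \<rat> \<subseteq> S \<and> (\<forall>x\<in>S. \<forall>y\<in>S. x + y \<in> S \<and> x * y \<in> S)"

text \<open>Coefficient rings are kept as sets of reals, not as types, because the ring grows with
  the stage of the chain. A polynomial over such a ring is then a real polynomial with restricted
  coefficients.\<close>

definition polys :: "real set \<Rightarrow> real poly set" where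
  "polys S = {p. \<forall>i. coeff p i \<in> S}"

definition transc :: "real set \<Rightarrow> real \<Rightarrow> bool" where
  "transc S s \<longleftrightarrow> (\<forall>p\<in>polys S. poly p s = 0 \<longrightarrow> p = 0)"

definition adjoin :: "real set \<Rightarrow> real \<Rightarrow> real set" where
  "adjoin S s = (\<lambda>p. poly p s) ` polys S"

definition polyfn :: "real set \<Rightarrow> (real \<Rightarrow> real) set" where
  "polyfn S = poly ` polys S"

definition fps_over :: "real set \<Rightarrow> real fps set" where
  "fps_over S = {f. \<forall>n. fps_nth f n \<in> S}"

text \<open>Polynomial dependence is required of each coefficient separately, with no bound on the
  degrees. Two families can thus be compared one coefficient at a time, where agreement at
  infinitely many parameters, or at one transcendental one, is decisive.\<close>

definition polyfam :: "real set \<Rightarrow> (real \<Rightarrow> real fps) set" where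
  "polyfam S = {F. \<forall>n. (\<lambda>\<sigma>. fps_nth (F \<sigma>) n) \<in> polyfn S}"

lemma qsubringD:
  assumes "qsubring S"
  shows "x \<in> \<rat> \<Longrightarrow> x \<in> S" "x \<in> S \<Longrightarrow> y \<in> S \<Longrightarrow> x + y \<in> S" "x \<in> S \<Longrightarrow> y \<in> S \<Longrightarrow> x * y \<in> S"
    "x \<in> S \<Longrightarrow> - x \<in> S" "x \<in> S \<Longrightarrow> y \<in> S \<Longrightarrow> x - y \<in> S" "0 \<in> S" "1 \<in> S"
proof -
  have neg: "- x \<in> S" if "x \<in> S" for x
  proof -
    have "(-1) * x \<in> S" using assms that unfolding qsubring_def by (meson Rats_1 Rats_minus_iff subsetD)
    then show ?thesis by simp
  qed
  show "x \<in> S \<Longrightarrow> - x \<in> S" by (rule neg)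
  show "x \<in> S \<Longrightarrow> y \<in> S \<Longrightarrow> x - y \<in> S"
    using neg[of y] assms unfolding qsubring_def by (metis diff_conv_add_uminus)
qed (use assms in \<open>auto simp: qsubring_def\<close>)

lemma qsubring_sum: "qsubring S \<Longrightarrow> (\<And>i. i \<in> A \<Longrightarrow> f i \<in> S) \<Longrightarrow> sum f A \<in> S"
  by (induction A rule: infinite_finite_induct) (auto intro: qsubringD)

lemma qsubring_power: "qsubring S \<Longrightarrow> x \<in> S \<Longrightarrow> x ^ n \<in> S"
  by (induction n) (auto intro: qsubringD)

lemma qsubring_UNIV: "qsubring UNIV"
  by (simp add: qsubring_def)

lemma polys_add: "qsubring S \<Longrightarrow> p \<in> polys S \<Longrightarrow> q \<in> polys S \<Longrightarrow> p + q \<in> polys S"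
  by (auto simp: polys_def intro: qsubringD)

lemma polys_diff: "qsubring S \<Longrightarrow> p \<in> polys S \<Longrightarrow> q \<in> polys S \<Longrightarrow> p - q \<in> polys S"
  by (auto simp: polys_def intro: qsubringD)

lemma polys_mult: "qsubring S \<Longrightarrow> p \<in> polys S \<Longrightarrow> q \<in> polys S \<Longrightarrow> p * q \<in> polys S"
  by (auto simp: polys_def coeff_mult intro!: qsubring_sum intro: qsubringD)

lemma polys_pCons: "c \<in> S \<Longrightarrow> p \<in> polys S \<Longrightarrow> pCons c p \<in> polys S"
  by (auto simp: polys_def coeff_pCons split: nat.split)

lemma polys_0: "qsubring S \<Longrightarrow> 0 \<in> polys S"
  by (auto simp: polys_def intro: qsubringD)

lemma qsubring_poly: "qsubring S \<Longrightarrow> p \<in> polys S \<Longrightarrow> x \<in> S \<Longrightarrow> poly p x \<in> S"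
  unfolding poly_altdef polys_def by (auto intro!: qsubring_sum intro: qsubringD qsubring_power)

lemma polyfn_const: "qsubring S \<Longrightarrow> c \<in> S \<Longrightarrow> (\<lambda>\<sigma>. c) \<in> polyfn S"
  unfolding polyfn_def by (rule image_eqI[of _ _ "[:c:]"]) (auto intro!: polys_pCons polys_0)

lemma polyfn_id: "qsubring S \<Longrightarrow> (\<lambda>\<sigma>. \<sigma>) \<in> polyfn S"
  unfolding polyfn_def
  by (rule image_eqI[of _ _ "[:0, 1:]"]) (auto intro!: polys_pCons polys_0 qsubringD)

lemma polyfn_add: "qsubring S \<Longrightarrow> f \<in> polyfn S \<Longrightarrow> g \<in> polyfn S \<Longrightarrow> (\<lambda>\<sigma>. f \<sigma> + g \<sigma>) \<in> polyfn S"
  unfolding polyfn_def by (auto intro!: image_eqI[OF _ polys_add])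

lemma polyfn_diff: "qsubring S \<Longrightarrow> f \<in> polyfn S \<Longrightarrow> g \<in> polyfn S \<Longrightarrow> (\<lambda>\<sigma>. f \<sigma> - g \<sigma>) \<in> polyfn S"
proof -
  assume S: "qsubring S" and "f \<in> polyfn S" "g \<in> polyfn S"
  then obtain p q where pq: "p \<in> polys S" "q \<in> polys S" "f = poly p" "g = poly q"
    by (auto simp: polyfn_def)
  have "(\<lambda>\<sigma>. f \<sigma> - g \<sigma>) = poly (p - q)" by (simp add: pq fun_eq_iff)
  then show ?thesis using polys_diff[OF S pq(1,2)] by (auto simp: polyfn_def)
qed

lemma polyfn_mult: "qsubring S \<Longrightarrow> f \<in> polyfn S \<Longrightarrow> g \<in> polyfn S \<Longrightarrow> (\<lambda>\<sigma>. f \<sigma> * g \<sigma>) \<in> polyfn S"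
  unfolding polyfn_def by (auto intro!: image_eqI[OF _ polys_mult])

lemma polyfn_sum:
  "qsubring S \<Longrightarrow> (\<And>i. i \<in> A \<Longrightarrow> f i \<in> polyfn S) \<Longrightarrow> (\<lambda>\<sigma>. \<Sum>i\<in>A. f i \<sigma>) \<in> polyfn S"
  by (induction A rule: infinite_finite_induct) (auto intro: polyfn_const polyfn_add qsubringD)

lemma polyfn_prod:
  "qsubring S \<Longrightarrow> (\<And>i. i \<in> A \<Longrightarrow> f i \<in> polyfn S) \<Longrightarrow> (\<lambda>\<sigma>. \<Prod>i\<in>A. f i \<sigma>) \<in> polyfn S"
  by (induction A rule: infinite_finite_induct) (auto intro: polyfn_const polyfn_mult qsubringD)

lemma polyfn_power: "qsubring S \<Longrightarrow> f \<in> polyfn S \<Longrightarrow> (\<lambda>\<sigma>. f \<sigma> ^ n) \<in> polyfn S"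
  by (induction n) (auto intro: polyfn_const polyfn_mult qsubringD)

lemma polyfn_scale:
  assumes "qsubring S" "f \<in> polyfn S" "c \<in> S" shows "(\<lambda>\<sigma>. f (\<sigma> * c)) \<in> polyfn S"
proof -
  obtain p where p: "p \<in> polys S" "f = poly p" using assms by (auto simp: polyfn_def)
  have "(\<lambda>\<sigma>. \<Sum>i\<le>degree p. coeff p i * (\<sigma> * c) ^ i) \<in> polyfn S"
    using assms p(1)
    by (intro polyfn_sum polyfn_mult polyfn_power polyfn_const polyfn_id) (auto simp: polys_def)
  then show ?thesis by (simp add: p(2) poly_altdef)
qed

lemma polyfn_eq_infinite:
  assumes "f \<in> polyfn S" "g \<in> polyfn S" "infinite {\<sigma>. f \<sigma> = g \<sigma>}"
  shows "f = g"
proof -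
  obtain p q where pq: "f = poly p" "g = poly q" using assms by (auto simp: polyfn_def)
  have "p - q = 0"
    using assms(3) poly_roots_finite[of "p - q"] by (auto simp: pq)
  then show ?thesis by (simp add: pq)
qed

lemma polyfn_transc_eq:
  assumes "qsubring S" "f \<in> polyfn S" "g \<in> polyfn S" "transc S s" "f s = g s"
  shows "f = g"
proof -
  obtain p q where pq: "f = poly p" "g = poly q" "p \<in> polys S" "q \<in> polys S"
    using assms by (auto simp: polyfn_def)
  have "p - q = 0"
    using assms(4,5) polys_diff[OF assms(1) pq(3,4)] by (auto simp: pq transc_def)
  then show ?thesis by (simp add: pq)
qed

lemma adjoin_eq: "adjoin S s = (\<lambda>f. f s) ` polyfn S"
  by (auto simp: adjoin_def polyfn_def)

lemma qsubring_adjoin: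
  assumes "qsubring S" shows "qsubring (adjoin S s)"
  unfolding qsubring_def
proof (intro conjI ballI)
  show "\<rat> \<subseteq> adjoin S s"
    using polyfn_const[OF assms qsubringD(1)[OF assms]] by (force simp: adjoin_eq)
  fix x y assume "x \<in> adjoin S s" "y \<in> adjoin S s"
  then obtain f g where fg: "f \<in> polyfn S" "g \<in> polyfn S" "x = f s" "y = g s"
    by (auto simp: adjoin_eq)
  show "x + y \<in> adjoin S s" unfolding adjoin_eq
    by (rule image_eqI[OF _ polyfn_add[OF assms fg(1,2)]]) (simp add: fg)
  show "x * y \<in> adjoin S s" unfolding adjoin_eq
    by (rule image_eqI[OF _ polyfn_mult[OF assms fg(1,2)]]) (simp add: fg)
qed

lemma adjoin_superset: "qsubring S \<Longrightarrow> S \<subseteq> adjoin S s"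
  using polyfn_const by (force simp: adjoin_eq)

lemma adjoin_gen: "qsubring S \<Longrightarrow> s \<in> adjoin S s"
  using polyfn_id by (force simp: adjoin_eq)

lemma fps_mult_over: "qsubring S \<Longrightarrow> f \<in> fps_over S \<Longrightarrow> g \<in> fps_over S \<Longrightarrow> f * g \<in> fps_over S"
  by (auto simp: fps_over_def fps_mult_nth intro!: qsubring_sum intro: qsubringD)

lemma fps_over_mono: "S \<subseteq> T \<Longrightarrow> f \<in> fps_over S \<Longrightarrow> f \<in> fps_over T"
  by (auto simp: fps_over_def)

lemma polyfam_const: "qsubring S \<Longrightarrow> f \<in> fps_over S \<Longrightarrow> (\<lambda>\<sigma>. f) \<in> polyfam S"
  by (auto simp: polyfam_def fps_over_def intro: polyfn_const)

lemma polyfam_mult: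
  "qsubring S \<Longrightarrow> F \<in> polyfam S \<Longrightarrow> G \<in> polyfam S \<Longrightarrow> (\<lambda>\<sigma>. F \<sigma> * G \<sigma>) \<in> polyfam S"
  by (auto simp: polyfam_def fps_mult_nth intro!: polyfn_sum polyfn_mult)

lemma polyfam_power:
  "qsubring S \<Longrightarrow> F \<in> polyfam S \<Longrightarrow> (\<lambda>\<sigma>. F \<sigma> ^ n) \<in> polyfam S"
  by (induction n) (auto intro!: polyfam_mult polyfam_const simp: fps_over_def fps_one_nth intro: qsubringD)

lemma polyfam_compose:
  "qsubring S \<Longrightarrow> F \<in> polyfam S \<Longrightarrow> G \<in> polyfam S \<Longrightarrow> (\<lambda>\<sigma>. F \<sigma> oo G \<sigma>) \<in> polyfam S"
  using polyfam_power[of S G]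
  by (auto simp: polyfam_def fps_compose_nth intro!: polyfn_sum polyfn_mult)

lemma polyfam_scale:
  "qsubring S \<Longrightarrow> F \<in> polyfam S \<Longrightarrow> c \<in> S \<Longrightarrow> (\<lambda>\<sigma>. F (\<sigma> * c)) \<in> polyfam S"
  unfolding polyfam_def using polyfn_scale by blast

lemma polyfam_adjoin: "F \<in> polyfam S \<Longrightarrow> F s \<in> fps_over (adjoin S s)"
  by (auto simp: polyfam_def fps_over_def adjoin_eq)

text \<open>The passage from the transcendental parameter to all others: each coefficient of the
  difference is a polynomial over \<open>S\<close> with root \<open>s\<close>, hence the zero
  polynomial.\<close>

lemma polyfam_transc_eq:
  assumes "qsubring S" "F \<in> polyfam S" "G \<in> polyfam S" "transc S s" "F s = G s"
  shows "F \<sigma> = G \<sigma>"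
proof (rule fps_ext)
  fix n
  show "fps_nth (F \<sigma>) n = fps_nth (G \<sigma>) n"
    using polyfn_transc_eq[of S "\<lambda>\<sigma>. fps_nth (F \<sigma>) n" "\<lambda>\<sigma>. fps_nth (G \<sigma>) n" s] assms
    by (auto simp: polyfam_def dest: fun_cong)
qed

text \<open>The difference of two corresponding coefficients is a polynomial with infinitely many
  roots. Laws of integer iteration are extended to real exponents in this way.\<close>

lemma polyfam_nat_eq:
  assumes "F \<in> polyfam UNIV" "G \<in> polyfam UNIV" "\<And>n::nat. F (real n) = G (real n)"
  shows "F \<sigma> = G \<sigma>"
proof (rule fps_ext)
  fix n
  have "range real \<subseteq> {\<sigma>. fps_nth (F \<sigma>) n = fps_nth (G \<sigma>) n}" using assms(3) by auto
  then have "infinite {\<sigma>. fps_nth (F \<sigma>) n = fps_nth (G \<sigma>) n}"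
    using finite_subset range_inj_infinite[OF inj_of_nat[where 'a=real]] by blast
  then show "fps_nth (F \<sigma>) n = fps_nth (G \<sigma>) n"
    using polyfn_eq_infinite[of "\<lambda>\<sigma>. fps_nth (F \<sigma>) n" UNIV "\<lambda>\<sigma>. fps_nth (G \<sigma>) n"] assms
    by (auto simp: polyfam_def dest: fun_cong)
qed

text \<open>The recursion for the coefficients of the compositional inverse divides only by powers
  of the linear coefficient. As this is 1, nothing leaves the polynomials over
  \<open>S\<close>.\<close>

lemma polyfam_fps_inv:
  assumes S: "qsubring S" and F: "F \<in> polyfam S" and F1: "\<And>\<sigma>. fps_nth (F \<sigma>) 1 = 1"
  shows "(\<lambda>\<sigma>. fps_inv (F \<sigma>)) \<in> polyfam S"
proof -
  have "(\<lambda>\<sigma>. compinv (F \<sigma>) n) \<in> polyfn S" for n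
  proof (induction n rule: less_induct)
    case (less n)
    show ?case
    proof (cases n)
      case 0
      then show ?thesis by (auto intro: polyfn_const S qsubringD[OF S])
    next
      case (Suc m)
      have "(\<lambda>\<sigma>. fps_nth fps_X n - (\<Sum>i = 0..m. compinv (F \<sigma>) i * fps_nth (F \<sigma> ^ i) n)) \<in> polyfn S"
        using less polyfam_power[OF S F]
        by (intro polyfn_diff[OF S] polyfn_sum[OF S] polyfn_mult[OF S] polyfn_const[OF S])
           (auto simp: polyfam_def Suc fps_X_def intro: qsubringD[OF S])
      then show ?thesis using F1 by (simp add: Suc)
    qed
  qed
  then show ?thesis by (simp add: polyfam_def fps_inv_def)
qed

section \<open>Iteration with real exponents\<close>

lemma subst_mult: "f \<otimes>\<^bsub>subst_group\<^esub> g = f oo g"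
  and subst_one: "\<one>\<^bsub>subst_group\<^esub> = fps_X"
  and subst_carrier: "f \<in> carrier subst_group \<longleftrightarrow> fps_nth f 0 = 0 \<and> fps_nth f 1 = 1"
  by (simp_all add: subst_group_def)

definition fdelta :: "real fps \<Rightarrow> real fps \<Rightarrow> real fps" where
  "fdelta u f = (f oo u) - f"

text \<open>Newton's binomial series for (1 + D)^\<sigma> applied to \<open>fps_X\<close>, where D =
  \<open>fdelta u\<close> and 1 + D is substitution of \<open>u\<close>. The sum may stop at k = n,
  because D raises the order and later terms do not reach coefficient n.\<close>

definition rpow :: "real fps \<Rightarrow> real \<Rightarrow> real fps" where
  "rpow u \<sigma> = Abs_fps (\<lambda>n. \<Sum>k\<le>n. (\<sigma> gchoose k) * fps_nth ((fdelta u ^^ k) fps_X) n)"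

text \<open>Substituting a series with linear coefficient 1 leaves the lowest coefficient unchanged,
  so each application of \<open>fdelta u\<close> raises the order by at least one.\<close>

lemma fdelta_order:
  assumes u: "u \<in> carrier subst_group" and "n < k"
  shows "fps_nth ((fdelta u ^^ k) fps_X) n = 0"
  using \<open>n < k\<close>
proof (induction k arbitrary: n)
  case (Suc k)
  define g where "g = (fdelta u ^^ k) fps_X"
  have g: "fps_nth g i = 0" if "i < k" for i using Suc.IH that by (simp add: g_def)
  have u0: "fps_nth u 0 = 0" "fps_nth u 1 = 1" using u by (auto simp: subst_carrier)
  have ui: "fps_nth (u ^ n) n = 1" using startsby_zero_power_nth_same[OF u0(1), of n] u0 by simp
  have "fps_nth (g oo u) n = (\<Sum>i = 0..n. fps_nth g i * fps_nth (u ^ i) n)"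
    by (simp add: fps_compose_nth)
  also have "\<dots> = (\<Sum>i = 0..n. if i = n then fps_nth g n else 0)"
    using Suc.prems g ui by (intro sum.cong) auto
  also have "\<dots> = fps_nth g n" by simp
  finally show ?case by (simp add: g_def fdelta_def[of u "(fdelta u ^^ k) fps_X"])
qed auto

lemma fdelta_additive: "fdelta u (\<Sum>i\<in>A. fps_const (c i) * f i) = (\<Sum>i\<in>A. fps_const (c i) * fdelta u (f i))"
  if "u \<in> carrier subst_group" for c :: "'b \<Rightarrow> real"
  using that
  by (simp add: fdelta_def fps_compose_sum_distrib fps_compose_mult_distrib subst_carrier
      right_diff_distrib sum_subtractf)

text \<open>Substitution of \<open>u\<close> is the identity plus the linear operator
  \<open>fdelta u\<close>, so the binomial theorem applies to its iterates.\<close>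

lemma fdelta_binomial:
  assumes "u \<in> carrier subst_group"
  shows "((\<lambda>f. f oo u) ^^ m) f = (\<Sum>k\<le>m. fps_const (real (m choose k)) * (fdelta u ^^ k) f)"
proof (induction m)
  case (Suc m)
  define a where "a k = fps_const (real (m choose k))" for k
  have *: "g oo u = fdelta u g + g" for g :: "real fps" by (simp add: fdelta_def)
  have "((\<lambda>f. f oo u) ^^ Suc m) f
      = fdelta u (\<Sum>k\<le>m. a k * (fdelta u ^^ k) f) + (\<Sum>k\<le>m. a k * (fdelta u ^^ k) f)"
    using *[of "((\<lambda>f. f oo u) ^^ m) f"] by (simp only: funpow.simps comp_apply Suc.IH a_def)
  also have "\<dots> = (\<Sum>k\<le>m. a k * (fdelta u ^^ Suc k) f) + (\<Sum>k\<le>m. a k * (fdelta u ^^ k) f)"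
    by (simp add: a_def fdelta_additive[OF assms])
  also have "(\<Sum>k\<le>m. a k * (fdelta u ^^ k) f)
     = f + (\<Sum>k\<le>m. fps_const (real (m choose Suc k)) * (fdelta u ^^ Suc k) f)"
  proof -
    have "(\<Sum>k\<le>Suc m. a k * (fdelta u ^^ k) f)
        = f + (\<Sum>k\<le>m. fps_const (real (m choose Suc k)) * (fdelta u ^^ Suc k) f)"
      by (subst sum.atMost_Suc_shift) (simp add: a_def)
    then show ?thesis by (simp add: a_def binomial_eq_0)
  qed
  also have "(\<Sum>k\<le>m. a k * (fdelta u ^^ Suc k) f) + \<dots>
     = (\<Sum>k\<le>Suc m. fps_const (real (Suc m choose k)) * (fdelta u ^^ k) f)"
    by (subst sum.atMost_Suc_shift)
       (simp add: a_def algebra_simps sum.distrib flip: fps_const_add)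
  finally show ?case .
qed simp

lemma rpow_nat_funpow:
  assumes "u \<in> carrier subst_group"
  shows "rpow u (real m) = ((\<lambda>f. f oo u) ^^ m) fps_X"
proof (rule fps_ext)
  fix n
  have "fps_nth (((\<lambda>f. f oo u) ^^ m) fps_X) n
      = (\<Sum>k\<le>m. real (m choose k) * fps_nth ((fdelta u ^^ k) fps_X) n)"
    by (simp add: fdelta_binomial[OF assms] fps_sum_nth)
  also have "\<dots> = (\<Sum>k\<le>max m n. real (m choose k) * fps_nth ((fdelta u ^^ k) fps_X) n)"
    by (rule sum.mono_neutral_left) auto
  also have "\<dots> = (\<Sum>k\<le>n. real (m choose k) * fps_nth ((fdelta u ^^ k) fps_X) n)"
    using fdelta_order[OF assms] by (intro sum.mono_neutral_right) auto
  finally show "fps_nth (rpow u (real m)) n = fps_nth (((\<lambda>f. f oo u) ^^ m) fps_X) n"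
    by (simp add: rpow_def binomial_gbinomial)
qed

lemma rpow_0: "u \<in> carrier subst_group \<Longrightarrow> rpow u 0 = fps_X"
  using rpow_nat_funpow[of u 0] by simp

lemma rpow_Suc: "u \<in> carrier subst_group \<Longrightarrow> rpow u (real (Suc m)) = rpow u (real m) oo u"
  using rpow_nat_funpow[of u m] rpow_nat_funpow[of u "Suc m"] by (simp del: of_nat_Suc)

lemma rpow_1: "u \<in> carrier subst_group \<Longrightarrow> rpow u 1 = u"
  using rpow_Suc[of u 0] by (simp add: rpow_0 subst_carrier)

lemma rpow_closed: "u \<in> carrier subst_group \<Longrightarrow> rpow u \<sigma> \<in> carrier subst_group"
  by (auto simp: subst_carrier rpow_def fdelta_def fps_compose_nth)

text \<open>The denominators \<open>fact k\<close> are a reason for requiring coefficient rings to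
  contain the rationals.\<close>

lemma polyfn_gbinomial: "qsubring S \<Longrightarrow> (\<lambda>\<sigma>. \<sigma> gchoose k) \<in> polyfn S"
proof -
  assume S: "qsubring S"
  have f: "1 / fact k \<in> S" by (metis Rats_1 Rats_divide Rats_of_nat of_nat_fact qsubringD(1)[OF S])
  have "(\<lambda>\<sigma>. (\<Prod>i = 0..<k. \<sigma> - real i) * (1 / fact k)) \<in> polyfn S"
    using S by (intro polyfn_mult polyfn_prod polyfn_diff polyfn_id polyfn_const)
       (auto intro: qsubringD(1)[OF S] f)
  then show ?thesis by (simp add: gbinomial_prod_rev)
qed

lemma fdelta_over: "qsubring S \<Longrightarrow> u \<in> fps_over S \<Longrightarrow> f \<in> fps_over S \<Longrightarrow> fdelta u f \<in> fps_over S"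
proof -
  assume S: "qsubring S" and u: "u \<in> fps_over S" and f: "f \<in> fps_over S"
  have "u ^ n \<in> fps_over S" for n
  proof (induction n)
    case 0
    show ?case using S by (auto simp: fps_over_def fps_one_nth intro: qsubringD)
  qed (auto intro!: fps_mult_over S u)
  then show ?thesis using f S
    by (auto simp: fps_over_def fdelta_def fps_compose_nth intro!: qsubringD(5) qsubring_sum qsubringD(3))
qed

lemma fps_X_over: "qsubring S \<Longrightarrow> fps_X \<in> fps_over S"
  by (auto simp: fps_over_def fps_X_def intro: qsubringD)

lemma polyfam_rpow: "qsubring S \<Longrightarrow> u \<in> fps_over S \<Longrightarrow> rpow u \<in> polyfam S"
proof -
  assume S: "qsubring S" and u: "u \<in> fps_over S"
  have "(fdelta u ^^ k) fps_X \<in> fps_over S" for k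
    by (induction k) (auto intro!: fdelta_over fps_X_over S u)
  then show ?thesis using S
    by (auto simp: polyfam_def rpow_def fps_over_def intro!: polyfn_sum polyfn_mult polyfn_gbinomial
        polyfn_const)
qed

lemma fps_over_UNIV [simp]: "f \<in> fps_over UNIV" by (simp add: fps_over_def)

lemma rpow_commute:
  assumes u: "u \<in> carrier subst_group" and c: "c \<in> carrier subst_group" and cu: "c oo u = u oo c"
  shows "c oo rpow u \<sigma> = rpow u \<sigma> oo c"
proof -
  have *: "c oo rpow u (real n) = rpow u (real n) oo c" for n
  proof (induction n)
    case 0
    then show ?case using u c by (simp add: rpow_0 subst_carrier)
  next
    case (Suc n)
    have 0: "fps_nth (rpow u (real n)) 0 = 0" "fps_nth c 0 = 0" "fps_nth u 0 = 0"
      using rpow_closed[OF u] u c by (auto simp: subst_carrier)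
    have "c oo rpow u (real (Suc n)) = (c oo rpow u (real n)) oo u"
      using 0 by (simp only: rpow_Suc[OF u] fps_compose_assoc)
    also have "\<dots> = rpow u (real n) oo (c oo u)" using 0 by (simp only: Suc.IH fps_compose_assoc)
    also have "\<dots> = (rpow u (real n) oo u) oo c" using 0 by (simp only: cu fps_compose_assoc)
    finally show ?case by (simp only: rpow_Suc[OF u])
  qed
  show ?thesis
    by (rule polyfam_nat_eq[of "\<lambda>\<sigma>. c oo rpow u \<sigma>" "\<lambda>\<sigma>. rpow u \<sigma> oo c", OF _ _ *])
       (intro polyfam_compose polyfam_const polyfam_rpow qsubring_UNIV fps_over_UNIV)+
qed

lemma polyfam_shift: "F \<in> polyfam UNIV \<Longrightarrow> (\<lambda>\<sigma>. F (\<sigma> + c)) \<in> polyfam UNIV"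
proof -
  assume F: "F \<in> polyfam UNIV"
  have "(\<lambda>\<sigma>. f (\<sigma> + c)) \<in> polyfn UNIV" if f: "f \<in> polyfn UNIV" for f
  proof -
    obtain p where p: "f = poly p" using f by (auto simp: polyfn_def)
    have "(\<lambda>\<sigma>. f (\<sigma> + c)) = poly (pcompose p [:c, 1:])" by (auto simp: p poly_pcompose add.commute)
    then show ?thesis by (auto simp: polyfn_def polys_def)
  qed
  then show ?thesis using F unfolding polyfam_def by blast
qed

lemma rpow_add:
  assumes u: "u \<in> carrier subst_group"
  shows "rpow u (\<sigma> + \<tau>) = rpow u \<sigma> oo rpow u \<tau>"
proof -
  have pf: "rpow u \<in> polyfam UNIV" "(\<lambda>\<sigma>. c) \<in> polyfam UNIV" for c :: "real fps"
    by (auto intro!: polyfam_rpow polyfam_const qsubring_UNIV)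
  have 0: "fps_nth (rpow u \<sigma>) 0 = 0" "fps_nth u 0 = 0" for \<sigma>
    using rpow_closed[OF u] u by (auto simp: subst_carrier)
  have nat: "rpow u (real n + real m) = rpow u (real n) oo rpow u (real m)" for n m
  proof (induction m)
    case 0
    then show ?case using u by (simp add: rpow_0)
  next
    case (Suc m)
    have "rpow u (real n + real (Suc m)) = rpow u (real (Suc (n + m)))" by (simp add: add_ac)
    also have "\<dots> = rpow u (real (n + m)) oo u" by (rule rpow_Suc[OF u])
    also have "\<dots> = rpow u (real n) oo (rpow u (real m) oo u)"
      using Suc 0 by (simp add: fps_compose_assoc)
    finally show ?case by (simp only: rpow_Suc[OF u])
  qed
  have sh: "(\<lambda>\<sigma>. rpow u (\<sigma> + c)) \<in> polyfam UNIV" for c by (rule polyfam_shift[OF pf(1)])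
  \<comment> \<open>The exponents are released one at a time: first \<sigma> becomes real with a
    natural second exponent, then the second exponent follows in the same way.\<close>
  have 1: "rpow u (\<sigma> + real m) = rpow u \<sigma> oo rpow u (real m)" for \<sigma> m
    by (rule polyfam_nat_eq[of "\<lambda>\<sigma>. rpow u (\<sigma> + real m)" "\<lambda>\<sigma>. rpow u \<sigma> oo rpow u (real m)",
          OF sh polyfam_compose[OF qsubring_UNIV pf] nat])
  have 2: "rpow u (\<tau> + \<sigma>) = rpow u \<sigma> oo rpow u \<tau>"
    by (rule polyfam_nat_eq[of "\<lambda>\<tau>. rpow u (\<tau> + \<sigma>)" "\<lambda>\<tau>. rpow u \<sigma> oo rpow u \<tau>",
          OF sh polyfam_compose[OF qsubring_UNIV pf(2,1)]])
       (subst add.commute, rule 1)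
  show ?thesis using 2 by (simp add: add.commute)
qed

section \<open>Commuting power series\<close>

interpretation SG: group subst_group
  by (rule subst_group_is_group)

lemma (in group) commute_inv:
  assumes "x \<in> carrier G" "u \<in> carrier G" "x \<otimes> u = u \<otimes> x"
  shows "inv x \<otimes> u = u \<otimes> inv x"
proof -
  have "x \<otimes> (u \<otimes> inv x) = (u \<otimes> x) \<otimes> inv x" using assms by (simp add: m_assoc[symmetric])
  also have "\<dots> = u" using assms by (simp add: m_assoc)
  finally show ?thesis using assms by (subst HOL.eq_commute) (simp add: inv_solve_left)
qed

text \<open>The filtration of the substitution group by order of contact with the identity: f = r +
  O(r^n). The coefficient at n is then the leading one, possibly zero.\<close>

definition flat :: "nat \<Rightarrow> real fps \<Rightarrow> bool" where
  "flat n f \<longleftrightarrow> f \<in> carrier subst_group \<and> (\<forall>i. 2 \<le> i \<longrightarrow> i < n \<longrightarrow> fps_nth f i = 0)"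

lemma flat_decomp:
  assumes "flat n f" "2 \<le> n"
  obtains h where "f = fps_X + fps_X ^ n * h" "\<And>i. fps_nth h i = fps_nth f (n + i)"
proof
  show "f = fps_X + fps_X ^ n * Abs_fps (\<lambda>i. fps_nth f (n + i))"
  proof (rule fps_ext)
    fix i
    have "i = 0 \<or> i = 1 \<or> (2 \<le> i \<and> i < n) \<or> n \<le> i" by linarith
    then show "fps_nth f i = fps_nth (fps_X + fps_X ^ n * Abs_fps (\<lambda>i. fps_nth f (n + i))) i"
      using assms by (auto simp: flat_def subst_carrier fps_X_power_mult_nth)
  qed
qed auto

text \<open>Binomial expansion to first order; the remainder carries the square of the perturbation,
  which is the factor \<open>fps_X ^ (2 * n)\<close>.\<close>

lemma power_X_plus:
  fixes h :: "real fps"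
  shows "\<exists>q. (fps_X + fps_X ^ n * h) ^ k
    = fps_X ^ k + of_nat k * fps_X ^ (k - 1) * (fps_X ^ n * h) + fps_X ^ (2 * n) * q"
proof (induction k)
  case (Suc k)
  then obtain q where q: "(fps_X + fps_X ^ n * h) ^ k
    = fps_X ^ k + of_nat k * fps_X ^ (k - 1) * (fps_X ^ n * h) + fps_X ^ (2 * n) * q" by blast
  have X: "fps_X * (of_nat k * fps_X ^ (k - 1)) = of_nat k * (fps_X :: real fps) ^ k" by (cases k) auto
  have alg: "(x + y * h) * (a + b * (y * h) + z * q)
      = x * a + (a + x * b) * (y * h) + (z * (q * (x + y * h)) + y * y * (b * h * h))"
    for x y a b z :: "real fps" by (simp add: algebra_simps)
  have "(fps_X + fps_X ^ n * h) ^ Suc k = fps_X ^ Suc k + of_nat (Suc k) * fps_X ^ k * (fps_X ^ n * h)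
      + fps_X ^ (2 * n) * (q * (fps_X + fps_X ^ n * h) + of_nat k * fps_X ^ (k - 1) * h * h)"
    unfolding power_Suc q alg X mult_2 power_add by (simp add: distrib_left distrib_right)
  then show ?case by auto
qed (auto intro: exI[of _ 0])

lemma power_X_plus_nth:
  fixes h :: "real fps"
  assumes "N < 2 * n"
  shows "fps_nth ((fps_X + fps_X ^ n * h) ^ k) N
    = (if N = k then 1 else 0) + (if k - 1 + n \<le> N then real k * fps_nth h (N - (k - 1 + n)) else 0)"
proof -
  obtain q where q: "(fps_X + fps_X ^ n * h) ^ k
    = fps_X ^ k + of_nat k * fps_X ^ (k - 1) * (fps_X ^ n * h) + fps_X ^ (2 * n) * q"
    using power_X_plus by blast
  have "of_nat k * fps_X ^ (k - 1) * (fps_X ^ n * h) = fps_const (real k) * (fps_X ^ (k - 1 + n) * h)"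
    by (simp only: fps_of_nat power_add mult.assoc)
  then show ?thesis using assms unfolding q
    by (simp only: fps_add_nth fps_X_power_mult_nth fps_X_power_nth fps_mult_left_const_nth) auto
qed

text \<open>First-order Taylor expansion of a composition, exact below order \<open>2 * n\<close>.\<close>

lemma compose_X_plus_nth:
  fixes f h :: "real fps"
  assumes "N < 2 * n" "1 \<le> n"
  shows "fps_nth (f oo (fps_X + fps_X ^ n * h)) N
    = fps_nth f N + (if n \<le> N then \<Sum>j\<le>N - n. real (Suc j) * fps_nth f (Suc j) * fps_nth h (N - n - j) else 0)"
proof -
  define t where "t k = (if k - 1 + n \<le> N then fps_nth f k * (real k * fps_nth h (N - (k - 1 + n))) else 0)" for k
  have "fps_nth (f oo (fps_X + fps_X ^ n * h)) N = (\<Sum>k=0..N. (if N = k then fps_nth f k else 0) + t k)"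
    unfolding fps_compose_nth power_X_plus_nth[OF assms(1)] t_def
    by (intro sum.cong) (auto simp: algebra_simps)
  also have "\<dots> = fps_nth f N + (\<Sum>k\<le>N. t k)" by (simp add: sum.distrib atMost_atLeast0)
  also have "(\<Sum>k\<le>N. t k)
    = (if n \<le> N then \<Sum>j\<le>N - n. real (Suc j) * fps_nth f (Suc j) * fps_nth h (N - n - j) else 0)"
  proof (cases "n \<le> N")
    case True
    then obtain M where M: "N = Suc M" using assms(2) by (cases N) auto
    have "(\<Sum>k\<le>N. t k) = (\<Sum>j\<le>M. t (Suc j))"
      unfolding M sum.atMost_Suc_shift by (simp add: t_def)
    also have "\<dots> = (\<Sum>j\<le>N - n. t (Suc j))"
      using assms(2) True M by (intro sum.mono_neutral_right) (auto simp: t_def)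
    also have "\<dots> = (\<Sum>j\<le>N - n. real (Suc j) * fps_nth f (Suc j) * fps_nth h (N - n - j))"
      using True by (intro sum.cong) (auto simp: t_def add.commute)
    finally show ?thesis using True by simp
  next
    case False
    then have "t k = 0" for k by (simp add: t_def)
    with False show ?thesis by simp
  qed
  finally show ?thesis .
qed

text \<open>At order n only the linear term of the outer series sees the perturbation in
  \<open>g\<close>, so leading coefficients add up.\<close>

lemma compose_flat_nth:
  assumes g: "flat n g" and n: "2 \<le> n" and f: "fps_nth f 1 = 1"
  shows "N < n \<Longrightarrow> fps_nth (f' oo g) N = fps_nth f' N"
    "fps_nth (f oo g) n = fps_nth f n + fps_nth g n"
proof -
  obtain h where h: "g = fps_X + fps_X ^ n * h" "\<And>i. fps_nth h i = fps_nth g (n + i)"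
    using flat_decomp[OF g n] by blast
  show "N < n \<Longrightarrow> fps_nth (f' oo g) N = fps_nth f' N"
    unfolding h(1) using n by (subst compose_X_plus_nth) auto
  have "fps_nth (f oo (fps_X + fps_X ^ n * h)) n = fps_nth f n + fps_nth g n"
    using n f by (subst compose_X_plus_nth) (auto simp: h(2))
  then show "fps_nth (f oo g) n = fps_nth f n + fps_nth g n" by (simp add: h(1)[symmetric])
qed

lemma power_one_plus_nth:
  fixes h :: "real fps"
  assumes "1 \<le> k" "i \<le> k"
  shows "fps_nth ((1 + fps_X ^ k * h) ^ m) i = (if i = 0 then 1 else if i = k then real m * fps_nth h 0 else 0)"
proof -
  have "\<exists>q. (1 + fps_X ^ k * h) ^ m = 1 + of_nat m * (fps_X ^ k * h) + fps_X ^ (2 * k) * q"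
  proof (induction m)
    case (Suc m)
    then obtain q where q: "(1 + fps_X ^ k * h) ^ m = 1 + of_nat m * (fps_X ^ k * h) + fps_X ^ (2 * k) * q"
      by blast
    have X2: "(fps_X :: real fps) ^ (2 * k) = fps_X ^ k * fps_X ^ k" by (simp add: mult_2 power_add)
    have "(1 + fps_X ^ k * h) ^ Suc m = 1 + of_nat (Suc m) * (fps_X ^ k * h)
        + fps_X ^ (2 * k) * (q + of_nat m * h * h + fps_X ^ k * h * q)"
      unfolding power_Suc q X2 by (simp add: algebra_simps)
    then show ?case by blast
  qed (auto intro: exI[of _ 0])
  then obtain q where q: "(1 + fps_X ^ k * h) ^ m = 1 + of_nat m * (fps_X ^ k * h) + fps_X ^ (2 * k) * q"
    by blast
  have "of_nat m * (fps_X ^ k * h) = fps_const (real m) * (fps_X ^ k * h)" by (simp add: fps_of_nat)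
  then show ?thesis using assms by (auto simp: q fps_X_power_mult_nth)
qed

text \<open>The two compositions are compared at coefficient n + m - 1. Beyond the symmetric part,
  one order of composition contributes n times the product of the leading coefficients and the other
  contributes m times this product.\<close>

lemma flat_commute_neq:
  assumes f: "flat n f" "fps_nth f n \<noteq> 0" and g: "flat m g" "fps_nth g m \<noteq> 0" and nm: "2 \<le> n" "n < m"
  shows "f oo g \<noteq> g oo f"
proof -
  define N where "N = n + m - 1"
  have mn: "m + (n - 1) = N" using nm by (simp add: N_def)
  obtain p where p: "f = fps_X + fps_X ^ n * p" "\<And>i. fps_nth p i = fps_nth f (n + i)"
    using flat_decomp[OF f(1) nm(1)] by blast
  obtain h where h: "g = fps_X + fps_X ^ m * h" "\<And>i. fps_nth h i = fps_nth g (m + i)"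
    using flat_decomp[OF g(1)] nm by auto
  have f01: "fps_nth f 0 = 0" "fps_nth f (Suc 0) = 1" using f by (auto simp: flat_def subst_carrier)
  have "fps_nth (f oo g) N = fps_nth f N + (\<Sum>j\<le>n - 1. real (Suc j) * fps_nth f (Suc j) * fps_nth h (n - 1 - j))"
    unfolding h(1) using nm by (subst compose_X_plus_nth) (auto simp: N_def)
  also have "(\<Sum>j\<le>n - 1. real (Suc j) * fps_nth f (Suc j) * fps_nth h (n - 1 - j))
      = (\<Sum>j\<in>{0, n - 1}. real (Suc j) * fps_nth f (Suc j) * fps_nth h (n - 1 - j))"
    using f nm by (intro sum.mono_neutral_right) (auto simp: flat_def)
  also have "\<dots> = fps_nth g N + real n * fps_nth f n * fps_nth g m"
    using nm f01 mn by (simp add: h(2) del: One_nat_def)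
  finally have 1: "fps_nth (f oo g) N = fps_nth f N + fps_nth g N + real n * fps_nth f n * fps_nth g m"
    by simp
  \<comment> \<open>With \<open>f\<close> as inner series the expansion
    \<open>compose_X_plus_nth\<close> does not reach N, since N is at least 2 * n. Writing
    \<open>f\<close> as \<open>fps_X\<close> times a unit gives the coefficient directly.\<close>
  have fm: "f ^ m = fps_X ^ m * (1 + fps_X ^ (n - 1) * p) ^ m"
  proof -
    have "f = fps_X * (1 + fps_X ^ (n - 1) * p)"
      using nm by (subst p(1)) (cases n, auto simp: distrib_left mult.assoc)
    then have "f ^ m = (fps_X * (1 + fps_X ^ (n - 1) * p)) ^ m" by (rule arg_cong)
    then show ?thesis by (simp only: power_mult_distrib)
  qed
  have "g oo f = f + f ^ m * (h oo f)"
    by (subst h(1)) (simp add: fps_compose_add_distrib fps_compose_mult_distrib f01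
        flip: fps_compose_power)
  then have "fps_nth (g oo f) N = fps_nth f N + fps_nth (fps_X ^ m * ((1 + fps_X ^ (n - 1) * p) ^ m * (h oo f))) N"
    by (simp add: fm mult.assoc)
  also have "fps_nth (fps_X ^ m * ((1 + fps_X ^ (n - 1) * p) ^ m * (h oo f))) N
     = fps_nth ((1 + fps_X ^ (n - 1) * p) ^ m * (h oo f)) (n - 1)"
    using nm by (simp add: fps_X_power_mult_nth N_def)
  also have "\<dots> = (\<Sum>i\<in>{0..n-1}. fps_nth ((1 + fps_X ^ (n - 1) * p) ^ m) i * fps_nth (h oo f) (n - 1 - i))"
    by (simp add: fps_mult_nth)
  also have "\<dots> = (\<Sum>i\<in>{0, n - 1}. fps_nth ((1 + fps_X ^ (n - 1) * p) ^ m) i * fps_nth (h oo f) (n - 1 - i))"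
    using nm by (intro sum.mono_neutral_right) (auto simp: power_one_plus_nth)
  also have "\<dots> = fps_nth (h oo f) (n - 1) + real m * fps_nth f n * fps_nth (h oo f) 0"
    using nm by (simp add: power_one_plus_nth p(2))
  also have "fps_nth (h oo f) (n - 1) = fps_nth g N"
    using compose_flat_nth(1)[OF f(1) nm(1), of f "n - 1" h] nm f01 mn by (simp add: h(2) del: One_nat_def) simp
  also have "fps_nth (h oo f) 0 = fps_nth g m"
    by (simp add: h(2) fps_compose_nth)
  finally have 2: "fps_nth (g oo f) N = fps_nth f N + fps_nth g N + real m * fps_nth f n * fps_nth g m"
    by simp
  have "real n * fps_nth f n * fps_nth g m \<noteq> real m * fps_nth f n * fps_nth g m"
    using f(2) g(2) nm by simp
  with 1 2 show ?thesis by auto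
qed

lemma flat_obtain:
  assumes "u \<in> carrier subst_group" "u \<noteq> fps_X"
  obtains n where "2 \<le> n" "flat n u" "fps_nth u n \<noteq> 0"
proof -
  define P where "P n \<longleftrightarrow> 2 \<le> n \<and> fps_nth u n \<noteq> 0" for n
  have "\<exists>n. P n"
  proof (rule ccontr)
    assume "\<not> (\<exists>n. P n)"
    then have "fps_nth u n = fps_nth fps_X n" for n
      using assms(1) by (cases "n = 0 \<or> n = 1") (auto simp: P_def subst_carrier fps_X_def)
    then show False using assms(2) by (auto intro: fps_ext)
  qed
  then obtain n where n: "P n" "\<forall>m<n. \<not> P m" using exists_least_iff[of P] by blast
  have "flat n u" using assms(1) n(2) unfolding flat_def P_def by blast
  then show ?thesis using n(1) unfolding P_def by (intro that[of n]) simp_all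
qed

text \<open>Nontrivial commuting series have the same order of contact, by
  \<open>flat_commute_neq\<close>. Coefficient n therefore tells whether a series in the centralizer
  of \<open>u\<close> is trivial.\<close>

lemma commuting_flat:
  assumes u: "flat n u" "2 \<le> n" "fps_nth u n \<noteq> 0"
    and v: "v \<in> carrier subst_group" "v oo u = u oo v"
  shows "flat n v" "fps_nth v n = 0 \<Longrightarrow> v = fps_X"
proof -
  have "flat n v \<and> fps_nth v n \<noteq> 0" if "v \<noteq> fps_X"
  proof -
    obtain m where m: "2 \<le> m" "flat m v" "fps_nth v m \<noteq> 0" using flat_obtain[OF v(1) \<open>v \<noteq> fps_X\<close>] by blast
    have "m = n"
    proof (rule linorder_cases[of m n])
      assume "m < n" then show ?thesis using flat_commute_neq[OF m(2,3) u(1,3) m(1)] v(2) by simp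
    next
      assume "n < m" then show ?thesis using flat_commute_neq[OF u(1,3) m(2,3) u(2)] v(2) by simp
    qed
    then show ?thesis using m by simp
  qed
  moreover have "flat n fps_X" by (auto simp: flat_def subst_carrier)
  ultimately show "flat n v" "fps_nth v n = 0 \<Longrightarrow> v = fps_X" by auto
qed

lemma commuting_add:
  assumes "flat n u" "2 \<le> n" "fps_nth u n \<noteq> 0"
    and "v \<in> carrier subst_group" "v oo u = u oo v" "w \<in> carrier subst_group" "w oo u = u oo w"
  shows "fps_nth (v oo w) n = fps_nth v n + fps_nth w n"
  using compose_flat_nth(2)[OF commuting_flat(1)[OF assms(1-3,6,7)] assms(2)] assms(4)
  by (auto simp: subst_carrier)

lemma commuting_mult:
  assumes "u \<in> carrier subst_group" "v \<in> carrier subst_group" "v oo u = u oo v"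
    "w \<in> carrier subst_group" "w oo u = u oo w"
  shows "(v oo w) oo u = u oo (v oo w)"
proof -
  have 0: "fps_nth u 0 = 0" "fps_nth v 0 = 0" "fps_nth w 0 = 0" using assms by (auto simp: subst_carrier)
  have "(v oo w) oo u = v oo (u oo w)" using 0 assms(5) by (simp add: fps_compose_assoc[symmetric])
  also have "\<dots> = (u oo v) oo w" using 0 assms(3) by (simp add: fps_compose_assoc)
  finally show ?thesis using 0 by (simp add: fps_compose_assoc)
qed

text \<open>On the centralizer of \<open>u\<close> the coefficient at n is additive and has trivial
  kernel, so it embeds the centralizer into the additive reals. The proof applies the kernel
  statement to \<open>v oo w'\<close> with \<open>w'\<close> inverse to \<open>w\<close>.\<close>

lemma commuting_inj:
  assumes u: "flat n u" "2 \<le> n" "fps_nth u n \<noteq> 0"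
    and v: "v \<in> carrier subst_group" "v oo u = u oo v"
    and w: "w \<in> carrier subst_group" "w oo u = u oo w" and eq: "fps_nth v n = fps_nth w n"
  shows "v = w"
proof -
  have uc: "u \<in> carrier subst_group" using u by (simp add: flat_def)
  define w' where "w' = inv\<^bsub>subst_group\<^esub> w"
  have w': "w' \<in> carrier subst_group" "w' oo u = u oo w'"
  proof -
    show "w' \<in> carrier subst_group" using w by (simp add: w'_def)
    have "w \<otimes>\<^bsub>subst_group\<^esub> u = u \<otimes>\<^bsub>subst_group\<^esub> w" using w(2) by (simp add: subst_mult)
    then have "w' \<otimes>\<^bsub>subst_group\<^esub> u = u \<otimes>\<^bsub>subst_group\<^esub> w'"
      unfolding w'_def using w(1) uc by (intro SG.commute_inv)
    then show "w' oo u = u oo w'" by (simp add: subst_mult)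
  qed
  have z: "v oo w' \<in> carrier subst_group" using SG.m_closed[OF v(1) w'(1)] by (simp add: subst_mult)
  have zu: "(v oo w') oo u = u oo (v oo w')" by (rule commuting_mult[OF uc v w'])
  have zw: "(v oo w') oo w = v"
    using SG.m_assoc[OF v(1) w'(1) w(1)] SG.l_inv[OF w(1)] SG.r_one[OF v(1)]
    by (simp add: subst_mult w'_def)
  have "fps_nth v n = fps_nth (v oo w') n + fps_nth w n"
    using commuting_add[OF u z zu w] by (simp add: zw)
  then have "v oo w' = fps_X" using eq commuting_flat(2)[OF u z zu] by simp
  then show ?thesis using zw w(1) by (simp add: subst_carrier)
qed

text \<open>Both products lie in the centralizer of \<open>u\<close> and have the same leading
  coefficient. Commutation is thus transitive through a nontrivial series.\<close>

lemma commuting_abelian: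
  assumes u: "u \<in> carrier subst_group" "u \<noteq> fps_X"
    and v: "v \<in> carrier subst_group" "v oo u = u oo v"
    and w: "w \<in> carrier subst_group" "w oo u = u oo w"
  shows "v oo w = w oo v"
proof -
  obtain n where n: "2 \<le> n" "flat n u" "fps_nth u n \<noteq> 0" using flat_obtain[OF u] .
  have c: "v oo w \<in> carrier subst_group" "w oo v \<in> carrier subst_group"
    using SG.m_closed v(1) w(1) by (auto simp: subst_mult)
  show ?thesis
    by (rule commuting_inj[OF n(2,1,3) c(1) commuting_mult[OF u(1) v w] c(2) commuting_mult[OF u(1) w v]])
       (simp add: commuting_add[OF n(2,1,3)] v w)
qed

text \<open>Conjugation preserves the leading coefficient, and within the centralizer of
  \<open>u\<close> this coefficient determines the series. The lemma turns "the conjugate commutes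
  with u" into "the conjugating element commutes with u".\<close>

lemma conj_commuting:
  assumes u: "u \<in> carrier subst_group" "u \<noteq> fps_X"
    and v: "v \<in> carrier subst_group" "v oo u = u oo v"
    and g: "g \<in> carrier subst_group" "g oo u = v oo g"
  shows "v = u"
proof -
  obtain n where n: "2 \<le> n" "flat n u" "fps_nth u n \<noteq> 0" using flat_obtain[OF u] .
  have fv: "flat n v" by (rule commuting_flat(1)[OF n(2,1,3) v])
  obtain h where h: "v = fps_X + fps_X ^ n * h" "\<And>i. fps_nth h i = fps_nth v (n + i)"
    using flat_decomp[OF fv n(1)] by blast
  have g01: "fps_nth g 0 = 0" "fps_nth g 1 = 1" using g by (auto simp: subst_carrier)
  have "fps_nth (g oo u) n = fps_nth g n + fps_nth u n"
    using compose_flat_nth(2)[OF n(2,1)] g01 by simp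
  moreover have "v oo g = g + g ^ n * (h oo g)"
    by (subst h(1)) (simp add: fps_compose_add_distrib fps_compose_mult_distrib g01
        flip: fps_compose_power)
  moreover have "fps_nth (g ^ n * (h oo g)) n = fps_nth v n"
  proof -
    have "fps_nth (g ^ n * (h oo g)) n = (\<Sum>i\<in>{n}. fps_nth (g ^ n) i * fps_nth (h oo g) (n - i))"
      unfolding fps_mult_nth using startsby_zero_power_prefix[OF g01(1)]
      by (intro sum.mono_neutral_right) auto
    then show ?thesis
      using startsby_zero_power_nth_same[OF g01(1), of n] g01 by (simp add: h(2) fps_compose_nth)
  qed
  ultimately have "fps_nth u n = fps_nth v n" using g(2) by simp
  then show ?thesis using commuting_inj[OF n(2,1,3) v u(1) HOL.refl] by simp
qed

section \<open>Big powers\<close>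

context group
begin

lemma commutator_eq_one_iff:
  assumes "a \<in> carrier G" "b \<in> carrier G"
  shows "group_commutator G a b = \<one> \<longleftrightarrow> a \<otimes> b = b \<otimes> a"
proof -
  have "group_commutator G a b = (a \<otimes> b) \<otimes> inv (b \<otimes> a)"
    using assms by (simp add: group_commutator_def inv_mult_group m_assoc)
  also have "\<dots> = \<one> \<longleftrightarrow> a \<otimes> b = b \<otimes> a"
    using assms by (metis inv_closed inv_equality inv_inv m_closed r_inv)
  finally show ?thesis .
qed

lemma power_product_Nil [simp]: "power_product G [] as = \<one>" "power_product G us [] = \<one>"
  by (simp_all add: power_product_def)

lemma power_product_Cons [simp]:
  "power_product G (u # us) (a # as) = u [^] a \<otimes> power_product G us as"
  by (simp add: power_product_def)

lemma power_product_closed [simp]: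
  "set us \<subseteq> carrier G \<Longrightarrow> power_product G us as \<in> carrier G"
proof (induction us arbitrary: as)
  case (Cons u us)
  then show ?case by (cases as) auto
qed simp

lemma power_product_append:
  assumes "length us = length as" "set us \<subseteq> carrier G" "set vs \<subseteq> carrier G"
  shows "power_product G (us @ vs) (as @ bs) = power_product G us as \<otimes> power_product G vs bs"
  using assms by (induction us as rule: list_induct2) (auto simp: m_assoc)

lemma power_product_inv:
  assumes "length us = length as" "set us \<subseteq> carrier G"
  shows "power_product G (rev (map (m_inv G) us)) (rev as) = inv (power_product G us as)"
  using assms
proof (induction us as rule: list_induct2)
  case (Cons u us a as)
  have "power_product G (rev (map (m_inv G) us) @ [inv u]) (rev as @ [a])
      = power_product G (rev (map (m_inv G) us)) (rev as) \<otimes> power_product G [inv u] [a]"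
    using Cons by (intro power_product_append) auto
  then show ?case using Cons by (simp add: inv_mult_group int_pow_inv)
qed simp

lemma commutation_free_Cons:
  "commutation_free G (a # b # us) \<longleftrightarrow> group_commutator G a b \<noteq> \<one> \<and> commutation_free G (b # us)"
  unfolding commutation_free_def by (simp add: All_less_Suc2)

lemma commutation_free_short [simp]: "commutation_free G []" "commutation_free G [a]"
  by (simp_all add: commutation_free_def)

lemma commutation_free_successively:
  "set us \<subseteq> carrier G \<Longrightarrow> commutation_free G us \<longleftrightarrow> successively (\<lambda>a b. a \<otimes> b \<noteq> b \<otimes> a) us"
  by (induction us rule: induct_list012) (auto simp: commutation_free_Cons commutator_eq_one_iff)

end

text \<open>The big powers condition for a subset, with powers and commutators computed in the
  ambient group: it is applied to images of the groups of the chain inside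
  \<open>subst_group\<close>, which is not itself assumed to satisfy it.\<close>

definition bp_set :: "('a, 'b) monoid_scheme \<Rightarrow> 'a set \<Rightarrow> bool" where
  "bp_set G K \<longleftrightarrow> subgroup K G \<and>
     (\<forall>us. us \<noteq> [] \<longrightarrow> set us \<subseteq> K - {\<one>\<^bsub>G\<^esub>} \<longrightarrow> commutation_free G us \<longrightarrow> independent_tuple G us)"

lemma hom_power_product:
  assumes "group H" "group G" "\<phi> \<in> hom H G" "set us \<subseteq> carrier H"
  shows "\<phi> (power_product H us as) = power_product G (map \<phi> us) as"
proof -
  interpret group_hom H G \<phi> using assms by (simp add: group_hom_def group_hom_axioms_def)
  show ?thesis using assms(4)
  proof (induction us arbitrary: as)
    case (Cons u us)
    then show ?case by (cases as) (auto simp: hom_int_pow)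
  qed simp
qed

lemma hom_group_commutator:
  assumes "group H" "group G" "\<phi> \<in> hom H G" "a \<in> carrier H" "b \<in> carrier H"
  shows "\<phi> (group_commutator H a b) = group_commutator G (\<phi> a) (\<phi> b)"
proof -
  interpret group_hom H G \<phi> using assms by (simp add: group_hom_def group_hom_axioms_def)
  show ?thesis using assms(4,5) by (simp add: group_commutator_def)
qed

lemma independent_tuple_hom:
  assumes "group H" "group G" "\<phi> \<in> hom H G" "set us \<subseteq> carrier H" "independent_tuple G (map \<phi> us)"
  shows "independent_tuple H us"
proof -
  have "\<phi> \<one>\<^bsub>H\<^esub> = \<one>\<^bsub>G\<^esub>" using assms(1-3) by (rule hom_one[rotated])
  then show ?thesis using assms(5) hom_power_product[OF assms(1-4)]
    unfolding independent_tuple_def by (metis length_map)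
qed

lemma mon_eq_one:
  assumes "group H" "group G" "\<phi> \<in> mon H G" "x \<in> carrier H"
  shows "\<phi> x = \<one>\<^bsub>G\<^esub> \<longleftrightarrow> x = \<one>\<^bsub>H\<^esub>"
proof -
  have "\<phi> \<one>\<^bsub>H\<^esub> = \<one>\<^bsub>G\<^esub>" using assms by (intro hom_one) (auto simp: mon_def)
  then show ?thesis using assms unfolding mon_def
    by (metis (no_types, lifting) group.is_monoid inj_on_eq_iff mem_Collect_eq monoid.one_closed)
qed

lemma bp_set_image:
  assumes BP: "BP_group H" and G: "group G" and \<phi>: "\<phi> \<in> mon H G"
  shows "bp_set G (\<phi> ` carrier H)"
proof -
  have H: "group H" using BP by (simp add: BP_group_def)
  have hom: "\<phi> \<in> hom H G" and inj: "inj_on \<phi> (carrier H)" using \<phi> by (auto simp: mon_def)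
  interpret group_hom H G \<phi> using H G hom by (simp add: group_hom_def group_hom_axioms_def)
  have "independent_tuple G vs" if vs: "vs \<noteq> []" "set vs \<subseteq> \<phi> ` carrier H - {\<one>\<^bsub>G\<^esub>}" "commutation_free G vs" for vs
  proof -
    have "vs \<in> lists (\<phi> ` carrier H)" using vs(2) by auto
    then obtain us where us: "vs = map \<phi> us" "set us \<subseteq> carrier H"
      unfolding lists_image by auto
    have nt: "nontrivial_tuple H us"
      using us vs by (auto simp: nontrivial_tuple_def)
    have cf: "commutation_free H us"
    proof (unfold commutation_free_def, intro allI impI)
      fix i assume i: "Suc i < length us"
      then have c: "us ! i \<in> carrier H" "us ! Suc i \<in> carrier H"
        using us(2) nth_mem[of i us] nth_mem[of "Suc i" us] by auto
      have "\<phi> (group_commutator H (us ! i) (us ! Suc i)) \<noteq> \<one>\<^bsub>G\<^esub>"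
        using vs(3) i us(1) unfolding hom_group_commutator[OF H G hom c] commutation_free_def by auto
      then show "group_commutator H (us ! i) (us ! Suc i) \<noteq> \<one>\<^bsub>H\<^esub>" by auto
    qed
    obtain n :: nat where n: "\<And>as. length as = length us \<Longrightarrow> (\<forall>a\<in>set as. a \<ge> int n) \<Longrightarrow> power_product H us as \<noteq> \<one>\<^bsub>H\<^esub>"
      using BP nt cf unfolding BP_group_def independent_tuple_def by blast
    have "power_product G vs as \<noteq> \<one>\<^bsub>G\<^esub>" if "length as = length vs" "\<forall>a\<in>set as. a \<ge> int n" for as
      using n[of as] that mon_eq_one[OF H G \<phi> group.power_product_closed[OF H us(2), of as]]
        hom_power_product[OF H G hom us(2), of as] us(1) by simp
    then show ?thesis unfolding independent_tuple_def by blast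
  qed
  then show ?thesis unfolding bp_set_def using img_is_subgroup by blast
qed

text \<open>A tuple involves finitely many nontrivial elements, namely its entries and the
  commutators of neighbours. One \<Phi> n keeps all of them nontrivial, and a vanishing product of
  powers would be carried over to the image tuple in \<open>K\<close>.\<close>

lemma BP_group_discriminated:
  fixes \<Phi> :: "nat \<Rightarrow> 'h \<Rightarrow> 'g"
  assumes H: "group H" and G: "group G" and K: "bp_set G K"
    and hom: "\<And>n. \<Phi> n \<in> hom H G" and img: "\<And>n h. h \<in> carrier H \<Longrightarrow> \<Phi> n h \<in> K"
    and disc: "\<And>h. h \<in> carrier H \<Longrightarrow> h \<noteq> \<one>\<^bsub>H\<^esub> \<Longrightarrow> \<forall>\<^sub>F n in sequentially. \<Phi> n h \<noteq> \<one>\<^bsub>G\<^esub>"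
  shows "BP_group H"
  unfolding BP_group_def
proof (intro conjI allI impI H)
  fix us assume nt: "nontrivial_tuple H us" and cf: "commutation_free H us"
  have us: "set us \<subseteq> carrier H" using nt by (auto simp: nontrivial_tuple_def)
  interpret H: group H by (rule H)
  have "\<forall>\<^sub>F n in sequentially. \<forall>u\<in>set us. \<Phi> n u \<noteq> \<one>\<^bsub>G\<^esub>"
    using nt by (intro eventually_ball_finite) (auto simp: nontrivial_tuple_def intro!: disc)
  moreover have "\<forall>\<^sub>F n in sequentially. \<forall>i\<in>{i. Suc i < length us}.
      \<Phi> n (group_commutator H (us ! i) (us ! Suc i)) \<noteq> \<one>\<^bsub>G\<^esub>"
  proof (intro eventually_ball_finite ballI)
    show "finite {i. Suc i < length us}" by (rule finite_subset[of _ "{..length us}"]) auto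
    fix i assume "i \<in> {i. Suc i < length us}"
    then have i: "Suc i < length us" by simp
    then have "us ! i \<in> carrier H" "us ! Suc i \<in> carrier H" using us nth_mem[of i us] nth_mem[of "Suc i" us] by auto
    then show "\<forall>\<^sub>F n in sequentially. \<Phi> n (group_commutator H (us ! i) (us ! Suc i)) \<noteq> \<one>\<^bsub>G\<^esub>"
      using cf i by (intro disc) (auto simp: commutation_free_def group_commutator_def)
  qed
  ultimately have "\<forall>\<^sub>F n in sequentially. (\<forall>u\<in>set us. \<Phi> n u \<noteq> \<one>\<^bsub>G\<^esub>) \<and> (\<forall>i\<in>{i. Suc i < length us}.
      \<Phi> n (group_commutator H (us ! i) (us ! Suc i)) \<noteq> \<one>\<^bsub>G\<^esub>)" by (rule eventually_conj)
  then obtain n where n: "\<forall>u\<in>set us. \<Phi> n u \<noteq> \<one>\<^bsub>G\<^esub>"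
      "\<forall>i\<in>{i. Suc i < length us}. \<Phi> n (group_commutator H (us ! i) (us ! Suc i)) \<noteq> \<one>\<^bsub>G\<^esub>"
    by (auto simp: eventually_sequentially)
  have "commutation_free G (map (\<Phi> n) us)"
  proof (unfold commutation_free_def, intro allI impI)
    fix i assume i: "Suc i < length (map (\<Phi> n) us)"
    then have "us ! i \<in> carrier H" "us ! Suc i \<in> carrier H" using us nth_mem[of i us] nth_mem[of "Suc i" us] by auto
    then show "group_commutator G (map (\<Phi> n) us ! i) (map (\<Phi> n) us ! Suc i) \<noteq> \<one>\<^bsub>G\<^esub>"
      using n(2) i hom_group_commutator[OF H G hom[of n], of "us ! i" "us ! Suc i"] by fastforce
  qed
  moreover have "set (map (\<Phi> n) us) \<subseteq> K - {\<one>\<^bsub>G\<^esub>}" using n(1) img us by auto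
  moreover have "map (\<Phi> n) us \<noteq> []" using nt by (simp add: nontrivial_tuple_def)
  ultimately have "independent_tuple G (map (\<Phi> n) us)" using K unfolding bp_set_def by blast
  then show "independent_tuple H us" by (rule independent_tuple_hom[OF H G hom us])
qed

lemma BP_group_mon:
  assumes "group H" "group G" "bp_set G K" "\<phi> \<in> mon H G" "\<phi> ` carrier H \<subseteq> K"
  shows "BP_group H"
proof (rule BP_group_discriminated[OF assms(1-3), of "\<lambda>_. \<phi>"])
  show "\<phi> \<in> hom H G" using assms(4) by (simp add: mon_def)
  show "\<phi> h \<in> K" if "h \<in> carrier H" for h using assms(5) that by blast
  show "\<forall>\<^sub>F n in sequentially. \<phi> h \<noteq> \<one>\<^bsub>G\<^esub>" if "h \<in> carrier H" "h \<noteq> \<one>\<^bsub>H\<^esub>" for h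
    using mon_eq_one[OF assms(1,2,4)] that by simp
qed

text \<open>The list [(m1, g1), ..., (mk, gk)] stands for w^m1 g1 ... w^mk gk, and \<open>P\<close>
  marks the elements across which neighbouring powers of w could merge. The last g is unrestricted
  because no power of w follows it.\<close>

fun wreduced :: "('a \<Rightarrow> bool) \<Rightarrow> (int \<times> 'a) list \<Rightarrow> bool" where
  "wreduced P [] = True"
| "wreduced P [(m, g)] = (m \<noteq> 0)"
| "wreduced P ((m, g) # x # ws) = (m \<noteq> 0 \<and> \<not> P g \<and> wreduced P (x # ws))"

context group
begin

fun gword :: "'a \<Rightarrow> int \<Rightarrow> (int \<times> 'a) list \<Rightarrow> 'a" where
  "gword w n [] = \<one>"
| "gword w n ((m, g) # ws) = w [^] (n * m) \<otimes> (g \<otimes> gword w n ws)"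

text \<open>Pushing every g to the right turns the word into a product of powers of conjugates of w
  by the prefixes g1 ... gi. The sign of m is moved into the base, so that the exponents n * |m|
  become large and positive; \<open>conj_end\<close> is the factor left over at the right.\<close>

fun conjs :: "'a \<Rightarrow> 'a \<Rightarrow> (int \<times> 'a) list \<Rightarrow> 'a list" where
  "conjs w x [] = []"
| "conjs w x ((m, g) # ws) = (x \<otimes> w [^] (sgn m) \<otimes> inv x) # conjs w (x \<otimes> g) ws"

fun conj_end :: "'a \<Rightarrow> (int \<times> 'a) list \<Rightarrow> 'a" where
  "conj_end x [] = x"
| "conj_end x ((m, g) # ws) = conj_end (x \<otimes> g) ws"

lemma inv_mult_cancel [simp]: "x \<in> carrier G \<Longrightarrow> y \<in> carrier G \<Longrightarrow> inv x \<otimes> (x \<otimes> y) = y"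
  and mult_inv_cancel [simp]: "x \<in> carrier G \<Longrightarrow> y \<in> carrier G \<Longrightarrow> x \<otimes> (inv x \<otimes> y) = y"
  by (simp_all add: m_assoc[symmetric])

lemma length_conjs [simp]: "length (conjs w x ws) = length ws"
  by (induction w x ws rule: conjs.induct) auto

lemma conj_hom: "x \<in> carrier G \<Longrightarrow> (\<lambda>a. x \<otimes> a \<otimes> inv x) \<in> hom G G"
proof (rule homI)
  fix a b assume x: "x \<in> carrier G" and ab: "a \<in> carrier G" "b \<in> carrier G"
  have "x \<otimes> a \<otimes> inv x \<otimes> (x \<otimes> b \<otimes> inv x) = x \<otimes> a \<otimes> (inv x \<otimes> x) \<otimes> b \<otimes> inv x"
    using x ab by (simp add: m_assoc del: l_inv)
  then show "x \<otimes> (a \<otimes> b) \<otimes> inv x = x \<otimes> a \<otimes> inv x \<otimes> (x \<otimes> b \<otimes> inv x)"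
    using x ab by (simp add: m_assoc)
qed auto

lemma conj_int_pow:
  "x \<in> carrier G \<Longrightarrow> a \<in> carrier G \<Longrightarrow> (x \<otimes> a \<otimes> inv x) [^] (k::int) = x \<otimes> a [^] k \<otimes> inv x"
  using hom_int_pow[OF conj_hom _ is_group is_group] by simp

lemma conj_eq_iff:
  "x \<in> carrier G \<Longrightarrow> a \<in> carrier G \<Longrightarrow> b \<in> carrier G \<Longrightarrow> x \<otimes> a \<otimes> inv x = x \<otimes> b \<otimes> inv x \<longleftrightarrow> a = b"
  by (simp add: m_assoc)

lemma commute_inv_iff:
  assumes "x \<in> carrier G" "y \<in> carrier G"
  shows "inv x \<otimes> y = y \<otimes> inv x \<longleftrightarrow> x \<otimes> y = y \<otimes> x"
  using commute_inv[of x y] commute_inv[of "inv x" y] assms by auto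

lemma commute_inv_iff':
  assumes "x \<in> carrier G" "y \<in> carrier G"
  shows "y \<otimes> inv x = inv x \<otimes> y \<longleftrightarrow> y \<otimes> x = x \<otimes> y"
  using commute_inv_iff[OF assms] by (auto simp: eq_commute)

lemma int_pow_sgn:
  assumes "x \<in> carrier G" "m \<noteq> 0"
  shows "x [^] (sgn m :: int) = x \<or> x [^] (sgn m :: int) = inv x"
  using assms by (cases m "0::int" rule: linorder_cases) (auto simp: int_pow_neg)

lemma conj_eq_one_iff:
  "x \<in> carrier G \<Longrightarrow> a \<in> carrier G \<Longrightarrow> x \<otimes> a \<otimes> inv x = \<one> \<longleftrightarrow> a = \<one>"
  using conj_eq_iff[of x a \<one>] by simp

lemma conjs_in:
  assumes K: "subgroup K G" "w \<in> K" "w \<noteq> \<one>" and "x \<in> K" "snd ` set ws \<subseteq> K" "wreduced P ws"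
  shows "set (conjs w x ws) \<subseteq> K - {\<one>}"
proof -
  interpret K: subgroup K G by (rule K)
  have sg: "w [^] sgn m \<in> K \<and> w [^] sgn m \<noteq> \<one>" if "m \<noteq> 0" for m :: int
    using int_pow_sgn[of w m] that K(2,3) inv_eq_1_iff[of w] by (metis K.m_inv_closed K.mem_carrier)
  have "x \<otimes> w [^] sgn m \<otimes> inv x \<in> K - {\<one>}" if "x \<in> K" "m \<noteq> 0" for x and m :: int
    using sg[OF that(2)] that(1) conj_eq_one_iff[of x "w [^] sgn m"] by simp
  then show ?thesis using assms(4-)
    by (induction P ws arbitrary: x rule: wreduced.induct) auto
qed

lemma conj_commute_iff:
  assumes "x \<in> carrier G" "a \<in> carrier G" "b \<in> carrier G"
  shows "(x \<otimes> a \<otimes> inv x) \<otimes> (x \<otimes> b \<otimes> inv x) = (x \<otimes> b \<otimes> inv x) \<otimes> (x \<otimes> a \<otimes> inv x)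
    \<longleftrightarrow> a \<otimes> b = b \<otimes> a"
  using hom_mult[OF conj_hom[OF assms(1)] assms(2,3)] hom_mult[OF conj_hom[OF assms(1)] assms(3,2)]
    conj_eq_iff[OF assms(1), of "a \<otimes> b" "b \<otimes> a"] assms by simp

text \<open>Neighbouring entries are conjugates of w or its inverse by x and by x g. Conjugated back
  by x, they commute only if w commutes with g w g^-1, in which case \<open>P g\<close> holds,
  contrary to reducedness.\<close>

lemma conjs_successively:
  assumes K: "subgroup K G" "w \<in> K"
    and P: "\<And>g. g \<in> K \<Longrightarrow> w \<otimes> (g \<otimes> w \<otimes> inv g) = (g \<otimes> w \<otimes> inv g) \<otimes> w \<Longrightarrow> P g"
    and "x \<in> K" "snd ` set ws \<subseteq> K" "wreduced P ws"
  shows "successively (\<lambda>a b. a \<otimes> b \<noteq> b \<otimes> a) (conjs w x ws)"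
  using assms(4-) P
proof (induction P ws arbitrary: x rule: wreduced.induct)
  case (3 P m g y ws)
  interpret K: subgroup K G by (rule K)
  obtain m' g' where y: "y = (m', g')" by force
  have c: "g \<in> carrier G" "w \<in> carrier G" "x \<in> carrier G" "g \<in> K" using 3 K by auto
  have m': "m' \<noteq> 0" using 3(4) y by (cases ws) auto
  define c where "c = g \<otimes> w \<otimes> inv g"
  have cc: "c \<in> carrier G" using c by (simp add: c_def)
  have "w \<otimes> c \<noteq> c \<otimes> w" using 3(5)[OF c(4)] 3(4) by (auto simp: c_def)
  then have "w [^] sgn m \<otimes> c [^] sgn m' \<noteq> c [^] sgn m' \<otimes> w [^] sgn m"
    using int_pow_sgn[OF c(2), of m] int_pow_sgn[OF cc m'] 3(4) c cc
    by (auto simp: commute_inv_iff commute_inv_iff')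
  then have "(x \<otimes> w [^] sgn m \<otimes> inv x) \<otimes> (x \<otimes> c [^] sgn m' \<otimes> inv x)
      \<noteq> (x \<otimes> c [^] sgn m' \<otimes> inv x) \<otimes> (x \<otimes> w [^] sgn m \<otimes> inv x)"
    using c cc by (subst conj_commute_iff) auto
  moreover have "x \<otimes> c [^] sgn m' \<otimes> inv x = (x \<otimes> g) \<otimes> w [^] sgn m' \<otimes> inv (x \<otimes> g)"
    unfolding c_def conj_int_pow[OF c(1,2)] using c by (simp add: m_assoc inv_mult_group)
  moreover have "successively (\<lambda>a b. a \<otimes> b \<noteq> b \<otimes> a) (conjs w (x \<otimes> g) (y # ws))"
    using 3 by auto
  ultimately show ?case by (simp add: y)
qed auto

lemma conj_end_closed:
  "x \<in> carrier G \<Longrightarrow> snd ` set ws \<subseteq> carrier G \<Longrightarrow> conj_end x ws \<in> carrier G"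
  by (induction x ws rule: conj_end.induct) auto

lemma gword_closed [simp]:
  "w \<in> carrier G \<Longrightarrow> snd ` set ws \<subseteq> carrier G \<Longrightarrow> gword w n ws \<in> carrier G"
  by (induction w n ws rule: gword.induct) auto

lemma conjs_closed:
  "w \<in> carrier G \<Longrightarrow> x \<in> carrier G \<Longrightarrow> snd ` set ws \<subseteq> carrier G \<Longrightarrow> set (conjs w x ws) \<subseteq> carrier G"
  by (induction w x ws rule: conjs.induct) auto

lemma gword_conjs:
  assumes "w \<in> carrier G" "x \<in> carrier G" "snd ` set ws \<subseteq> carrier G"
  shows "x \<otimes> gword w n ws
    = power_product G (conjs w x ws) (map (\<lambda>(m, g). n * \<bar>m\<bar>) ws) \<otimes> conj_end x ws"
  using assms
proof (induction w x ws rule: conjs.induct)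
  case (2 w x m g ws)
  have c: "g \<in> carrier G" "w \<in> carrier G" "x \<in> carrier G" "snd ` set ws \<subseteq> carrier G" using 2 by auto
  have "(x \<otimes> w [^] (sgn m) \<otimes> inv x) [^] (n * \<bar>m\<bar>) = x \<otimes> w [^] (n * m) \<otimes> inv x"
    using c by (simp add: conj_int_pow int_pow_pow mult.left_commute[of "sgn m"] sgn_mult_abs)
  moreover have "x \<otimes> gword w n ((m, g) # ws) = (x \<otimes> w [^] (n * m) \<otimes> inv x) \<otimes> ((x \<otimes> g) \<otimes> gword w n ws)"
  proof -
    have "(x \<otimes> w [^] (n * m) \<otimes> inv x) \<otimes> ((x \<otimes> g) \<otimes> gword w n ws)
      = x \<otimes> w [^] (n * m) \<otimes> (inv x \<otimes> x) \<otimes> (g \<otimes> gword w n ws)"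
      using c by (simp add: m_assoc del: l_inv)
    then show ?thesis using c by (simp add: m_assoc)
  qed
  moreover have "(x \<otimes> g) \<otimes> gword w n ws
    = power_product G (conjs w (x \<otimes> g) ws) (map (\<lambda>(m, g). n * \<bar>m\<bar>) ws) \<otimes> conj_end (x \<otimes> g) ws"
    using c by (intro "2.IH") auto
  ultimately show ?case
    using c conjs_closed[of w "x \<otimes> g" ws] conj_end_closed[of "x \<otimes> g" ws]
    by (simp only: conjs.simps list.map prod.case power_product_Cons conj_end.simps)
       (rule m_assoc[symmetric], auto)
qed simp

text \<open>If the word vanishes for two exponents that are far apart, the quotient of the two values is a
  product of big powers of a commutation-free tuple.\<close>

lemma eventually_gword_neq_one:
  assumes K: "bp_set G K" and w: "w \<in> K" "w \<noteq> \<one>"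
    and P: "\<And>g. g \<in> K \<Longrightarrow> w \<otimes> (g \<otimes> w \<otimes> inv g) = (g \<otimes> w \<otimes> inv g) \<otimes> w \<Longrightarrow> P g"
    and x: "x \<in> K" and ws: "snd ` set ws \<subseteq> K" "wreduced P ws" "ws \<noteq> []"
  shows "\<forall>\<^sub>F n in sequentially. x \<otimes> gword w (int n) ws \<noteq> \<one>"
proof -
  have KG: "subgroup K G" using K by (simp add: bp_set_def)
  interpret K: subgroup K G by (rule KG)
  have wsG: "snd ` set ws \<subseteq> carrier G" using ws(1) K.subset by auto
  define vs where "vs = conjs w x ws"
  define e where "e = conj_end x ws"
  define ex where "ex n = map (\<lambda>(m, g). int n * \<bar>m\<bar>) ws" for n
  have len: "length (ex n) = length vs" for n by (simp add: ex_def vs_def)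
  have vsK: "set vs \<subseteq> K - {\<one>}" unfolding vs_def by (rule conjs_in[OF KG w x ws(1,2)])
  have suc: "successively (\<lambda>a b. a \<otimes> b \<noteq> b \<otimes> a) vs"
    unfolding vs_def by (rule conjs_successively[OF KG w(1) P x ws(1,2)])
  have vsG: "set vs \<subseteq> carrier G" using vsK K.subset by auto
  have eG: "e \<in> carrier G" unfolding e_def using x wsG by (intro conj_end_closed) auto
  have m0: "m \<noteq> 0" if "(m, g) \<in> set ws" for m g
    using ws(2) that by (induction P ws rule: wreduced.induct) auto
  have word: "x \<otimes> gword w (int n) ws = power_product G vs (ex n) \<otimes> e" for n
    unfolding vs_def ex_def e_def using w x wsG by (intro gword_conjs) auto
  obtain us v where us: "vs = us @ [v]"
    using ws(3) by (metis length_conjs length_0_conv rev_exhaust vs_def)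
  \<comment> \<open>In the quotient of the values for n and n' the common end factor
    \<open>e\<close> cancels and the two powers of the last entry \<open>v\<close> merge: what
    remains is us^as v^(a - b) us^-bs, read backwards in the last block. The middle exponent b - a
    is large only if n and n' are far apart.\<close>
  define T where "T = us @ rev (map (m_inv G) (us @ [v]))"
  have TK: "set T \<subseteq> K - {\<one>}"
    using vsK unfolding T_def us by (auto simp: inv_eq_1_iff K.mem_carrier)
  have usG: "set us \<subseteq> carrier G" "v \<in> carrier G" using vsG us by auto
  have "successively (\<lambda>a b. a \<otimes> b \<noteq> b \<otimes> a) T"
  proof -
    have "successively (\<lambda>a b. inv b \<otimes> inv a \<noteq> inv a \<otimes> inv b) vs"
      by (rule successively_mono[OF suc])
         (use vsG in \<open>auto simp: commute_inv_iff commute_inv_iff' subset_iff\<close>)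
    then have "successively (\<lambda>a b. a \<otimes> b \<noteq> b \<otimes> a) (rev (map (m_inv G) vs))"
      by (simp add: successively_rev successively_map)
    moreover have "last us \<otimes> inv v \<noteq> inv v \<otimes> last us" if "us \<noteq> []"
      using suc that usG last_in_set[OF that]
      by (subst commute_inv_iff') (auto simp: us successively_append_iff)
    ultimately show ?thesis
      using suc unfolding T_def us by (auto simp: successively_append_iff)
  qed
  then have "commutation_free G T"
    using commutation_free_successively[of T] TK K.subset by auto
  then have "independent_tuple G T" using K TK by (auto simp: bp_set_def T_def)
  then obtain N :: nat where N: "\<And>as. length as = length T \<Longrightarrow> (\<forall>a\<in>set as. a \<ge> int N) \<Longrightarrow> power_product G T as \<noteq> \<one>"
    unfolding independent_tuple_def by blast
  define B where "B = {n. x \<otimes> gword w (int n) ws = \<one>}"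
  have far: "n' < n + N" if n: "n \<in> B" "n' \<in> B" "N \<le> n" for n n'
  proof (rule ccontr)
    assume "\<not> n' < n + N"
    then have n': "n + N \<le> n'" by simp
    obtain as a where as: "ex n = as @ [a]" using len[of n] us by (metis length_0_conv rev_exhaust snoc_eq_iff_butlast)
    obtain bs b where bs: "ex n' = bs @ [b]" using len[of n'] us by (metis length_0_conv rev_exhaust snoc_eq_iff_butlast)
    have la: "length as = length us" "length bs = length us" using len[of n] len[of n'] us as bs by auto
    have ge: "c \<ge> int N" if c: "c \<in> set (ex n) \<union> set (ex n')" for c
    proof -
      obtain m g k where "c = int k * \<bar>m\<bar>" "(m, g) \<in> set ws" "k \<ge> N"
        using c n(3) add_leD2[OF n'] by (auto simp: ex_def)
      then show ?thesis using m0[of m g] mult_mono[of "int N" "int k" 1 "\<bar>m\<bar>"] by auto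
    qed
    have "b - a \<ge> int N"
    proof -
      obtain m g where mg: "last ws = (m, g)" by force
      have "(m, g) \<in> set ws" using ws(3) mg last_in_set by force
      then have "\<bar>m\<bar> \<ge> 1" using m0[of m g] by simp
      moreover have "a = int n * \<bar>m\<bar>" "b = int n' * \<bar>m\<bar>"
        using arg_cong[OF as, of last] arg_cong[OF bs, of last] ws(3) mg by (auto simp: ex_def last_map)
      moreover have "int N * 1 \<le> (int n' - int n) * \<bar>m\<bar>"
        using n' \<open>\<bar>m\<bar> \<ge> 1\<close> by (intro mult_mono) auto
      ultimately show ?thesis by (simp add: algebra_simps)
    qed
    then have "power_product G T (as @ (b - a) # rev bs) \<noteq> \<one>"
      using ge la as bs by (intro N) (auto simp: T_def)
    moreover have "power_product G T (as @ (b - a) # rev bs)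
        = power_product G us as \<otimes> (inv v [^] (b - a) \<otimes> inv (power_product G us bs))"
    proof -
      have "set (inv v # rev (map (m_inv G) us)) \<subseteq> carrier G" using usG by auto
      then show ?thesis
        unfolding T_def using la usG power_product_append[of us as "inv v # rev (map (m_inv G) us)" "(b - a) # rev bs"]
        by (simp add: power_product_inv)
    qed
    moreover have "power_product G us as = power_product G us bs \<otimes> v [^] (b - a)"
    proof -
      have pe: "power_product G vs (ex k) = inv e" if "k \<in> B" for k
      proof -
        have "power_product G vs (ex k) \<otimes> e = \<one>" using that word[of k] by (simp add: B_def)
        then show ?thesis using inv_equality[OF _ eG power_product_closed[OF vsG]] by simp
      qed
      have "power_product G vs (ex n) = power_product G vs (ex n')" using n(1,2) by (simp add: pe)
      then have "power_product G us as \<otimes> v [^] a = power_product G us bs \<otimes> v [^] b"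
        using la usG by (simp add: us as bs power_product_append)
      then have "power_product G us as = power_product G us bs \<otimes> v [^] b \<otimes> inv (v [^] a)"
        using usG by (simp add: inv_solve_right)
      then show ?thesis using usG by (simp add: int_pow_diff m_assoc)
    qed
    ultimately show False using usG by (simp add: int_pow_inv m_assoc)
  qed
  have "finite B"
  proof (rule ccontr)
    assume "infinite B"
    then obtain n where n: "n \<in> B" "N \<le> n" by (meson infinite_nat_iff_unbounded_le)
    obtain n' where n': "n' \<in> B" "n + N \<le> n'" using \<open>infinite B\<close> by (meson infinite_nat_iff_unbounded_le)
    show False using far[OF n(1) n'(1) n(2)] n'(2) by simp
  qed
  then obtain M where M: "\<forall>n\<in>B. n < M" using finite_nat_set_iff_bounded by blast
  have "x \<otimes> gword w (int n) ws \<noteq> \<one>" if "M \<le> n" for n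
    using M that by (force simp: B_def)
  then show ?thesis unfolding eventually_sequentially by blast
qed

end

section \<open>Words with a real parameter\<close>

lemma rpow_int:
  assumes u: "u \<in> carrier subst_group"
  shows "rpow u (real_of_int k) = u [^]\<^bsub>subst_group\<^esub> k"
proof -
  have nat: "rpow u (real n) = u [^]\<^bsub>subst_group\<^esub> n" for n :: nat
  proof (induction n)
    case 0
    then show ?case using u by (simp add: rpow_0 subst_one)
  next
    case (Suc n)
    then show ?case by (simp only: rpow_Suc[OF u] SG.nat_pow_Suc subst_mult)
  qed
  show ?thesis
  proof (cases k rule: int_cases2)
    case (nonneg n)
    then show ?thesis using nat[of n] by (simp add: int_pow_int)
  next
    case (nonpos n)
    have "rpow u (real_of_int k) \<otimes>\<^bsub>subst_group\<^esub> rpow u (real n) = \<one>\<^bsub>subst_group\<^esub>"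
      using rpow_add[OF u, of "- real n" "real n"] nonpos u by (simp add: subst_mult subst_one rpow_0)
    then have "rpow u (real_of_int k) = inv\<^bsub>subst_group\<^esub> (rpow u (real n))"
      using SG.inv_equality rpow_closed[OF u] by metis
    then show ?thesis using nat[of n] u nonpos by (simp add: SG.int_pow_neg_int)
  qed
qed

fun wfam :: "real fps \<Rightarrow> (int \<times> real fps) list \<Rightarrow> real \<Rightarrow> real fps" where
  "wfam w [] \<sigma> = fps_X"
| "wfam w ((m, g) # ws) \<sigma> = rpow w (\<sigma> * real_of_int m) oo (g oo wfam w ws \<sigma>)"

lemma wfam_nat:
  "w \<in> carrier subst_group \<Longrightarrow> wfam w ws (real n) = SG.gword w (int n) ws"
proof (induction ws)
  case (Cons a ws)
  obtain m g where a: "a = (m, g)" by force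
  have "rpow w (real n * real_of_int m) = w [^]\<^bsub>subst_group\<^esub> (int n * m)"
    using rpow_int[OF Cons.prems, of "int n * m"] by simp
  then show ?case using Cons by (simp add: a subst_mult)
qed (simp add: subst_one)

lemma polyfam_wfam:
  "qsubring S \<Longrightarrow> w \<in> fps_over S \<Longrightarrow> snd ` set ws \<subseteq> fps_over S \<Longrightarrow> wfam w ws \<in> polyfam S"
proof (induction ws)
  case (Cons a ws)
  obtain m g where a: "a = (m, g)" by force
  have "(\<lambda>\<sigma>. rpow w (\<sigma> * real_of_int m) oo (g oo wfam w ws \<sigma>)) \<in> polyfam S"
    using Cons a
    by (intro polyfam_compose polyfam_const polyfam_scale[of S "rpow w"] polyfam_rpow)
       (auto intro: qsubringD)
  moreover have "(\<lambda>\<sigma>. rpow w (\<sigma> * real_of_int m) oo (g oo wfam w ws \<sigma>)) = wfam w (a # ws)"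
    by (simp add: a fun_eq_iff)
  ultimately show ?case by simp
next
  case Nil
  have "wfam w [] = (\<lambda>\<sigma>. fps_X)" by (simp add: fun_eq_iff)
  then show ?case using Nil by (simp add: polyfam_const fps_X_over)
qed

text \<open>By \<open>conj_commuting\<close>, a conjugate of \<open>w\<close> that commutes with
  \<open>w\<close> equals \<open>w\<close>. It is therefore enough that the inner elements of the
  word do not commute with \<open>w\<close> itself.\<close>

lemma eventually_wfam_neq:
  assumes K: "bp_set subst_group K" and w: "w \<in> K" "w \<noteq> fps_X" and x: "x \<in> K"
    and ws: "snd ` set ws \<subseteq> K" "wreduced (\<lambda>g. g oo w = w oo g) ws" "ws \<noteq> []"
  shows "\<forall>\<^sub>F n in sequentially. (x oo wfam w ws (real n)) \<noteq> fps_X"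
proof -
  have sub: "subgroup K subst_group" using K by (simp add: bp_set_def)
  interpret K: subgroup K subst_group by (rule sub)
  have "\<forall>\<^sub>F n in sequentially. x \<otimes>\<^bsub>subst_group\<^esub> SG.gword w (int n) ws \<noteq> \<one>\<^bsub>subst_group\<^esub>"
  proof (rule SG.eventually_gword_neq_one[OF K w(1) _ _ x ws])
    fix g assume g: "g \<in> K"
    define v where "v = g \<otimes>\<^bsub>subst_group\<^esub> w \<otimes>\<^bsub>subst_group\<^esub> inv\<^bsub>subst_group\<^esub> g"
    assume "w \<otimes>\<^bsub>subst_group\<^esub> (g \<otimes>\<^bsub>subst_group\<^esub> w \<otimes>\<^bsub>subst_group\<^esub> inv\<^bsub>subst_group\<^esub> g)
        = g \<otimes>\<^bsub>subst_group\<^esub> w \<otimes>\<^bsub>subst_group\<^esub> inv\<^bsub>subst_group\<^esub> g \<otimes>\<^bsub>subst_group\<^esub> w"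
    then have 1: "v oo w = w oo v" by (simp add: v_def subst_mult)
    have "v \<otimes>\<^bsub>subst_group\<^esub> g = g \<otimes>\<^bsub>subst_group\<^esub> w"
      using g w(1) K.subset by (simp add: v_def SG.m_assoc)
    then have 2: "g oo w = v oo g" by (simp add: subst_mult)
    have "v \<in> carrier subst_group" using g w(1) by (simp add: v_def)
    then have "v = w" using conj_commuting[OF _ w(2) _ 1 _ 2] g w(1) by simp
    then show "g oo w = w oo g" using 2 by simp
  qed (use w in \<open>simp add: subst_one\<close>)
  then show ?thesis using w(1) by (simp add: wfam_nat subst_mult subst_one)
qed

lemma mon_of_trivial_kernel:
  assumes "group H" "group G" "\<phi> \<in> hom H G"
    and "\<And>h. h \<in> carrier H \<Longrightarrow> \<phi> h = \<one>\<^bsub>G\<^esub> \<Longrightarrow> h = \<one>\<^bsub>H\<^esub>"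
  shows "\<phi> \<in> mon H G"
proof -
  interpret group_hom H G \<phi> using assms by (simp add: group_hom_def group_hom_axioms_def)
  have "inj_on \<phi> (carrier H)"
  proof (rule inj_onI)
    fix x y assume xy: "x \<in> carrier H" "y \<in> carrier H" "\<phi> x = \<phi> y"
    then have "x \<otimes>\<^bsub>H\<^esub> inv\<^bsub>H\<^esub> y = \<one>\<^bsub>H\<^esub>" by (intro assms(4)) auto
    then show "x = y" using xy G.inv_equality[of x "inv\<^bsub>H\<^esub> y"] by simp
  qed
  then show ?thesis using assms(3) by (simp add: mon_def)
qed

text \<open>An element killed at the transcendental \<open>s\<close> would be killed at every
  natural number, because \<Psi> depends on the parameter polynomially; this contradicts
  \<open>disc\<close>. The natural specializations land in \<open>K\<close> and give the big powers
  condition at the same time.\<close>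

lemma discriminating_family:
  assumes H: "group H" and S: "qsubring S" and K: "bp_set subst_group K" and s: "transc S s"
    and hom: "\<And>\<sigma>. \<Psi> \<sigma> \<in> hom H subst_group"
    and img: "\<And>n h. h \<in> carrier H \<Longrightarrow> \<Psi> (real n) h \<in> K"
    and poly: "\<And>h. h \<in> carrier H \<Longrightarrow> (\<lambda>\<sigma>. \<Psi> \<sigma> h) \<in> polyfam S"
    and disc: "\<And>h. h \<in> carrier H \<Longrightarrow> h \<noteq> \<one>\<^bsub>H\<^esub> \<Longrightarrow> \<forall>\<^sub>F n in sequentially. \<Psi> (real n) h \<noteq> fps_X"
  shows "BP_group H" "\<Psi> s \<in> mon H subst_group" "\<And>h. h \<in> carrier H \<Longrightarrow> \<Psi> s h \<in> fps_over (adjoin S s)"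
proof -
  show "BP_group H"
    by (rule BP_group_discriminated[OF H subst_group_is_group K, of "\<lambda>n. \<Psi> (real n)"])
       (use hom img disc in \<open>auto simp: subst_one\<close>)
  show "\<Psi> s \<in> mon H subst_group"
  proof (rule mon_of_trivial_kernel[OF H subst_group_is_group hom])
    fix h assume h: "h \<in> carrier H" "\<Psi> s h = \<one>\<^bsub>subst_group\<^esub>"
    have "\<Psi> (real n) h = fps_X" for n
      using polyfam_transc_eq[OF S poly[OF h(1)] polyfam_const[OF S fps_X_over[OF S]] s] h(2)
      by (simp add: subst_one)
    then show "h = \<one>\<^bsub>H\<^esub>" using disc[OF h(1)] by auto
  qed
  show "\<And>h. h \<in> carrier H \<Longrightarrow> \<Psi> s h \<in> fps_over (adjoin S s)"
    using polyfam_adjoin[OF poly] .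
qed

section \<open>Groups given by generators and relations\<close>

definition weval :: "('k, 'm) monoid_scheme \<Rightarrow> ('x \<Rightarrow> 'k) \<Rightarrow> 'x gword \<Rightarrow> 'k" where
  "weval K f w = foldr (\<lambda>(x, b) y. (if b then f x else inv\<^bsub>K\<^esub> f x) \<otimes>\<^bsub>K\<^esub> y) w \<one>\<^bsub>K\<^esub>"

lemma gwords_simps [simp]:
  "[] \<in> gwords X" "(x, b) # w \<in> gwords X \<longleftrightarrow> x \<in> X \<and> w \<in> gwords X"
  "u @ v \<in> gwords X \<longleftrightarrow> u \<in> gwords X \<and> v \<in> gwords X"
  by (auto simp: gwords_def)

context group
begin

lemma weval_simps [simp]:
  "weval G f [] = \<one>" "weval G f ((x, b) # w) = (if b then f x else inv f x) \<otimes> weval G f w"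
  by (simp_all add: weval_def)

lemma weval_closed [simp]:
  "f ` X \<subseteq> carrier G \<Longrightarrow> w \<in> gwords X \<Longrightarrow> weval G f w \<in> carrier G"
proof (induction w)
  case (Cons a w)
  then show ?case by (cases a) auto
qed simp

lemma weval_append:
  "f ` X \<subseteq> carrier G \<Longrightarrow> u \<in> gwords X \<Longrightarrow> v \<in> gwords X
    \<Longrightarrow> weval G f (u @ v) = weval G f u \<otimes> weval G f v"
proof (induction u)
  case (Cons a u)
  then show ?case by (cases a) (auto simp: m_assoc image_subset_iff)
qed simp

lemma pres_eq_weval:
  assumes f: "f ` X \<subseteq> carrier G"
    and R: "\<And>u v. (u, v) \<in> R \<Longrightarrow> u \<in> gwords X \<Longrightarrow> v \<in> gwords X \<Longrightarrow> weval G f u = weval G f v"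
  shows "pres_eq X R u v \<Longrightarrow> weval G f u = weval G f v"
proof (induction rule: pres_eq.induct)
  case (append u u' v v')
  then show ?case using f pres_eq_gwords by (metis weval_append)
next
  case (cancel x b)
  then show ?case using f by (auto simp: image_subset_iff)
qed (use R in auto)

text \<open>Von Dyck's theorem. The homomorphism evaluates a chosen representative of a class, and
  \<open>pres_eq_weval\<close> makes the choice immaterial.\<close>

lemma presented_group_lift:
  assumes f: "f ` X \<subseteq> carrier G"
    and R: "\<And>u v. (u, v) \<in> R \<Longrightarrow> u \<in> gwords X \<Longrightarrow> v \<in> gwords X \<Longrightarrow> weval G f u = weval G f v"
  obtains \<Phi> where "\<Phi> \<in> hom (presented_group X R) G"
    "\<And>w. w \<in> gwords X \<Longrightarrow> \<Phi> (pres_class X R w) = weval G f w"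
proof
  define \<Phi> where "\<Phi> A = weval G f (SOME w. w \<in> A)" for A
  have eq: "\<Phi> (pres_class X R w) = weval G f w" if "w \<in> gwords X" for w
  proof -
    have "w \<in> pres_class X R w" using that by (simp add: pres_class_def pres_eq.refl)
    then have "(SOME v. v \<in> pres_class X R w) \<in> pres_class X R w" by (rule someI)
    then show ?thesis unfolding \<Phi>_def
      using pres_eq_weval[OF f R] by (metis mem_Collect_eq pres_class_def)
  qed
  show "\<And>w. w \<in> gwords X \<Longrightarrow> \<Phi> (pres_class X R w) = weval G f w" by (rule eq)
  show "\<Phi> \<in> hom (presented_group X R) G"
  proof (rule homI)
    fix A B assume "A \<in> carrier (presented_group X R)" "B \<in> carrier (presented_group X R)"
    then obtain u v where uv: "u \<in> gwords X" "v \<in> gwords X" "A = pres_class X R u" "B = pres_class X R v"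
      by (auto simp: presented_group_def)
    then show "\<Phi> (A \<otimes>\<^bsub>presented_group X R\<^esub> B) = \<Phi> A \<otimes> \<Phi> B"
      using f by (simp add: pres_class_mult eq weval_append)
  next
    fix A assume "A \<in> carrier (presented_group X R)"
    then show "\<Phi> A \<in> carrier G" using f by (auto simp: presented_group_def eq)
  qed
qed

end

lemma presented_group_one: "\<one>\<^bsub>presented_group X R\<^esub> = pres_class X R []"
  by (simp add: presented_group_def)

lemma pres_class_carrier: "w \<in> gwords X \<Longrightarrow> pres_class X R w \<in> carrier (presented_group X R)"
  by (simp add: presented_group_def)

lemma pres_class_rel:
  "(u, v) \<in> R \<Longrightarrow> u \<in> gwords X \<Longrightarrow> v \<in> gwords X \<Longrightarrow> pres_class X R u = pres_class X R v"
  by (simp add: pres_class_eq_iff pres_eq.rel)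

lemma pres_class_inverse:
  assumes "x \<in> X"
  shows "pres_class X R [(x, False)] = inv\<^bsub>presented_group X R\<^esub> (pres_class X R [(x, True)])"
proof -
  interpret P: group "presented_group X R" by (rule presented_group_is_group)
  have "pres_class X R [(x, False)] \<otimes>\<^bsub>presented_group X R\<^esub> pres_class X R [(x, True)] = \<one>\<^bsub>presented_group X R\<^esub>"
    using assms pres_eq.cancel[of x X R False] by (simp add: pres_class_mult presented_group_one pres_class_eq_iff)
  then show ?thesis using assms by (intro P.inv_equality[symmetric]) (auto intro: pres_class_carrier)
qed

lemma presented_group_induct [consumes 1, case_names one gen]:
  assumes A: "A \<in> carrier (presented_group X R)"
    and one: "P \<one>\<^bsub>presented_group X R\<^esub>"
    and gen: "\<And>x b A. x \<in> X \<Longrightarrow> A \<in> carrier (presented_group X R) \<Longrightarrow> P A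
      \<Longrightarrow> P (pres_class X R [(x, b)] \<otimes>\<^bsub>presented_group X R\<^esub> A)"
  shows "P A"
proof -
  obtain w where w: "w \<in> gwords X" "A = pres_class X R w" using A by (auto simp: presented_group_def)
  have "P (pres_class X R w)" using w(1)
  proof (induction w)
    case Nil
    then show ?case using one by (simp add: presented_group_one)
  next
    case (Cons a w)
    obtain x b where a: "a = (x, b)" by force
    have "P (pres_class X R [(x, b)] \<otimes>\<^bsub>presented_group X R\<^esub> pres_class X R w)"
      using Cons a by (intro gen) (auto intro: pres_class_carrier)
    then show ?case using Cons a by (simp add: pres_class_mult)
  qed
  then show ?thesis by (simp add: w)
qed

lemma table_hom:
  assumes H: "group H" and X: "\<iota> ` carrier H \<subseteq> X" and R: "table_rels \<iota> H \<subseteq> R"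
  shows "(\<lambda>g. pres_class X R [(\<iota> g, True)]) \<in> hom H (presented_group X R)"
proof (rule homI)
  fix x y assume xy: "x \<in> carrier H" "y \<in> carrier H"
  interpret group H by (rule H)
  have "pres_class X R [(\<iota> x, True), (\<iota> y, True)] = pres_class X R [(\<iota> (x \<otimes>\<^bsub>H\<^esub> y), True)]"
    using X R xy by (intro pres_class_rel) (auto simp: table_rels_def)
  then show "pres_class X R [(\<iota> (x \<otimes>\<^bsub>H\<^esub> y), True)]
    = pres_class X R [(\<iota> x, True)] \<otimes>\<^bsub>presented_group X R\<^esub> pres_class X R [(\<iota> y, True)]"
    using X xy by (simp add: pres_class_mult image_subset_iff)
qed (use X in \<open>auto intro!: pres_class_carrier\<close>)

lemma hom_m_inv:
  "group H \<Longrightarrow> group G \<Longrightarrow> \<phi> \<in> hom H G \<Longrightarrow> x \<in> carrier H \<Longrightarrow> \<phi> (inv\<^bsub>H\<^esub> x) = inv\<^bsub>G\<^esub> \<phi> x"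
  by (simp add: group_hom.hom_inv group_hom_axioms_def group_hom_def)

section \<open>Amalgamated products\<close>

definition amalgam_incr ::
    "('a, 'b) monoid_scheme \<Rightarrow> ('a, 'c) monoid_scheme \<Rightarrow> 'a set \<Rightarrow> 'a \<Rightarrow> ('a + 'a) gword set" where
  "amalgam_incr G F C f = pres_class (amalgam_gens G F) (amalgam_rels G F C) [(Inr f, True)]"

lemma amalgam_group: "group (amalgam G F C)"
  by (simp add: amalgam_def presented_group_is_group)

lemma amalgam_incl_hom: "group G \<Longrightarrow> amalgam_incl G F C \<in> hom G (amalgam G F C)"
  unfolding amalgam_incl_def[abs_def] amalgam_def
  by (intro table_hom) (auto simp: amalgam_gens_def amalgam_rels_def)

lemma amalgam_incr_hom: "group F \<Longrightarrow> amalgam_incr G F C \<in> hom F (amalgam G F C)"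
  unfolding amalgam_incr_def[abs_def] amalgam_def
  by (intro table_hom) (auto simp: amalgam_gens_def amalgam_rels_def)

lemma amalgam_incl_eq_incr:
  "c \<in> C \<Longrightarrow> c \<in> carrier G \<Longrightarrow> c \<in> carrier F \<Longrightarrow> amalgam_incl G F C c = amalgam_incr G F C c"
  unfolding amalgam_incl_def amalgam_incr_def
  by (intro pres_class_rel) (auto simp: amalgam_gens_def amalgam_rels_def)

lemma amalgam_induct [consumes 3, case_names one left right]:
  assumes A: "A \<in> carrier (amalgam G F C)" and G: "group G" and F: "group F"
    and one: "P \<one>\<^bsub>amalgam G F C\<^esub>"
    and left: "\<And>g A. g \<in> carrier G \<Longrightarrow> A \<in> carrier (amalgam G F C) \<Longrightarrow> P A
      \<Longrightarrow> P (amalgam_incl G F C g \<otimes>\<^bsub>amalgam G F C\<^esub> A)"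
    and right: "\<And>f A. f \<in> carrier F \<Longrightarrow> A \<in> carrier (amalgam G F C) \<Longrightarrow> P A
      \<Longrightarrow> P (amalgam_incr G F C f \<otimes>\<^bsub>amalgam G F C\<^esub> A)"
  shows "P A"
  using A unfolding amalgam_def
proof (induction rule: presented_group_induct)
  case one
  then show ?case using assms(4) by (simp add: amalgam_def)
next
  case (gen x b A)
  show ?case
  proof (cases x)
    case (Inl g)
    then have g: "g \<in> carrier G" using gen by (auto simp: amalgam_gens_def)
    have "pres_class (amalgam_gens G F) (amalgam_rels G F C) [(x, b)] = amalgam_incl G F C (if b then g else inv\<^bsub>G\<^esub> g)"
      using hom_m_inv[OF G amalgam_group amalgam_incl_hom[OF G] g] gen(1)
      by (auto simp: Inl amalgam_incl_def amalgam_def pres_class_inverse)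
    then show ?thesis using left[of "if b then g else inv\<^bsub>G\<^esub> g" A] gen g group.inv_closed[OF G g]
      by (auto simp: amalgam_def split: if_splits)
  next
    case (Inr g)
    then have g: "g \<in> carrier F" using gen by (auto simp: amalgam_gens_def)
    have "pres_class (amalgam_gens G F) (amalgam_rels G F C) [(x, b)] = amalgam_incr G F C (if b then g else inv\<^bsub>F\<^esub> g)"
      using hom_m_inv[OF F amalgam_group amalgam_incr_hom[OF F] g] gen(1)
      by (auto simp: Inr amalgam_incr_def amalgam_def pres_class_inverse)
    then show ?thesis using right[of "if b then g else inv\<^bsub>F\<^esub> g" A] gen g group.inv_closed[OF F g]
      by (auto simp: amalgam_def split: if_splits)
  qed
qed

lemma amalgam_lift:
  assumes G: "group G" and F: "group F" and K: "group K"
    and a: "\<alpha> \<in> hom G K" and b: "\<beta> \<in> hom F K" and C: "\<And>c. c \<in> C \<Longrightarrow> \<alpha> c = \<beta> c"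
  obtains \<Phi> where "\<Phi> \<in> hom (amalgam G F C) K"
    "\<And>g. g \<in> carrier G \<Longrightarrow> \<Phi> (amalgam_incl G F C g) = \<alpha> g"
    "\<And>f. f \<in> carrier F \<Longrightarrow> \<Phi> (amalgam_incr G F C f) = \<beta> f"
proof -
  interpret K: group K by (rule K)
  interpret a: group_hom G K \<alpha> using G K a by (simp add: group_hom_def group_hom_axioms_def)
  interpret b: group_hom F K \<beta> using F K b by (simp add: group_hom_def group_hom_axioms_def)
  have f: "case_sum \<alpha> \<beta> ` amalgam_gens G F \<subseteq> carrier K"
    by (auto simp: amalgam_gens_def)
  obtain \<Phi> where \<Phi>: "\<Phi> \<in> hom (amalgam G F C) K"
    "\<And>w. w \<in> gwords (amalgam_gens G F)
      \<Longrightarrow> \<Phi> (pres_class (amalgam_gens G F) (amalgam_rels G F C) w) = weval K (case_sum \<alpha> \<beta>) w"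
  proof (rule K.presented_group_lift[OF f, of "amalgam_rels G F C"])
    fix u v assume uv: "(u, v) \<in> amalgam_rels G F C" "u \<in> gwords (amalgam_gens G F)" "v \<in> gwords (amalgam_gens G F)"
    show "weval K (case_sum \<alpha> \<beta>) u = weval K (case_sum \<alpha> \<beta>) v"
      using uv C by (auto simp: amalgam_rels_def table_rels_def amalgam_gens_def)
  qed (simp add: amalgam_def)
  have "\<Phi> (amalgam_incl G F C g) = \<alpha> g" if "g \<in> carrier G" for g
    unfolding amalgam_incl_def using that by (subst \<Phi>(2)) (auto simp: amalgam_gens_def)
  moreover have "\<Phi> (amalgam_incr G F C f) = \<beta> f" if "f \<in> carrier F" for f
    unfolding amalgam_incr_def using that by (subst \<Phi>(2)) (auto simp: amalgam_gens_def)
  ultimately show ?thesis by (rule that[OF \<Phi>(1)])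
qed

fun aprod ::
    "('a, 'b) monoid_scheme \<Rightarrow> ('a, 'c) monoid_scheme \<Rightarrow> 'a set \<Rightarrow> ('a \<times> 'a) list \<Rightarrow> ('a + 'a) gword set" where
  "aprod G F C [] = \<one>\<^bsub>amalgam G F C\<^esub>"
| "aprod G F C ((f, g) # ws) = amalgam_incr G F C f \<otimes>\<^bsub>amalgam G F C\<^esub>
     (amalgam_incl G F C g \<otimes>\<^bsub>amalgam G F C\<^esub> aprod G F C ws)"

text \<open>Inner syllables must avoid \<open>C\<close>, so that no two neighbours can be merged
  across the amalgamated subgroup. The last element of the first factor is free, and may be the
  identity.\<close>

fun areduced :: "'a set \<Rightarrow> ('a \<times> 'a) list \<Rightarrow> bool" where
  "areduced C [] = True"
| "areduced C [(f, g)] = (f \<notin> C)"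
| "areduced C ((f, g) # x # ws) = (f \<notin> C \<and> g \<notin> C \<and> areduced C (x # ws))"

lemma areduced_head: "areduced C ((f, g) # ws) \<Longrightarrow> f' \<notin> C \<Longrightarrow> areduced C ((f', g) # ws)"
  by (cases ws) auto

lemma areduced_tl: "areduced C (x # ws) \<Longrightarrow> areduced C ws"
  by (cases x; cases ws) auto

text \<open>Expressions of this shape survive left multiplication by an element of either factor: it
  is absorbed into the leading element, prepended, or merged with the first syllables.\<close>

lemma amalgam_normal_form:
  assumes A: "A \<in> carrier (amalgam G F C)" and G: "group G" and F: "group F" and C: "C \<subseteq> carrier G" "C \<subseteq> carrier F"
  shows "\<exists>g ws. g \<in> carrier G \<and> areduced C ws \<and> set ws \<subseteq> carrier F \<times> carrier G \<and>
    A = amalgam_incl G F C g \<otimes>\<^bsub>amalgam G F C\<^esub> aprod G F C ws"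
proof -
  interpret H: group "amalgam G F C" by (rule amalgam_group)
  interpret G: group G by (rule G)
  interpret F: group F by (rule F)
  interpret l: group_hom G "amalgam G F C" "amalgam_incl G F C"
    using amalgam_incl_hom[OF G] by (simp add: group_hom_def group_hom_axioms_def G.is_group H.is_group)
  interpret r: group_hom F "amalgam G F C" "amalgam_incr G F C"
    using amalgam_incr_hom[OF F] by (simp add: group_hom_def group_hom_axioms_def F.is_group H.is_group)
  have ap: "aprod G F C ws \<in> carrier (amalgam G F C)" if "set ws \<subseteq> carrier F \<times> carrier G" for ws
    using that by (induction ws) auto
  note eq = amalgam_incl_eq_incr[of _ C G F]
  show ?thesis using A G F
  proof (induction rule: amalgam_induct)
    case one
    then show ?case by (intro exI[of _ "\<one>\<^bsub>G\<^esub>"] exI[of _ "[]"]) simp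
  next
    case (left g A)
    then obtain g0 ws where *: "g0 \<in> carrier G" "areduced C ws" "set ws \<subseteq> carrier F \<times> carrier G"
      "A = amalgam_incl G F C g0 \<otimes>\<^bsub>amalgam G F C\<^esub> aprod G F C ws" by blast
    then show ?case using left ap[of ws]
      by (intro exI[of _ "g \<otimes>\<^bsub>G\<^esub> g0"] exI[of _ ws]) (simp add: H.m_assoc)
  next
    case (right f A)
    then obtain g0 ws where *: "g0 \<in> carrier G" "areduced C ws" "set ws \<subseteq> carrier F \<times> carrier G"
      "A = amalgam_incl G F C g0 \<otimes>\<^bsub>amalgam G F C\<^esub> aprod G F C ws" by blast
    note apw = ap[OF *(3)]
    consider "f \<in> C" | "f \<notin> C" "g0 \<notin> C" | "g0 \<in> C" by blast
    then show ?case
    proof cases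
      case 1
      then show ?thesis using right * C apw eq[of f, symmetric]
        by (intro exI[of _ "f \<otimes>\<^bsub>G\<^esub> g0"] exI[of _ ws]) (auto simp: H.m_assoc)
    next
      case 2
      have "areduced C ((f, g0) # ws)" using 2 *(2) by (cases ws) auto
      then show ?thesis using right * apw
        by (intro exI[of _ "\<one>\<^bsub>G\<^esub>"] exI[of _ "(f, g0) # ws"]) auto
    next
      case 3
      \<comment> \<open>Here g0 belongs to both factors, so it joins f on the F side and the result
        meets the first syllable f1 of the word. If the merged syllable falls into \<open>C\<close>,
        it crosses over to the G side and joins g1.\<close>
      define f' where "f' = f \<otimes>\<^bsub>F\<^esub> g0"
      have f': "f' \<in> carrier F" using right 3 C by (auto simp: f'_def)
      have A': "amalgam_incr G F C f \<otimes>\<^bsub>amalgam G F C\<^esub> A = amalgam_incr G F C f' \<otimes>\<^bsub>amalgam G F C\<^esub> aprod G F C ws"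
        using right 3 C * apw eq[of g0] by (auto simp: f'_def H.m_assoc subset_iff)
      show ?thesis
      proof (cases ws)
        case Nil
        show ?thesis
        proof (cases "f' \<in> C")
          case True
          then show ?thesis using A' Nil f' C eq[of f']
            by (intro exI[of _ f'] exI[of _ "[]"]) auto
        next
          case False
          then show ?thesis using A' Nil f'
            by (intro exI[of _ "\<one>\<^bsub>G\<^esub>"] exI[of _ "[(f', \<one>\<^bsub>G\<^esub>)]"]) auto
        qed
      next
        case (Cons x ws')
        obtain f1 g1 where x: "x = (f1, g1)" by force
        have c1: "f1 \<in> carrier F" "g1 \<in> carrier G" "set ws' \<subseteq> carrier F \<times> carrier G" using * Cons x by auto
        note apw' = ap[OF c1(3)]
        define f'' where "f'' = f' \<otimes>\<^bsub>F\<^esub> f1"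
        have f'': "f'' \<in> carrier F" using f' c1 by (simp add: f''_def)
        have A'': "amalgam_incr G F C f \<otimes>\<^bsub>amalgam G F C\<^esub> A = amalgam_incr G F C f'' \<otimes>\<^bsub>amalgam G F C\<^esub>
            (amalgam_incl G F C g1 \<otimes>\<^bsub>amalgam G F C\<^esub> aprod G F C ws')"
          unfolding A' using Cons x f' c1 apw' by (simp add: f''_def H.m_assoc)
        show ?thesis
        proof (cases "f'' \<in> C")
          case True
          then show ?thesis using A'' f'' C eq[of f''] c1 apw' areduced_tl[of C x ws'] *(2) Cons
            by (intro exI[of _ "f'' \<otimes>\<^bsub>G\<^esub> g1"] exI[of _ ws']) (auto simp: H.m_assoc subset_iff)
        next
          case False
          then show ?thesis using A'' f'' c1 areduced_head[of C f1 g1 ws' f''] *(2) Cons x apw'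
            by (intro exI[of _ "\<one>\<^bsub>G\<^esub>"] exI[of _ "(f'', g1) # ws'"]) auto
        qed
      qed
    qed
  qed
qed

lemma (in group) int_pow_commute_of:
  assumes "x \<in> carrier G" "y \<in> carrier G" "y \<otimes> x = x \<otimes> y"
  shows "x [^] (m::int) \<otimes> y = y \<otimes> x [^] m"
proof -
  have "y \<otimes> x \<otimes> inv y = x" using assms by (simp add: m_assoc)
  then have "x [^] m = y \<otimes> x [^] m \<otimes> inv y" using conj_int_pow[of y x m] assms by simp
  then show ?thesis using assms
    by (metis int_pow_closed inv_closed l_inv m_assoc m_closed r_one)
qed

lemma rpow_rpow:
  assumes u: "u \<in> carrier subst_group"
  shows "rpow (rpow u \<sigma>) (real_of_int m) = rpow u (\<sigma> * real_of_int m)"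
proof -
  have v: "rpow u \<sigma> \<in> carrier subst_group" by (rule rpow_closed[OF u])
  have nat: "rpow (rpow u \<sigma>) (real n) = rpow u (\<sigma> * real n)" for n :: nat
  proof (induction n)
    case (Suc n)
    have "\<sigma> * real (Suc n) = \<sigma> * real n + \<sigma>" by (simp add: algebra_simps)
    then show ?case by (simp only: rpow_Suc[OF v] Suc.IH rpow_add[OF u, symmetric])
  qed (use u v in \<open>simp add: rpow_0\<close>)
  show ?thesis
  proof (cases m rule: int_cases2)
    case (nonneg n)
    then show ?thesis using nat[of n] by simp
  next
    case (nonpos n)
    have inv: "rpow x (- \<tau>) = inv\<^bsub>subst_group\<^esub> rpow x \<tau>" if "x \<in> carrier subst_group" for x \<tau>
      using SG.inv_equality[of "rpow x (- \<tau>)" "rpow x \<tau>"] rpow_add[OF that, of "-\<tau>" \<tau>] rpow_closed[OF that]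
      by (simp add: subst_mult subst_one rpow_0[OF that])
    show ?thesis using nonpos inv[OF u, of "\<sigma> * real n"] inv[OF v, of "real n"] nat[of n] by simp
  qed
qed

lemma (in group) subgroup_int_pow_closed:
  assumes "subgroup K G" "w \<in> K" shows "w [^] (n::int) \<in> K"
  using group.int_pow_closed[OF subgroup_imp_group[OF assms(1)], of w n] int_pow_consistent[OF assms, of n] assms
  by simp

lemma (in group) gword_in_subgroup:
  assumes K: "subgroup K G" "w \<in> K" "snd ` set ws \<subseteq> K"
  shows "gword w n ws \<in> K"
  using assms(3)
proof (induction ws)
  case (Cons a ws)
  then show ?case
    using K subgroup_int_pow_closed[OF K(1,2)] by (cases a) (auto intro!: subgroup.m_closed[OF K(1)])
qed (use K in \<open>simp add: subgroup.one_closed\<close>)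

text \<open>After conjugation of the second factor, a syllable pair f g becomes w^\<sigma> f
  w^(-\<sigma>) g. Read as a word in powers of w this is a letter with exponent 1 followed by one
  with exponent -1.\<close>

fun awords :: "('a \<Rightarrow> real fps) \<Rightarrow> ('a \<times> 'a) list \<Rightarrow> (int \<times> real fps) list" where
  "awords r [] = []"
| "awords r ((f, g) # ws) = (1, r f) # (-1, r g) # awords r ws"

text \<open>The second factor is conjugated by a big power of an element \<open>w\<close> whose centralizer meets both
  factors exactly in the amalgamated subgroup.\<close>

lemma amalgam_embedding:
  fixes G :: "'a monoid"
  assumes G: "group G" and F: "subgroup F G" and r: "r \<in> mon G subst_group" and S: "qsubring S"
    and K: "bp_set subst_group K" and rK: "r ` carrier G \<subseteq> K" and rS: "r ` carrier G \<subseteq> fps_over S"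
    and w: "w \<in> K" "w \<noteq> fps_X" "w \<in> fps_over S"
    and CG: "C = {x \<in> carrier G. r x oo w = w oo r x}" and CF: "C \<subseteq> F"
    and s: "transc S s"
  shows "BP_group (amalgam G (G\<lparr>carrier := F\<rparr>) C)"
    "\<exists>\<psi> \<in> mon (amalgam G (G\<lparr>carrier := F\<rparr>) C) subst_group.
       (\<forall>A \<in> carrier (amalgam G (G\<lparr>carrier := F\<rparr>) C). \<psi> A \<in> fps_over (adjoin S s)) \<and>
       (\<forall>g \<in> carrier G. \<psi> (amalgam_incl G (G\<lparr>carrier := F\<rparr>) C g) = r g)"
proof -
  let ?F = "G\<lparr>carrier := F\<rparr>"
  let ?H = "amalgam G ?F C"
  interpret G: group G by (rule G)
  have Fg: "group ?F" by (rule G.subgroup_imp_group[OF F])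
  have FG: "F \<subseteq> carrier G" using F by (rule subgroup.subset)
  have Ksub: "subgroup K subst_group" using K by (simp add: bp_set_def)
  interpret K: subgroup K subst_group by (rule Ksub)
  have wc: "w \<in> carrier subst_group" using w by simp
  have rhom: "r \<in> hom G subst_group" using r by (simp add: mon_def)
  have rc: "r g \<in> carrier subst_group" if "g \<in> carrier G" for g using rhom that by (auto simp: hom_def)
  have rw0: "fps_nth (rpow w \<sigma>) 0 = 0" for \<sigma> using rpow_closed[OF wc] by (auto simp: subst_carrier)
  define \<beta> where "\<beta> \<sigma> f = rpow w \<sigma> oo (r f oo rpow w (- \<sigma>))" for \<sigma> f
  have inv: "rpow w (- \<sigma>) = inv\<^bsub>subst_group\<^esub> rpow w \<sigma>" for \<sigma>
    using SG.inv_equality[of "rpow w (- \<sigma>)" "rpow w \<sigma>"] rpow_add[OF wc, of "-\<sigma>" \<sigma>] rpow_closed[OF wc]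
    by (simp add: subst_mult subst_one rpow_0[OF wc])
  have bhom: "\<beta> \<sigma> \<in> hom ?F subst_group" for \<sigma>
  proof -
    have "(\<lambda>a. rpow w \<sigma> \<otimes>\<^bsub>subst_group\<^esub> a \<otimes>\<^bsub>subst_group\<^esub> inv\<^bsub>subst_group\<^esub> rpow w \<sigma>) \<circ> r \<in> hom G subst_group"
      using SG.conj_hom[OF rpow_closed[OF wc]] rhom by (rule hom_compose[rotated])
    then have h: "(\<lambda>a. rpow w \<sigma> \<otimes>\<^bsub>subst_group\<^esub> a \<otimes>\<^bsub>subst_group\<^esub> inv\<^bsub>subst_group\<^esub> rpow w \<sigma>) \<circ> r \<in> hom ?F subst_group"
      using FG by (auto simp: hom_def Pi_def subset_iff)
    moreover have "\<beta> \<sigma> f = ((\<lambda>a. rpow w \<sigma> \<otimes>\<^bsub>subst_group\<^esub> a \<otimes>\<^bsub>subst_group\<^esub> inv\<^bsub>subst_group\<^esub> rpow w \<sigma>) \<circ> r) f"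
      if "f \<in> F" for f
      using SG.m_assoc[OF rpow_closed[OF wc] rc SG.inv_closed[OF rpow_closed[OF wc]], of f \<sigma> \<sigma>] that FG
      by (auto simp: \<beta>_def inv[symmetric] subst_mult)
    ultimately show ?thesis
      using subgroup.m_closed[OF F] by (auto simp: hom_def Pi_def)
  qed
  \<comment> \<open>Elements of \<open>C\<close> commute with \<open>w\<close>, hence with all its
    real powers, so the conjugation fixes them and the maps on the two factors glue.\<close>
  have agree: "r c = \<beta> \<sigma> c" if c: "c \<in> C" for c \<sigma>
  proof -
    have c': "c \<in> carrier G" "r c oo w = w oo r c" using c CG by auto
    have "r c oo rpow w (-\<sigma>) = rpow w (-\<sigma>) oo r c" by (rule rpow_commute[OF wc rc[OF c'(1)] c'(2)])
    then have "\<beta> \<sigma> c = (rpow w \<sigma> oo rpow w (-\<sigma>)) oo r c"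
      using rw0 rc[OF c'(1)] by (simp add: \<beta>_def fps_compose_assoc subst_carrier)
    also have "\<dots> = r c" using rpow_add[OF wc, of \<sigma> "-\<sigma>"] rc[OF c'(1)] by (simp add: rpow_0[OF wc] subst_carrier)
    finally show ?thesis by simp
  qed
  have "\<exists>\<Phi>. \<Phi> \<in> hom ?H subst_group \<and> (\<forall>g\<in>carrier G. \<Phi> (amalgam_incl G ?F C g) = r g)
      \<and> (\<forall>f\<in>F. \<Phi> (amalgam_incr G ?F C f) = \<beta> \<sigma> f)" for \<sigma>
    by (rule amalgam_lift[OF G Fg subst_group_is_group rhom bhom[of \<sigma>] agree[of _ \<sigma>]]) auto
  then obtain \<Psi> where \<Psi>: "\<And>\<sigma>. \<Psi> \<sigma> \<in> hom ?H subst_group"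
      "\<And>\<sigma> g. g \<in> carrier G \<Longrightarrow> \<Psi> \<sigma> (amalgam_incl G ?F C g) = r g"
      "\<And>\<sigma> f. f \<in> F \<Longrightarrow> \<Psi> \<sigma> (amalgam_incr G ?F C f) = \<beta> \<sigma> f"
    by metis
  have H: "group ?H" by (rule amalgam_group)
  interpret H: group ?H by (rule H)
  have mult: "\<Psi> \<sigma> (A \<otimes>\<^bsub>?H\<^esub> B) = \<Psi> \<sigma> A oo \<Psi> \<sigma> B" if "A \<in> carrier ?H" "B \<in> carrier ?H" for A B \<sigma>
    using hom_mult[OF \<Psi>(1) that] by (simp add: subst_mult)
  have inl: "amalgam_incl G ?F C g \<in> carrier ?H" if "g \<in> carrier G" for g
    using amalgam_incl_hom[OF G, of ?F C] that by (auto simp: hom_def)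
  have inr: "amalgam_incr G ?F C g \<in> carrier ?H" if "g \<in> F" for g
    using amalgam_incr_hom[OF Fg, of G C] that by (auto simp: hom_def)
  have ap: "aprod G ?F C ws \<in> carrier ?H" if "set ws \<subseteq> F \<times> carrier G" for ws
    using that by (induction ws) (auto intro!: H.m_closed inl inr)
  have wf: "\<Psi> \<sigma> (aprod G ?F C ws) = wfam w (awords r ws) \<sigma>" if "set ws \<subseteq> F \<times> carrier G" for ws \<sigma>
    using that
  proof (induction ws)
    case Nil
    show ?case using hom_one[OF \<Psi>(1) H subst_group_is_group] by (simp add: subst_one)
  next
    case (Cons a ws)
    obtain f g where a: "a = (f, g)" by force
    have c: "f \<in> F" "g \<in> carrier G" "set ws \<subseteq> F \<times> carrier G" "f \<in> carrier G" using Cons a FG by auto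
    define W where "W = wfam w (awords r ws) \<sigma>"
    have IH: "\<Psi> \<sigma> (aprod G ?F C ws) = W" unfolding W_def by (rule Cons.IH[OF c(3)])
    have "W \<in> carrier subst_group" using \<Psi>(1)[of \<sigma>] ap[OF c(3)] unfolding IH[symmetric] by (auto simp: hom_def)
    then have 0: "fps_nth (r f) 0 = 0" "fps_nth (r g) 0 = 0" "fps_nth W 0 = 0"
      using rc c by (auto simp: subst_carrier)
    have "\<Psi> \<sigma> (aprod G ?F C (a # ws)) = \<beta> \<sigma> f oo (r g oo W)"
      using c ap[OF c(3)] inl[OF c(2)] inr[OF c(1)] by (simp add: a mult \<Psi>(2,3) IH)
    also have "\<dots> = rpow w \<sigma> oo (r f oo (rpow w (- \<sigma>) oo (r g oo W)))"
      using 0 rw0 by (simp add: \<beta>_def fps_compose_assoc)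
    finally show ?case by (simp add: a W_def)
  qed
  have nP: "\<not> (r g oo w = w oo r g)" if "g \<in> carrier G" "g \<notin> C" for g
    using that CG by auto
  have red: "wreduced (\<lambda>g. g oo w = w oo g) (awords r ws)" if "areduced C ws" "set ws \<subseteq> F \<times> carrier G" for ws
    using that CG
  proof (induction C ws rule: areduced.induct)
    case (2 C' f g)
    then show ?case using FG by (auto simp: subset_iff)
  next
    case (3 C' f g x ws)
    obtain f' g' where x: "x = (f', g')" by force
    show ?case using 3 FG by (auto simp: x subset_iff)
  qed simp
  have sn: "snd ` set (awords r ws) \<subseteq> r ` carrier G" if "set ws \<subseteq> F \<times> carrier G" for ws
    using that FG by (induction r ws rule: awords.induct) auto
  have nf: "\<exists>g ws. g \<in> carrier G \<and> areduced C ws \<and> set ws \<subseteq> F \<times> carrier G \<and>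
      A = amalgam_incl G ?F C g \<otimes>\<^bsub>?H\<^esub> aprod G ?F C ws \<and> (\<forall>\<sigma>. \<Psi> \<sigma> A = r g oo wfam w (awords r ws) \<sigma>)"
    if A: "A \<in> carrier ?H" for A
  proof -
    obtain g ws where g: "g \<in> carrier G" "areduced C ws" "set ws \<subseteq> F \<times> carrier G"
        "A = amalgam_incl G ?F C g \<otimes>\<^bsub>?H\<^esub> aprod G ?F C ws"
      using amalgam_normal_form[OF A G Fg] CG CF by auto
    moreover have "\<Psi> \<sigma> A = r g oo wfam w (awords r ws) \<sigma>" for \<sigma>
      using g by (simp add: mult inl ap \<Psi>(2) wf)
    ultimately show ?thesis by blast
  qed
  \<comment> \<open>At natural parameters the values are products of elements of \<open>K\<close>;
    at a general parameter they are words in real powers of \<open>w\<close>. These are the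
    hypotheses of \<open>discriminating_family\<close>.\<close>
  have fam: "\<Psi> (real n) A \<in> K" "(\<lambda>\<sigma>. \<Psi> \<sigma> A) \<in> polyfam S"
      "A \<noteq> \<one>\<^bsub>?H\<^esub> \<Longrightarrow> \<forall>\<^sub>F n in sequentially. \<Psi> (real n) A \<noteq> fps_X"
    if A: "A \<in> carrier ?H" for A n
  proof -
    obtain g ws where g: "g \<in> carrier G" "areduced C ws" "set ws \<subseteq> F \<times> carrier G"
        "A = amalgam_incl G ?F C g \<otimes>\<^bsub>?H\<^esub> aprod G ?F C ws" "\<And>\<sigma>. \<Psi> \<sigma> A = r g oo wfam w (awords r ws) \<sigma>"
      using nf[OF A] by blast
    note sK = subset_trans[OF sn[OF g(3)] rK]
    have gw: "SG.gword w n (awords r ws) \<in> K" for n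
      by (rule SG.gword_in_subgroup[OF Ksub w(1) sK])
    show "\<Psi> (real n) A \<in> K" using rK g(1) gw K.m_closed by (auto simp: g(5) wfam_nat[OF wc] subst_mult)
    have "wfam w (awords r ws) \<in> polyfam S"
      using S w(3) sn[OF g(3)] rS by (intro polyfam_wfam) auto
    then show "(\<lambda>\<sigma>. \<Psi> \<sigma> A) \<in> polyfam S"
      unfolding g(5) using S rS g(1) by (intro polyfam_compose polyfam_const) auto
    show "\<forall>\<^sub>F n in sequentially. \<Psi> (real n) A \<noteq> fps_X" if A1: "A \<noteq> \<one>\<^bsub>?H\<^esub>"
    proof (cases "ws = []")
      case True
      then have "A = amalgam_incl G ?F C g" using g inl[OF g(1)] by simp
      then have "g \<noteq> \<one>\<^bsub>G\<^esub>"
        using A1 hom_one[OF amalgam_incl_hom[OF G] G H] by auto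
      then have "r g \<noteq> fps_X" using mon_eq_one[OF G subst_group_is_group r g(1)] by (simp add: subst_one)
      then show ?thesis using True by (simp add: g(5))
    next
      case False
      then have "awords r ws \<noteq> []" by (cases ws) auto
      then show ?thesis
        unfolding g(5) using rK g(1) by (intro eventually_wfam_neq[OF K w(1,2) _ sK red[OF g(2,3)]]) auto
    qed
  qed
  note D = discriminating_family[OF H S K s \<Psi>(1) fam]
  show "BP_group ?H" by (rule D(1))
  show "\<exists>\<psi> \<in> mon ?H subst_group. (\<forall>A \<in> carrier ?H. \<psi> A \<in> fps_over (adjoin S s)) \<and>
       (\<forall>g \<in> carrier G. \<psi> (amalgam_incl G ?F C g) = r g)"
    using D(2,3) \<Psi>(2) by (intro bexI[of _ "\<Psi> s"]) auto
qed

section \<open>Extensions of centralizers\<close>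

definition stable_letter :: "('a, 'b) monoid_scheme \<Rightarrow> 'a \<Rightarrow> 'a option gword set" where
  "stable_letter G u = pres_class (centr_ext_gens G) (centr_ext_rels G u) [(None, True)]"

lemma centr_ext_group: "group (centr_ext G u)"
  by (simp add: centr_ext_def presented_group_is_group)

lemma centr_ext_incl_hom: "group G \<Longrightarrow> centr_ext_incl G u \<in> hom G (centr_ext G u)"
  unfolding centr_ext_incl_def[abs_def] centr_ext_def
  by (intro table_hom) (auto simp: centr_ext_gens_def centr_ext_rels_def)

lemma stable_letter_closed: "stable_letter G u \<in> carrier (centr_ext G u)"
  unfolding stable_letter_def centr_ext_def by (intro pres_class_carrier) (auto simp: centr_ext_gens_def)

lemma stable_letter_commute:
  assumes G: "group G" and c: "c \<in> centralizer G u"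
  shows "centr_ext_incl G u c \<otimes>\<^bsub>centr_ext G u\<^esub> stable_letter G u
    = stable_letter G u \<otimes>\<^bsub>centr_ext G u\<^esub> centr_ext_incl G u c"
proof -
  let ?X = "centr_ext_gens G" and ?R = "centr_ext_rels G u"
  interpret H: group "centr_ext G u" by (rule centr_ext_group)
  have cG: "c \<in> carrier G" using c by (simp add: centralizer_def)
  have ic: "centr_ext_incl G u c \<in> carrier (centr_ext G u)"
    using centr_ext_incl_hom[OF G] cG by (auto simp: hom_def)
  note t = stable_letter_closed[of G u]
  have X: "Some c \<in> ?X" "None \<in> ?X" using cG by (auto simp: centr_ext_gens_def)
  have "pres_class ?X ?R [(Some c, True), (None, True), (Some c, False), (None, False)] = pres_class ?X ?R []"
    using X c by (intro pres_class_rel) (auto simp: centr_ext_rels_def)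
  moreover have "pres_class ?X ?R [(Some c, True), (None, True), (Some c, False), (None, False)]
    = pres_class ?X ?R [(Some c, True)] \<otimes>\<^bsub>centr_ext G u\<^esub> (pres_class ?X ?R [(None, True)] \<otimes>\<^bsub>centr_ext G u\<^esub>
      (pres_class ?X ?R [(Some c, False)] \<otimes>\<^bsub>centr_ext G u\<^esub> pres_class ?X ?R [(None, False)]))"
    using X by (simp add: centr_ext_def pres_class_mult)
  ultimately have "group_commutator (centr_ext G u) (centr_ext_incl G u c) (stable_letter G u) = \<one>\<^bsub>centr_ext G u\<^esub>"
    using X ic t unfolding group_commutator_def
    by (simp add: centr_ext_incl_def stable_letter_def pres_class_inverse H.m_assoc)
       (simp add: centr_ext_def presented_group_one pres_class_inverse)
  then show ?thesis using H.commutator_eq_one_iff[OF ic t] by simp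
qed

lemma centr_ext_induct [consumes 2, case_names one left stable]:
  assumes A: "A \<in> carrier (centr_ext G u)" and G: "group G"
    and one: "P \<one>\<^bsub>centr_ext G u\<^esub>"
    and left: "\<And>g A. g \<in> carrier G \<Longrightarrow> A \<in> carrier (centr_ext G u) \<Longrightarrow> P A
      \<Longrightarrow> P (centr_ext_incl G u g \<otimes>\<^bsub>centr_ext G u\<^esub> A)"
    and stable: "\<And>(m::int) A. m \<noteq> 0 \<Longrightarrow> A \<in> carrier (centr_ext G u) \<Longrightarrow> P A
      \<Longrightarrow> P (stable_letter G u [^]\<^bsub>centr_ext G u\<^esub> m \<otimes>\<^bsub>centr_ext G u\<^esub> A)"
  shows "P A"
  using A unfolding centr_ext_def
proof (induction rule: presented_group_induct)
  case one
  then show ?case using assms(3) by (simp add: centr_ext_def)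
next
  case (gen x b A)
  interpret H: group "centr_ext G u" by (rule centr_ext_group)
  note t = stable_letter_closed[of G u]
  show ?case
  proof (cases x)
    case (Some g)
    then have g: "g \<in> carrier G" using gen by (auto simp: centr_ext_gens_def)
    have "pres_class (centr_ext_gens G) (centr_ext_rels G u) [(x, b)] = centr_ext_incl G u (if b then g else inv\<^bsub>G\<^esub> g)"
      using hom_m_inv[OF G centr_ext_group centr_ext_incl_hom[OF G] g, of u] gen(1)
      by (auto simp: Some centr_ext_incl_def centr_ext_def pres_class_inverse)
    then show ?thesis using left[of "if b then g else inv\<^bsub>G\<^esub> g" A] gen g group.inv_closed[OF G g]
      by (auto simp: centr_ext_def split: if_splits)
  next
    case None
    have "pres_class (centr_ext_gens G) (centr_ext_rels G u) [(x, b)]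
        = stable_letter G u [^]\<^bsub>centr_ext G u\<^esub> (if b then 1 else -1 :: int)"
    proof (cases b)
      case False
      have "pres_class (centr_ext_gens G) (centr_ext_rels G u) [(x, False)] = inv\<^bsub>centr_ext G u\<^esub> stable_letter G u"
        using gen(1) by (simp add: None stable_letter_def centr_ext_def pres_class_inverse)
      also have "\<dots> = stable_letter G u [^]\<^bsub>centr_ext G u\<^esub> (-1 :: int)"
        using H.int_pow_neg[OF t, of 1] t by simp
      finally show ?thesis using False by simp
    qed (simp add: None stable_letter_def[symmetric] t)
    then show ?thesis using stable[of "if b then 1 else -1" A] gen
      by (auto simp: centr_ext_def split: if_splits)
  qed
qed

lemma centr_ext_lift:
  assumes G: "group G" and K: "group K" and a: "\<alpha> \<in> hom G K" and \<tau>: "\<tau> \<in> carrier K"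
    and comm: "\<And>c. c \<in> centralizer G u \<Longrightarrow> \<alpha> c \<otimes>\<^bsub>K\<^esub> \<tau> = \<tau> \<otimes>\<^bsub>K\<^esub> \<alpha> c"
  obtains \<Phi> where "\<Phi> \<in> hom (centr_ext G u) K"
    "\<And>g. g \<in> carrier G \<Longrightarrow> \<Phi> (centr_ext_incl G u g) = \<alpha> g" "\<Phi> (stable_letter G u) = \<tau>"
proof -
  let ?X = "centr_ext_gens G" and ?R = "centr_ext_rels G u"
  interpret K: group K by (rule K)
  interpret a: group_hom G K \<alpha> using G K a by (simp add: group_hom_def group_hom_axioms_def)
  define f where "f = case_option \<tau> \<alpha>"
  have f: "f ` ?X \<subseteq> carrier K" using \<tau> by (auto simp: f_def centr_ext_gens_def)
  obtain \<Phi> where \<Phi>: "\<Phi> \<in> hom (centr_ext G u) K"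
    "\<And>w. w \<in> gwords ?X \<Longrightarrow> \<Phi> (pres_class ?X ?R w) = weval K f w"
  proof (rule K.presented_group_lift[OF f, of ?R])
    fix v w assume vw: "(v, w) \<in> ?R" "v \<in> gwords ?X" "w \<in> gwords ?X"
    have "\<alpha> c \<otimes>\<^bsub>K\<^esub> (\<tau> \<otimes>\<^bsub>K\<^esub> (inv\<^bsub>K\<^esub> \<alpha> c \<otimes>\<^bsub>K\<^esub> inv\<^bsub>K\<^esub> \<tau>)) = \<one>\<^bsub>K\<^esub>" if c: "c \<in> centralizer G u" for c
    proof -
      have "\<alpha> c \<in> carrier K" using c by (simp add: centralizer_def)
      then have "group_commutator K (\<alpha> c) \<tau> = \<one>\<^bsub>K\<^esub>"
        using K.commutator_eq_one_iff[of "\<alpha> c" \<tau>] comm[OF c] \<tau> by simp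
      then show ?thesis
        using \<open>\<alpha> c \<in> carrier K\<close> \<tau> unfolding group_commutator_def by (simp add: K.m_assoc)
    qed
    then show "weval K f v = weval K f w"
      using vw \<tau> by (auto simp: centr_ext_rels_def table_rels_def centr_ext_gens_def f_def centralizer_def)
  qed (simp add: centr_ext_def)
  have "\<Phi> (centr_ext_incl G u g) = \<alpha> g" if "g \<in> carrier G" for g
    unfolding centr_ext_incl_def using that by (subst \<Phi>(2)) (auto simp: centr_ext_gens_def f_def)
  moreover have "\<Phi> (stable_letter G u) = \<tau>"
    unfolding stable_letter_def using \<tau> by (subst \<Phi>(2)) (auto simp: centr_ext_gens_def f_def)
  ultimately show ?thesis by (rule that[OF \<Phi>(1)])
qed

fun cprod :: "('a, 'b) monoid_scheme \<Rightarrow> 'a \<Rightarrow> (int \<times> 'a) list \<Rightarrow> 'a option gword set" where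
  "cprod G u [] = \<one>\<^bsub>centr_ext G u\<^esub>"
| "cprod G u ((m, g) # ws) = stable_letter G u [^]\<^bsub>centr_ext G u\<^esub> m \<otimes>\<^bsub>centr_ext G u\<^esub>
     (centr_ext_incl G u g \<otimes>\<^bsub>centr_ext G u\<^esub> cprod G u ws)"

lemma wreduced_head: "wreduced P ((m, g) # ws) \<Longrightarrow> m' \<noteq> 0 \<Longrightarrow> wreduced P ((m', g) # ws)"
  by (cases ws) auto

lemma wreduced_tl: "wreduced P (x # ws) \<Longrightarrow> wreduced P ws"
  by (cases x; cases ws) auto

text \<open>A power of the stable letter slides through a leading element that centralizes
  \<open>u\<close> and merges with the next power. If the exponents cancel, the two neighbouring
  elements of \<open>G\<close> multiply; otherwise the word keeps its shape.\<close>

lemma centr_ext_normal_form: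
  assumes A: "A \<in> carrier (centr_ext G u)" and G: "group G"
  shows "\<exists>g ws. g \<in> carrier G \<and> wreduced (\<lambda>g. g \<in> centralizer G u) ws \<and> snd ` set ws \<subseteq> carrier G \<and>
    A = centr_ext_incl G u g \<otimes>\<^bsub>centr_ext G u\<^esub> cprod G u ws"
proof -
  interpret H: group "centr_ext G u" by (rule centr_ext_group)
  interpret G: group G by (rule G)
  interpret l: group_hom G "centr_ext G u" "centr_ext_incl G u"
    using centr_ext_incl_hom[OF G] by (simp add: group_hom_def group_hom_axioms_def G.is_group H.is_group)
  note t = stable_letter_closed[of G u]
  have cp: "cprod G u ws \<in> carrier (centr_ext G u)" if "snd ` set ws \<subseteq> carrier G" for ws
    using that by (induction ws) (auto intro!: t H.m_closed)
  show ?thesis using A G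
  proof (induction rule: centr_ext_induct)
    case one
    then show ?case by (intro exI[of _ "\<one>\<^bsub>G\<^esub>"] exI[of _ "[]"]) simp
  next
    case (left g A)
    then obtain g0 ws where *: "g0 \<in> carrier G" "wreduced (\<lambda>g. g \<in> centralizer G u) ws" "snd ` set ws \<subseteq> carrier G"
      "A = centr_ext_incl G u g0 \<otimes>\<^bsub>centr_ext G u\<^esub> cprod G u ws" by blast
    then show ?case using left cp[of ws]
      by (intro exI[of _ "g \<otimes>\<^bsub>G\<^esub> g0"] exI[of _ ws]) (simp add: H.m_assoc)
  next
    case (stable m A)
    then obtain g0 ws where *: "g0 \<in> carrier G" "wreduced (\<lambda>g. g \<in> centralizer G u) ws" "snd ` set ws \<subseteq> carrier G"
      "A = centr_ext_incl G u g0 \<otimes>\<^bsub>centr_ext G u\<^esub> cprod G u ws" by blast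
    note cpw = cp[OF *(3)]
    show ?case
    proof (cases "g0 \<in> centralizer G u")
      case False
      have "wreduced (\<lambda>g. g \<in> centralizer G u) ((m, g0) # ws)" using False stable *(2) by (cases ws) auto
      then show ?thesis using * cpw t
        by (intro exI[of _ "\<one>\<^bsub>G\<^esub>"] exI[of _ "(m, g0) # ws"]) auto
    next
      case True
      define tm where "tm m = stable_letter G u [^]\<^bsub>centr_ext G u\<^esub> (m::int)" for m
      have tmc: "tm m \<in> carrier (centr_ext G u)" for m using t by (simp add: tm_def)
      have tm_add: "tm i \<otimes>\<^bsub>centr_ext G u\<^esub> tm j = tm (i + j)" for i j
        using H.int_pow_mult[OF t] by (simp add: tm_def)
      have comm: "tm m \<otimes>\<^bsub>centr_ext G u\<^esub> centr_ext_incl G u g0 = centr_ext_incl G u g0 \<otimes>\<^bsub>centr_ext G u\<^esub> tm m"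
        using H.int_pow_commute_of[OF t, of "centr_ext_incl G u g0" m] stable_letter_commute[OF G True] *(1)
        by (simp add: tm_def)
      have A': "tm m \<otimes>\<^bsub>centr_ext G u\<^esub> A = centr_ext_incl G u g0 \<otimes>\<^bsub>centr_ext G u\<^esub> (tm m \<otimes>\<^bsub>centr_ext G u\<^esub> cprod G u ws)"
        using * cpw tmc comm by (simp add: H.m_assoc[symmetric])
      show ?thesis
      proof (cases ws)
        case Nil
        then show ?thesis using A' * tmc stable t unfolding tm_def
          by (intro exI[of _ g0] exI[of _ "[(m, \<one>\<^bsub>G\<^esub>)]"]) auto
      next
        case (Cons x ws')
        obtain m1 g1 where x: "x = (m1, g1)" by force
        have c1: "g1 \<in> carrier G" "snd ` set ws' \<subseteq> carrier G" using * Cons x by auto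
        note cpw' = cp[OF c1(2)]
        have A'': "tm m \<otimes>\<^bsub>centr_ext G u\<^esub> A = centr_ext_incl G u g0 \<otimes>\<^bsub>centr_ext G u\<^esub> (tm (m + m1)
            \<otimes>\<^bsub>centr_ext G u\<^esub> (centr_ext_incl G u g1 \<otimes>\<^bsub>centr_ext G u\<^esub> cprod G u ws'))"
          unfolding A' Cons x cprod.simps tm_def[symmetric] tm_add[symmetric]
          using cpw' c1 tmc *(1) by (simp add: H.m_assoc)
        show ?thesis
        proof (cases "m + m1 = 0")
          case True
          then have 1: "tm m \<otimes>\<^bsub>centr_ext G u\<^esub> A = centr_ext_incl G u (g0 \<otimes>\<^bsub>G\<^esub> g1) \<otimes>\<^bsub>centr_ext G u\<^esub> cprod G u ws'"
            unfolding A'' using cpw' c1(1) *(1) True by (simp add: tm_def[of 0] H.m_assoc)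
          have 2: "wreduced (\<lambda>g. g \<in> centralizer G u) ws'"
            using *(2) unfolding Cons by (rule wreduced_tl)
          have 3: "g0 \<otimes>\<^bsub>G\<^esub> g1 \<in> carrier G" using *(1) c1(1) by simp
          show ?thesis
            by (rule exI[of _ "g0 \<otimes>\<^bsub>G\<^esub> g1"], rule exI[of _ ws'])
               (intro conjI 1[unfolded tm_def] 2 3 c1(2))
        next
          case False
          then have 2: "wreduced (\<lambda>g. g \<in> centralizer G u) ((m + m1, g1) # ws')"
            by (rule wreduced_head[OF *(2)[unfolded Cons x]])
          have 3: "snd ` set ((m + m1, g1) # ws') \<subseteq> carrier G" using c1 by simp
          have 1: "tm m \<otimes>\<^bsub>centr_ext G u\<^esub> A = centr_ext_incl G u g0 \<otimes>\<^bsub>centr_ext G u\<^esub> cprod G u ((m + m1, g1) # ws')"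
            unfolding A'' by (simp add: tm_def)
          show ?thesis
            by (rule exI[of _ g0], rule exI[of _ "(m + m1, g1) # ws'"])
               (intro conjI 1[unfolded tm_def] 2 3 *(1))
        qed
      qed
    qed
  qed
qed

text \<open>The real powers of \<open>r u\<close> commute with the whole image of the centralizer,
  so the defining relations hold for every exponent. The image of the stable letter is recorded
  because the nonabelian free product builds its conjugating element from it.\<close>

lemma centr_ext_embedding:
  assumes BP: "BP_group G" and r: "r \<in> mon G subst_group" and S: "qsubring S"
    and rS: "r ` carrier G \<subseteq> fps_over S" and u: "u \<in> carrier G" "u \<noteq> \<one>\<^bsub>G\<^esub>" and s: "transc S s"
  shows "BP_group (centr_ext G u)"
    "\<exists>\<psi> \<in> mon (centr_ext G u) subst_group.
       (\<forall>A \<in> carrier (centr_ext G u). \<psi> A \<in> fps_over (adjoin S s)) \<and>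
       (\<forall>g \<in> carrier G. \<psi> (centr_ext_incl G u g) = r g) \<and> \<psi> (stable_letter G u) = rpow (r u) s"
proof -
  let ?H = "centr_ext G u"
  have G: "group G" using BP by (simp add: BP_group_def)
  interpret G: group G by (rule G)
  define K where "K = r ` carrier G"
  have K: "bp_set subst_group K" unfolding K_def by (rule bp_set_image[OF BP subst_group_is_group r])
  have Ksub: "subgroup K subst_group" using K by (simp add: bp_set_def)
  interpret K: subgroup K subst_group by (rule Ksub)
  define w where "w = r u"
  have rhom: "r \<in> hom G subst_group" and rinj: "inj_on r (carrier G)" using r by (auto simp: mon_def)
  have rc: "r g \<in> carrier subst_group" if "g \<in> carrier G" for g using rhom that by (auto simp: hom_def)
  have w: "w \<in> K" "w \<noteq> fps_X" "w \<in> fps_over S" "w \<in> carrier subst_group"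
    using u rS rc mon_eq_one[OF G subst_group_is_group r u(1)] by (auto simp: w_def K_def subst_one)
  have comm: "g \<in> centralizer G u \<longleftrightarrow> r g oo w = w oo r g" if "g \<in> carrier G" for g
  proof -
    have "r g oo w = r (g \<otimes>\<^bsub>G\<^esub> u)" "w oo r g = r (u \<otimes>\<^bsub>G\<^esub> g)"
      using hom_mult[OF rhom] u that by (auto simp: w_def subst_mult)
    then show ?thesis using inj_on_eq_iff[OF rinj] u that by (auto simp: centralizer_def)
  qed
  have agree: "r c \<otimes>\<^bsub>subst_group\<^esub> rpow w \<sigma> = rpow w \<sigma> \<otimes>\<^bsub>subst_group\<^esub> r c" if "c \<in> centralizer G u" for c \<sigma>
    using that comm[of c] rc[of c] rpow_commute[OF w(4), of "r c" \<sigma>] by (simp add: centralizer_def subst_mult)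
  have "\<exists>\<Phi>. \<Phi> \<in> hom ?H subst_group \<and> (\<forall>g\<in>carrier G. \<Phi> (centr_ext_incl G u g) = r g)
      \<and> \<Phi> (stable_letter G u) = rpow w \<sigma>" for \<sigma>
    by (rule centr_ext_lift[OF G subst_group_is_group rhom rpow_closed[OF w(4)] agree[of _ \<sigma>]]) auto
  then obtain \<Psi> where \<Psi>: "\<And>\<sigma>. \<Psi> \<sigma> \<in> hom ?H subst_group"
      "\<And>\<sigma> g. g \<in> carrier G \<Longrightarrow> \<Psi> \<sigma> (centr_ext_incl G u g) = r g"
      "\<And>\<sigma>. \<Psi> \<sigma> (stable_letter G u) = rpow w \<sigma>"
    by metis
  have H: "group ?H" by (rule centr_ext_group)
  interpret H: group ?H by (rule H)
  have mult: "\<Psi> \<sigma> (A \<otimes>\<^bsub>?H\<^esub> B) = \<Psi> \<sigma> A oo \<Psi> \<sigma> B" if "A \<in> carrier ?H" "B \<in> carrier ?H" for A B \<sigma>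
    using hom_mult[OF \<Psi>(1) that] by (simp add: subst_mult)
  have inl: "centr_ext_incl G u g \<in> carrier ?H" if "g \<in> carrier G" for g
    using centr_ext_incl_hom[OF G, of u] that by (auto simp: hom_def)
  note t = stable_letter_closed[of G u]
  have cp: "cprod G u ws \<in> carrier ?H" if "snd ` set ws \<subseteq> carrier G" for ws
    using that by (induction ws) (auto intro!: t inl H.m_closed)
  have tpow: "\<Psi> \<sigma> (stable_letter G u [^]\<^bsub>?H\<^esub> (m::int)) = rpow w (\<sigma> * real_of_int m)" for \<sigma> m
  proof -
    have "\<Psi> \<sigma> (stable_letter G u [^]\<^bsub>?H\<^esub> m) = rpow (rpow w \<sigma>) (real_of_int m)"
      using hom_int_pow[OF \<Psi>(1) t H subst_group_is_group] rpow_int[OF rpow_closed[OF w(4)]] by (simp add: \<Psi>(3))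
    also have "\<dots> = rpow w (\<sigma> * real_of_int m)" by (rule rpow_rpow[OF w(4)])
    finally show ?thesis .
  qed
  define tr where "tr = map (\<lambda>(m::int, g). (m, r g))"
  have wf: "\<Psi> \<sigma> (cprod G u ws) = wfam w (tr ws) \<sigma>" if "snd ` set ws \<subseteq> carrier G" for ws \<sigma>
    using that
  proof (induction ws)
    case Nil
    show ?case using hom_one[OF \<Psi>(1) H subst_group_is_group] by (simp add: subst_one tr_def)
  next
    case (Cons a ws)
    obtain m g where a: "a = (m, g)" by force
    then show ?case using Cons cp[of ws] t inl by (simp add: mult \<Psi>(2) tpow tr_def)
  qed
  have red: "wreduced (\<lambda>g. g oo w = w oo g) (tr ws)"
    if "wreduced (\<lambda>g. g \<in> centralizer G u) ws" "snd ` set ws \<subseteq> carrier G" for ws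
    using that by (induction "\<lambda>g. g \<in> centralizer G u" ws rule: wreduced.induct) (auto simp: tr_def comm)
  have sn: "snd ` set (tr ws) \<subseteq> r ` carrier G" if "snd ` set ws \<subseteq> carrier G" for ws
    using that by (auto simp: tr_def)
  have fam: "\<Psi> (real n) A \<in> K" "(\<lambda>\<sigma>. \<Psi> \<sigma> A) \<in> polyfam S"
      "A \<noteq> \<one>\<^bsub>?H\<^esub> \<Longrightarrow> \<forall>\<^sub>F n in sequentially. \<Psi> (real n) A \<noteq> fps_X"
    if A: "A \<in> carrier ?H" for A n
  proof -
    obtain g ws where g: "g \<in> carrier G" "wreduced (\<lambda>g. g \<in> centralizer G u) ws" "snd ` set ws \<subseteq> carrier G"
        "A = centr_ext_incl G u g \<otimes>\<^bsub>?H\<^esub> cprod G u ws"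
      using centr_ext_normal_form[OF A G] by blast
    have g5: "\<Psi> \<sigma> A = r g oo wfam w (tr ws) \<sigma>" for \<sigma>
      using g by (simp add: mult inl cp \<Psi>(2) wf)
    have sK: "snd ` set (tr ws) \<subseteq> K" unfolding K_def by (rule sn[OF g(3)])
    have gw: "SG.gword w n (tr ws) \<in> K" for n
      by (rule SG.gword_in_subgroup[OF Ksub w(1) sK])
    show "\<Psi> (real n) A \<in> K"
      using g(1) gw K.m_closed[of "r g"] by (auto simp: g5 wfam_nat[OF w(4)] subst_mult K_def)
    have "wfam w (tr ws) \<in> polyfam S"
      using S w(3) sn[OF g(3)] rS by (intro polyfam_wfam) auto
    then show "(\<lambda>\<sigma>. \<Psi> \<sigma> A) \<in> polyfam S"
      unfolding g5 using S rS g(1) by (intro polyfam_compose polyfam_const) auto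
    show "\<forall>\<^sub>F n in sequentially. \<Psi> (real n) A \<noteq> fps_X" if A1: "A \<noteq> \<one>\<^bsub>?H\<^esub>"
    proof (cases "ws = []")
      case True
      then have "A = centr_ext_incl G u g" using g inl[OF g(1)] by simp
      then have "g \<noteq> \<one>\<^bsub>G\<^esub>"
        using A1 hom_one[OF centr_ext_incl_hom[OF G] G H] by auto
      then have "r g \<noteq> fps_X" using mon_eq_one[OF G subst_group_is_group r g(1)] by (simp add: subst_one)
      then show ?thesis using True by (simp add: g5 tr_def)
    next
      case False
      then have "tr ws \<noteq> []" by (simp add: tr_def)
      then show ?thesis
        unfolding g5 using g(1) by (intro eventually_wfam_neq[OF K w(1,2) _ sK red[OF g(2,3)]]) (auto simp: K_def)
    qed
  qed
  note D = discriminating_family[OF H S K s \<Psi>(1) fam]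
  show "BP_group ?H" by (rule D(1))
  show "\<exists>\<psi> \<in> mon ?H subst_group. (\<forall>A \<in> carrier ?H. \<psi> A \<in> fps_over (adjoin S s)) \<and>
       (\<forall>g \<in> carrier G. \<psi> (centr_ext_incl G u g) = r g) \<and> \<psi> (stable_letter G u) = rpow (r u) s"
    using D(2,3) \<Psi>(2,3) by (intro bexI[of _ "\<Psi> s"]) (auto simp: w_def)
qed

section \<open>Algebraically independent reals\<close>

inductive_set rg :: "real set \<Rightarrow> real set" for A where
  rg_rat: "q \<in> \<rat> \<Longrightarrow> q \<in> rg A"
| rg_base: "a \<in> A \<Longrightarrow> a \<in> rg A"
| rg_add: "x \<in> rg A \<Longrightarrow> y \<in> rg A \<Longrightarrow> x + y \<in> rg A"
| rg_mult: "x \<in> rg A \<Longrightarrow> y \<in> rg A \<Longrightarrow> x * y \<in> rg A"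

lemma qsubring_rg: "qsubring (rg A)"
  by (auto simp: qsubring_def intro: rg.intros)

lemma rg_least: "qsubring S \<Longrightarrow> A \<subseteq> S \<Longrightarrow> rg A \<subseteq> S"
proof
  fix x assume S: "qsubring S" "A \<subseteq> S" and "x \<in> rg A"
  from this(3) show "x \<in> S" by induction (use S in \<open>auto intro: qsubringD\<close>)
qed

lemma rg_mono: "A \<subseteq> B \<Longrightarrow> rg A \<subseteq> rg B"
  by (rule rg_least[OF qsubring_rg]) (auto intro: rg_base)

lemma rg_insert: "rg (insert x A) = adjoin (rg A) x"
proof
  show "rg (insert x A) \<subseteq> adjoin (rg A) x"
    using adjoin_superset[OF qsubring_rg[of A], of x] adjoin_gen[OF qsubring_rg]
    by (intro rg_least qsubring_adjoin qsubring_rg) (auto intro: rg_base)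
  show "adjoin (rg A) x \<subseteq> rg (insert x A)"
    unfolding adjoin_def
  proof
    fix y assume "y \<in> (\<lambda>p. poly p x) ` polys (rg A)"
    then obtain p where p: "p \<in> polys (rg A)" "y = poly p x" by auto
    have "p \<in> polys (rg (insert x A))" using p(1) rg_mono[of A "insert x A"] by (auto simp: polys_def)
    then show "y \<in> rg (insert x A)" unfolding p(2) by (intro qsubring_poly qsubring_rg rg_base) auto
  qed
qed

lemma rg_finite: "x \<in> rg A \<Longrightarrow> \<exists>B. finite B \<and> B \<subseteq> A \<and> x \<in> rg B"
proof (induction rule: rg.induct)
  case (rg_rat q)
  then show ?case by (intro exI[of _ "{}"]) (auto intro: rg.rg_rat)
next
  case (rg_base a)
  then show ?case by (intro exI[of _ "{a}"]) (auto intro: rg.rg_base)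
next
  case (rg_add x y)
  then obtain B C where "finite B" "B \<subseteq> A" "x \<in> rg B" "finite C" "C \<subseteq> A" "y \<in> rg C" by blast
  then show ?case using rg_mono[of B "B \<union> C"] rg_mono[of C "B \<union> C"]
    by (intro exI[of _ "B \<union> C"]) (auto intro: rg.rg_add)
next
  case (rg_mult x y)
  then obtain B C where "finite B" "B \<subseteq> A" "x \<in> rg B" "finite C" "C \<subseteq> A" "y \<in> rg C" by blast
  then show ?case using rg_mono[of B "B \<union> C"] rg_mono[of C "B \<union> C"]
    by (intro exI[of _ "B \<union> C"]) (auto intro: rg.rg_mult)
qed

text \<open>Relative algebraic closure in the reals. Finite character and exchange make it the
  closure operator of a pregeometry, which is all that the basis argument uses.\<close>

definition acl :: "real set \<Rightarrow> real set" where
  "acl A = {x. \<not> transc (rg A) x}"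

lemma acl_iff: "x \<in> acl A \<longleftrightarrow> (\<exists>p\<in>polys (rg A). p \<noteq> 0 \<and> poly p x = 0)"
  by (auto simp: acl_def transc_def)

lemma acl_mono: "A \<subseteq> B \<Longrightarrow> acl A \<subseteq> acl B"
  using rg_mono[of A B] by (fastforce simp: acl_iff polys_def)

lemma acl_base: "x \<in> A \<Longrightarrow> x \<in> acl A"
  unfolding acl_iff
  by (rule bexI[of _ "[:- x, 1:]"])
     (auto intro!: polys_pCons polys_0 qsubring_rg qsubringD(4,7)[OF qsubring_rg] intro: rg_base)

lemma acl_finite: assumes "x \<in> acl A" shows "\<exists>B. finite B \<and> B \<subseteq> A \<and> x \<in> acl B"
proof -
  obtain p where p: "p \<in> polys (rg A)" "p \<noteq> 0" "poly p x = 0" using assms by (auto simp: acl_iff)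
  have "\<forall>i. \<exists>B. finite B \<and> B \<subseteq> A \<and> coeff p i \<in> rg B" using p(1) rg_finite by (auto simp: polys_def)
  then obtain B where B: "\<And>i. finite (B i)" "\<And>i. B i \<subseteq> A" "\<And>i. coeff p i \<in> rg (B i)" by metis
  define D where "D = (\<Union>i\<le>degree p. B i)"
  have "coeff p i \<in> rg D" for i
  proof (cases "i \<le> degree p")
    case True
    then have "B i \<subseteq> D" by (auto simp: D_def)
    then show ?thesis using B(3) rg_mono by blast
  qed (auto simp: coeff_eq_0 intro: rg_rat)
  then have "x \<in> acl D" using p by (auto simp: acl_iff polys_def)
  moreover have "finite D" "D \<subseteq> A" using B by (auto simp: D_def)
  ultimately show ?thesis by blast
qed

text \<open>A relation for y over A and x is a polynomial in two variables. Sorted by powers of x,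
  it is a relation for x over A and y, unless all its coefficients vanish at y; in that case y is
  algebraic over A or the relation was trivial.\<close>

lemma acl_exchange:
  assumes y: "y \<in> acl (insert x A)" "y \<notin> acl A"
  shows "x \<in> acl (insert y A)"
proof (rule ccontr)
  assume x: "x \<notin> acl (insert y A)"
  obtain p where p: "p \<in> polys (rg (insert x A))" "p \<noteq> 0" "poly p y = 0" using y by (auto simp: acl_iff)
  have "\<forall>i. \<exists>q\<in>polys (rg A). coeff p i = poly q x"
    using p(1) unfolding rg_insert by (auto simp: polys_def adjoin_def)
  then obtain q where q: "\<And>i. q i \<in> polys (rg A)" "\<And>i. coeff p i = poly (q i) x" by metis
  define P where "P = (\<Sum>i\<le>degree p. smult (y ^ i) (q i))"
  have "coeff P j \<in> rg (insert y A)" for j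
    unfolding P_def coeff_sum coeff_smult
    using q(1) rg_mono[of A "insert y A"]
    by (intro qsubring_sum qsubringD(3) qsubring_power qsubring_rg) (auto simp: polys_def intro: rg_base)
  moreover have "poly P x = 0"
  proof -
    have "poly P x = (\<Sum>i\<le>degree p. coeff p i * y ^ i)" by (simp add: P_def poly_sum q(2) mult.commute)
    then show ?thesis using p(3) poly_altdef[of p y] by simp
  qed
  ultimately have "P = 0" using x by (auto simp: acl_iff polys_def)
  have "coeff (q i) j = 0" if "i \<le> degree p" for i j
  proof -
    \<comment> \<open>For fixed j this collects the coefficients of x^j along the powers of y. Its
      value at y is a coefficient of \<open>P\<close>, hence 0, and y is transcendental over
      A.\<close>
    define R where "R = (\<Sum>i\<le>degree p. monom (coeff (q i) j) i)"
    have cR: "coeff R k = (if k \<le> degree p then coeff (q k) j else 0)" for k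
      by (auto simp: R_def coeff_sum if_distrib cong: if_cong)
    have "R \<in> polys (rg A)" using q(1) by (auto simp: polys_def cR intro: rg_rat)
    moreover have "poly R y = coeff P j"
      by (simp add: R_def P_def poly_sum poly_monom coeff_sum mult.commute)
    ultimately have "R = 0" using y(2) \<open>P = 0\<close> by (auto simp: acl_iff)
    then show ?thesis using cR[of i] that by simp
  qed
  then have "q i = 0" if "i \<le> degree p" for i using that by (intro poly_eqI) simp
  then have "lead_coeff p = 0" by (simp add: q(2))
  then show False using p(2) by simp
qed

text \<open>Zorn's lemma on the sets independent over \<open>K\<close>: finite character handles
  unions of chains, and exchange shows that a maximal independent set generates everything.\<close>

lemma transcendence_basis:
  "\<exists>B. (\<forall>b\<in>B. b \<notin> acl (K \<union> (B - {b}))) \<and> acl (K \<union> B) = UNIV"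
proof -
  define indep where "indep B \<longleftrightarrow> (\<forall>b\<in>B. b \<notin> acl (K \<union> (B - {b})))" for B
  have "\<exists>M\<in>{B. indep B}. \<forall>X\<in>{B. indep B}. M \<subseteq> X \<longrightarrow> X = M"
  proof (rule subset_Zorn_nonempty)
    have "indep {}" by (simp add: indep_def)
    then show "{B. indep B} \<noteq> {}" by auto
  next
    fix C assume C: "C \<noteq> {}" "subset.chain {B. indep B} C"
    have "b \<notin> acl (K \<union> (\<Union>C - {b}))" if b: "b \<in> \<Union>C" for b
    proof
      assume "b \<in> acl (K \<union> (\<Union>C - {b}))"
      from acl_finite[OF this] obtain D where D: "finite D" "D \<subseteq> K \<union> (\<Union>C - {b})" "b \<in> acl D"
        by (elim exE conjE)
      \<comment> \<open>Including \<open>b\<close> ensures that the member of the chain found next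
        contains both \<open>b\<close> and the part of \<open>D\<close> outside
        \<open>K\<close>.\<close>
      have "finite (insert b (D - K))" using D(1) by simp
      moreover have "insert b (D - K) \<subseteq> \<Union>C" using D(2) b by blast
      ultimately
      obtain B where B: "B \<in> C" "insert b (D - K) \<subseteq> B"
        by (rule finite_subset_Union_chain[OF _ _ C])
      have "D \<subseteq> K \<union> (B - {b})" using D(2) B(2) by blast
      then have "b \<in> acl (K \<union> (B - {b}))" using D(3) acl_mono[of D] by auto
      moreover have "indep B" using C(2) B(1) by (auto simp: subset.chain_def)
      ultimately show False using B by (auto simp: indep_def)
    qed
    then show "\<Union>C \<in> {B. indep B}" by (auto simp: indep_def)
  qed
  then obtain B where B: "indep B" "\<And>X. indep X \<Longrightarrow> B \<subseteq> X \<Longrightarrow> X = B" by auto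
  have "x \<in> acl (K \<union> B)" for x
  proof (rule ccontr)
    assume x: "x \<notin> acl (K \<union> B)"
    then have xB: "x \<notin> B" using acl_base by blast
    have "indep (insert x B)" unfolding indep_def
    proof
      fix b assume b: "b \<in> insert x B"
      show "b \<notin> acl (K \<union> (insert x B - {b}))"
      proof (cases "b = x")
        case True
        then show ?thesis using x xB by (auto simp: insert_Diff_if)
      next
        case False
        then have bB: "b \<in> B" using b by simp
        \<comment> \<open>If \<open>b\<close> became algebraic once \<open>x\<close> is adjoined,
          exchange would make \<open>x\<close> algebraic over K \<union> B.\<close>
        have "insert x (K \<union> (B - {b})) = K \<union> (insert x B - {b})" "insert b (K \<union> (B - {b})) = K \<union> B"
          using False bB by auto
        then show ?thesis using acl_exchange[of b x "K \<union> (B - {b})"] B(1) bB x by (auto simp: indep_def)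
      qed
    qed
    then show False using B(2)[of "insert x B"] xB by blast
  qed
  then show ?thesis using B(1) by (auto simp: indep_def)
qed

section \<open>Cardinalities of generated rings and algebraic closures\<close>

lemma lepoll_iff_ordLeq: "A \<lesssim> B \<longleftrightarrow> (card_of A, card_of B) \<in> ordLeq"
  by (simp add: lepoll_def card_of_ordLeq)

lemma UN_lepoll_infinite: "infinite D \<Longrightarrow> I \<lesssim> D \<Longrightarrow> (\<And>i. i \<in> I \<Longrightarrow> A i \<lesssim> D) \<Longrightarrow> (\<Union>i\<in>I. A i) \<lesssim> D"
  unfolding lepoll_iff_ordLeq by (rule card_of_UNION_ordLeq_infinite) auto

lemma Times_lepoll_infinite: "infinite D \<Longrightarrow> A \<lesssim> D \<Longrightarrow> B \<lesssim> D \<Longrightarrow> A \<times> B \<lesssim> D"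
  unfolding lepoll_iff_ordLeq by (rule card_of_Sigma_ordLeq_infinite) auto

lemma countable_lepoll_infinite: "countable A \<Longrightarrow> infinite D \<Longrightarrow> A \<lesssim> D"
proof -
  assume "countable A" and D: "infinite D"
  then have "inj_on (to_nat_on A) A" by (intro inj_on_to_nat_on)
  then have "A \<lesssim> (UNIV :: nat set)" by (auto simp: lepoll_def)
  then show ?thesis using D unfolding infinite_le_lepoll by (rule lepoll_trans)
qed

lemma Un_lepoll_infinite: "infinite D \<Longrightarrow> A \<lesssim> D \<Longrightarrow> B \<lesssim> D \<Longrightarrow> A \<union> B \<lesssim> D"
  using UN_lepoll_infinite[of D "UNIV :: bool set" "\<lambda>b. if b then A else B"] countable_lepoll_infinite[of "UNIV :: bool set" D]
  by (simp add: UNIV_bool Un_commute)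

text \<open>The generated ring is exhausted by countably many stages, each adding the sums and
  products of the previous one, and no stage outgrows an infinite \<open>D\<close>.\<close>

lemma rg_lepoll:
  assumes D: "infinite D" shows "rg D \<lesssim> D"
proof -
  define R where "R = rec_nat (D \<union> \<rat>) (\<lambda>_ X. X \<union> ((\<lambda>(x, y). x + y) ` (X \<times> X) \<union> (\<lambda>(x, y). x * y) ` (X \<times> X)))"
  have R0: "R 0 = D \<union> \<rat>" and RS: "R (Suc n) = R n \<union> ((\<lambda>(x, y). x + y) ` (R n \<times> R n) \<union> (\<lambda>(x, y). x * y) ` (R n \<times> R n))" for n
    by (simp_all add: R_def)
  have "R n \<lesssim> D" for n
  proof (induction n)
    case 0
    show ?case unfolding R0
      by (intro Un_lepoll_infinite[OF D] lepoll_refl countable_lepoll_infinite D countable_rat)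
  next
    case (Suc n)
    have RR: "f ` (R n \<times> R n) \<lesssim> D" for f :: "real \<times> real \<Rightarrow> real"
      by (rule lepoll_trans[OF image_lepoll Times_lepoll_infinite[OF D Suc Suc]])
    show ?case unfolding RS by (intro Un_lepoll_infinite[OF D] Suc RR)
  qed
  then have U: "(\<Union>n. R n) \<lesssim> D"
    using D by (intro UN_lepoll_infinite) (auto simp: infinite_le_lepoll)
  have mono: "R m \<subseteq> R n" if "m \<le> n" for m n
    using that by (induction rule: dec_induct) (auto simp: RS)
  have "rg D \<subseteq> (\<Union>n. R n)"
  proof
    fix x assume "x \<in> rg D"
    then show "x \<in> (\<Union>n. R n)"
    proof induction
      case (rg_add x y)
      then obtain m n where "x \<in> R m" "y \<in> R n" by auto
      then have "x \<in> R (max m n)" "y \<in> R (max m n)" using mono[of m "max m n"] mono[of n "max m n"] by auto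
      then have "x + y \<in> R (Suc (max m n))" by (force simp: RS)
      then show ?case by blast
    next
      case (rg_mult x y)
      then obtain m n where "x \<in> R m" "y \<in> R n" by auto
      then have "x \<in> R (max m n)" "y \<in> R (max m n)" using mono[of m "max m n"] mono[of n "max m n"] by auto
      then have "x * y \<in> R (Suc (max m n))" by (force simp: RS)
      then show ?case by blast
    qed (use R0 in auto)
  qed
  then show ?thesis by (rule lepoll_trans[OF subset_imp_lepoll U])
qed

lemma polys_lepoll:
  assumes D: "infinite D" "S \<lesssim> D" shows "polys S \<lesssim> D"
proof -
  define P where "P = rec_nat {0} (\<lambda>_ X. (\<lambda>(a, p). pCons a p) ` (S \<times> X))"
  have P0: "P 0 = {0}" and PS: "P (Suc n) = (\<lambda>(a, p). pCons a p) ` (S \<times> P n)" for n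
    by (simp_all add: P_def)
  have "P n \<lesssim> D" for n
  proof (induction n)
    case 0
    show ?case unfolding P0 using D by (intro countable_lepoll_infinite) auto
  next
    case (Suc n)
    show ?case unfolding PS by (rule lepoll_trans[OF image_lepoll Times_lepoll_infinite[OF D(1,2) Suc]])
  qed
  then have U: "(\<Union>n. P n) \<lesssim> D"
    using D by (intro UN_lepoll_infinite) (auto simp: infinite_le_lepoll)
  have "p \<in> (\<Union>n. P n)" if "p \<in> polys S" for p
    using that
  proof (induction p)
    case (pCons a p)
    have h: "coeff (pCons a p) i \<in> S" for i using pCons.prems by (simp add: polys_def)
    have "coeff p i \<in> S" for i using h[of "Suc i"] by simp
    then have "p \<in> polys S" by (simp add: polys_def)
    then obtain n where n: "p \<in> P n" using pCons.IH by auto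
    have "(a, p) \<in> S \<times> P n" using h[of 0] n by simp
    then have "pCons a p \<in> P (Suc n)" unfolding PS by (rule rev_image_eqI) simp
    then show ?case by (rule UN_I[OF UNIV_I])
  next
    case 0
    show ?case by (rule UN_I[of 0]) (simp_all add: P0)
  qed
  then have "polys S \<subseteq> (\<Union>n. P n)" by blast
  then show ?thesis by (rule lepoll_trans[OF subset_imp_lepoll U])
qed

text \<open>The closure is a union of finite root sets, indexed by the nonzero polynomials over the
  generated ring.\<close>

lemma acl_lepoll:
  assumes D: "infinite D" shows "acl D \<lesssim> D"
proof -
  have "acl D = (\<Union>p\<in>polys (rg D) - {0}. {x. poly p x = 0})" by (auto simp: acl_iff)
  also have "\<dots> \<lesssim> D"
  proof (rule UN_lepoll_infinite[OF D])
    show "polys (rg D) - {0} \<lesssim> D"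
      by (rule lepoll_trans[OF subset_imp_lepoll polys_lepoll[OF D rg_lepoll[OF D]]]) auto
    show "{x. poly p x = 0} \<lesssim> D" if "p \<in> polys (rg D) - {0}" for p
      using that poly_roots_finite[of p] by (intro countable_lepoll_infinite D countable_finite) auto
  qed
  finally show ?thesis .
qed

lemma lesspoll_iff_not: "A \<prec> B \<longleftrightarrow> A \<lesssim> B \<and> \<not> B \<lesssim> A"
  by (auto simp: lesspoll_def intro: lepoll_antisym eqpoll_imp_lepoll eqpoll_sym)

lemma lepoll_linear: "A \<lesssim> B \<or> B \<lesssim> A"
  unfolding lepoll_iff_ordLeq using ordLeq_total[OF card_of_Well_order card_of_Well_order] .

text \<open>A transcendence basis of the reals over a set smaller than the continuum must have the
  size of the continuum, for otherwise its algebraic closure would be too small. The index set then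
  injects into the basis.\<close>

lemma transcendental_family:
  fixes K :: "real set" and I :: "'i set"
  assumes K: "K \<prec> (UNIV :: real set)" and I: "I \<lesssim> (UNIV :: real set)"
  obtains e :: "'i \<Rightarrow> real" where "\<And>i. i \<in> I \<Longrightarrow> e i \<notin> acl (K \<union> e ` (I - {i}))"
proof -
  obtain B where B: "\<forall>b\<in>B. b \<notin> acl (K \<union> (B - {b}))" "acl (K \<union> B) = UNIV" using transcendence_basis by blast
  have infR: "infinite (UNIV :: real set)" by (rule infinite_UNIV_char_0)
  \<comment> \<open>The rationals make the base infinite, as the cardinality bounds require, and it
    stays smaller than the reals.\<close>
  define K' where "K' = K \<union> \<rat>"
  have ratR: "\<not> (UNIV :: real set) \<lesssim> (\<rat> :: real set)"
    using countable_lepoll[OF countable_rat] uncountable_UNIV_real by blast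
  have infQ: "infinite (\<rat> :: real set)" using Rats_infinite .
  have K': "\<not> (UNIV :: real set) \<lesssim> K'"
  proof
    assume U: "(UNIV :: real set) \<lesssim> K'"
    show False
    proof (cases "(\<rat> :: real set) \<lesssim> K")
      case True
      then have "infinite K" using infQ lepoll_trans[of "UNIV :: nat set" "\<rat> :: real set" K] by (simp add: infinite_le_lepoll)
      then have "K' \<lesssim> K" unfolding K'_def using True by (intro Un_lepoll_infinite) auto
      then show False using K lepoll_trans[OF U] by (auto simp: lesspoll_iff_not)
    next
      case False
      then have "K \<lesssim> (\<rat> :: real set)" using lepoll_linear by blast
      then have "K' \<lesssim> (\<rat> :: real set)" unfolding K'_def using infQ by (intro Un_lepoll_infinite) auto
      then show False using ratR lepoll_trans[OF U] by blast
    qed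
  qed
  have infK': "infinite K'" using infQ by (auto simp: K'_def)
  have "UNIV = acl (K' \<union> B)" using B(2) acl_mono[of "K \<union> B" "K' \<union> B"] by (auto simp: K'_def)
  moreover have "acl (K' \<union> B) \<lesssim> K' \<union> B" by (rule acl_lepoll) (use infK' in auto)
  ultimately have U: "(UNIV :: real set) \<lesssim> K' \<union> B" by simp
  have "(UNIV :: real set) \<lesssim> B"
  proof (cases "B \<lesssim> K'")
    case True
    then have "K' \<union> B \<lesssim> K'" using infK' by (intro Un_lepoll_infinite) auto
    then show ?thesis using K' lepoll_trans[OF U] by blast
  next
    case False
    then have KB: "K' \<lesssim> B" using lepoll_linear by blast
    then have "infinite B" using infK' lepoll_trans[of "UNIV :: nat set" K' B] by (simp add: infinite_le_lepoll)
    then have "K' \<union> B \<lesssim> B" using KB by (intro Un_lepoll_infinite) auto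
    then show ?thesis by (rule lepoll_trans[OF U])
  qed
  then have "I \<lesssim> B" by (rule lepoll_trans[OF I])
  then obtain e where e: "inj_on e I" "e ` I \<subseteq> B" by (auto simp: lepoll_def)
  show ?thesis
  proof (rule that[of e])
    fix i assume i: "i \<in> I"
    have "K \<union> e ` (I - {i}) \<subseteq> K \<union> (B - {e i})" using e i by (auto dest: inj_onD)
    then show "e i \<notin> acl (K \<union> e ` (I - {i}))" using B(1) e i acl_mono by blast
  qed
qed

section \<open>Two by two matrices\<close>

text \<open>Quadruples inherit addition, scaling and topology from the instances for products, so
  that limits of matrices can be taken directly.\<close>

type_synonym mat2 = "real \<times> real \<times> real \<times> real"

fun mm :: "mat2 \<Rightarrow> mat2 \<Rightarrow> mat2" where
  "mm (a, b, c, d) (a', b', c', d') = (a * a' + b * c', a * b' + b * d', c * a' + d * c', c * b' + d * d')"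

fun mdet :: "mat2 \<Rightarrow> real" where "mdet (a, b, c, d) = a * d - b * c"

fun mtr :: "mat2 \<Rightarrow> real" where "mtr (a, b, c, d) = a + d"

fun madj :: "mat2 \<Rightarrow> mat2" where "madj (a, b, c, d) = (d, - b, - c, a)"

abbreviation mone :: mat2 where "mone \<equiv> (1, 0, 0, 1)"

definition sl2 :: "mat2 monoid" where
  "sl2 = \<lparr>carrier = {m. mdet m = 1}, monoid.mult = mm, one = mone\<rparr>"

lemma mm_assoc: "mm (mm A B) C = mm A (mm B C)"
  by (cases A; cases B; cases C) (simp add: algebra_simps)

lemma mdet_mm: "mdet (mm A B) = mdet A * mdet B"
  by (cases A; cases B) (simp add: algebra_simps)

lemma mtr_commute: "mtr (mm A B) = mtr (mm B A)"
  by (cases A; cases B) (simp add: algebra_simps)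

lemma mm_one [simp]: "mm mone A = A" "mm A mone = A"
  by (cases A; simp)+

lemma mm_scaleR: "mm (k *\<^sub>R A) B = k *\<^sub>R mm A B" "mm A (k *\<^sub>R B) = k *\<^sub>R mm A B"
  by (cases A; cases B; simp add: algebra_simps)+

lemma mm_add: "mm (A + A') B = mm A B + mm A' B" "mm A (B + B') = mm A B + mm A B'"
  by (cases A; cases A'; cases B; simp add: algebra_simps) (cases A; cases B; cases B'; simp add: algebra_simps)

lemma mm_diff: "mm (A - A') B = mm A B - mm A' B" "mm A (B - B') = mm A B - mm A B'"
  by (cases A; cases A'; cases B; simp add: algebra_simps) (cases A; cases B; cases B'; simp add: algebra_simps)

lemma tendsto_mm:
  assumes "(f \<longlongrightarrow> A) F" "(g \<longlongrightarrow> B) F" shows "((\<lambda>x. mm (f x) (g x)) \<longlongrightarrow> mm A B) F"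
proof -
  define a where "a i x = (case i of 0 \<Rightarrow> fst x | Suc 0 \<Rightarrow> fst (snd x) | Suc (Suc 0) \<Rightarrow> fst (snd (snd x)) | _ \<Rightarrow> snd (snd (snd x)))"
    for i :: nat and x :: mat2
  have mm: "mm x y = (a 0 x * a 0 y + a 1 x * a 2 y, a 0 x * a 1 y + a 1 x * a 3 y,
      a 2 x * a 0 y + a 3 x * a 2 y, a 2 x * a 1 y + a 3 x * a 3 y)" for x y
    by (cases x; cases y) (simp add: a_def numeral_2_eq_2 numeral_3_eq_3)
  have "((\<lambda>x. a i (f x)) \<longlongrightarrow> a i A) F" "((\<lambda>x. a i (g x)) \<longlongrightarrow> a i B) F" for i
    using assms by (auto simp: a_def split: nat.split intro!: tendsto_intros)
  then show ?thesis unfolding mm by (intro tendsto_intros)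
qed

lemma sl2_group: "group sl2"
proof (rule groupI)
  fix A assume "A \<in> carrier sl2"
  then show "\<exists>B\<in>carrier sl2. B \<otimes>\<^bsub>sl2\<^esub> A = \<one>\<^bsub>sl2\<^esub>"
    by (intro bexI[of _ "madj A"]; cases A) (auto simp: sl2_def algebra_simps)
qed (auto simp: sl2_def mm_assoc mdet_mm)

interpretation SL: group sl2 by (rule sl2_group)

lemma sl2_simps:
  "A \<otimes>\<^bsub>sl2\<^esub> B = mm A B" "\<one>\<^bsub>sl2\<^esub> = mone" "A \<in> carrier sl2 \<longleftrightarrow> mdet A = 1"
  by (simp_all add: sl2_def)

lemma sl2_inv: "A \<in> carrier sl2 \<Longrightarrow> inv\<^bsub>sl2\<^esub> A = madj A"
  by (rule SL.inv_equality) (cases A; auto simp: sl2_def algebra_simps)+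

lemma cayley_hamilton: "mdet A = 1 \<Longrightarrow> mm A A = mtr A *\<^sub>R A - mone"
  by (cases A) (simp add: algebra_simps)

text \<open>Fricke's trace identity for commutators.\<close>

lemma mtr_commutator:
  assumes "A \<in> carrier sl2" "B \<in> carrier sl2"
  shows "mtr (group_commutator sl2 A B)
    = (mtr A)\<^sup>2 + (mtr B)\<^sup>2 + (mtr (mm A B))\<^sup>2 - mtr A * mtr B * mtr (mm A B) - 2"
proof -
  \<comment> \<open>The identity made homogeneous by inserting determinants: in this form it is a
    polynomial identity in the eight entries, without side conditions.\<close>
  have hom: "mtr (mm (mm (mm A B) (madj A)) (madj B)) = (mtr A)\<^sup>2 * mdet B + (mtr B)\<^sup>2 * mdet A
      + (mtr (mm A B))\<^sup>2 - mtr A * mtr B * mtr (mm A B) - 2 * mdet A * mdet B"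
    by (cases A; cases B) (simp add: algebra_simps power2_eq_square)
  then show ?thesis using assms by (simp add: group_commutator_def sl2_simps sl2_inv)
qed

text \<open>Here b and b' are eigenvalues, and the range of B - b' consists of common eigenvectors
  of A and B, whence the trace 2. The calculation gets this from Fricke's identity with mtr A = b +
  1/b, mtr B = b' + 1/b' and mtr (A B) = b/b' + b'/b.\<close>

lemma mtr_commutator_eq_2:
  assumes A: "A \<in> carrier sl2" and B: "B \<in> carrier sl2"
    and b: "b\<^sup>2 - mtr A * b + 1 = 0" "b'\<^sup>2 - mtr B * b' + 1 = 0"
    and prod: "mm (A - b *\<^sub>R mone) (B - b' *\<^sub>R mone) = 0"
  shows "mtr (group_commutator sl2 A B) = 2"
proof -
  have b0: "b \<noteq> 0" "b' \<noteq> 0" using b by auto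
  have x: "mtr A = b + 1 / b" and y: "mtr B = b' + 1 / b'"
    using b b0 by (auto simp: field_simps power2_eq_square)
  have "mtr (mm (A - b *\<^sub>R mone) (B - b' *\<^sub>R mone)) = mtr (mm A B) - b' * mtr A - b * mtr B + 2 * b * b'"
    by (cases A; cases B) (simp add: algebra_simps)
  then have "mtr (mm A B) = b' * mtr A + b * mtr B - 2 * b * b'" using prod by (simp add: zero_prod_def)
  also have "\<dots> = b' / b + b / b'" unfolding x y using b0 by (simp add: field_simps)
  finally have z: "mtr (mm A B) = b' / b + b / b'" .
  show ?thesis unfolding mtr_commutator[OF A B] x y z using b0
    by (simp add: field_simps power2_eq_square)
qed

text \<open>A singular B is a column times a row, so A B C is the column of A B times the row of B
  C, and both are nonzero.\<close>

lemma mm_rank_one: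
  assumes B: "mdet B = 0" and "mm A B \<noteq> 0" "mm B C \<noteq> 0"
  shows "mm A (mm B C) \<noteq> 0"
proof -
  obtain b1 b2 b3 b4 where Bq: "B = (b1, b2, b3, b4)" by (cases B)
  have "\<exists>p q r s. B = (p * r, p * s, q * r, q * s)"
  proof (cases "b1 = 0 \<and> b2 = 0")
    case True
    then have "B = (0 * b3, 0 * b4, 1 * b3, 1 * b4)" by (simp add: Bq)
    then show ?thesis by blast
  next
    case False
    then consider "b1 \<noteq> 0" | "b2 \<noteq> 0" by blast
    then show ?thesis
    proof cases
      case 1
      have "B = (1 * b1, 1 * b2, (b3 / b1) * b1, (b3 / b1) * b2)" using 1 B by (simp add: Bq field_simps)
      then show ?thesis by blast
    next
      case 2
      have "B = (1 * b1, 1 * b2, (b4 / b2) * b1, (b4 / b2) * b2)" using 2 B by (simp add: Bq field_simps)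
      then show ?thesis by blast
    qed
  qed
  then obtain p q r s where Bf: "B = (p * r, p * s, q * r, q * s)" by blast
  obtain a b c d where Af: "A = (a, b, c, d)" by (cases A)
  obtain a' b' c' d' where Cf: "C = (a', b', c', d')" by (cases C)
  define v1 v2 x1 x2 where "v1 = a * p + b * q" and "v2 = c * p + d * q" and "x1 = r * a' + s * c'" and "x2 = r * b' + s * d'"
  have "mm A B = (v1 * r, v1 * s, v2 * r, v2 * s)"
    by (simp add: Af Bf v1_def v2_def algebra_simps)
  then have v: "v1 \<noteq> 0 \<or> v2 \<noteq> 0" using assms(2) by (auto simp: zero_prod_def)
  have "mm B C = (p * x1, p * x2, q * x1, q * x2)"
    by (simp add: Cf Bf x1_def x2_def algebra_simps)
  then have x: "x1 \<noteq> 0 \<or> x2 \<noteq> 0" using assms(3) by (auto simp: zero_prod_def)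
  have "mm A (mm B C) = (v1 * x1, v1 * x2, v2 * x1, v2 * x2)"
    by (simp add: Af Bf Cf v1_def v2_def x1_def x2_def algebra_simps)
  then show ?thesis using v x by (auto simp: zero_prod_def)
qed

text \<open>Rescaled powers of A converge to a nonzero multiple of A - b, where b is an eigenvalue:
  the smaller one for a hyperbolic matrix, 1 for a unipotent one. This common form treats both
  classes together. The scale c has to tend to 0, so that a sequence of products equal to the
  identity would be scaled to 0.\<close>

definition growing :: "mat2 \<Rightarrow> (nat \<Rightarrow> real) \<Rightarrow> real \<Rightarrow> real \<Rightarrow> bool" where
  "growing A c b k \<longleftrightarrow> b\<^sup>2 - mtr A * b + 1 = 0 \<and> k \<noteq> 0 \<and> A \<noteq> b *\<^sub>R mone \<and>
     c \<longlonglongrightarrow> 0 \<and> (\<lambda>n. c n *\<^sub>R (A [^]\<^bsub>sl2\<^esub> n)) \<longlonglongrightarrow> k *\<^sub>R (A - b *\<^sub>R mone)"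

lemma growing_hyperbolic:
  assumes A: "A \<in> carrier sl2" and tr: "\<bar>mtr A\<bar> > 2"
  obtains c b k where "growing A c b k"
proof -
  define t where "t = mtr A"
  have t4: "t\<^sup>2 > 4" using power_strict_mono[of 2 "\<bar>t\<bar>" 2] tr by (simp add: t_def)
  \<comment> \<open>The sign of the trace selects the eigenvalue of larger modulus.\<close>
  define a where "a = (t + sgn t * sqrt (t\<^sup>2 - 4)) / 2"
  have sg: "(sgn t)\<^sup>2 = 1" "t \<noteq> 0" using tr by (auto simp: t_def sgn_if)
  have "2 * a - t = sgn t * sqrt (t\<^sup>2 - 4)" by (simp add: a_def field_simps)
  then have "(2 * a - t)\<^sup>2 = t\<^sup>2 - 4" using t4 sg by (simp add: power_mult_distrib)
  moreover have "(2 * a - t)\<^sup>2 = 4 * (a\<^sup>2 - t * a) + t\<^sup>2" by (simp add: power2_eq_square algebra_simps)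
  ultimately have "4 * (a\<^sup>2 - t * a) = 4 * (- 1)" by simp
  then have "a\<^sup>2 - t * a = - 1" by (rule mult_left_cancel[THEN iffD1, rotated]) simp
  then have a1: "a\<^sup>2 - t * a + 1 = 0" by simp
  have "2 * \<bar>a\<bar> = \<bar>t\<bar> + sqrt (t\<^sup>2 - 4)"
  proof -
    have "2 * \<bar>(t + sgn t * r) / 2\<bar> = \<bar>t\<bar> + r" if "0 \<le> r" for r
      using that sg(2) by (cases "t > 0") auto
    then show ?thesis unfolding a_def using t4 by simp
  qed
  moreover have "sqrt (t\<^sup>2 - 4) > 0" using t4 by simp
  moreover have "\<bar>t\<bar> > 2" using tr by (simp add: t_def)
  ultimately have "\<bar>a\<bar> > 1" by linarith
  note a = a1 this
  define b where "b = 1 / a"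
  have a0: "a \<noteq> 0" using a by auto
  have ab: "a * b = 1" "a + b = t" "b \<noteq> 0" "b\<^sup>2 - t * b + 1 = 0"
    using a a0 by (auto simp: b_def field_simps power2_eq_square)
  have "\<bar>b\<bar> < 1" using a by (simp add: b_def)
  have amb: "a - b \<noteq> 0" using a \<open>\<bar>b\<bar> < 1\<close> by auto
  have Ab: "A \<noteq> b *\<^sub>R mone"
  proof
    assume "A = b *\<^sub>R mone"
    then have "t = 2 * b" by (simp add: t_def)
    then show False using ab amb by simp
  qed
  define k where "k = 1 / (a - b)"
  have CH: "mm A A = t *\<^sub>R A - mone" using A by (simp add: cayley_hamilton t_def sl2_simps)
  \<comment> \<open>Spectral decomposition: up to the factor k, the matrices A - b and a - A are the
    projections to the two eigenlines.\<close>
  have pow: "A [^]\<^bsub>sl2\<^esub> n = (k * a ^ n) *\<^sub>R (A - b *\<^sub>R mone) + (k * b ^ n) *\<^sub>R (a *\<^sub>R mone - A)" for n :: nat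
  proof (induction n)
    case 0
    have "k *\<^sub>R (A - b *\<^sub>R mone) + k *\<^sub>R (a *\<^sub>R mone - A) = (k * (a - b)) *\<^sub>R mone"
      by (cases A) (simp add: algebra_simps)
    then show ?case using amb by (simp add: sl2_simps k_def)
  next
    case (Suc n)
    have 12: "mm (A - b *\<^sub>R mone) A = a *\<^sub>R (A - b *\<^sub>R mone)" "mm (a *\<^sub>R mone - A) A = b *\<^sub>R (a *\<^sub>R mone - A)"
    proof -
      have "mm (A - b *\<^sub>R mone) A = (t - b) *\<^sub>R A - (a * b) *\<^sub>R mone" "mm (a *\<^sub>R mone - A) A = (a * b) *\<^sub>R mone - (t - a) *\<^sub>R A"
        by (simp_all only: mm_diff mm_scaleR mm_one CH ab(1) scaleR_diff_left) (simp_all add: algebra_simps)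
      moreover have "t - b = a" "t - a = b" using ab(2) by auto
      ultimately show "mm (A - b *\<^sub>R mone) A = a *\<^sub>R (A - b *\<^sub>R mone)" "mm (a *\<^sub>R mone - A) A = b *\<^sub>R (a *\<^sub>R mone - A)"
        by (simp_all only: scaleR_diff_right scaleR_scaleR mult.commute[of b a])
    qed
    have "A [^]\<^bsub>sl2\<^esub> Suc n = mm ((k * a ^ n) *\<^sub>R (A - b *\<^sub>R mone) + (k * b ^ n) *\<^sub>R (a *\<^sub>R mone - A)) A"
      by (simp only: Suc SL.nat_pow_Suc sl2_simps)
    also have "\<dots> = (k * a ^ n) *\<^sub>R (a *\<^sub>R (A - b *\<^sub>R mone)) + (k * b ^ n) *\<^sub>R (b *\<^sub>R (a *\<^sub>R mone - A))"
      by (simp only: mm_add mm_scaleR 12)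
    finally show ?case by (simp only: scaleR_scaleR power_Suc mult_ac)
  qed
  have lim: "(\<lambda>n. (1 / a ^ n) *\<^sub>R (A [^]\<^bsub>sl2\<^esub> n)) \<longlonglongrightarrow> k *\<^sub>R (A - b *\<^sub>R mone)"
  proof -
    have "(1 / a ^ n) *\<^sub>R ((k * a ^ n) *\<^sub>R M + (k * b ^ n) *\<^sub>R N) = k *\<^sub>R M + (k * (b * b) ^ n) *\<^sub>R N" for n and M N :: mat2
      using a0 by (simp add: scaleR_add_right b_def power_divide power_mult_distrib)
    then have eq: "(1 / a ^ n) *\<^sub>R (A [^]\<^bsub>sl2\<^esub> n) = k *\<^sub>R (A - b *\<^sub>R mone) + (k * (b * b) ^ n) *\<^sub>R (a *\<^sub>R mone - A)" for n
      by (simp only: pow)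
    have bb: "norm (b * b) < 1" using abs_square_less_1[of b] \<open>\<bar>b\<bar> < 1\<close> by (simp add: power2_eq_square)
    have "(\<lambda>n. k *\<^sub>R M + (k * (b * b) ^ n) *\<^sub>R N) \<longlonglongrightarrow> k *\<^sub>R M + (k * 0) *\<^sub>R N" for M N :: mat2
      by (intro tendsto_intros LIMSEQ_power_zero bb)
    from this[of "A - b *\<^sub>R mone" "a *\<^sub>R mone - A"] show ?thesis
      unfolding eq mult_zero_right scaleR_zero_left add_0_right .
  qed
  have "(\<lambda>n. 1 / a ^ n) \<longlonglongrightarrow> 0"
    using LIMSEQ_power_zero[of b] \<open>\<bar>b\<bar> < 1\<close> by (simp add: b_def power_one_over)
  then have "growing A (\<lambda>n. 1 / a ^ n) b k"
    using lim ab Ab amb by (auto simp: growing_def t_def k_def)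
  then show ?thesis by (rule that)
qed

text \<open>The square of A - 1 vanishes, so A^n = 1 + n (A - 1), and division by n gives the
  limit.\<close>

lemma growing_unipotent:
  assumes A: "A \<in> carrier sl2" and tr: "mtr A = 2" "A \<noteq> mone"
  obtains c b k where "growing A c b k"
proof -
  have CH: "mm A A = 2 *\<^sub>R A - mone" using A tr by (simp add: cayley_hamilton sl2_simps)
  have 1: "mm (A - mone) A = A - mone"
    by (simp only: mm_diff mm_one CH scaleR_2) simp
  have pow: "A [^]\<^bsub>sl2\<^esub> n = mone + real n *\<^sub>R (A - mone)" for n :: nat
  proof (induction n)
    case (Suc n)
    have alg: "A + x *\<^sub>R (A - e) = e + (1 + x) *\<^sub>R (A - e)" for x and e :: mat2 by (simp add: algebra_simps)
    have "A [^]\<^bsub>sl2\<^esub> Suc n = mm (mone + real n *\<^sub>R (A - mone)) A"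
      by (simp only: Suc SL.nat_pow_Suc sl2_simps)
    also have "\<dots> = A + real n *\<^sub>R (A - mone)" by (simp only: mm_add mm_scaleR mm_one 1)
    finally show ?case by (simp only: alg of_nat_Suc)
  qed (simp add: sl2_simps)
  have "(\<lambda>n. (1 / real n) *\<^sub>R e + N) \<longlonglongrightarrow> 0 *\<^sub>R e + N" for e N :: mat2
    by (intro tendsto_intros lim_1_over_n)
  from this[of mone "A - mone"] have l0: "(\<lambda>n. (1 / real n) *\<^sub>R mone + (A - mone)) \<longlonglongrightarrow> A - mone"
    by (simp only: scaleR_zero_left add_0)
  have "(1 / x) *\<^sub>R (e + x *\<^sub>R N) = (1 / x) *\<^sub>R e + N" if "x \<noteq> 0" for x and e N :: mat2
    using that by (simp add: scaleR_add_right)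
  then have "(1 / real n) *\<^sub>R (A [^]\<^bsub>sl2\<^esub> n) = (1 / real n) *\<^sub>R mone + (A - mone)" if "n \<ge> 1" for n
    using that by (simp only: pow)
  then have "(\<lambda>n. (1 / real n) *\<^sub>R (A [^]\<^bsub>sl2\<^esub> n)) \<longlonglongrightarrow> A - mone"
    by (intro Lim_transform_eventually[OF l0]) (auto simp: eventually_sequentially intro!: exI[of _ 1])
  then have "(\<lambda>n. (1 / real n) *\<^sub>R (A [^]\<^bsub>sl2\<^esub> n)) \<longlonglongrightarrow> 1 *\<^sub>R (A - 1 *\<^sub>R mone)"
    by (simp only: scaleR_one)
  then have "growing A (\<lambda>n. 1 / real n) 1 1"
    using tr lim_1_over_n by (auto simp: growing_def)
  then show ?thesis by (rule that)
qed

text \<open>Each factor is rescaled separately; its exponent may be arbitrary as long as it is at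
  least n. For an empty tuple no scale tending to 0 could have limit \<open>mone\<close>, hence the
  condition on \<open>us\<close>.\<close>

lemma sl2_power_product_limit:
  assumes "list_all2 (\<lambda>A P. \<exists>c b k. growing A c b k \<and> P = k *\<^sub>R (A - b *\<^sub>R mone)) us Ps"
    and "\<And>n. length (as n) = length us" "\<And>n. \<forall>a\<in>set (as n). a \<ge> int n" and "us \<noteq> []"
  shows "\<exists>d. d \<longlonglongrightarrow> 0 \<and> (\<lambda>n. d n *\<^sub>R power_product sl2 us (as n)) \<longlonglongrightarrow> foldr mm Ps mone"
  using assms
proof (induction arbitrary: as rule: list_all2_induct)
  case (Cons A us P Ps)
  obtain c b k where g: "growing A c b k" "P = k *\<^sub>R (A - b *\<^sub>R mone)" using Cons.hyps by blast
  define a bs where "a n = nat (hd (as n))" and "bs n = tl (as n)" for n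
  have as: "as n = int (a n) # bs n" "length (bs n) = length us" "\<forall>a\<in>set (bs n). a \<ge> int n" "a n \<ge> n" for n
  proof -
    obtain x xs where x: "as n = x # xs" using Cons.prems(1)[of n] by (cases "as n") auto
    have "x \<ge> int n" using Cons.prems(2)[of n] by (auto simp: x)
    then show "as n = int (a n) # bs n" "length (bs n) = length us" "\<forall>a\<in>set (bs n). a \<ge> int n" "a n \<ge> n"
      using Cons.prems(1,2)[of n] by (auto simp: x a_def bs_def)
  qed
  have "filterlim a at_top sequentially"
    using as(4) by (intro filterlim_at_top_mono[OF filterlim_ident]) auto
  then have lim: "(\<lambda>n. c (a n)) \<longlonglongrightarrow> 0" "(\<lambda>n. c (a n) *\<^sub>R (A [^]\<^bsub>sl2\<^esub> a n)) \<longlonglongrightarrow> P"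
    using g filterlim_compose[of c "nhds 0" sequentially a]
      filterlim_compose[of "\<lambda>n. c n *\<^sub>R (A [^]\<^bsub>sl2\<^esub> n)" _ sequentially a]
    by (auto simp: growing_def)
  show ?case
  proof (cases "us = []")
    case True
    then show ?thesis using lim Cons(2) as by (intro exI[of _ "\<lambda>n. c (a n)"]) (auto simp: sl2_simps int_pow_int)
  next
    case False
    obtain d where d: "d \<longlonglongrightarrow> 0" "(\<lambda>n. d n *\<^sub>R power_product sl2 us (bs n)) \<longlonglongrightarrow> foldr mm Ps mone"
      using Cons.IH[of bs] as False by blast
    have "(\<lambda>n. (c (a n) * d n) *\<^sub>R power_product sl2 (A # us) (as n)) \<longlonglongrightarrow> mm P (foldr mm Ps mone)"
      using tendsto_mm[OF lim(2) d(2)] by (simp add: as sl2_simps int_pow_int mm_scaleR mult.commute)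
    moreover have "(\<lambda>n. c (a n) * d n) \<longlonglongrightarrow> 0 * 0" by (intro tendsto_intros lim d)
    ultimately show ?thesis by (intro exI[of _ "\<lambda>n. c (a n) * d n"]) simp
  qed
qed simp

text \<open>If products with arbitrarily large exponents were the identity, the rescaled products
  would tend to 0. Their limit is a product of singular matrices in which no two neighbours
  annihilate each other, by \<open>mtr_commutator_eq_2\<close>, so by \<open>mm_rank_one\<close> it
  is nonzero.\<close>

lemma sl2_independent:
  assumes us: "us \<noteq> []" "set us \<subseteq> carrier sl2"
    and good: "\<And>A. A \<in> set us \<Longrightarrow> \<bar>mtr A\<bar> > 2 \<or> mtr A = 2 \<and> A \<noteq> mone"
    and adj: "successively (\<lambda>A B. mtr (group_commutator sl2 A B) \<noteq> 2) us"
  shows "independent_tuple sl2 us"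
proof (rule ccontr)
  assume "\<not> independent_tuple sl2 us"
  then have "\<forall>n. \<exists>as. length as = length us \<and> (\<forall>a\<in>set as. a \<ge> int n) \<and> power_product sl2 us as = mone"
    by (auto simp: independent_tuple_def sl2_simps)
  then obtain as where as: "\<And>n. length (as n) = length us" "\<And>n. \<forall>a\<in>set (as n). a \<ge> int n"
      "\<And>n. power_product sl2 us (as n) = mone" by metis
  have gr: "\<forall>A\<in>set us. \<exists>c b k. growing A c b k"
    using good us growing_hyperbolic growing_unipotent by (metis subsetD)
  then obtain cf bf kf where f: "\<And>A. A \<in> set us \<Longrightarrow> growing A (cf A) (bf A) (kf A)" by metis
  define Pf where "Pf A = kf A *\<^sub>R (A - bf A *\<^sub>R mone)" for A
  have nz: "foldr mm (map Pf vs) mone \<noteq> 0" if "vs \<noteq> []" "set vs \<subseteq> set us" "successively (\<lambda>A B. mtr (group_commutator sl2 A B) \<noteq> 2) vs" for vs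
    using that
  proof (induction vs rule: induct_list012)
    case (2 A)
    then have "growing A (cf A) (bf A) (kf A)" using f by simp
    then show ?case by (auto simp: growing_def Pf_def)
  next
    case (3 A B vs)
    have gA: "growing A (cf A) (bf A) (kf A)" "growing B (cf B) (bf B) (kf B)" "A \<in> carrier sl2" "B \<in> carrier sl2"
      using f 3(4) us by auto
    have AB: "mm (Pf A) (Pf B) \<noteq> 0"
    proof
      assume "mm (Pf A) (Pf B) = 0"
      then have "mm (A - bf A *\<^sub>R mone) (B - bf B *\<^sub>R mone) = 0"
        using gA(1,2) by (simp add: Pf_def mm_scaleR growing_def)
      then have "mtr (group_commutator sl2 A B) = 2"
        using gA by (intro mtr_commutator_eq_2[of A B "bf A" "bf B"]) (auto simp: growing_def)
      then show False using 3(5) by simp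
    qed
    have "mdet (Pf B) = (kf B)\<^sup>2 * ((bf B)\<^sup>2 - mtr B * bf B + mdet B)"
      by (cases B) (simp add: Pf_def algebra_simps power2_eq_square)
    then have dB: "mdet (Pf B) = 0" using gA(2,4) by (simp add: growing_def sl2_simps)
    show ?case
    proof (cases "vs = []")
      case True
      then show ?thesis using AB by simp
    next
      case False
      have "mm (Pf B) (foldr mm (map Pf vs) mone) \<noteq> 0" using "3.IH"(2) 3(4,5) by auto
      then show ?thesis using mm_rank_one[OF dB AB] by simp
    qed
  qed simp
  have "list_all2 (\<lambda>A P. \<exists>c b k. growing A c b k \<and> P = k *\<^sub>R (A - b *\<^sub>R mone)) us (map Pf us)"
    unfolding list_all2_map2 list_all2_same Pf_def using f by blast
  from sl2_power_product_limit[OF this as(1,2) us(1)] obtain d where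
    d: "d \<longlonglongrightarrow> 0" "(\<lambda>n. d n *\<^sub>R power_product sl2 us (as n)) \<longlonglongrightarrow> foldr mm (map Pf us) mone" by blast
  have "(\<lambda>n. d n *\<^sub>R e) \<longlonglongrightarrow> 0 *\<^sub>R e" for e :: mat2 by (intro tendsto_intros d)
  from this[of mone] have l0: "(\<lambda>n. d n *\<^sub>R mone) \<longlonglongrightarrow> 0" by (simp only: scaleR_zero_left)
  have "foldr mm (map Pf us) mone = 0"
    by (rule LIMSEQ_unique[OF d(2)[unfolded as(3)] l0])
  then show False using nz[OF us(1) subset_refl adj] by simp
qed

section \<open>Free products of abelian groups\<close>

text \<open>Translation by l, then the lower unitriangular matrix with entry -\<kappa> m. The sign
  is chosen so that \<kappa> = 1 / N gives the map x to N x / (N - m x), to which the conjugated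
  second factor will degenerate.\<close>

fun wm :: "real \<Rightarrow> (real \<times> real) list \<Rightarrow> mat2" where
  "wm \<kappa> [] = mone"
| "wm \<kappa> ((l, m) # ps) = mm (mm (1, l, 0, 1) (1, 0, - \<kappa> * m, 1)) (wm \<kappa> ps)"

text \<open>The upper left entry grows exactly like \<kappa>^n, with leading coefficient the product
  of the numbers -l m, while the lower right entry is of smaller order.\<close>

lemma wm_growth:
  assumes "set ps \<subseteq> (UNIV - {0}) \<times> (UNIV - {0})" "ps \<noteq> []"
  shows "filterlim (\<lambda>\<kappa>. \<bar>mtr (wm \<kappa> ps)\<bar>) at_top at_top"
proof -
  define n where "n = length ps"
  \<comment> \<open>The induction needs all four entries. The limit c'' of the normalized lower
    right entry is 1 for the empty word and 0 afterwards, which explains its conditional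
    clause.\<close>
  have "\<exists>p q r s. (\<forall>\<kappa>. wm \<kappa> ps = (p \<kappa>, q \<kappa>, r \<kappa>, s \<kappa>)) \<and> (\<exists>c c' c''. c \<noteq> 0 \<and> (ps \<noteq> [] \<longrightarrow> c'' = 0) \<and>
      ((\<lambda>\<kappa>. p \<kappa> / \<kappa> ^ length ps) \<longlongrightarrow> c) at_top \<and> ((\<lambda>\<kappa>. q \<kappa> / \<kappa> ^ length ps) \<longlongrightarrow> 0) at_top \<and>
      ((\<lambda>\<kappa>. r \<kappa> / \<kappa> ^ length ps) \<longlongrightarrow> c') at_top \<and> ((\<lambda>\<kappa>. s \<kappa> / \<kappa> ^ length ps) \<longlongrightarrow> c'') at_top)"
    using assms(1)
  proof (induction ps)
    case Nil
    show ?case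
      by (intro exI[of _ "\<lambda>_. 1"] exI[of _ "\<lambda>_. 0"] exI[of _ 1] exI[of _ 0] conjI allI) auto
  next
    case (Cons a ps)
    obtain l m where a: "a = (l, m)" by force
    have lm: "l \<noteq> 0" "m \<noteq> 0" using Cons.prems a by auto
    define K where "K \<kappa> = \<kappa> ^ length ps" for \<kappa> :: real
    have "set ps \<subseteq> (UNIV - {0}) \<times> (UNIV - {0})" using Cons.prems by simp
    from Cons.IH[OF this] obtain p q r s c c' c'' where IH0: "\<forall>\<kappa>. wm \<kappa> ps = (p \<kappa>, q \<kappa>, r \<kappa>, s \<kappa>)" "c \<noteq> 0"
      "((\<lambda>\<kappa>. p \<kappa> / \<kappa> ^ length ps) \<longlongrightarrow> c) at_top" "((\<lambda>\<kappa>. q \<kappa> / \<kappa> ^ length ps) \<longlongrightarrow> 0) at_top"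
      "((\<lambda>\<kappa>. r \<kappa> / \<kappa> ^ length ps) \<longlongrightarrow> c') at_top" "((\<lambda>\<kappa>. s \<kappa> / \<kappa> ^ length ps) \<longlongrightarrow> c'') at_top"
      by blast
    note IH = IH0(1)[rule_format] IH0(2) IH0(3-6)[folded K_def]
    have inv: "((\<lambda>\<kappa>::real. 1 / \<kappa>) \<longlongrightarrow> 0) at_top"
      using tendsto_inverse_0_at_top[OF filterlim_ident] by (simp add: inverse_eq_divide)
    have w: "wm \<kappa> (a # ps) = ((1 - \<kappa> * (l * m)) * p \<kappa> + l * r \<kappa>, (1 - \<kappa> * (l * m)) * q \<kappa> + l * s \<kappa>,
        - (\<kappa> * m) * p \<kappa> + r \<kappa>, - (\<kappa> * m) * q \<kappa> + s \<kappa>)" for \<kappa>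
      by (simp add: a IH(1) algebra_simps)
    have 1: "((\<lambda>\<kappa>. (1 / \<kappa> - l * m) * (x \<kappa> / K \<kappa>) + l * (1 / \<kappa>) * (y \<kappa> / K \<kappa>)) \<longlongrightarrow> (0 - l * m) * cx + l * 0 * cy) at_top"
      if "((\<lambda>\<kappa>. x \<kappa> / K \<kappa>) \<longlongrightarrow> cx) at_top" "((\<lambda>\<kappa>. y \<kappa> / K \<kappa>) \<longlongrightarrow> cy) at_top" for x y cx cy
      by (intro tendsto_intros inv that)
    have 2: "((\<lambda>\<kappa>. - m * (x \<kappa> / K \<kappa>) + (1 / \<kappa>) * (y \<kappa> / K \<kappa>)) \<longlongrightarrow> - m * cx + 0 * cy) at_top"
      if "((\<lambda>\<kappa>. x \<kappa> / K \<kappa>) \<longlongrightarrow> cx) at_top" "((\<lambda>\<kappa>. y \<kappa> / K \<kappa>) \<longlongrightarrow> cy) at_top" for x y cx cy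
      by (intro tendsto_intros inv that)
    have ev: "\<forall>\<^sub>F \<kappa> in at_top. \<kappa> > (0::real)" by (rule eventually_gt_at_top)
    have eq: "(1 / \<kappa> - l * m) * (X / K \<kappa>) + l * (1 / \<kappa>) * (Y / K \<kappa>)
        = ((1 - \<kappa> * (l * m)) * X + l * Y) / \<kappa> ^ length (a # ps)"
      "- m * (X / K \<kappa>) + (1 / \<kappa>) * (Y / K \<kappa>) = (- (\<kappa> * m) * X + Y) / \<kappa> ^ length (a # ps)"
      if "\<kappa> > 0" for X Y \<kappa> :: real
    proof -
      have K0: "K \<kappa> \<noteq> 0" and KS: "\<kappa> ^ length (a # ps) = \<kappa> * K \<kappa>" using that by (simp_all add: K_def)
      have "(1 / \<kappa> - l * m) * (X / z) + l * (1 / \<kappa>) * (Y / z) = ((1 - \<kappa> * (l * m)) * X + l * Y) / (\<kappa> * z)"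
        "- m * (X / z) + (1 / \<kappa>) * (Y / z) = (- (\<kappa> * m) * X + Y) / (\<kappa> * z)" if "z \<noteq> 0" for z
        using that \<open>\<kappa> > 0\<close> by (simp_all add: field_simps)
      from this[OF K0] show "(1 / \<kappa> - l * m) * (X / K \<kappa>) + l * (1 / \<kappa>) * (Y / K \<kappa>)
          = ((1 - \<kappa> * (l * m)) * X + l * Y) / \<kappa> ^ length (a # ps)"
        "- m * (X / K \<kappa>) + (1 / \<kappa>) * (Y / K \<kappa>) = (- (\<kappa> * m) * X + Y) / \<kappa> ^ length (a # ps)"
        unfolding KS .
    qed
    have 3: "((\<lambda>\<kappa>. ((1 - \<kappa> * (l * m)) * x \<kappa> + l * y \<kappa>) / \<kappa> ^ length (a # ps)) \<longlongrightarrow> - (l * m) * cx) at_top"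
      if "((\<lambda>\<kappa>. x \<kappa> / K \<kappa>) \<longlongrightarrow> cx) at_top" "((\<lambda>\<kappa>. y \<kappa> / K \<kappa>) \<longlongrightarrow> cy) at_top" for x y cx cy
    proof -
      have "((\<lambda>\<kappa>. (1 / \<kappa> - l * m) * (x \<kappa> / K \<kappa>) + l * (1 / \<kappa>) * (y \<kappa> / K \<kappa>)) \<longlongrightarrow> - (l * m) * cx) at_top"
        using 1[OF that] by simp
      then show ?thesis
        by (rule Lim_transform_eventually) (rule eventually_mono[OF ev], rule eq(1))
    qed
    have 4: "((\<lambda>\<kappa>. (- (\<kappa> * m) * x \<kappa> + y \<kappa>) / \<kappa> ^ length (a # ps)) \<longlongrightarrow> - m * cx) at_top"
      if "((\<lambda>\<kappa>. x \<kappa> / K \<kappa>) \<longlongrightarrow> cx) at_top" "((\<lambda>\<kappa>. y \<kappa> / K \<kappa>) \<longlongrightarrow> cy) at_top" for x y cx cy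
    proof -
      have "((\<lambda>\<kappa>. - m * (x \<kappa> / K \<kappa>) + (1 / \<kappa>) * (y \<kappa> / K \<kappa>)) \<longlongrightarrow> - m * cx) at_top"
        using 2[OF that] by simp
      then show ?thesis
        by (rule Lim_transform_eventually) (rule eventually_mono[OF ev], rule eq(2))
    qed
    define p' q' r' s' where "p' \<kappa> = (1 - \<kappa> * (l * m)) * p \<kappa> + l * r \<kappa>" and "q' \<kappa> = (1 - \<kappa> * (l * m)) * q \<kappa> + l * s \<kappa>"
      and "r' \<kappa> = - (\<kappa> * m) * p \<kappa> + r \<kappa>" and "s' \<kappa> = - (\<kappa> * m) * q \<kappa> + s \<kappa>" for \<kappa>
    have w': "wm \<kappa> (a # ps) = (p' \<kappa>, q' \<kappa>, r' \<kappa>, s' \<kappa>)" for \<kappa>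
      unfolding w p'_def q'_def r'_def s'_def ..
    have c0: "- (l * m) * c \<noteq> 0" using IH(2) lm by simp
    have lims: "((\<lambda>\<kappa>. p' \<kappa> / \<kappa> ^ length (a # ps)) \<longlongrightarrow> - (l * m) * c) at_top"
      "((\<lambda>\<kappa>. q' \<kappa> / \<kappa> ^ length (a # ps)) \<longlongrightarrow> 0) at_top"
      "((\<lambda>\<kappa>. r' \<kappa> / \<kappa> ^ length (a # ps)) \<longlongrightarrow> - m * c) at_top"
      "((\<lambda>\<kappa>. s' \<kappa> / \<kappa> ^ length (a # ps)) \<longlongrightarrow> 0) at_top"
      using 3[OF IH(3,5)] 3[OF IH(4,6)] 4[OF IH(3,5)] 4[OF IH(4,6)]
      unfolding p'_def q'_def r'_def s'_def by simp_all
    show ?case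
      by (rule exI[of _ p'], rule exI[of _ q'], rule exI[of _ r'], rule exI[of _ s'], rule conjI[OF allI[OF w']],
          rule exI[of _ "- (l * m) * c"], rule exI[of _ "- m * c"], rule exI[of _ 0])
         (intro conjI impI HOL.refl c0 lims)
  qed
  then obtain p q r s c c'' where w0: "\<forall>\<kappa>. wm \<kappa> ps = (p \<kappa>, q \<kappa>, r \<kappa>, s \<kappa>)" "c \<noteq> 0" "ps \<noteq> [] \<longrightarrow> c'' = 0"
      "((\<lambda>\<kappa>. p \<kappa> / \<kappa> ^ length ps) \<longlongrightarrow> c) at_top" "((\<lambda>\<kappa>. s \<kappa> / \<kappa> ^ length ps) \<longlongrightarrow> c'') at_top"
    by blast
  have c'': "c'' = 0" using w0(3) assms(2) by simp
  note w = w0(1)[rule_format] w0(2) w0(4,5)[folded n_def, unfolded c'']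
  have "((\<lambda>\<kappa>. \<bar>p \<kappa> / \<kappa> ^ n + s \<kappa> / \<kappa> ^ n\<bar>) \<longlongrightarrow> \<bar>c + 0\<bar>) at_top" by (intro tendsto_intros w)
  moreover have "filterlim (\<lambda>\<kappa>::real. \<kappa> ^ n) at_top at_top"
    using assms(2) by (intro filterlim_pow_at_top filterlim_ident) (simp add: n_def)
  ultimately have "filterlim (\<lambda>\<kappa>. \<bar>p \<kappa> / \<kappa> ^ n + s \<kappa> / \<kappa> ^ n\<bar> * \<kappa> ^ n) at_top at_top"
    using w(2) by (intro filterlim_tendsto_pos_mult_at_top[of _ "\<bar>c + 0\<bar>"]) auto
  then show ?thesis
  proof (rule filterlim_cong[THEN iffD1, rotated -1])
    show "\<forall>\<^sub>F \<kappa> in at_top. \<bar>p \<kappa> / \<kappa> ^ n + s \<kappa> / \<kappa> ^ n\<bar> * \<kappa> ^ n = \<bar>mtr (wm \<kappa> ps)\<bar>"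
      using eventually_gt_at_top[of "0::real"]
    proof eventually_elim
      case (elim \<kappa>)
      have "\<bar>p \<kappa> / \<kappa> ^ n + s \<kappa> / \<kappa> ^ n\<bar> * \<kappa> ^ n = \<bar>(p \<kappa> / \<kappa> ^ n + s \<kappa> / \<kappa> ^ n) * \<kappa> ^ n\<bar>"
        using elim by (simp only: abs_mult) simp
      also have "(p \<kappa> / \<kappa> ^ n + s \<kappa> / \<kappa> ^ n) * \<kappa> ^ n = p \<kappa> + s \<kappa>" using elim by (simp add: field_simps)
      finally show ?case by (simp add: w(1))
    qed
  qed auto
qed

lemma wm_polyfn:
  "\<exists>p q r s. p \<in> polyfn UNIV \<and> q \<in> polyfn UNIV \<and> r \<in> polyfn UNIV \<and> s \<in> polyfn UNIV \<and>
    (\<forall>\<kappa>. wm \<kappa> ps = (p \<kappa>, q \<kappa>, r \<kappa>, s \<kappa>))"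
proof (induction ps)
  case Nil
  show ?case
    by (intro exI[of _ "\<lambda>_. 1"] exI[of _ "\<lambda>_. 0"] conjI polyfn_const qsubring_UNIV) auto
next
  case (Cons a ps)
  obtain l m where a: "a = (l, m)" by force
  obtain p q r s where IH: "p \<in> polyfn UNIV" "q \<in> polyfn UNIV" "r \<in> polyfn UNIV" "s \<in> polyfn UNIV"
    "\<And>\<kappa>. wm \<kappa> ps = (p \<kappa>, q \<kappa>, r \<kappa>, s \<kappa>)" using Cons by blast
  have w: "wm \<kappa> (a # ps) = ((1 - \<kappa> * (l * m)) * p \<kappa> + l * r \<kappa>, (1 - \<kappa> * (l * m)) * q \<kappa> + l * s \<kappa>,
      (0 - \<kappa> * m) * p \<kappa> + r \<kappa>, (0 - \<kappa> * m) * q \<kappa> + s \<kappa>)" for \<kappa>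
    by (simp add: a IH(5) algebra_simps)
  have 1: "(\<lambda>\<kappa>. (1 - \<kappa> * (l * m)) * x \<kappa> + l * y \<kappa>) \<in> polyfn UNIV" "(\<lambda>\<kappa>. (0 - \<kappa> * m) * x \<kappa> + y \<kappa>) \<in> polyfn UNIV"
    if "x \<in> polyfn UNIV" "y \<in> polyfn UNIV" for x y
    using that
    by (intro polyfn_add polyfn_mult polyfn_diff polyfn_const polyfn_id qsubring_UNIV; simp)+
  show ?case
    by (rule exI, rule exI, rule exI, rule exI, rule conjI[OF 1(1)[OF IH(1,3)]],
        rule conjI[OF 1(1)[OF IH(2,4)]], rule conjI[OF 1(2)[OF IH(1,3)]], rule conjI[OF 1(2)[OF IH(2,4)]])
       (rule allI, rule w)
qed

text \<open>\<open>lam\<close> will be the translation number of the Moebius series that represents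
  an element. Being injective into the additive reals, it makes \<open>G\<close> abelian and
  torsion-free.\<close>

locale abelian_double =
  fixes G :: "'a monoid" and F :: "'a set" and lam :: "'a \<Rightarrow> real"
  assumes G: "group G" and F: "subgroup F G"
    and lam_mult: "x \<in> carrier G \<Longrightarrow> y \<in> carrier G \<Longrightarrow> lam (x \<otimes>\<^bsub>G\<^esub> y) = lam x + lam y"
    and lam_inj: "inj_on lam (carrier G)"
begin

abbreviation "H \<equiv> amalgam G (G\<lparr>carrier := F\<rparr>) {\<one>\<^bsub>G\<^esub>}"
abbreviation "il \<equiv> amalgam_incl G (G\<lparr>carrier := F\<rparr>) {\<one>\<^bsub>G\<^esub>}"
abbreviation "ir \<equiv> amalgam_incr G (G\<lparr>carrier := F\<rparr>) {\<one>\<^bsub>G\<^esub>}"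

interpretation G: group G by (rule G)
interpretation F: subgroup F G by (rule F)
interpretation H: group H by (rule amalgam_group)

lemma F_group: "group (G\<lparr>carrier := F\<rparr>)" by (rule G.subgroup_imp_group[OF F])

lemma lam_one: "lam \<one>\<^bsub>G\<^esub> = 0"
  using lam_mult[of "\<one>\<^bsub>G\<^esub>" "\<one>\<^bsub>G\<^esub>"] by simp

lemma lam_eq_0: "x \<in> carrier G \<Longrightarrow> lam x = 0 \<longleftrightarrow> x = \<one>\<^bsub>G\<^esub>"
  using inj_on_eq_iff[OF lam_inj, of x "\<one>\<^bsub>G\<^esub>"] lam_one by simp

lemma il_closed: "g \<in> carrier G \<Longrightarrow> il g \<in> carrier H"
  using amalgam_incl_hom[OF G, of "G\<lparr>carrier := F\<rparr>" "{\<one>\<^bsub>G\<^esub>}"] by (auto simp: hom_def)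

lemma ir_closed: "f \<in> F \<Longrightarrow> ir f \<in> carrier H"
  using amalgam_incr_hom[OF F_group, of G "{\<one>\<^bsub>G\<^esub>}"] by (auto simp: hom_def)

lemma il_mult: "g \<in> carrier G \<Longrightarrow> h \<in> carrier G \<Longrightarrow> il (g \<otimes>\<^bsub>G\<^esub> h) = il g \<otimes>\<^bsub>H\<^esub> il h"
  using hom_mult[OF amalgam_incl_hom[OF G]] .

lemma ir_mult: "g \<in> F \<Longrightarrow> h \<in> F \<Longrightarrow> ir (g \<otimes>\<^bsub>G\<^esub> h) = ir g \<otimes>\<^bsub>H\<^esub> ir h"
  using hom_mult[OF amalgam_incr_hom[OF F_group, of G], of g h] by simp

lemma il_one: "il \<one>\<^bsub>G\<^esub> = \<one>\<^bsub>H\<^esub>"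
  using hom_one[OF amalgam_incl_hom[OF G] G amalgam_group] .

lemma ir_one: "ir \<one>\<^bsub>G\<^esub> = \<one>\<^bsub>H\<^esub>"
  using hom_one[OF amalgam_incr_hom[OF F_group, of G] F_group amalgam_group] by simp

fun pprod :: "('a \<times> 'a) list \<Rightarrow> ('a + 'a) gword set" where
  "pprod [] = \<one>\<^bsub>H\<^esub>"
| "pprod ((g, f) # ps) = (il g \<otimes>\<^bsub>H\<^esub> ir f) \<otimes>\<^bsub>H\<^esub> pprod ps"

lemma pprod_closed: "set ps \<subseteq> carrier G \<times> F \<Longrightarrow> pprod ps \<in> carrier H"
  by (induction ps) (auto intro!: H.m_closed il_closed ir_closed)

lemma pprod_append:
  "set ps \<subseteq> carrier G \<times> F \<Longrightarrow> set qs \<subseteq> carrier G \<times> F \<Longrightarrow> pprod (ps @ qs) = pprod ps \<otimes>\<^bsub>H\<^esub> pprod qs"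
proof (induction ps)
  case (Cons a ps)
  then show ?case
    using pprod_closed[of ps] pprod_closed[of qs] by (cases a) (simp add: il_closed ir_closed H.m_assoc)
qed (simp add: pprod_closed)

lemma ex_pprod:
  assumes "A \<in> carrier H" shows "\<exists>ps. set ps \<subseteq> carrier G \<times> F \<and> A = pprod ps"
  using assms G F_group
proof (induction rule: amalgam_induct)
  case one
  then show ?case by (intro exI[of _ "[]"]) simp
next
  case (left g A)
  then obtain ps where "set ps \<subseteq> carrier G \<times> F" "A = pprod ps" by blast
  then show ?case using left
    by (intro exI[of _ "(g, \<one>\<^bsub>G\<^esub>) # ps"]) (auto simp: ir_one il_closed)
next
  case (right f A)
  then obtain ps where "set ps \<subseteq> carrier G \<times> F" "A = pprod ps" by blast
  then show ?case using right
    by (intro exI[of _ "(\<one>\<^bsub>G\<^esub>, f) # ps"]) (auto simp: il_one ir_closed)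
qed

text \<open>A conjugate with the shortest expression is cyclically reduced.\<close>

lemma conjugate_form:
  assumes A: "A \<in> carrier H" "A \<noteq> \<one>\<^bsub>H\<^esub>"
  obtains (left) x g where "x \<in> carrier H" "g \<in> carrier G" "g \<noteq> \<one>\<^bsub>G\<^esub>" "x \<otimes>\<^bsub>H\<^esub> A \<otimes>\<^bsub>H\<^esub> inv\<^bsub>H\<^esub> x = il g"
  | (right) x f where "x \<in> carrier H" "f \<in> F" "f \<noteq> \<one>\<^bsub>G\<^esub>" "x \<otimes>\<^bsub>H\<^esub> A \<otimes>\<^bsub>H\<^esub> inv\<^bsub>H\<^esub> x = ir f"
  | (cyclic) x ps where "x \<in> carrier H" "ps \<noteq> []" "set ps \<subseteq> (carrier G - {\<one>\<^bsub>G\<^esub>}) \<times> (F - {\<one>\<^bsub>G\<^esub>})"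
      "x \<otimes>\<^bsub>H\<^esub> A \<otimes>\<^bsub>H\<^esub> inv\<^bsub>H\<^esub> x = pprod ps"
proof -
  define P where "P n \<longleftrightarrow> (\<exists>ps x. length ps = n \<and> set ps \<subseteq> carrier G \<times> F \<and> x \<in> carrier H \<and>
      x \<otimes>\<^bsub>H\<^esub> A \<otimes>\<^bsub>H\<^esub> inv\<^bsub>H\<^esub> x = pprod ps)" for n
  have "\<exists>n. P n"
  proof -
    obtain ps where "set ps \<subseteq> carrier G \<times> F" "A = pprod ps" using ex_pprod[OF A(1)] by blast
    then have "P (length ps)" unfolding P_def
      using A(1) by (intro exI[of _ ps] exI[of _ "\<one>\<^bsub>H\<^esub>"]) auto
    then show ?thesis by blast
  qed
  then obtain n where n: "P n" "\<forall>m<n. \<not> P m" using exists_least_iff[of P] by blast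
  obtain ps x where ps: "length ps = n" "set ps \<subseteq> carrier G \<times> F" "x \<in> carrier H"
      "x \<otimes>\<^bsub>H\<^esub> A \<otimes>\<^bsub>H\<^esub> inv\<^bsub>H\<^esub> x = pprod ps" using n(1) unfolding P_def by blast
  have conj: "x \<otimes>\<^bsub>H\<^esub> A \<otimes>\<^bsub>H\<^esub> inv\<^bsub>H\<^esub> x \<noteq> \<one>\<^bsub>H\<^esub>"
    using H.conj_eq_one_iff[OF ps(3) A(1)] A(2) by simp
  \<comment> \<open>Conjugation by the inverse of a prefix moves that prefix to the end of the
    word.\<close>
  have rot: "\<exists>y\<in>carrier H. y \<otimes>\<^bsub>H\<^esub> A \<otimes>\<^bsub>H\<^esub> inv\<^bsub>H\<^esub> y = pprod (ys @ xs)" if xy: "ps = xs @ ys" for xs ys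
  proof -
    have s: "set xs \<subseteq> carrier G \<times> F" "set ys \<subseteq> carrier G \<times> F" using ps(2) xy by auto
    note c = pprod_closed[OF s(1)] pprod_closed[OF s(2)]
    define y where "y = inv\<^bsub>H\<^esub> (pprod xs) \<otimes>\<^bsub>H\<^esub> x"
    have yc: "y \<in> carrier H" using c ps(3) by (simp add: y_def)
    have "y \<otimes>\<^bsub>H\<^esub> A \<otimes>\<^bsub>H\<^esub> inv\<^bsub>H\<^esub> y = inv\<^bsub>H\<^esub> (pprod xs) \<otimes>\<^bsub>H\<^esub> (x \<otimes>\<^bsub>H\<^esub> A \<otimes>\<^bsub>H\<^esub> inv\<^bsub>H\<^esub> x) \<otimes>\<^bsub>H\<^esub> pprod xs"
      using c ps(3) A(1) by (simp add: y_def H.inv_mult_group H.m_assoc)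
    also have "\<dots> = pprod ys \<otimes>\<^bsub>H\<^esub> pprod xs"
      unfolding ps(4) xy pprod_append[OF s] using c by simp
    also have "\<dots> = pprod (ys @ xs)" by (rule pprod_append[OF s(2,1), symmetric])
    finally show ?thesis using yc by (rule bexI)
  qed
  show ?thesis
  proof (cases "set ps \<subseteq> (carrier G - {\<one>\<^bsub>G\<^esub>}) \<times> (F - {\<one>\<^bsub>G\<^esub>})")
    case True
    have "ps \<noteq> []"
    proof
      assume "ps = []"
      then have "pprod ps = \<one>\<^bsub>H\<^esub>" by (simp only: pprod.simps)
      with conj ps(4) show False by (simp only:)
    qed
    then show ?thesis by (rule cyclic[OF ps(3) _ True ps(4)])
  next
    case False
    \<comment> \<open>A pair with a trivial component is rotated to the front. It then merges with
      the following pair if f is trivial, and with the last pair, its cyclic predecessor, if g is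
      trivial; either way the expression gets shorter. A word consisting of this pair alone lies in
      a factor.\<close>
    then obtain g f where gf: "(g, f) \<in> set ps" "g = \<one>\<^bsub>G\<^esub> \<or> f = \<one>\<^bsub>G\<^esub>" using ps(2) by auto
    have gfc: "g \<in> carrier G" "f \<in> F" using gf ps(2) by auto
    obtain xs ys where xy: "ps = xs @ (g, f) # ys" using gf(1) by (meson split_list)
    define zs where "zs = ys @ xs"
    have zs: "set zs \<subseteq> carrier G \<times> F" "length zs + 1 = n" using ps xy by (auto simp: zs_def)
    obtain y where y: "y \<in> carrier H" "y \<otimes>\<^bsub>H\<^esub> A \<otimes>\<^bsub>H\<^esub> inv\<^bsub>H\<^esub> y = pprod ((g, f) # zs)"
      using rot[OF xy] by (auto simp: zs_def)
    have y1: "pprod ((g, f) # zs) \<noteq> \<one>\<^bsub>H\<^esub>"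
      using H.conj_eq_one_iff[OF y(1) A(1)] A(2) y(2) by simp
    show ?thesis
    proof (cases zs)
      case Nil
      show ?thesis
      proof (cases "f = \<one>\<^bsub>G\<^esub>")
        case True
        have e: "pprod ((g, f) # zs) = il g" unfolding Nil True using gfc by (simp add: ir_one il_closed)
        have "g \<noteq> \<one>\<^bsub>G\<^esub>" using y1 unfolding e by (auto simp: il_one)
        then show ?thesis by (rule left[OF y(1) gfc(1) _ y(2)[unfolded e]])
      next
        case False
        then have g1: "g = \<one>\<^bsub>G\<^esub>" using gf(2) by simp
        have e: "pprod ((g, f) # zs) = ir f" unfolding Nil g1 using gfc by (simp add: il_one ir_closed)
        show ?thesis by (rule right[OF y(1) gfc(2) False y(2)[unfolded e]])
      qed
    next
      case (Cons z zs')
      have "\<exists>qs v. length qs < n \<and> set qs \<subseteq> carrier G \<times> F \<and> v \<in> carrier H \<and> v \<otimes>\<^bsub>H\<^esub> A \<otimes>\<^bsub>H\<^esub> inv\<^bsub>H\<^esub> v = pprod qs"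
      proof (cases "f = \<one>\<^bsub>G\<^esub>")
        case True
        obtain g' f' where z: "z = (g', f')" by force
        have c: "g' \<in> carrier G" "f' \<in> F" "set zs' \<subseteq> carrier G \<times> F" using zs Cons z by auto
        have "pprod ((g, f) # zs) = pprod ((g \<otimes>\<^bsub>G\<^esub> g', f') # zs')"
          using gfc c pprod_closed[OF c(3)] unfolding Cons z True
          by (simp add: ir_one il_mult il_closed ir_closed H.m_assoc)
        then have e: "y \<otimes>\<^bsub>H\<^esub> A \<otimes>\<^bsub>H\<^esub> inv\<^bsub>H\<^esub> y = pprod ((g \<otimes>\<^bsub>G\<^esub> g', f') # zs')"
          by (simp only: y(2))
        show ?thesis
          by (rule exI[of _ "(g \<otimes>\<^bsub>G\<^esub> g', f') # zs'"], rule exI[of _ y], intro conjI e y(1))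
             (use c gfc zs(2) Cons in simp_all)
      next
        case False
        then have g1: "g = \<one>\<^bsub>G\<^esub>" using gf(2) by simp
        obtain us g' f' where us: "zs = us @ [(g', f')]"
          using Cons by (metis list.distinct(1) prod.exhaust rev_exhaust)
        have c: "g' \<in> carrier G" "f' \<in> F" "set us \<subseteq> carrier G \<times> F" using zs us by auto
        define v where "v = (il g' \<otimes>\<^bsub>H\<^esub> ir f') \<otimes>\<^bsub>H\<^esub> y"
        define w where "w = il g' \<otimes>\<^bsub>H\<^esub> ir f'"
        have wc: "w \<in> carrier H" using c by (simp add: w_def il_closed ir_closed)
        have e: "pprod ((g, f) # zs) = (ir f \<otimes>\<^bsub>H\<^esub> pprod us) \<otimes>\<^bsub>H\<^esub> w"
          unfolding us g1 using c gfc pprod_closed[OF c(3)] wc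
          by (simp add: pprod_append il_one ir_closed il_closed H.m_assoc w_def)
        have "v \<otimes>\<^bsub>H\<^esub> A \<otimes>\<^bsub>H\<^esub> inv\<^bsub>H\<^esub> v = w \<otimes>\<^bsub>H\<^esub> (y \<otimes>\<^bsub>H\<^esub> A \<otimes>\<^bsub>H\<^esub> inv\<^bsub>H\<^esub> y) \<otimes>\<^bsub>H\<^esub> inv\<^bsub>H\<^esub> w"
          unfolding v_def w_def[symmetric] using y(1) A(1) wc by (simp add: H.inv_mult_group H.m_assoc)
        also have "\<dots> = w \<otimes>\<^bsub>H\<^esub> (ir f \<otimes>\<^bsub>H\<^esub> pprod us)"
          unfolding y(2) e using wc gfc c pprod_closed[OF c(3)] by (simp add: ir_closed H.m_assoc)
        also have "\<dots> = pprod ((g', f' \<otimes>\<^bsub>G\<^esub> f) # us)"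
          unfolding w_def using c gfc pprod_closed[OF c(3)] by (simp add: ir_mult il_closed ir_closed H.m_assoc)
        finally have "v \<otimes>\<^bsub>H\<^esub> A \<otimes>\<^bsub>H\<^esub> inv\<^bsub>H\<^esub> v = pprod ((g', f' \<otimes>\<^bsub>G\<^esub> f) # us)" .
        note e' = this
        have vc: "v \<in> carrier H" using wc y(1) unfolding v_def w_def[symmetric] by simp
        show ?thesis
          by (rule exI[of _ "(g', f' \<otimes>\<^bsub>G\<^esub> f) # us"], rule exI[of _ v], intro conjI e' vc)
             (use c gfc zs(2) us in simp_all)
      qed
      then obtain qs v where q: "length qs < n" "set qs \<subseteq> carrier G \<times> F" "v \<in> carrier H"
          "v \<otimes>\<^bsub>H\<^esub> A \<otimes>\<^bsub>H\<^esub> inv\<^bsub>H\<^esub> v = pprod qs" by (elim exE conjE)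
      have "P (length qs)" unfolding P_def
        by (rule exI[of _ qs], rule exI[of _ v]) (intro conjI HOL.refl q)
      then show ?thesis using n(2) q(1) by simp
    qed
  qed
qed

end

text \<open>Equality on infinitely many points makes the product of the two polynomials equal to 1,
  so both have degree 0.\<close>

lemma polyfn_unit_const:
  assumes "p \<in> polyfn UNIV" "s \<in> polyfn UNIV" "\<And>\<kappa>. \<kappa> > 0 \<Longrightarrow> p \<kappa> * s \<kappa> = 1"
  shows "\<exists>c. \<forall>\<kappa>. p \<kappa> = c"
proof -
  obtain P Q where PQ: "p = poly P" "s = poly Q" using assms(1,2) by (auto simp: polyfn_def)
  have inf: "infinite {0<..(1::real)}" by (rule infinite_Ioc) simp
  have "(\<lambda>\<kappa>. p \<kappa> * s \<kappa>) = (\<lambda>_. 1)"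
  proof (rule polyfn_eq_infinite[of _ UNIV])
    show "infinite {\<kappa>. p \<kappa> * s \<kappa> = 1}"
      by (rule infinite_super[OF _ inf]) (use assms(3) in auto)
  qed (intro polyfn_mult polyfn_const qsubring_UNIV assms UNIV_I)+
  then have "poly (P * Q) = poly 1" by (simp add: PQ fun_eq_iff)
  then have PQ1: "P * Q = 1" by (simp only: poly_eq_poly_eq_iff)
  then have "P \<noteq> 0" "Q \<noteq> 0" by auto
  then have "degree P + degree Q = 0" using degree_mult_eq[of P Q] PQ1 by simp
  then obtain c where "P = [:c:]" by (auto elim: degree_eq_zeroE)
  then show ?thesis by (auto simp: PQ)
qed

lemma madj_inverse: "mdet A = 1 \<Longrightarrow> mm A (madj A) = mone" "mdet A = 1 \<Longrightarrow> mm (madj A) A = mone"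
  by (cases A; simp add: algebra_simps)+

text \<open>E V = U V U^-1 and E^-1 U = V U V^-1 are conjugates of V and U. For unitriangular E
  these trace equations become linear conditions on the off-diagonal entries of U and V.\<close>

lemma sl2_commutator_eq:
  assumes U: "U \<in> carrier sl2" and V: "V \<in> carrier sl2" and E: "group_commutator sl2 U V = E"
  shows "mtr (mm E V) = mtr V" "mtr (mm (madj E) U) = mtr U"
proof -
  have d: "mdet U = 1" "mdet V = 1" using U V by (auto simp: sl2_simps)
  have e: "mm (mm (mm U V) (madj U)) (madj V) = E" using E U V by (simp add: group_commutator_def sl2_simps sl2_inv)
  have "mm E V = mm (mm U V) (madj U)"
    unfolding e[symmetric] mm_assoc madj_inverse(2)[OF d(2)] mm_one ..
  then have "mtr (mm E V) = mtr (mm (madj U) (mm U V))" by (simp only: mtr_commute)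
  then show "mtr (mm E V) = mtr V"
    by (simp only: mm_assoc[symmetric] madj_inverse(2)[OF d(1)] mm_one)
  have adj: "madj (mm A B) = mm (madj B) (madj A)" "madj (madj A) = A" for A B
    by (cases A; cases B; simp add: algebra_simps)+
  have "mm (madj E) U = mm (mm V U) (madj V)"
  proof -
    have "mm (madj E) U = mm V (mm U (mm (madj V) (mm (madj U) U)))"
      unfolding e[symmetric] adj mm_assoc ..
    then show ?thesis by (simp only: madj_inverse(2)[OF d(1)] mm_one mm_assoc)
  qed
  then have "mtr (mm (madj E) U) = mtr (mm (madj V) (mm V U))" by (simp only: mtr_commute)
  then show "mtr (mm (madj E) U) = mtr U"
    by (simp only: mm_assoc[symmetric] madj_inverse(2)[OF d(2)] mm_one)
qed

context abelian_double
begin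

interpretation G: group G by (rule G)
interpretation F: subgroup F G by (rule F)
interpretation H: group H by (rule amalgam_group)

definition Theta :: "real \<Rightarrow> ('a + 'a) gword set \<Rightarrow> mat2" where
  "Theta \<kappa> = (SOME \<Phi>. \<Phi> \<in> hom H sl2 \<and> (\<forall>g\<in>carrier G. \<Phi> (il g) = (1, lam g, 0, 1)) \<and>
     (\<forall>f\<in>F. \<Phi> (ir f) = (1, 0, - \<kappa> * lam f, 1)))"

lemma Theta:
  "Theta \<kappa> \<in> hom H sl2" "g \<in> carrier G \<Longrightarrow> Theta \<kappa> (il g) = (1, lam g, 0, 1)"
  "f \<in> F \<Longrightarrow> Theta \<kappa> (ir f) = (1, 0, - \<kappa> * lam f, 1)"
proof -
  have a: "(\<lambda>g. (1, lam g, 0, 1)) \<in> hom G sl2"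
    by (rule homI) (auto simp: sl2_simps lam_mult)
  have b: "(\<lambda>f. (1, 0, - \<kappa> * lam f, 1)) \<in> hom (G\<lparr>carrier := F\<rparr>) sl2"
    by (rule homI) (auto simp: sl2_simps lam_mult algebra_simps)
  have "\<exists>\<Phi>. \<Phi> \<in> hom H sl2 \<and> (\<forall>g\<in>carrier G. \<Phi> (il g) = (1, lam g, 0, 1)) \<and>
     (\<forall>f\<in>F. \<Phi> (ir f) = (1, 0, - \<kappa> * lam f, 1))"
    by (rule amalgam_lift[OF G F_group sl2_group a b, of "{\<one>\<^bsub>G\<^esub>}"]) (auto simp: lam_one)
  from someI_ex[OF this] show "Theta \<kappa> \<in> hom H sl2" "g \<in> carrier G \<Longrightarrow> Theta \<kappa> (il g) = (1, lam g, 0, 1)"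
    "f \<in> F \<Longrightarrow> Theta \<kappa> (ir f) = (1, 0, - \<kappa> * lam f, 1)" unfolding Theta_def[symmetric] by auto
qed

lemma Theta_closed: "A \<in> carrier H \<Longrightarrow> Theta \<kappa> A \<in> carrier sl2"
  using Theta(1) by (auto simp: hom_def)

lemma Theta_mult: "A \<in> carrier H \<Longrightarrow> B \<in> carrier H \<Longrightarrow> Theta \<kappa> (A \<otimes>\<^bsub>H\<^esub> B) = mm (Theta \<kappa> A) (Theta \<kappa> B)"
  using hom_mult[OF Theta(1)] by (simp add: sl2_simps)

lemma Theta_one: "Theta \<kappa> \<one>\<^bsub>H\<^esub> = mone"
  using hom_one[OF Theta(1) amalgam_group sl2_group] by (simp add: sl2_simps)

lemma Theta_pprod:
  "set ps \<subseteq> carrier G \<times> F \<Longrightarrow> Theta \<kappa> (pprod ps) = wm \<kappa> (map (\<lambda>(g, f). (lam g, lam f)) ps)"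
proof (induction ps)
  case (Cons a ps)
  obtain g f where a: "a = (g, f)" by force
  have c: "g \<in> carrier G" "f \<in> F" "set ps \<subseteq> carrier G \<times> F" using Cons.prems a by auto
  show ?case
    unfolding a pprod.simps list.map prod.case wm.simps Cons.IH[OF c(3), symmetric]
    using c by (simp only: Theta_mult H.m_closed il_closed ir_closed pprod_closed Theta(2,3))
qed (simp add: Theta_one)

lemma Theta_conj:
  assumes "x \<in> carrier H" "A \<in> carrier H"
  shows "mtr (Theta \<kappa> (x \<otimes>\<^bsub>H\<^esub> A \<otimes>\<^bsub>H\<^esub> inv\<^bsub>H\<^esub> x)) = mtr (Theta \<kappa> A)"
    "Theta \<kappa> A = mone \<Longrightarrow> Theta \<kappa> (x \<otimes>\<^bsub>H\<^esub> A \<otimes>\<^bsub>H\<^esub> inv\<^bsub>H\<^esub> x) = mone"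
proof -
  have d: "mdet (Theta \<kappa> x) = 1" using Theta_closed[OF assms(1)] by (simp add: sl2_simps)
  have i: "Theta \<kappa> (inv\<^bsub>H\<^esub> x) = madj (Theta \<kappa> x)"
    using hom_m_inv[OF amalgam_group sl2_group Theta(1) assms(1)] sl2_inv[OF Theta_closed[OF assms(1)]] by simp
  have e: "Theta \<kappa> (x \<otimes>\<^bsub>H\<^esub> A \<otimes>\<^bsub>H\<^esub> inv\<^bsub>H\<^esub> x) = mm (mm (Theta \<kappa> x) (Theta \<kappa> A)) (madj (Theta \<kappa> x))"
    using assms by (simp only: Theta_mult H.m_closed H.inv_closed i)
  have "mtr (mm (mm (Theta \<kappa> x) (Theta \<kappa> A)) (madj (Theta \<kappa> x))) = mtr (mm (madj (Theta \<kappa> x)) (mm (Theta \<kappa> x) (Theta \<kappa> A)))"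
    by (rule mtr_commute)
  then show "mtr (Theta \<kappa> (x \<otimes>\<^bsub>H\<^esub> A \<otimes>\<^bsub>H\<^esub> inv\<^bsub>H\<^esub> x)) = mtr (Theta \<kappa> A)"
    unfolding e by (simp only: mm_assoc[symmetric] madj_inverse(2)[OF d] mm_one)
  show "Theta \<kappa> A = mone \<Longrightarrow> Theta \<kappa> (x \<otimes>\<^bsub>H\<^esub> A \<otimes>\<^bsub>H\<^esub> inv\<^bsub>H\<^esub> x) = mone"
    unfolding e by (simp only: mm_one madj_inverse(1)[OF d])
qed

text \<open>Conjugates of elements of a factor become unipotent, and nontrivial as soon as \<kappa>
  > 0. Every other nontrivial element is conjugate to a cyclically reduced word, to which
  \<open>wm_growth\<close> applies.\<close>

lemma Theta_trace:
  assumes A: "A \<in> carrier H" "A \<noteq> \<one>\<^bsub>H\<^esub>"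
  shows "filterlim (\<lambda>\<kappa>. \<bar>mtr (Theta \<kappa> A)\<bar>) at_top at_top \<or>
    (\<forall>\<kappa>>0. mtr (Theta \<kappa> A) = 2 \<and> Theta \<kappa> A \<noteq> mone)"
  using A
proof (cases rule: conjugate_form)
  case (left x g)
  have t: "Theta \<kappa> (x \<otimes>\<^bsub>H\<^esub> A \<otimes>\<^bsub>H\<^esub> inv\<^bsub>H\<^esub> x) = (1, lam g, 0, 1)" for \<kappa>
    unfolding left(4) by (rule Theta(2)[OF left(2)])
  have "lam g \<noteq> 0" using lam_eq_0 left by simp
  then show ?thesis using Theta_conj[OF left(1) A(1)] unfolding t by auto
next
  case (right x f)
  have t: "Theta \<kappa> (x \<otimes>\<^bsub>H\<^esub> A \<otimes>\<^bsub>H\<^esub> inv\<^bsub>H\<^esub> x) = (1, 0, - \<kappa> * lam f, 1)" for \<kappa>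
    unfolding right(4) by (rule Theta(3)[OF right(2)])
  have l0: "lam f \<noteq> 0" using lam_eq_0[OF F.mem_carrier[OF right(2)]] right by simp
  have "mtr (Theta \<kappa> A) = 2" for \<kappa> using Theta_conj(1)[OF right(1) A(1), of \<kappa>] unfolding t by simp
  moreover have "Theta \<kappa> A \<noteq> mone" if "\<kappa> > 0" for \<kappa>
    using Theta_conj(2)[OF right(1) A(1), of \<kappa>] l0 that unfolding t by auto
  ultimately show ?thesis by blast
next
  case (cyclic x ps)
  have ps: "set ps \<subseteq> carrier G \<times> F" using cyclic(3) by blast
  have t: "mtr (Theta \<kappa> A) = mtr (wm \<kappa> (map (\<lambda>(g, f). (lam g, lam f)) ps))" for \<kappa>
    using Theta_conj(1)[OF cyclic(1) A(1), of \<kappa>] unfolding cyclic(4) Theta_pprod[OF ps] by simp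
  have "filterlim (\<lambda>\<kappa>. \<bar>mtr (wm \<kappa> (map (\<lambda>(g, f). (lam g, lam f)) ps))\<bar>) at_top at_top"
    by (rule wm_growth) (use cyclic(2,3) lam_eq_0 F.mem_carrier in \<open>auto simp: subset_iff\<close>)
  then show ?thesis unfolding t by (rule disjI1)
qed

lemma Theta_entries:
  assumes "A \<in> carrier H"
  obtains p q r s where "p \<in> polyfn UNIV" "q \<in> polyfn UNIV" "r \<in> polyfn UNIV" "s \<in> polyfn UNIV"
    "\<And>\<kappa>. Theta \<kappa> A = (p \<kappa>, q \<kappa>, r \<kappa>, s \<kappa>)" "\<And>\<kappa>. p \<kappa> * s \<kappa> - q \<kappa> * r \<kappa> = 1"
proof -
  obtain ps where ps: "set ps \<subseteq> carrier G \<times> F" "A = pprod ps" using ex_pprod[OF assms] by blast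
  obtain p q r s where pq: "p \<in> polyfn UNIV" "q \<in> polyfn UNIV" "r \<in> polyfn UNIV" "s \<in> polyfn UNIV"
    "\<forall>\<kappa>. wm \<kappa> (map (\<lambda>(g, f). (lam g, lam f)) ps) = (p \<kappa>, q \<kappa>, r \<kappa>, s \<kappa>)"
    using wm_polyfn by blast
  show ?thesis
  proof (rule that[OF pq(1-4)])
    show T: "Theta \<kappa> A = (p \<kappa>, q \<kappa>, r \<kappa>, s \<kappa>)" for \<kappa> unfolding ps(2) Theta_pprod[OF ps(1)] using pq(5) by simp
    show "p \<kappa> * s \<kappa> - q \<kappa> * r \<kappa> = 1" for \<kappa> using Theta_closed[OF assms, of \<kappa>] by (simp add: T sl2_simps)
  qed
qed

text \<open>A constant trace does not tend to infinity, so \<open>Theta_trace\<close> leaves only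
  the unipotent alternative.\<close>

lemma Theta_bounded_trace:
  assumes A: "A \<in> carrier H" and c: "\<And>\<kappa>. \<kappa> > 0 \<Longrightarrow> mtr (Theta \<kappa> A) = c" and "\<kappa> > 0"
  shows "mtr (Theta \<kappa> A) = 2" "A \<noteq> \<one>\<^bsub>H\<^esub> \<Longrightarrow> Theta \<kappa> A \<noteq> mone"
proof -
  have nf: "\<not> filterlim (\<lambda>\<kappa>. \<bar>mtr (Theta \<kappa> A)\<bar>) at_top at_top"
  proof
    assume "filterlim (\<lambda>\<kappa>. \<bar>mtr (Theta \<kappa> A)\<bar>) at_top at_top"
    then have "\<forall>\<^sub>F \<kappa> in at_top. \<bar>mtr (Theta \<kappa> A)\<bar> > \<bar>c\<bar>" by (simp add: filterlim_at_top_dense)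
    then have "\<forall>\<^sub>F \<kappa>::real in at_top. False"
      using eventually_gt_at_top[of "0::real"] by eventually_elim (simp add: c)
    then show False by simp
  qed
  then show "A \<noteq> \<one>\<^bsub>H\<^esub> \<Longrightarrow> Theta \<kappa> A \<noteq> mone" using Theta_trace[OF A] assms(3) by blast
  show "mtr (Theta \<kappa> A) = 2"
    using Theta_trace[OF A] assms(3) nf by (cases "A = \<one>\<^bsub>H\<^esub>") (auto simp: Theta_one)
qed

text \<open>The determinant condition becomes p s = 1 for positive \<kappa>, so the polynomials p
  and s are constant. Then the trace is constant and therefore 2, and p + s = 2 with p s = 1 leaves
  only p = s = 1.\<close>

lemma Theta_triangular:
  assumes A: "A \<in> carrier H" and T: "\<And>\<kappa>. Theta \<kappa> A = (p \<kappa>, q \<kappa>, r \<kappa>, s \<kappa>)"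
    and pq: "p \<in> polyfn UNIV" "s \<in> polyfn UNIV" and d: "\<And>\<kappa>. p \<kappa> * s \<kappa> - q \<kappa> * r \<kappa> = 1"
    and z: "\<And>\<kappa>. \<kappa> > 0 \<Longrightarrow> q \<kappa> * r \<kappa> = 0" and "\<kappa> > 0"
  shows "p \<kappa> = 1" "s \<kappa> = 1"
proof -
  have ps: "p \<kappa> * s \<kappa> = 1" "s \<kappa> * p \<kappa> = 1" if "\<kappa> > 0" for \<kappa> using d[of \<kappa>] z[OF that] by (auto simp: mult.commute)
  obtain c c' where c: "\<And>\<kappa>. p \<kappa> = c" "\<And>\<kappa>. s \<kappa> = c'"
    using polyfn_unit_const[OF pq ps(1)] polyfn_unit_const[OF pq(2,1) ps(2)] by blast
  have "mtr (Theta \<kappa> A) = 2"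
    by (rule Theta_bounded_trace(1)[OF A, of "c + c'"]) (auto simp: T c \<open>\<kappa> > 0\<close>)
  then have "p \<kappa> + s \<kappa> = 2" by (simp add: T)
  moreover have "(p \<kappa> - 1) * (p \<kappa> - 1) = 1 - p \<kappa> * (2 - p \<kappa>)" by (simp add: algebra_simps)
  ultimately have "(p \<kappa> - 1) * (p \<kappa> - 1) = 0" using ps(1)[OF \<open>\<kappa> > 0\<close>] by (metis add_diff_cancel_left' diff_self)
  then show "p \<kappa> = 1" "s \<kappa> = 1" using \<open>p \<kappa> + s \<kappa> = 2\<close> by auto
qed

text \<open>Trace 2 threatens only if the commutator is conjugate into a factor. Its image is then
  unitriangular, the trace equations make the images of the two conjugated elements triangular on
  the same side, hence unitriangular by \<open>Theta_triangular\<close>, and such matrices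
  commute.\<close>

lemma Theta_commutator:
  assumes u: "u \<in> carrier H" and v: "v \<in> carrier H" and uv: "group_commutator H u v \<noteq> \<one>\<^bsub>H\<^esub>"
  shows "\<forall>\<^sub>F \<kappa> in at_top. mtr (group_commutator sl2 (Theta \<kappa> u) (Theta \<kappa> v)) \<noteq> 2"
proof -
  define C where "C = group_commutator H u v"
  have C: "C \<in> carrier H" "C \<noteq> \<one>\<^bsub>H\<^esub>" using u v uv by (auto simp: C_def group_commutator_def)
  have TC: "Theta \<kappa> (group_commutator H a b) = group_commutator sl2 (Theta \<kappa> a) (Theta \<kappa> b)"
    if "a \<in> carrier H" "b \<in> carrier H" for \<kappa> a b
    by (rule hom_group_commutator[OF amalgam_group sl2_group Theta(1) that])
  have triv: False if x: "x \<in> carrier H" and E: "\<And>\<kappa>. Theta \<kappa> (x \<otimes>\<^bsub>H\<^esub> C \<otimes>\<^bsub>H\<^esub> inv\<^bsub>H\<^esub> x) = (1, l \<kappa>, m \<kappa>, 1)"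
     and lm: "(\<forall>\<kappa>>0. l \<kappa> \<noteq> 0 \<and> m \<kappa> = 0) \<or> (\<forall>\<kappa>>0. l \<kappa> = 0 \<and> m \<kappa> \<noteq> 0)" for x l m
  proof -
    define cj where "cj a = x \<otimes>\<^bsub>H\<^esub> a \<otimes>\<^bsub>H\<^esub> inv\<^bsub>H\<^esub> x" for a
    have cj: "cj u \<in> carrier H" "cj v \<in> carrier H" using x u v by (auto simp: cj_def)
    have "cj C = group_commutator H (cj u) (cj v)" unfolding cj_def C_def
      by (rule hom_group_commutator[OF amalgam_group amalgam_group H.conj_hom[OF x] u v])
    then have E': "group_commutator sl2 (Theta \<kappa> (cj u)) (Theta \<kappa> (cj v)) = (1, l \<kappa>, m \<kappa>, 1)" for \<kappa>
      using E[of \<kappa>] TC[OF cj, of \<kappa>] by (simp add: cj_def)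
    obtain p q r s where a: "p \<in> polyfn UNIV" "q \<in> polyfn UNIV" "r \<in> polyfn UNIV" "s \<in> polyfn UNIV"
      "\<And>\<kappa>. Theta \<kappa> (cj u) = (p \<kappa>, q \<kappa>, r \<kappa>, s \<kappa>)" "\<And>\<kappa>. p \<kappa> * s \<kappa> - q \<kappa> * r \<kappa> = 1"
      using Theta_entries[OF cj(1)] by blast
    obtain p' q' r' s' where b: "p' \<in> polyfn UNIV" "q' \<in> polyfn UNIV" "r' \<in> polyfn UNIV" "s' \<in> polyfn UNIV"
      "\<And>\<kappa>. Theta \<kappa> (cj v) = (p' \<kappa>, q' \<kappa>, r' \<kappa>, s' \<kappa>)" "\<And>\<kappa>. p' \<kappa> * s' \<kappa> - q' \<kappa> * r' \<kappa> = 1"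
      using Theta_entries[OF cj(2)] by blast
    \<comment> \<open>Multiplication by the unitriangular commutator changes the trace of the other
      matrix by exactly these sums, up to sign.\<close>
    have tr: "l \<kappa> * r' \<kappa> + m \<kappa> * q' \<kappa> = 0" "l \<kappa> * r \<kappa> + m \<kappa> * q \<kappa> = 0" for \<kappa>
      using sl2_commutator_eq[OF Theta_closed[OF cj(1)] Theta_closed[OF cj(2)] E', of \<kappa>]
      by (simp_all add: a(5) b(5) algebra_simps)
    have qr: "(\<forall>\<kappa>>0. r \<kappa> = 0 \<and> r' \<kappa> = 0) \<or> (\<forall>\<kappa>>0. q \<kappa> = 0 \<and> q' \<kappa> = 0)"
      using lm tr by (metis add_0 add_0_right mult_eq_0_iff)
    then have qr0: "q \<kappa> * r \<kappa> = 0" "q' \<kappa> * r' \<kappa> = 0" if "\<kappa> > 0" for \<kappa> using that by auto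
    have "Theta 1 (cj u) = (1, q 1, r 1, 1)" "Theta 1 (cj v) = (1, q' 1, r' 1, 1)"
      using Theta_triangular[OF cj(1) a(5,1,4,6) qr0(1), of 1] Theta_triangular[OF cj(2) b(5,1,4,6) qr0(2), of 1]
      by (simp_all add: a(5) b(5))
    then have "Theta 1 (cj u) \<otimes>\<^bsub>sl2\<^esub> Theta 1 (cj v) = Theta 1 (cj v) \<otimes>\<^bsub>sl2\<^esub> Theta 1 (cj u)"
      using qr by (auto simp: sl2_simps)
    then have "(1, l 1, m 1, 1) = mone"
      using SL.commutator_eq_one_iff[OF Theta_closed[OF cj(1), of 1] Theta_closed[OF cj(2), of 1]] E'[of 1]
      by (simp add: sl2_simps)
    then show False using lm by auto
  qed
  from C show ?thesis
  proof (cases rule: conjugate_form)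
    case (left x g)
    have "lam g \<noteq> 0" using lam_eq_0 left by simp
    then show ?thesis using triv[OF left(1), of "\<lambda>_. lam g" "\<lambda>_. 0"] Theta(2)[OF left(2)] unfolding left(4) by auto
  next
    case (right x f)
    have "lam f \<noteq> 0" using lam_eq_0[OF F.mem_carrier[OF right(2)]] right by simp
    then show ?thesis using triv[OF right(1), of "\<lambda>_. 0" "\<lambda>\<kappa>. - \<kappa> * lam f"] Theta(3)[OF right(2)] unfolding right(4) by auto
  next
    case (cyclic x ps)
    have ps: "set ps \<subseteq> carrier G \<times> F" using cyclic(3) by blast
    have t: "mtr (Theta \<kappa> C) = mtr (wm \<kappa> (map (\<lambda>(g, f). (lam g, lam f)) ps))" for \<kappa>
      using Theta_conj(1)[OF cyclic(1) C(1), of \<kappa>] unfolding cyclic(4) Theta_pprod[OF ps] by simp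
    have "filterlim (\<lambda>\<kappa>. \<bar>mtr (wm \<kappa> (map (\<lambda>(g, f). (lam g, lam f)) ps))\<bar>) at_top at_top"
      by (rule wm_growth) (use cyclic(2,3) lam_eq_0 F.mem_carrier in \<open>auto simp: subset_iff\<close>)
    then have "\<forall>\<^sub>F \<kappa> in at_top. \<bar>mtr (Theta \<kappa> C)\<bar> > 2" unfolding t by (simp add: filterlim_at_top_dense)
    then show ?thesis unfolding TC[OF u v, symmetric] C_def[symmetric]
      by (rule eventually_mono) auto
  qed
qed

text \<open>All conditions of \<open>sl2_independent\<close> hold for large \<kappa>, and a tuple
  imposes finitely many of them. Independence is pulled back along one
  \<open>Theta \<kappa>\<close>, with \<kappa> depending on the tuple.\<close>

lemma BP_free_product: "BP_group H"
  unfolding BP_group_def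
proof (intro conjI allI impI amalgam_group)
  fix us assume nt: "nontrivial_tuple H us" and cf: "commutation_free H us"
  have us: "set us \<subseteq> carrier H" "us \<noteq> []" using nt by (auto simp: nontrivial_tuple_def)
  have 1: "\<forall>\<^sub>F \<kappa> in at_top. \<forall>u\<in>set us. \<bar>mtr (Theta \<kappa> u)\<bar> > 2 \<or> mtr (Theta \<kappa> u) = 2 \<and> Theta \<kappa> u \<noteq> mone"
  proof (intro eventually_ball_finite ballI finite_set)
    fix u assume "u \<in> set us"
    then have u: "u \<in> carrier H" "u \<noteq> \<one>\<^bsub>H\<^esub>" using nt by (auto simp: nontrivial_tuple_def)
    from Theta_trace[OF u] show "\<forall>\<^sub>F \<kappa> in at_top. \<bar>mtr (Theta \<kappa> u)\<bar> > 2 \<or> mtr (Theta \<kappa> u) = 2 \<and> Theta \<kappa> u \<noteq> mone"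
    proof
      assume "filterlim (\<lambda>\<kappa>. \<bar>mtr (Theta \<kappa> u)\<bar>) at_top at_top"
      then have "\<forall>\<^sub>F \<kappa> in at_top. \<bar>mtr (Theta \<kappa> u)\<bar> > 2" by (simp add: filterlim_at_top_dense)
      then show ?thesis by (rule eventually_mono) auto
    next
      assume "\<forall>\<kappa>>0. mtr (Theta \<kappa> u) = 2 \<and> Theta \<kappa> u \<noteq> mone"
      then show ?thesis by (intro eventually_mono[OF eventually_gt_at_top[of "0::real"]]) auto
    qed
  qed
  have 2: "\<forall>\<^sub>F \<kappa> in at_top. \<forall>i\<in>{i. Suc i < length us}.
      mtr (group_commutator sl2 (Theta \<kappa> (us ! i)) (Theta \<kappa> (us ! Suc i))) \<noteq> 2"
  proof (intro eventually_ball_finite ballI)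
    show "finite {i. Suc i < length us}" by (rule finite_subset[of _ "{..length us}"]) auto
    fix i assume "i \<in> {i. Suc i < length us}"
    then have i: "Suc i < length us" by simp
    then have "us ! i \<in> carrier H" "us ! Suc i \<in> carrier H" using us nth_mem[of i us] nth_mem[of "Suc i" us] by auto
    then show "\<forall>\<^sub>F \<kappa> in at_top. mtr (group_commutator sl2 (Theta \<kappa> (us ! i)) (Theta \<kappa> (us ! Suc i))) \<noteq> 2"
      using cf i by (intro Theta_commutator) (auto simp: commutation_free_def)
  qed
  obtain \<kappa> where k: "\<forall>u\<in>set us. \<bar>mtr (Theta \<kappa> u)\<bar> > 2 \<or> mtr (Theta \<kappa> u) = 2 \<and> Theta \<kappa> u \<noteq> mone"
     "\<forall>i\<in>{i. Suc i < length us}. mtr (group_commutator sl2 (Theta \<kappa> (us ! i)) (Theta \<kappa> (us ! Suc i))) \<noteq> 2"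
    using eventually_happens[OF eventually_conj[OF 1 2]] by auto
  have "independent_tuple sl2 (map (Theta \<kappa>) us)"
  proof (rule sl2_independent)
    show "successively (\<lambda>A B. mtr (group_commutator sl2 A B) \<noteq> 2) (map (Theta \<kappa>) us)"
      using k(2) by (auto simp: successively_conv_nth)
  qed (use us k(1) Theta_closed in auto)
  then show "independent_tuple H us" by (rule independent_tuple_hom[OF amalgam_group sl2_group Theta(1) us(1)])
qed

end

section \<open>A free product inside the substitution group\<close>

text \<open>The series \<open>r / (1 + l r)\<close>: in the coordinate \<open>1 / r\<close> it is the translation by \<open>l\<close>.\<close>

definition mob :: "real \<Rightarrow> real fps" where
  "mob l = Abs_fps (\<lambda>n. if n = 0 then 0 else (- l) ^ (n - 1))"

lemma mob_mult: "mob l * (1 + fps_const l * fps_X) = fps_X"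
proof (rule fps_ext)
  fix n
  have "mob l * (1 + fps_const l * fps_X) = mob l + fps_const l * (mob l * fps_X)" by (simp add: algebra_simps)
  moreover have "n = 0 \<or> n = 1 \<or> (\<exists>k. n = Suc (Suc k))" by presburger
  ultimately show "fps_nth (mob l * (1 + fps_const l * fps_X)) n = fps_nth fps_X n"
    by (auto simp: mob_def)
qed

lemma mob_nth: "fps_nth (mob l) 0 = 0" "fps_nth (mob l) 1 = 1" "fps_nth (mob l) 2 = - l"
  by (simp_all add: mob_def)

lemma mob_carrier: "mob l \<in> carrier subst_group"
  by (simp add: subst_carrier mob_def)

lemma mob_0: "mob 0 = fps_X"
  by (rule fps_ext) (auto simp: mob_def fps_X_def)

lemma mob_compose: "mob l oo mob m = mob (l + m)"
proof -
  define A where "A = 1 + fps_const (l + m) * (fps_X :: real fps)"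
  have "(mob l * (1 + fps_const l * fps_X)) oo mob m = fps_X oo mob m" by (simp only: mob_mult)
  then have "(mob l oo mob m) * (1 + fps_const l * mob m) = mob m"
    using mob_nth(1)[of m] by (simp add: fps_compose_mult_distrib fps_compose_add_distrib)
  then have "(mob l oo mob m) * ((1 + fps_const l * mob m) * (1 + fps_const m * fps_X)) = mob m * (1 + fps_const m * fps_X)"
    by (simp only: mult.assoc[symmetric])
  moreover have "(1 + fps_const l * mob m) * (1 + fps_const m * fps_X)
      = (1 + fps_const m * fps_X) + fps_const l * (mob m * (1 + fps_const m * fps_X))"
    by (simp only: distrib_right mult_1_left mult.assoc)
  then have "(1 + fps_const l * mob m) * (1 + fps_const m * fps_X) = A"
    unfolding mob_mult by (simp add: A_def algebra_simps flip: fps_const_add)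
  ultimately have "(mob l oo mob m) * A = mob (l + m) * A" by (simp add: mob_mult A_def)
  moreover have "fps_nth A 0 \<noteq> 0" by (simp add: A_def)
  then have "A \<noteq> 0" by auto
  ultimately show ?thesis by simp
qed

text \<open>The series \<open>r / (1 - s r\<^sup>2)\<close>, by which the second factor is conjugated.\<close>

definition psq :: "real \<Rightarrow> real fps" where
  "psq s = Abs_fps (\<lambda>n. if odd n then s ^ (n div 2) else 0)"

lemma psq_carrier: "psq s \<in> carrier subst_group"
  by (simp add: subst_carrier psq_def)

lemma psq_mult: "psq s * (1 - fps_const s * fps_X ^ 2) = fps_X"
proof (rule fps_ext)
  fix n :: nat
  have e: "psq s * (1 - fps_const s * fps_X ^ 2) = psq s - fps_const s * (fps_X ^ 2 * psq s)" by (simp add: algebra_simps)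
  have "n = 0 \<or> n = 1 \<or> (\<exists>k. n = k + 2)" by presburger
  then show "fps_nth (psq s * (1 - fps_const s * fps_X ^ 2)) n = fps_nth fps_X n"
    unfolding e by (auto simp: psq_def fps_X_power_mult_nth)
qed

lemma polyfam_psq: "qsubring S \<Longrightarrow> psq \<in> polyfam S"
proof -
  assume S: "qsubring S"
  have "(\<lambda>\<sigma>. fps_nth (psq \<sigma>) n) \<in> polyfn S" for n
    using S by (cases "odd n") (auto simp: psq_def intro: polyfn_const polyfn_power polyfn_id qsubringD)
  then show ?thesis by (simp add: polyfam_def)
qed

lemma polyfam_mob: "qsubring S \<Longrightarrow> c \<in> S \<Longrightarrow> (\<lambda>\<sigma>. mob (\<sigma> * c)) \<in> polyfam S"
proof -
  assume S: "qsubring S" and c: "c \<in> S"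
  have "(\<lambda>\<sigma>. \<sigma> * (- c)) \<in> polyfn S"
    using S c by (intro polyfn_mult polyfn_id polyfn_const) (auto intro: qsubringD)
  then have k: "(\<lambda>\<sigma>. (- (\<sigma> * c)) ^ k) \<in> polyfn S" for k using S by (intro polyfn_power) simp_all
  have "(\<lambda>\<sigma>. fps_nth (mob (\<sigma> * c)) n) \<in> polyfn S" for n
    using S k by (cases "n = 0") (auto simp: mob_def intro: polyfn_const qsubringD)
  then show ?thesis by (simp add: polyfam_def)
qed

lemma mob_over: "qsubring S \<Longrightarrow> c \<in> S \<Longrightarrow> mob c \<in> fps_over S"
  by (auto simp: fps_over_def mob_def intro!: qsubring_power qsubringD(4) intro: qsubringD)

text \<open>In the coordinate x = 1 / r the series \<open>psq s\<close> is x - s / x, so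
  \<open>bmap s m\<close> takes x to the y with y - s / y = x - s / x + m. For s = j N, with j m in
  place of m and j large, the terms of size j dominate and y tends to N x / (N - m x).\<close>

definition bmap :: "real \<Rightarrow> real \<Rightarrow> real fps" where
  "bmap s m = fps_inv (psq s) oo (mob m oo psq s)"

lemma psq_inv: "fps_inv (psq s) = inv\<^bsub>subst_group\<^esub> psq s"
proof -
  have "fps_inv (psq s) oo psq s = fps_X" using psq_carrier[of s] by (intro fps_inv) (auto simp: subst_carrier)
  moreover have "fps_inv (psq s) \<in> carrier subst_group"
    using psq_carrier[of s] by (simp add: subst_carrier fps_inv_def)
  ultimately show ?thesis using SG.inv_equality[of "fps_inv (psq s)" "psq s"] psq_carrier
    by (simp add: subst_mult subst_one)
qed

lemma bmap_conj: "bmap s m = inv\<^bsub>subst_group\<^esub> psq s \<otimes>\<^bsub>subst_group\<^esub> mob m \<otimes>\<^bsub>subst_group\<^esub> inv\<^bsub>subst_group\<^esub> (inv\<^bsub>subst_group\<^esub> psq s)"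
  using SG.m_assoc[of "inv\<^bsub>subst_group\<^esub> psq s" "mob m" "psq s"] psq_carrier[of s] mob_carrier[of m]
  by (simp add: bmap_def psq_inv subst_mult)

lemma bmap_carrier: "bmap s m \<in> carrier subst_group"
  unfolding bmap_conj using psq_carrier mob_carrier by simp

lemma bmap_add: "bmap s (m + n) = bmap s m oo bmap s n"
  using hom_mult[OF SG.conj_hom[of "inv\<^bsub>subst_group\<^esub> psq s"], of "mob m" "mob n"] psq_carrier mob_carrier
  unfolding bmap_conj by (simp add: subst_mult mob_compose)

text \<open>The relation between \<open>psq s oo bmap s m\<close> and \<open>mob m oo psq s\<close>
  with denominators cleared. A series with zero constant term is determined by this
  equation.\<close>

lemma bmap_quadratic:
  "(1 + fps_const m * fps_X - fps_const s * fps_X ^ 2) * bmap s m + fps_const s * fps_X * (bmap s m)\<^sup>2 = fps_X"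
proof -
  define b where "b = bmap s m"
  define Q where "Q = mob m oo psq s"
  define A where "A = 1 + fps_const m * fps_X - fps_const s * (fps_X :: real fps) ^ 2"
  have b0: "fps_nth b 0 = 0" using bmap_carrier by (simp add: b_def subst_carrier)
  have p0: "fps_nth (psq s) 0 = 0" by (simp add: psq_def)
  have "psq s \<otimes>\<^bsub>subst_group\<^esub> b = Q"
    unfolding b_def bmap_conj Q_def using psq_carrier mob_carrier by (simp add: SG.m_assoc) (simp add: subst_mult)
  then have pb: "psq s oo b = Q" by (simp add: subst_mult)
  have "(psq s * (1 - fps_const s * fps_X ^ 2)) oo b = fps_X oo b" by (simp only: psq_mult)
  then have 1: "Q * (1 - fps_const s * b\<^sup>2) = b"
    using b0 by (simp add: fps_compose_mult_distrib fps_compose_sub_distrib pb fps_compose_power[symmetric])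
  have "(mob m * (1 + fps_const m * fps_X)) oo psq s = fps_X oo psq s" by (simp only: mob_mult)
  then have "Q * (1 + fps_const m * psq s) = psq s"
    using p0 by (simp add: fps_compose_mult_distrib fps_compose_add_distrib Q_def)
  then have 3: "Q * ((1 + fps_const m * psq s) * (1 - fps_const s * fps_X ^ 2)) = psq s * (1 - fps_const s * fps_X ^ 2)"
    by (simp only: mult.assoc[symmetric])
  have "(1 + fps_const m * psq s) * (1 - fps_const s * fps_X ^ 2)
     = (1 - fps_const s * fps_X ^ 2) + fps_const m * (psq s * (1 - fps_const s * fps_X ^ 2))"
    by (simp only: distrib_right mult_1_left mult.assoc)
  then have 4: "(1 + fps_const m * psq s) * (1 - fps_const s * fps_X ^ 2) = A"
    unfolding psq_mult by (simp add: A_def)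
  have 2: "Q * A = fps_X" using 3 unfolding 4 psq_mult .
  have "A * b = A * (Q * (1 - fps_const s * b\<^sup>2))" using 1 by simp
  also have "\<dots> = (Q * A) * (1 - fps_const s * b\<^sup>2)" by (simp only: mult_ac)
  also have "\<dots> = fps_X - fps_const s * fps_X * b\<^sup>2" unfolding 2 by (simp add: algebra_simps)
  finally show ?thesis by (simp add: A_def b_def)
qed

fun wfps :: "real \<Rightarrow> real \<Rightarrow> (real \<times> real) list \<Rightarrow> real fps" where
  "wfps s t [] = fps_X"
| "wfps s t ((l, m) # ps) = mob l oo (bmap s (t * m) oo wfps s t ps)"

lemma wfps_nth_0: "fps_nth (wfps s t ps) 0 = 0"
  by (induction s t ps rule: wfps.induct) (auto simp: mob_nth)

section \<open>Words as expansions of analytic functions\<close>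

definition cfps :: "real fps \<Rightarrow> complex fps" where
  "cfps f = Abs_fps (\<lambda>n. complex_of_real (fps_nth f n))"

lemma cfps_nth [simp]: "fps_nth (cfps f) n = complex_of_real (fps_nth f n)"
  by (simp add: cfps_def)

lemma cfps_simps:
  "cfps (f + g) = cfps f + cfps g" "cfps (f - g) = cfps f - cfps g" "cfps (f * g) = cfps f * cfps g"
  "cfps 1 = 1" "cfps fps_X = fps_X" "cfps (fps_const c) = fps_const (complex_of_real c)"
  by (auto intro!: fps_ext simp: fps_mult_nth fps_X_def)

lemma cfps_power: "cfps (f ^ n) = cfps f ^ n"
  by (induction n) (simp_all add: cfps_simps)

lemma cfps_compose: "cfps (f oo g) = cfps f oo cfps g"
  by (rule fps_ext) (simp add: fps_compose_nth flip: cfps_power)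

definition mobz :: "real \<Rightarrow> complex \<Rightarrow> complex" where
  "mobz l z = z / (1 + of_real l * z)"

definition az :: "real \<Rightarrow> real \<Rightarrow> complex \<Rightarrow> complex" where
  "az s m z = 1 + of_real m * z - of_real s * z\<^sup>2"

text \<open>\<open>bz s m\<close> solves the quadratic equation of \<open>bmap s m\<close>; the root is written without cancellation at \<open>0\<close>.\<close>

definition bz :: "real \<Rightarrow> real \<Rightarrow> complex \<Rightarrow> complex" where
  "bz s m z = 2 * z / (az s m z + csqrt ((az s m z)\<^sup>2 + 4 * of_real s * z\<^sup>2))"

lemma has_fps_expansion_unique_ev:
  fixes f g :: "complex \<Rightarrow> complex"
  assumes "f has_fps_expansion F" "g has_fps_expansion E" "\<forall>\<^sub>F z in nhds 0. f z = g z"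
  shows "F = E"
proof -
  have "(\<lambda>z. f z - g z) has_fps_expansion F - E" using assms(1,2) by (rule has_fps_expansion_diff)
  moreover have "\<forall>\<^sub>F z in nhds 0. f z - g z = 0" using assms(3) by eventually_elim simp
  ultimately have "(\<lambda>_::complex. 0) has_fps_expansion F - E"
    using has_fps_expansion_cong[OF _ HOL.refl, of "\<lambda>z. f z - g z" "\<lambda>_. 0"] by blast
  then have "F - E = 0" using fps_expansion_unique_complex[of "\<lambda>_::complex. 0" "F - E" 0] by simp
  then show ?thesis by simp
qed

lemma mobz_expansion: "mobz l has_fps_expansion cfps (mob l)"
proof -
  have "mobz l analytic_on {0}" unfolding mobz_def[abs_def] by (intro analytic_intros) auto
  then obtain E where E: "mobz l has_fps_expansion E" using analytic_at_imp_has_fps_expansion_0 by blast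
  define A where "A = 1 + fps_const (complex_of_real l) * fps_X"
  have "(\<lambda>z. mobz l z * (1 + of_real l * z)) has_fps_expansion E * A"
    unfolding A_def by (intro fps_expansion_intros E)
  moreover have "(\<lambda>z::complex. z) has_fps_expansion fps_X" by (rule has_fps_expansion_fps_X)
  moreover have "\<forall>\<^sub>F z in nhds 0. mobz l z * (1 + of_real l * z) = z"
  proof -
    have "((\<lambda>z. 1 + of_real l * z) \<longlongrightarrow> 1 + of_real l * 0) (nhds (0::complex))"
      by (intro tendsto_intros filterlim_ident)
    then have "\<forall>\<^sub>F z in nhds (0::complex). 1 + of_real l * z \<noteq> 0" by (rule tendsto_imp_eventually_ne) simp
    then show ?thesis by eventually_elim (simp add: mobz_def)
  qed
  ultimately have "E * A = fps_X" by (rule has_fps_expansion_unique_ev)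
  moreover have "cfps (mob l) * A = fps_X"
    using arg_cong[OF mob_mult[of l], of cfps] by (simp add: cfps_simps A_def)
  moreover have "fps_nth A 0 \<noteq> 0" by (simp add: A_def)
  then have "A \<noteq> 0" by auto
  ultimately have "E = cfps (mob l)" by (metis mult_right_cancel)
  then show ?thesis using E by simp
qed

text \<open>The expansion E of \<open>bz\<close> and the series B satisfy the same quadratic
  equation. Subtracting the two equations gives (E - B) (A + S (E + B)) = 0, and the second factor
  has constant term 1.\<close>

lemma bz_expansion: "bz s m has_fps_expansion cfps (bmap s m)"
proof -
  have az_an: "az s m analytic_on {0}" unfolding az_def[abs_def] by (intro analytic_intros)
  have "bz s m analytic_on {0}" unfolding bz_def[abs_def]
    by (intro analytic_intros az_an) (auto simp: az_def)
  then obtain E where E: "bz s m has_fps_expansion E" using analytic_at_imp_has_fps_expansion_0 by blast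
  define A where "A = 1 + fps_const (complex_of_real m) * fps_X - fps_const (complex_of_real s) * fps_X ^ 2"
  define S where "S = fps_const (complex_of_real s) * fps_X"
  have azE: "az s m has_fps_expansion A" unfolding az_def[abs_def] A_def by (intro fps_expansion_intros)
  have "(\<lambda>z. az s m z * bz s m z + of_real s * z * (bz s m z)\<^sup>2) has_fps_expansion A * E + S * E\<^sup>2"
    unfolding S_def by (intro fps_expansion_intros E azE)
  moreover have "(\<lambda>z::complex. z) has_fps_expansion fps_X" by (rule has_fps_expansion_fps_X)
  moreover have "\<forall>\<^sub>F z in nhds 0. az s m z * bz s m z + of_real s * z * (bz s m z)\<^sup>2 = z"
  proof -
    define D where "D z = az s m z + csqrt ((az s m z)\<^sup>2 + 4 * of_real s * z\<^sup>2)" for z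
    have "D analytic_on {0}" unfolding D_def[abs_def]
      by (intro analytic_intros az_an) (auto simp: az_def)
    then have "isCont D 0"
      by (rule analytic_at_imp_isCont)
    then have "(D \<longlongrightarrow> D 0) (nhds 0)"
      by (simp only: isCont_def tendsto_at_iff_tendsto_nhds)
    then have "\<forall>\<^sub>F z in nhds 0. D z \<noteq> 0"
      by (rule tendsto_imp_eventually_ne) (simp add: D_def az_def)
    then have "\<forall>\<^sub>F z in nhds 0. az s m z + csqrt ((az s m z)\<^sup>2 + 4 * of_real s * z\<^sup>2) \<noteq> 0"
      by (simp only: D_def)
    then show ?thesis
    proof eventually_elim
      case (elim z)
      define a where "a = az s m z"
      define R where "R = csqrt (a\<^sup>2 + 4 * of_real s * z\<^sup>2)"
      have R2: "R\<^sup>2 = a\<^sup>2 + 4 * of_real s * z\<^sup>2" by (simp add: R_def)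
      have ne: "a + R \<noteq> 0" using elim by (simp add: a_def R_def)
      have b: "bz s m z = 2 * z / (a + R)" by (simp add: bz_def a_def R_def)
      define q where "q = 2 * z / (a + R)"
      have q: "q * (a + R) = 2 * z" using ne by (simp add: q_def)
      have "(a * q + of_real s * z * q\<^sup>2) * (a + R)\<^sup>2
          = a * (q * (a + R)) * (a + R) + of_real s * z * (q * (a + R))\<^sup>2"
        by (simp add: algebra_simps power2_eq_square)
      also have "\<dots> = 2 * a * z * (a + R) + z * (4 * of_real s * z\<^sup>2)"
        unfolding q by (simp add: power2_eq_square)
      also have "4 * of_real s * z\<^sup>2 = R\<^sup>2 - a\<^sup>2" using R2 by simp
      also have "2 * a * z * (a + R) + z * (R\<^sup>2 - a\<^sup>2) = z * (a + R)\<^sup>2" by (simp add: power2_eq_square algebra_simps)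
      finally show ?case using ne by (simp add: b a_def[symmetric] q_def[symmetric])
    qed
  qed
  ultimately have q1: "A * E + S * E\<^sup>2 = fps_X" by (rule has_fps_expansion_unique_ev)
  define B where "B = cfps (bmap s m)"
  have q2: "A * B + S * B\<^sup>2 = fps_X"
    using arg_cong[OF bmap_quadratic[of m s], of cfps] by (simp add: cfps_simps cfps_power A_def B_def S_def)
  have "(E - B) * (A + S * (E + B)) = (A * E + S * E\<^sup>2) - (A * B + S * B\<^sup>2)"
    by (simp add: algebra_simps power2_eq_square)
  then have "(E - B) * (A + S * (E + B)) = 0" unfolding q1 q2 by simp
  moreover have "fps_nth (A + S * (E + B)) 0 = 1" by (simp add: A_def S_def)
  then have "A + S * (E + B) \<noteq> 0" by (metis fps_zero_nth zero_neq_one)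
  ultimately have "E = B" by simp
  then show ?thesis using E by (simp add: B_def)
qed

fun wz :: "real \<Rightarrow> real \<Rightarrow> (real \<times> real) list \<Rightarrow> complex \<Rightarrow> complex" where
  "wz s t [] z = z"
| "wz s t ((l, m) # ps) z = mobz l (bz s (t * m) (wz s t ps z))"

lemma wz_expansion: "wz s t ps has_fps_expansion cfps (wfps s t ps)"
proof (induction ps)
  case Nil
  have "wz s t [] = (\<lambda>z. z)" by (simp add: fun_eq_iff)
  then show ?case by (simp add: cfps_simps has_fps_expansion_fps_X)
next
  case (Cons a ps)
  obtain l m where a: "a = (l, m)" by force
  have 1: "(bz s (t * m) \<circ> wz s t ps) has_fps_expansion (cfps (bmap s (t * m)) oo cfps (wfps s t ps))"
    by (rule has_fps_expansion_compose[OF bz_expansion Cons.IH]) (simp add: wfps_nth_0)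
  have "(mobz l \<circ> (bz s (t * m) \<circ> wz s t ps)) has_fps_expansion (cfps (mob l) oo (cfps (bmap s (t * m)) oo cfps (wfps s t ps)))"
    using bmap_carrier[of s "t * m"] by (intro has_fps_expansion_compose[OF mobz_expansion 1]) (simp add: subst_carrier)
  moreover have "mobz l \<circ> (bz s (t * m) \<circ> wz s t ps) = wz s t (a # ps)" by (simp add: fun_eq_iff a)
  ultimately show ?case by (simp only: a wfps.simps cfps_compose)
qed

text \<open>\<open>bx\<close> and \<open>wx\<close> are \<open>bz\<close> and \<open>wz\<close> in the coordinate \<open>1 / z\<close>, in which they are analytic on the whole real line.\<close>

definition Px :: "real \<Rightarrow> real \<Rightarrow> real \<Rightarrow> real" where
  "Px s m x = x\<^sup>2 + m * x - s"


definition bx :: "real \<Rightarrow> real \<Rightarrow> real \<Rightarrow> real" where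
  "bx s m x = 2 * s * x / (sqrt ((Px s m x)\<^sup>2 + 4 * s * x\<^sup>2) - Px s m x)"

fun wx :: "real \<Rightarrow> real \<Rightarrow> (real \<times> real) list \<Rightarrow> real \<Rightarrow> real" where
  "wx s t [] x = x"
| "wx s t ((l, m) # ps) x = l + bx s (t * m) (wx s t ps x)"

lemma bx_denominator:
  assumes "s > 0" shows "sqrt ((Px s m x)\<^sup>2 + 4 * s * x\<^sup>2) - Px s m x > 0"
proof (cases "x = 0")
  case True
  then show ?thesis using assms by (simp add: Px_def)
next
  case False
  then have "sqrt ((Px s m x)\<^sup>2) < sqrt ((Px s m x)\<^sup>2 + 4 * s * x\<^sup>2)"
    using assms by (intro real_sqrt_less_mono) simp
  then show ?thesis unfolding real_sqrt_abs by linarith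
qed

text \<open>With R the square root, (R + P) (R - P) = 4 s x^2. The present form suits large x; the
  defining one has no singularity at x = 0.\<close>

lemma bx_alt:
  assumes "s > 0" "x > 0"
  shows "bx s m x = (sqrt ((Px s m x)\<^sup>2 + 4 * s * x\<^sup>2) + Px s m x) / (2 * x)"
proof -
  define R where "R = sqrt ((Px s m x)\<^sup>2 + 4 * s * x\<^sup>2)"
  have R2: "R\<^sup>2 = (Px s m x)\<^sup>2 + 4 * s * x\<^sup>2" using assms by (simp add: R_def)
  have ne: "R - Px s m x > 0" unfolding R_def by (rule bx_denominator[OF assms(1)])
  have "(R + Px s m x) * (R - Px s m x) = 4 * s * x\<^sup>2" using R2 by (simp add: algebra_simps power2_eq_square)
  then have "2 * s * x / (R - Px s m x) = (R + Px s m x) / (2 * x)"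
    using ne assms by (simp add: field_simps power2_eq_square)
  then show ?thesis by (simp add: bx_def R_def)
qed

lemma bx_bz:
  assumes "s > 0" "x > 0"
  shows "bz s m (of_real (1 / x)) = of_real (1 / bx s m x)"
proof -
  define R where "R = sqrt ((Px s m x)\<^sup>2 + 4 * s * x\<^sup>2)"
  have a: "az s m (of_real (1 / x)) = of_real (Px s m x / x\<^sup>2)"
  proof -
    have "az s m (of_real (1 / x)) = of_real (1 + m * (1 / x) - s * (1 / x)\<^sup>2)" by (simp add: az_def)
    also have "1 + m * (1 / x) - s * (1 / x)\<^sup>2 = Px s m x / x\<^sup>2"
      using assms by (simp add: Px_def field_simps power2_eq_square)
    finally show ?thesis .
  qed
  have "(Px s m x / x\<^sup>2)\<^sup>2 + 4 * s * (1 / x)\<^sup>2 = ((Px s m x)\<^sup>2 + 4 * s * x\<^sup>2) / (x\<^sup>2)\<^sup>2"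
    using assms by (simp add: field_simps power2_eq_square)
  then have "sqrt ((Px s m x / x\<^sup>2)\<^sup>2 + 4 * s * (1 / x)\<^sup>2) = R / x\<^sup>2"
    by (simp only: real_sqrt_divide real_sqrt_abs R_def) simp
  moreover have "(az s m (of_real (1 / x)))\<^sup>2 + 4 * of_real s * (of_real (1 / x))\<^sup>2
      = complex_of_real ((Px s m x / x\<^sup>2)\<^sup>2 + 4 * s * (1 / x)\<^sup>2)" unfolding a by simp
  moreover have "(Px s m x / x\<^sup>2)\<^sup>2 + 4 * s * (1 / x)\<^sup>2 \<ge> 0" using assms by simp
  ultimately have c: "csqrt ((az s m (of_real (1 / x)))\<^sup>2 + 4 * of_real s * (of_real (1 / x))\<^sup>2) = of_real (R / x\<^sup>2)"
    by (simp only: csqrt_of_real)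
  have "bz s m (of_real (1 / x)) = of_real (2 * (1 / x) / (Px s m x / x\<^sup>2 + R / x\<^sup>2))"
    unfolding bz_def c unfolding a by simp
  also have "2 * (1 / x) / (Px s m x / x\<^sup>2 + R / x\<^sup>2) = 1 / ((R + Px s m x) / (2 * x))"
    using assms by (simp add: field_simps power2_eq_square)
  finally show ?thesis by (simp add: bx_alt[OF assms] R_def)
qed

lemma bx_at_top:
  assumes "s > 0" shows "filterlim (bx s m) at_top at_top"
proof (rule filterlim_at_top_mono)
  show "filterlim (\<lambda>x. (m - s) + x) at_top at_top"
    by (rule filterlim_tendsto_add_at_top[OF tendsto_const filterlim_ident])
  show "\<forall>\<^sub>F x in at_top. m - s + x \<le> bx s m x"
    using eventually_ge_at_top[of "1::real"]
  proof eventually_elim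
    case (elim x)
    have "sqrt ((Px s m x)\<^sup>2 + 4 * s * x\<^sup>2) \<ge> sqrt ((Px s m x)\<^sup>2)"
      using assms by (intro real_sqrt_le_mono) simp
    then have "sqrt ((Px s m x)\<^sup>2 + 4 * s * x\<^sup>2) \<ge> Px s m x" unfolding real_sqrt_abs by linarith
    then have "bx s m x \<ge> (Px s m x + Px s m x) / (2 * x)"
      unfolding bx_alt[OF assms less_le_trans[OF zero_less_one elim]]
      using elim by (intro divide_right_mono) auto
    moreover have "(Px s m x + Px s m x) / (2 * x) = x + m - s / x"
      using elim by (simp add: Px_def field_simps power2_eq_square)
    moreover have "s / x \<le> s / 1" using elim assms by (intro divide_left_mono) auto
    ultimately show ?case using elim by simp
  qed
qed

text \<open>Near infinity all intermediate values are positive. There the complex square root in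
  \<open>bz\<close> is the real one in \<open>bx\<close>, and the two words correspond under x = 1 /
  z.\<close>

lemma wx_wz:
  assumes "s > 0"
  shows "filterlim (wx s t ps) at_top at_top"
    "\<forall>\<^sub>F x in at_top. wz s t ps (of_real (1 / x)) = of_real (1 / wx s t ps x)"
proof (induction ps)
  case Nil
  show "filterlim (wx s t []) at_top at_top" by (simp add: filterlim_ident wx.simps[abs_def])
  show "\<forall>\<^sub>F x in at_top. wz s t [] (of_real (1 / x)) = of_real (1 / wx s t [] x)" by simp
next
  case (Cons a ps)
  obtain l m where a: "a = (l, m)" by force
  have 1: "filterlim (\<lambda>x. bx s (t * m) (wx s t ps x)) at_top at_top"
    by (rule filterlim_compose[OF bx_at_top[OF assms] Cons.IH(1)])
  have 2: "filterlim (\<lambda>x. l + bx s (t * m) (wx s t ps x)) at_top at_top"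
    by (rule filterlim_tendsto_add_at_top[OF tendsto_const 1])
  moreover have "wx s t (a # ps) = (\<lambda>x. l + bx s (t * m) (wx s t ps x))" by (simp add: a fun_eq_iff)
  ultimately show "filterlim (wx s t (a # ps)) at_top at_top" by (simp only:)
  have "\<forall>\<^sub>F x in at_top. wx s t ps x > 0" "\<forall>\<^sub>F x in at_top. bx s (t * m) (wx s t ps x) > 0"
    "\<forall>\<^sub>F x in at_top. l + bx s (t * m) (wx s t ps x) > 0"
    using Cons.IH(1) 1 2 by (auto simp: filterlim_at_top_dense)
  with Cons.IH(2) show "\<forall>\<^sub>F x in at_top. wz s t (a # ps) (of_real (1 / x)) = of_real (1 / wx s t (a # ps) x)"
  proof eventually_elim
    case (elim x)
    define y where "y = bx s (t * m) (wx s t ps x)"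
    have y: "y > 0" "l + y > 0" using elim by (auto simp: y_def)
    have "wz s t (a # ps) (of_real (1 / x)) = mobz l (of_real (1 / y))"
      using elim(1) bx_bz[OF assms elim(2)] by (simp only: a wz.simps y_def)
    also have "\<dots> = of_real ((1 / y) / (1 + l * (1 / y)))" by (simp add: mobz_def)
    also have "(1 / y) / (1 + l * (1 / y)) = 1 / (l + y)" using y by (simp add: field_simps)
    finally show ?case by (simp add: a y_def)
  qed
qed

text \<open>A trivial series makes the germ \<open>wz\<close> the identity near 0, and 1 / x tends
  to 0. Only large \<open>x\<close> are reached in this way.\<close>

lemma wx_eventually_id:
  assumes "s > 0" "wfps s t ps = fps_X"
  shows "\<forall>\<^sub>F x in at_top. wx s t ps x = x"
proof -
  have "\<forall>\<^sub>F z in nhds 0. eval_fps (cfps fps_X) z = wz s t ps z"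
    using wz_expansion[of s t ps] by (simp add: has_fps_expansion_def assms(2))
  then have ev: "\<forall>\<^sub>F z in nhds 0. wz s t ps z = z" by eventually_elim (simp add: cfps_simps)
  have "((\<lambda>x::real. complex_of_real (1 / x)) \<longlongrightarrow> of_real 0) at_top"
    by (intro tendsto_of_real) (simp add: tendsto_inverse_0_at_top[OF filterlim_ident] flip: inverse_eq_divide)
  then have "filterlim (\<lambda>x::real. complex_of_real (1 / x)) (nhds 0) at_top" by simp
  from this[unfolded filterlim_iff, rule_format, OF ev]
  have "\<forall>\<^sub>F x in at_top. wz s t ps (of_real (1 / x)) = of_real (1 / x)" .
  with wx_wz(2)[OF assms(1), of t ps] eventually_gt_at_top[of "0::real"] show ?thesis
  proof eventually_elim
    case (elim x)
    then have "1 / wx s t ps x = 1 / x" by (simp only: of_real_eq_iff)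
    then show ?case using elim by (simp add: field_simps)
  qed
qed

section \<open>Continuation along the real line\<close>

definition real_analytic_at :: "(real \<Rightarrow> real) \<Rightarrow> real \<Rightarrow> bool" where
  "real_analytic_at f x \<longleftrightarrow> (\<exists>F. F analytic_on {of_real x} \<and> (\<forall>\<^sub>F y in nhds x. F (of_real y) = of_real (f y)))"

lemma real_analytic_at_compose:
  assumes f: "real_analytic_at f x" and g: "real_analytic_at g (f x)"
  shows "real_analytic_at (\<lambda>y. g (f y)) x"
proof -
  obtain F where F: "F analytic_on {complex_of_real x}" "\<forall>\<^sub>F y in nhds x. F (of_real y) = of_real (f y)"
    using f by (auto simp: real_analytic_at_def)
  obtain G where G: "G analytic_on {complex_of_real (f x)}" "\<forall>\<^sub>F y in nhds (f x). G (of_real y) = of_real (g y)"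
    using g by (auto simp: real_analytic_at_def)
  have Fx: "F (of_real x) = of_real (f x)" using eventually_nhds_x_imp_x[OF F(2)] .
  have "(G \<circ> F) analytic_on {of_real x}"
    by (rule analytic_on_compose[OF F(1)]) (simp add: Fx G(1))
  moreover have "isCont f x"
  proof -
    have 1: "isCont F (of_real x)" by (rule analytic_at_imp_isCont[OF F(1)])
    have "isCont (\<lambda>y. of_real y :: complex) x" by (intro continuous_intros)
    from isCont_o2[OF this 1] have 2: "isCont (\<lambda>y. Re (F (of_real y))) x" by (rule continuous_Re)
    have "\<forall>\<^sub>F y in nhds x. Re (F (of_real y)) = f y" using F(2) by eventually_elim simp
    from isCont_cong[OF this] 2 show ?thesis by (rule iffD1)
  qed
  then have "filterlim f (nhds (f x)) (nhds x)" by (simp only: isCont_def tendsto_at_iff_tendsto_nhds)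
  from this[unfolded filterlim_iff, rule_format, OF G(2)]
  have "\<forall>\<^sub>F y in nhds x. G (of_real (f y)) = of_real (g (f y))" .
  with F(2) have "\<forall>\<^sub>F y in nhds x. (G \<circ> F) (of_real y) = of_real (g (f y))" by eventually_elim simp
  ultimately show ?thesis unfolding real_analytic_at_def by blast
qed

text \<open>For s > 0 the radicand is positive on the real line, which keeps the square root off its
  branch cut, and the denominator is positive as well.\<close>

lemma real_analytic_at_bx:
  assumes "s > 0" shows "real_analytic_at (bx s m) x"
  unfolding real_analytic_at_def
proof (intro exI conjI always_eventually allI)
  define P where "P z = z\<^sup>2 + of_real m * z - of_real s" for z :: complex
  let ?B = "\<lambda>z. 2 * of_real s * z / (csqrt ((P z)\<^sup>2 + 4 * of_real s * z\<^sup>2) - P z)"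
  have Pr: "P (of_real y) = of_real (Px s m y)" for y by (simp add: P_def Px_def)
  have rad: "(P (of_real y))\<^sup>2 + 4 * of_real s * (of_real y)\<^sup>2 = complex_of_real ((Px s m y)\<^sup>2 + 4 * s * y\<^sup>2)" for y
    by (simp add: Pr)
  have pos: "(Px s m y)\<^sup>2 + 4 * s * y\<^sup>2 > 0" for y
    using assms by (cases "y = 0") (auto simp: Px_def add_nonneg_pos)
  have c: "csqrt ((P (of_real y))\<^sup>2 + 4 * of_real s * (of_real y)\<^sup>2) = of_real (sqrt ((Px s m y)\<^sup>2 + 4 * s * y\<^sup>2))" for y
    unfolding rad by (rule csqrt_of_real[OF less_imp_le[OF pos]])
  have Pan: "P analytic_on {of_real x}" unfolding P_def[abs_def] by (intro analytic_intros)
  show "?B analytic_on {of_real x}"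
  proof (intro analytic_intros Pan)
    fix z assume "z \<in> {complex_of_real x}"
    then have z: "z = of_real x" by simp
    show "(P z)\<^sup>2 + 4 * of_real s * z\<^sup>2 \<notin> \<real>\<^sub>\<le>\<^sub>0"
      unfolding z rad nonpos_Reals_of_real_iff not_le by (rule pos)
    show "csqrt ((P z)\<^sup>2 + 4 * of_real s * z\<^sup>2) - P z \<noteq> 0"
      unfolding z c unfolding Pr of_real_diff[symmetric] of_real_eq_0_iff
      using bx_denominator[OF assms, of m x] by linarith
  qed
  show "?B (of_real y) = of_real (bx s m y)" for y
    unfolding c unfolding Pr by (simp add: bx_def)
qed

lemma real_analytic_at_wx:
  assumes "s > 0" shows "real_analytic_at (wx s t ps) x"
proof (induction ps)
  case Nil
  show ?case unfolding real_analytic_at_def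
    by (rule exI[of _ "\<lambda>z. z"], intro conjI analytic_on_ident) simp
next
  case (Cons a ps)
  obtain l m where a: "a = (l, m)" by force
  have add: "real_analytic_at (\<lambda>y. l + y) y" for y unfolding real_analytic_at_def
    by (rule exI[of _ "\<lambda>z. of_real l + z"], intro conjI analytic_on_add analytic_on_const analytic_on_ident) simp
  have 0: "real_analytic_at (\<lambda>y. bx s (t * m) (wx s t ps y)) x"
    by (rule real_analytic_at_compose[where f = "wx s t ps" and g = "bx s (t * m)", OF Cons.IH real_analytic_at_bx[OF assms]])
  have 1: "real_analytic_at (\<lambda>y. l + bx s (t * m) (wx s t ps y)) x"
    by (rule real_analytic_at_compose[where g = "\<lambda>y. l + y", OF 0 add])
  have e: "wx s t (a # ps) = (\<lambda>y. l + bx s (t * m) (wx s t ps y))" by (rule ext) (simp only: a wx.simps)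
  show ?case unfolding e by (rule 1)
qed

text \<open>The identity theorem on the connected real line: the points near which f is the identity
  form an open set, closed by analytic continuation of a local extension, and it is not empty
  because it contains all large points.\<close>

lemma real_analytic_id:
  assumes f: "\<And>x. real_analytic_at f x" and ev: "\<forall>\<^sub>F x in at_top. f x = x"
  shows "f x = x"
proof -
  define U where "U = {x. \<forall>\<^sub>F y in nhds x. f y = y}"
  have opU: "open U"
  proof (subst open_subopen, intro ballI)
    fix x assume "x \<in> U"
    then obtain T where T: "open T" "x \<in> T" "\<forall>y\<in>T. f y = y" by (auto simp: U_def eventually_nhds)
    have "T \<subseteq> U" unfolding U_def eventually_nhds using T(1,3) by blast
    then show "\<exists>T. open T \<and> x \<in> T \<and> T \<subseteq> U" using T(1,2) by blast
  qed
  have "closed U"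
    unfolding closed_limpt
  proof (intro allI impI)
    fix a assume a: "a islimpt U"
    obtain F where F: "F analytic_on {complex_of_real a}" "\<forall>\<^sub>F y in nhds a. F (of_real y) = of_real (f y)"
      using f[of a] by (auto simp: real_analytic_at_def)
    obtain e where e: "e > 0" "F holomorphic_on ball (of_real a) e"
      using F(1) by (auto simp: analytic_on_def)
    obtain d where d: "d > 0" "\<And>y. dist y a < d \<Longrightarrow> F (of_real y) = of_real (f y)"
      using F(2) by (auto simp: eventually_nhds_metric)
    \<comment> \<open>Real points of \<open>U\<close> are zeros of F z - z, and they accumulate at
      the centre of the disc.\<close>
    define Z where "Z = complex_of_real ` (U \<inter> ball a (min d e))"
    have lim: "complex_of_real a islimpt Z"
      unfolding islimpt_approachable
    proof (intro allI impI)
      fix r :: real assume "r > 0"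
      then obtain y where y: "y \<in> U" "y \<noteq> a" "dist y a < min r (min d e)"
        using a[unfolded islimpt_approachable, rule_format, of "min r (min d e)"] d(1) e(1) by auto
      then have "complex_of_real y \<in> Z" "complex_of_real y \<noteq> of_real a" "dist (complex_of_real y) (of_real a) < r"
        by (auto simp: Z_def dist_commute)
      then show "\<exists>z\<in>Z. z \<noteq> complex_of_real a \<and> dist z (complex_of_real a) < r" by blast
    qed
    have zero: "F z - z = 0" if "z \<in> ball (complex_of_real a) e" for z
    proof (rule analytic_continuation[of "\<lambda>z. F z - z" "ball (of_real a) e" Z "of_real a"])
      show "(\<lambda>z. F z - z) holomorphic_on ball (complex_of_real a) e" by (intro holomorphic_intros e)
      show "Z \<subseteq> ball (complex_of_real a) e" by (auto simp: Z_def)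
      fix z assume "z \<in> Z"
      then obtain y where y: "z = of_real y" "y \<in> U" "dist y a < d" by (auto simp: Z_def dist_commute)
      have "f y = y" using y(2) eventually_nhds_x_imp_x[of "\<lambda>y. f y = y" y] by (simp add: U_def)
      then show "F z - z = 0" using d(2)[OF y(3)] y(1) by simp
    next
      show "open (ball (complex_of_real a) e)" "connected (ball (complex_of_real a) e)"
        "of_real a \<in> ball (complex_of_real a) e" using e(1) by (simp_all add: convex_connected)
    qed (fact lim, fact that)
    have "f y = y" if y: "dist y a < min d e" for y
    proof -
      have "complex_of_real y \<in> ball (of_real a) e" using y by (simp add: dist_commute)
      then have "F (of_real y) - of_real y = 0" by (rule zero)
      then show ?thesis using d(2)[of y] y by simp
    qed
    then show "a \<in> U" unfolding U_def mem_Collect_eq eventually_nhds_metric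
      using d(1) e(1) by (intro exI[of _ "min d e"]) auto
  qed
  moreover have "U \<noteq> {}"
  proof -
    obtain N where N: "\<And>x. x \<ge> N \<Longrightarrow> f x = x" using ev by (auto simp: eventually_at_top_linorder)
    have "\<forall>\<^sub>F y in nhds (N + 1). f y = y"
      using eventually_nhds_in_open[of "{N<..}" "N + 1"] by (auto elim!: eventually_mono intro: N)
    then show ?thesis by (auto simp: U_def)
  qed
  ultimately have "U = UNIV" using opU clopen[of U] by simp
  then have "\<forall>\<^sub>F y in nhds x. f y = y" by (auto simp: U_def)
  then show ?thesis by (rule eventually_nhds_x_imp_x)
qed

text \<open>\<open>Px\<close> divided by j is \<open>p j\<close>, the radicand scales by j^2, and so
  j cancels from the quotient. In the limit the radicand is the square of m x - N; the assumed sign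
  gives 2 (N - m x) for the denominator.\<close>

lemma bx_limit:
  fixes X :: "nat \<Rightarrow> real"
  assumes X: "X \<longlonglongrightarrow> x" and N: "N \<ge> 1" and D: "real N - m * x > 0"
  shows "(\<lambda>j. bx (real (j * N)) (real j * m) (X j)) \<longlonglongrightarrow> real N * x / (real N - m * x)"
proof -
  define p where "p j = (X j)\<^sup>2 * inverse (real j) + m * X j - real N" for j :: nat
  have p: "p \<longlonglongrightarrow> x\<^sup>2 * 0 + m * x - real N" unfolding p_def[abs_def]
    by (intro tendsto_intros X LIMSEQ_inverse_real_of_nat[THEN LIMSEQ_imp_Suc] lim_inverse_n)
  have "(\<lambda>j. 2 * real N * X j / (sqrt ((p j)\<^sup>2 + 4 * real N * (X j)\<^sup>2 * inverse (real j)) - p j))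
      \<longlonglongrightarrow> 2 * real N * x / (sqrt ((x\<^sup>2 * 0 + m * x - real N)\<^sup>2 + 4 * real N * x\<^sup>2 * 0) - (x\<^sup>2 * 0 + m * x - real N))"
    using D by (intro tendsto_intros X p lim_inverse_n) simp
  also have "2 * real N * x / (sqrt ((x\<^sup>2 * 0 + m * x - real N)\<^sup>2 + 4 * real N * x\<^sup>2 * 0) - (x\<^sup>2 * 0 + m * x - real N))
     = real N * x / (real N - m * x)"
  proof -
    have "sqrt ((m * x - real N)\<^sup>2) = real N - m * x" using D by (simp only: real_sqrt_abs)
    then have e: "sqrt ((x\<^sup>2 * 0 + m * x - real N)\<^sup>2 + 4 * real N * x\<^sup>2 * 0) - (x\<^sup>2 * 0 + m * x - real N)
        = 2 * (real N - m * x)" by simp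
    have "2 * real N * x / (2 * (real N - m * x)) = 2 * (real N * x) / (2 * (real N - m * x))" by (simp only: mult.assoc)
    also have "\<dots> = real N * x / (real N - m * x)" by (rule mult_divide_mult_cancel_left) simp
    finally show ?thesis unfolding e .
  qed
  finally have L: "(\<lambda>j. 2 * real N * X j / (sqrt ((p j)\<^sup>2 + 4 * real N * (X j)\<^sup>2 * inverse (real j)) - p j))
      \<longlonglongrightarrow> real N * x / (real N - m * x)" .
  have eq: "2 * real N * X j / (sqrt ((p j)\<^sup>2 + 4 * real N * (X j)\<^sup>2 * inverse (real j)) - p j)
      = bx (real (j * N)) (real j * m) (X j)" if j: "j \<ge> 1" for j
  proof -
    have j0: "real j > 0" using j by simp
    have P: "Px (real (j * N)) (real j * m) (X j) = real j * p j"
      using j0 by (simp add: Px_def p_def field_simps)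
    have "(Px (real (j * N)) (real j * m) (X j))\<^sup>2 + 4 * real (j * N) * (X j)\<^sup>2
        = (real j)\<^sup>2 * ((p j)\<^sup>2 + 4 * real N * (X j)\<^sup>2 * inverse (real j))"
      unfolding P using j0 by (simp add: field_simps power2_eq_square)
    then have "sqrt ((Px (real (j * N)) (real j * m) (X j))\<^sup>2 + 4 * real (j * N) * (X j)\<^sup>2)
        = real j * sqrt ((p j)\<^sup>2 + 4 * real N * (X j)\<^sup>2 * inverse (real j))"
      by (simp only: real_sqrt_mult real_sqrt_abs abs_of_nat)
    then have "bx (real (j * N)) (real j * m) (X j)
      = (real j * (2 * real N * X j)) / (real j * (sqrt ((p j)\<^sup>2 + 4 * real N * (X j)\<^sup>2 * inverse (real j)) - p j))"
      unfolding bx_def P by (simp add: algebra_simps)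
    also have "\<dots> = 2 * real N * X j / (sqrt ((p j)\<^sup>2 + 4 * real N * (X j)\<^sup>2 * inverse (real j)) - p j)"
      using j0 by (intro mult_divide_mult_cancel_left) simp
    finally show ?thesis by (rule HOL.sym)
  qed
  show ?thesis
    by (rule Lim_transform_eventually[OF L eventually_mono[OF eventually_ge_at_top[of 1] eq]])
qed

text \<open>As \<open>j\<close> grows, the word with parameters \<open>s = j N\<close> and \<open>t = j\<close> converges to the
  fractional linear transformation given by the matrix word with parameter \<open>1 / N\<close>.\<close>

lemma wx_limit:
  "\<exists>M N0. \<forall>N\<ge>N0. \<forall>x\<in>{0..1}. \<forall>a b c d. wm (1 / real N) ps = (a, b, c, d) \<longrightarrow>
     c * x + d > 0 \<and> \<bar>(a * x + b) / (c * x + d)\<bar> \<le> M \<and>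
     (\<lambda>j. wx (real (j * N)) (real j) ps x) \<longlonglongrightarrow> (a * x + b) / (c * x + d)"
proof (induction ps)
  case Nil
  show ?case by (rule exI[of _ 1], rule exI[of _ 1]) auto
next
  case (Cons z ps)
  obtain l m where z: "z = (l, m)" by force
  obtain M N0 where IH: "\<And>N x a b c d. N \<ge> N0 \<Longrightarrow> x \<in> {0..1} \<Longrightarrow> wm (1 / real N) ps = (a, b, c, d) \<Longrightarrow>
     c * x + d > 0 \<and> \<bar>(a * x + b) / (c * x + d)\<bar> \<le> M \<and>
     (\<lambda>j. wx (real (j * N)) (real j) ps x) \<longlonglongrightarrow> (a * x + b) / (c * x + d)"
    using Cons.IH by blast
  \<comment> \<open>The bound M on the preceding values does not depend on N, so N can be chosen
    with N - m X at least N / 2. This keeps the denominators positive and at most doubles the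
    bound.\<close>
  define N1 where "N1 = max (max 1 N0) (nat \<lceil>2 * \<bar>m\<bar> * M\<rceil>)"
  show ?case
  proof (rule exI[of _ "\<bar>l\<bar> + 2 * M"], rule exI[of _ N1], intro allI ballI impI)
    fix N x a' b' c' d'
    assume N: "N \<ge> N1" and x: "x \<in> {0..(1::real)}" and w': "wm (1 / real N) (z # ps) = (a', b', c', d')"
    obtain a b c d where w: "wm (1 / real N) ps = (a, b, c, d)" by (metis prod.exhaust)
    have N': "N \<ge> N0" "N \<ge> 1" using N by (auto simp: N1_def)
    have "2 * \<bar>m\<bar> * M \<le> real (nat \<lceil>2 * \<bar>m\<bar> * M\<rceil>)" by linarith
    also have "\<dots> \<le> real N" using N unfolding of_nat_le_iff by (simp add: N1_def)
    finally have mM: "2 * \<bar>m\<bar> * M \<le> real N" .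
    define X where "X = (a * x + b) / (c * x + d)"
    have IHw: "c * x + d > 0" "\<bar>X\<bar> \<le> M" "(\<lambda>j. wx (real (j * N)) (real j) ps x) \<longlonglongrightarrow> X"
      using IH[OF N'(1) x w] unfolding X_def by blast+
    have N0: "real N > 0" using N'(2) by simp
    have "m * X \<le> \<bar>m\<bar> * \<bar>X\<bar>" by (simp flip: abs_mult)
    also have "\<dots> \<le> \<bar>m\<bar> * M" using IHw(2) by (intro mult_left_mono) auto
    finally have D: "real N - m * X \<ge> real N / 2" using mM by linarith
    then have D0: "real N - m * X > 0" using N0 by linarith
    have "\<bar>real N * X / (real N - m * X)\<bar> = real N * \<bar>X\<bar> / (real N - m * X)"
      using D0 by (simp add: abs_mult)
    also have "\<dots> \<le> real N * \<bar>X\<bar> / (real N / 2)" using D N0 D0 by (intro divide_left_mono) auto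
    also have "\<dots> = 2 * \<bar>X\<bar>" using N0 by (simp add: field_simps)
    finally have B: "\<bar>l + real N * X / (real N - m * X)\<bar> \<le> \<bar>l\<bar> + 2 * M" using IHw(2) by linarith
    have L: "(\<lambda>j. wx (real (j * N)) (real j) (z # ps) x) \<longlonglongrightarrow> l + real N * X / (real N - m * X)"
      unfolding z wx.simps by (intro tendsto_add tendsto_const bx_limit IHw(3) N'(2) D0)
    have e': "a' = (1 - l * m / real N) * a + l * c" "b' = (1 - l * m / real N) * b + l * d"
      "c' = c - m / real N * a" "d' = d - m / real N * b"
    proof -
      have "wm (1 / real N) (z # ps) = ((1 - l * m / real N) * a + l * c, (1 - l * m / real N) * b + l * d,
          c - m / real N * a, d - m / real N * b)" by (simp add: z w algebra_simps)
      then show "a' = (1 - l * m / real N) * a + l * c" "b' = (1 - l * m / real N) * b + l * d"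
        "c' = c - m / real N * a" "d' = d - m / real N * b" unfolding w' by blast+
    qed
    have Xe: "a * x + b = X * (c * x + d)" using IHw(1) by (simp add: X_def)
    have cd: "c' * x + d' = (c * x + d) * ((real N - m * X) / real N)"
    proof -
      define y where "y = c * x + d"
      have "c' * x + d' = (c * x + d) - m / real N * (a * x + b)" unfolding e' by (simp add: algebra_simps)
      also have "\<dots> = (c * x + d) * (1 - m * X / real N)"
        unfolding Xe y_def[symmetric] by (simp add: right_diff_distrib)
      also have "1 - m * X / real N = (real N - m * X) / real N" using N0 by (simp add: field_simps)
      finally show ?thesis .
    qed
    have ab: "a' * x + b' = (c * x + d) * X + l * (c' * x + d')"
    proof -
      have "a' * x + b' = (a * x + b) + l * ((c * x + d) - m / real N * (a * x + b))" unfolding e' by (simp add: algebra_simps)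
      also have "(c * x + d) - m / real N * (a * x + b) = c' * x + d'" unfolding e' by (simp add: algebra_simps)
      finally show ?thesis unfolding Xe by (simp only: mult.commute)
    qed
    have pos: "c' * x + d' > 0" unfolding cd using IHw(1) D0 N0 by simp
    have "(a' * x + b') / (c' * x + d') = l + (c * x + d) * X / (c' * x + d')"
      unfolding ab using pos by (simp add: add_divide_distrib)
    also have "(c * x + d) * X / (c' * x + d') = real N * X / (real N - m * X)"
    proof -
      have "y * X / (y * (D / n)) = n * X / D" if "y > 0" "D > 0" "n > 0" for y D n :: real
        using that by (simp add: field_simps)
      from this[OF IHw(1) D0 N0] show ?thesis unfolding cd .
    qed
    finally have v: "(a' * x + b') / (c' * x + d') = l + real N * X / (real N - m * X)" .
    show "c' * x + d' > 0 \<and> \<bar>(a' * x + b') / (c' * x + d')\<bar> \<le> \<bar>l\<bar> + 2 * M \<and>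
     (\<lambda>j. wx (real (j * N)) (real j) (z # ps) x) \<longlonglongrightarrow> (a' * x + b') / (c' * x + d')"
      unfolding v by (intro conjI pos B L)
  qed
qed

text \<open>Analytic continuation makes the word the identity on [0, 1] for every j, so the limiting
  fractional linear map fixes all points of [0, 1], which only a scalar matrix does.\<close>

lemma word_identity_scalar:
  assumes id: "\<And>j N. j \<ge> 1 \<Longrightarrow> N \<ge> 1 \<Longrightarrow> wfps (real (j * N)) (real j) ps = fps_X"
  shows "\<exists>N0. \<forall>N\<ge>N0. \<exists>a. wm (1 / real N) ps = (a, 0, 0, a)"
proof -
  obtain M N0 where lim: "\<And>N x a b c d. N \<ge> N0 \<Longrightarrow> x \<in> {0..1} \<Longrightarrow> wm (1 / real N) ps = (a, b, c, d) \<Longrightarrow>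
     c * x + d > 0 \<and> (\<lambda>j. wx (real (j * N)) (real j) ps x) \<longlonglongrightarrow> (a * x + b) / (c * x + d)"
    using wx_limit[of ps] by blast
  have "\<exists>a. wm (1 / real N) ps = (a, 0, 0, a)" if N: "N \<ge> max 1 N0" for N
  proof -
    obtain a b c d where w: "wm (1 / real N) ps = (a, b, c, d)" by (metis prod.exhaust)
    have N': "N \<ge> N0" "N \<ge> 1" using N by auto
    have fixed: "a * x + b = x * (c * x + d)" if x: "x \<in> {0..1}" for x
    proof -
      have "wx (real (j * N)) (real j) ps x = x" if "j \<ge> 1" for j
      proof -
        have s: "real (j * N) > 0" using that N'(2) by simp
        show ?thesis
          by (rule real_analytic_id[OF real_analytic_at_wx[OF s] wx_eventually_id[OF s id[OF that N'(2)]]])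
      qed
      then have "(\<lambda>j. wx (real (j * N)) (real j) ps x) \<longlonglongrightarrow> x"
        by (intro tendsto_eventually eventually_mono[OF eventually_ge_at_top[of 1]])
      then have "(a * x + b) / (c * x + d) = x" using lim[OF N'(1) x w] LIMSEQ_unique by blast
      then show ?thesis using lim[OF N'(1) x w] by (simp add: field_simps)
    qed
    \<comment> \<open>Three fixed points suffice.\<close>
    have "b = 0" "a + b = c + d" "a * (1 / 2) + b = 1 / 2 * (c * (1 / 2) + d)"
      using fixed[of 0] fixed[of 1] fixed[of "1 / 2"] by simp_all
    then have "b = 0" "c = 0" "d = a" by simp_all
    then show ?thesis using w by simp
  qed
  then show ?thesis by blast
qed

lemma psq_over: "qsubring S \<Longrightarrow> s \<in> S \<Longrightarrow> psq s \<in> fps_over S"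
  by (auto simp: fps_over_def psq_def intro: qsubring_power qsubringD)

text \<open>One statement per parameter, because the two numbers are specialized one after the other
  over different coefficient rings.\<close>

lemma wfps_polyfam:
  assumes S: "qsubring S" and ps: "set ps \<subseteq> S \<times> S"
  shows "s \<in> S \<Longrightarrow> (\<lambda>\<tau>. wfps s \<tau> ps) \<in> polyfam S" "t \<in> S \<Longrightarrow> (\<lambda>\<sigma>. wfps \<sigma> t ps) \<in> polyfam S"
proof -
  have psq1: "fps_nth (psq \<sigma>) 1 = 1" for \<sigma> using psq_carrier[of \<sigma>] by (simp add: subst_carrier)
  show "(\<lambda>\<tau>. wfps s \<tau> ps) \<in> polyfam S" if s: "s \<in> S"
    using ps
  proof (induction ps)
    case Nil
    show ?case unfolding wfps.simps by (rule polyfam_const[OF S fps_X_over[OF S]])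
  next
    case (Cons a ps)
    obtain l m where a: "a = (l, m)" by force
    have lm: "l \<in> S" "m \<in> S" "set ps \<subseteq> S \<times> S" using Cons.prems a by auto
    note p = polyfam_const[OF S psq_over[OF S s]]
    have "(\<lambda>\<tau>. bmap s (\<tau> * m)) \<in> polyfam S" unfolding bmap_def
      by (rule polyfam_compose[OF S polyfam_fps_inv[OF S p psq1] polyfam_compose[OF S polyfam_mob[OF S lm(2)] p]])
    then show ?case unfolding a wfps.simps
      by (intro polyfam_compose S polyfam_const mob_over lm(1) Cons.IH[OF lm(3)])
  qed
  show "(\<lambda>\<sigma>. wfps \<sigma> t ps) \<in> polyfam S" if t: "t \<in> S"
    using ps
  proof (induction ps)
    case Nil
    show ?case unfolding wfps.simps by (rule polyfam_const[OF S fps_X_over[OF S]])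
  next
    case (Cons a ps)
    obtain l m where a: "a = (l, m)" by force
    have lm: "l \<in> S" "t * m \<in> S" "set ps \<subseteq> S \<times> S" using Cons.prems a t qsubringD(3)[OF S] by auto
    note p = polyfam_psq[OF S]
    have "(\<lambda>\<sigma>. bmap \<sigma> (t * m)) \<in> polyfam S" unfolding bmap_def
      by (rule polyfam_compose[OF S polyfam_fps_inv[OF S p psq1] polyfam_compose[OF S polyfam_const[OF S mob_over[OF S lm(2)]] p]])
    then show ?case unfolding a wfps.simps
      by (intro polyfam_compose S polyfam_const mob_over lm(1) Cons.IH[OF lm(3)])
  qed
qed

context abelian_double
begin

interpretation G: group G by (rule G)
interpretation F: subgroup F G by (rule F)
interpretation H: group H by (rule amalgam_group)

definition Psi :: "real \<Rightarrow> real \<Rightarrow> ('a + 'a) gword set \<Rightarrow> real fps" where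
  "Psi s t = (SOME \<Phi>. \<Phi> \<in> hom H subst_group \<and> (\<forall>g\<in>carrier G. \<Phi> (il g) = mob (lam g)) \<and>
     (\<forall>f\<in>F. \<Phi> (ir f) = bmap s (t * lam f)))"

lemma bmap_0: "bmap s 0 = fps_X"
  using SG.r_inv[OF SG.inv_closed[OF psq_carrier]] psq_carrier[of s] unfolding bmap_conj mob_0
  by (simp flip: subst_one)

lemma Psi:
  "Psi s t \<in> hom H subst_group" "g \<in> carrier G \<Longrightarrow> Psi s t (il g) = mob (lam g)"
  "f \<in> F \<Longrightarrow> Psi s t (ir f) = bmap s (t * lam f)"
proof -
  have a: "(\<lambda>g. mob (lam g)) \<in> hom G subst_group"
    by (rule homI) (auto simp: subst_mult mob_carrier mob_compose lam_mult)
  have b: "(\<lambda>f. bmap s (t * lam f)) \<in> hom (G\<lparr>carrier := F\<rparr>) subst_group"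
    by (rule homI) (auto simp: subst_mult bmap_carrier bmap_add lam_mult distrib_left)
  have "\<exists>\<Phi>. \<Phi> \<in> hom H subst_group \<and> (\<forall>g\<in>carrier G. \<Phi> (il g) = mob (lam g)) \<and>
     (\<forall>f\<in>F. \<Phi> (ir f) = bmap s (t * lam f))"
    by (rule amalgam_lift[OF G F_group subst_group_is_group a b, of "{\<one>\<^bsub>G\<^esub>}"]) (auto simp: lam_one mob_0 bmap_0)
  from someI_ex[OF this] show "Psi s t \<in> hom H subst_group" "g \<in> carrier G \<Longrightarrow> Psi s t (il g) = mob (lam g)"
    "f \<in> F \<Longrightarrow> Psi s t (ir f) = bmap s (t * lam f)" unfolding Psi_def[symmetric] by auto
qed

lemma Psi_pprod:
  "set ps \<subseteq> carrier G \<times> F \<Longrightarrow> Psi s t (pprod ps) = wfps s t (map (\<lambda>(g, f). (lam g, lam f)) ps)"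
proof (induction ps)
  case Nil
  then show ?case
    using hom_one[OF Psi(1) amalgam_group subst_group_is_group] by (simp add: subst_one)
next
  case (Cons a ps)
  obtain g f where a: "a = (g, f)" by force
  have c: "g \<in> carrier G" "f \<in> F" "set ps \<subseteq> carrier G \<times> F" using Cons.prems a by auto
  note cl = il_closed[OF c(1)] ir_closed[OF c(2)] pprod_closed[OF c(3)]
  have n0: "fps_nth (bmap s (t * lam f)) 0 = 0" "fps_nth (mob (lam g)) 0 = 0"
    using bmap_carrier[of s "t * lam f"] mob_carrier[of "lam g"] by (simp_all add: subst_carrier)
  have "Psi s t (pprod (a # ps)) = (Psi s t (il g) oo Psi s t (ir f)) oo Psi s t (pprod ps)"
    unfolding a pprod.simps hom_mult[OF Psi(1) H.m_closed[OF cl(1,2)] cl(3)] hom_mult[OF Psi(1) cl(1,2)] subst_mult ..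
  also have "\<dots> = mob (lam g) oo (bmap s (t * lam f) oo Psi s t (pprod ps))"
    unfolding Psi(2)[OF c(1)] Psi(3)[OF c(2)]
    by (rule fps_compose_assoc[symmetric]) (use n0 wfps_nth_0 in \<open>auto simp: Cons.IH[OF c(3)]\<close>)
  finally show ?case unfolding Cons.IH[OF c(3)] by (simp add: a)
qed

text \<open>The matrix word is scalar at the infinitely many points \<kappa> = 1 / N, so its
  off-diagonal polynomials vanish identically. \<open>Theta_triangular\<close> then makes it the
  identity for positive \<kappa>, which \<open>Theta_bounded_trace\<close> excludes for a nontrivial
  element.\<close>

lemma Psi_trivial:
  assumes A: "A \<in> carrier H" and id: "\<And>j N. j \<ge> 1 \<Longrightarrow> N \<ge> 1 \<Longrightarrow> Psi (real (j * N)) (real j) A = fps_X"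
  shows "A = \<one>\<^bsub>H\<^esub>"
proof (rule ccontr)
  assume A1: "A \<noteq> \<one>\<^bsub>H\<^esub>"
  obtain ps where ps: "set ps \<subseteq> carrier G \<times> F" "A = pprod ps" using ex_pprod[OF A] by blast
  have "\<exists>N0. \<forall>N\<ge>N0. \<exists>a. wm (1 / real N) (map (\<lambda>(g, f). (lam g, lam f)) ps) = (a, 0, 0, a)"
    by (rule word_identity_scalar) (use id in \<open>simp only: Psi_pprod[OF ps(1)] ps(2)\<close>)
  then obtain N0 where N0: "\<And>N. N \<ge> N0 \<Longrightarrow> \<exists>a. Theta (1 / real N) A = (a, 0, 0, a)"
    unfolding ps(2) Theta_pprod[OF ps(1)] by blast
  obtain p q r s where a: "p \<in> polyfn UNIV" "q \<in> polyfn UNIV" "r \<in> polyfn UNIV" "s \<in> polyfn UNIV"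
    "\<And>\<kappa>. Theta \<kappa> A = (p \<kappa>, q \<kappa>, r \<kappa>, s \<kappa>)" "\<And>\<kappa>. p \<kappa> * s \<kappa> - q \<kappa> * r \<kappa> = 1"
    using Theta_entries[OF A] by blast
  define E where "E = (\<lambda>n. 1 / real (Suc n + N0)) ` UNIV"
  have E: "infinite E" unfolding E_def
    by (rule range_inj_infinite) (auto intro!: injI)
  have z: "q \<kappa> = 0" "r \<kappa> = 0" if k: "\<kappa> \<in> E" for \<kappa>
  proof -
    obtain n where "\<kappa> = 1 / real (Suc n + N0)" using k unfolding E_def by blast
    then show "q \<kappa> = 0" "r \<kappa> = 0" using N0[of "Suc n + N0"] a(5)[of \<kappa>] by auto
  qed
  have q0: "q = (\<lambda>_. 0)"
    by (rule polyfn_eq_infinite[OF a(2) polyfn_const[OF qsubring_UNIV UNIV_I] infinite_super[OF _ E]]) (use z in auto)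
  have r0: "r = (\<lambda>_. 0)"
    by (rule polyfn_eq_infinite[OF a(3) polyfn_const[OF qsubring_UNIV UNIV_I] infinite_super[OF _ E]]) (use z in auto)
  have ps1: "p \<kappa> = 1" "s \<kappa> = 1" if "\<kappa> > 0" for \<kappa>
    using Theta_triangular[OF A a(5,1,4,6) _ that] by (simp_all add: q0)
  have "Theta 1 A \<noteq> mone"
    by (rule Theta_bounded_trace(2)[OF A, of 2]) (use A1 ps1 in \<open>simp_all add: a(5)\<close>)
  then show False using ps1[of 1] by (simp add: a(5) q0 r0)
qed

lemma Psi_embedding:
  assumes S: "qsubring S" and lam: "lam ` carrier G \<subseteq> S" and s: "transc S s" and t: "transc (adjoin S s) t"
  shows "Psi s t \<in> mon H subst_group" "A \<in> carrier H \<Longrightarrow> Psi s t A \<in> fps_over (adjoin (adjoin S s) t)"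
proof -
  let ?L = "map (\<lambda>(g, f). (lam g, lam f))"
  let ?T = "adjoin S s"
  have T: "qsubring ?T" by (rule qsubring_adjoin[OF S])
  have L: "set (?L ps) \<subseteq> S \<times> S" if "set ps \<subseteq> carrier G \<times> F" for ps
    using that lam F.mem_carrier by fastforce
  have LT: "set (?L ps) \<subseteq> ?T \<times> ?T" if "set ps \<subseteq> carrier G \<times> F" for ps
    using L[OF that] adjoin_superset[OF S, of s] by blast
  note fam = wfps_polyfam(1)[OF T LT adjoin_gen[OF S]]
  show "Psi s t A \<in> fps_over (adjoin ?T t)" if A: "A \<in> carrier H" for A
  proof -
    obtain ps where ps: "set ps \<subseteq> carrier G \<times> F" "A = pprod ps" using ex_pprod[OF A] by blast
    show ?thesis unfolding ps(2) Psi_pprod[OF ps(1)] by (rule polyfam_adjoin[OF fam[OF ps(1)]])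
  qed
  show "Psi s t \<in> mon H subst_group"
  proof (rule mon_of_trivial_kernel[OF amalgam_group subst_group_is_group Psi(1)])
    fix A assume A: "A \<in> carrier H" and "Psi s t A = \<one>\<^bsub>subst_group\<^esub>"
    then have X: "Psi s t A = fps_X" by (simp add: subst_one)
    obtain ps where ps: "set ps \<subseteq> carrier G \<times> F" "A = pprod ps" using ex_pprod[OF A] by blast
    show "A = \<one>\<^bsub>H\<^esub>"
    proof (rule Psi_trivial[OF A])
      fix j N :: nat
      have j: "real j \<in> S" by (rule qsubringD(1)[OF S]) simp
      \<comment> \<open>The number t goes first, since it is transcendental over the ring that
        already contains s; afterwards s is replaced over \<open>S\<close>.\<close>
      have 1: "wfps s (real j) (?L ps) = fps_X"
        by (rule polyfam_transc_eq[OF T fam[OF ps(1)] polyfam_const[OF T fps_X_over[OF T]] t])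
           (use X in \<open>simp only: ps(2) Psi_pprod[OF ps(1)]\<close>)
      show "Psi (real (j * N)) (real j) A = fps_X"
        unfolding ps(2) Psi_pprod[OF ps(1)]
        by (rule polyfam_transc_eq[OF S wfps_polyfam(2)[OF S L[OF ps(1)] j] polyfam_const[OF S fps_X_over[OF S]] s 1])
    qed
  qed
qed

end

section \<open>One step of the chain\<close>

text \<open>The conjugating element \<open>w\<close> is taken from the image \<open>K\<close> of a
  centralizer extension, a BP-group larger than the image of \<open>G\<close>. The amalgam is formed
  over \<open>G\<close> alone, where only the identity commutes with \<open>w\<close>.\<close>

lemma free_product_embedding_nonabelian:
  fixes G :: "'a monoid"
  assumes BP: "BP_group G" and F: "subgroup F G" and r: "r \<in> mon G subst_group" and S: "qsubring S"
    and rS: "r ` carrier G \<subseteq> fps_over S"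
    and ab: "a \<in> carrier G" "b \<in> carrier G" "a \<otimes>\<^bsub>G\<^esub> b \<noteq> b \<otimes>\<^bsub>G\<^esub> a"
    and s: "transc S s" and t: "transc (adjoin S s) t"
  shows "BP_group (amalgam G (G\<lparr>carrier := F\<rparr>) {\<one>\<^bsub>G\<^esub>})"
    "\<exists>\<psi> \<in> mon (amalgam G (G\<lparr>carrier := F\<rparr>) {\<one>\<^bsub>G\<^esub>}) subst_group.
       (\<forall>A \<in> carrier (amalgam G (G\<lparr>carrier := F\<rparr>) {\<one>\<^bsub>G\<^esub>}). \<psi> A \<in> fps_over (adjoin (adjoin S s) t)) \<and>
       (\<forall>g \<in> carrier G. \<psi> (amalgam_incl G (G\<lparr>carrier := F\<rparr>) {\<one>\<^bsub>G\<^esub>} g) = r g)"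
proof -
  have G: "group G" using BP by (simp add: BP_group_def)
  interpret G: group G by (rule G)
  interpret F: subgroup F G by (rule F)
  have rh: "r \<in> hom G subst_group" and rinj: "inj_on r (carrier G)" using r by (auto simp: mon_def)
  have rc: "r x \<in> carrier subst_group" if "x \<in> carrier G" for x using rh that by (auto simp: hom_def)
  have rm: "r (x \<otimes>\<^bsub>G\<^esub> y) = r x oo r y" if "x \<in> carrier G" "y \<in> carrier G" for x y
    using hom_mult[OF rh that] by (simp add: subst_mult)
  have r1: "r \<one>\<^bsub>G\<^esub> = fps_X" using hom_one[OF rh G subst_group_is_group] by (simp add: subst_one)
  have a1: "a \<noteq> \<one>\<^bsub>G\<^esub>" using ab by auto
  define u v where "u = r a" and "v = r b"
  have uv: "u \<in> carrier subst_group" "v \<in> carrier subst_group" "u \<in> fps_over S" "v \<in> fps_over S"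
    using ab rc rS by (auto simp: u_def v_def)
  have nc: "u oo v \<noteq> v oo u"
  proof
    assume "u oo v = v oo u"
    then have "r (a \<otimes>\<^bsub>G\<^esub> b) = r (b \<otimes>\<^bsub>G\<^esub> a)" using ab by (simp add: rm u_def v_def)
    then show False using inj_onD[OF rinj] ab by blast
  qed
  let ?E = "centr_ext G a"
  have E: "BP_group ?E" by (rule centr_ext_embedding(1)[OF BP r S rS ab(1) a1 s])
  obtain \<phi> where \<phi>: "\<phi> \<in> mon ?E subst_group" "\<And>A. A \<in> carrier ?E \<Longrightarrow> \<phi> A \<in> fps_over (adjoin S s)"
    "\<And>g. g \<in> carrier G \<Longrightarrow> \<phi> (centr_ext_incl G a g) = r g" "\<phi> (stable_letter G a) = rpow u s"
    using centr_ext_embedding(2)[OF BP r S rS ab(1) a1 s] unfolding u_def by blast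
  define K where "K = \<phi> ` carrier ?E"
  have K: "bp_set subst_group K" unfolding K_def by (rule bp_set_image[OF E subst_group_is_group \<phi>(1)])
  have incl: "centr_ext_incl G a g \<in> carrier ?E" if "g \<in> carrier G" for g
    using centr_ext_incl_hom[OF G] that by (auto simp: hom_def)
  have rK: "r ` carrier G \<subseteq> K"
  proof
    fix x assume "x \<in> r ` carrier G"
    then obtain g where g: "g \<in> carrier G" "x = \<phi> (centr_ext_incl G a g)" using \<phi>(3) by auto
    show "x \<in> K" unfolding K_def g(2) by (rule imageI[OF incl[OF g(1)]])
  qed
  define w where "w = rpow u s oo v"
  have wK: "w \<in> K"
  proof -
    have "rpow u s \<in> K" unfolding K_def \<phi>(4)[symmetric] by (rule imageI[OF stable_letter_closed])
    moreover have "v \<in> K" using rK ab(2) by (auto simp: v_def)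
    ultimately show ?thesis
      using subgroup.m_closed[of K subst_group "rpow u s" v] K by (simp add: bp_set_def w_def subst_mult)
  qed
  have fam: "(\<lambda>\<sigma>. rpow u \<sigma> oo v) \<in> polyfam S"
    by (intro polyfam_compose S polyfam_rpow polyfam_const uv)
  have T: "qsubring (adjoin S s)" by (rule qsubring_adjoin[OF S])
  have wS: "w \<in> fps_over (adjoin S s)" unfolding w_def by (rule polyfam_adjoin[OF fam])
  have wX: "w \<noteq> fps_X"
  proof
    assume "w = fps_X"
    then have "rpow u 0 oo v = fps_X"
      unfolding w_def by (rule polyfam_transc_eq[OF S fam polyfam_const[OF S fps_X_over[OF S]] s])
    then have "v = fps_X" using uv(1,2) by (simp add: rpow_0 subst_carrier)
    then show False using nc uv by (simp add: subst_carrier)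
  qed
  have cw: "x = \<one>\<^bsub>G\<^esub>" if x: "x \<in> carrier G" and xw: "r x oo w = w oo r x" for x
  proof (rule ccontr)
    assume x1: "x \<noteq> \<one>\<^bsub>G\<^esub>"
    define g where "g = r x"
    have g: "g \<in> carrier subst_group" "g \<in> fps_over S" using x rc rS by (auto simp: g_def)
    have gX: "g \<noteq> fps_X" using inj_onD[OF rinj _ x G.one_closed] x1 r1 by (auto simp: g_def)
    have f1: "(\<lambda>\<sigma>. g oo (rpow u \<sigma> oo v)) \<in> polyfam S" "(\<lambda>\<sigma>. (rpow u \<sigma> oo v) oo g) \<in> polyfam S"
      by (intro polyfam_compose S fam polyfam_const g)+
    have eq: "g oo (rpow u \<sigma> oo v) = (rpow u \<sigma> oo v) oo g" for \<sigma>
      by (rule polyfam_transc_eq[OF S f1 s]) (use xw in \<open>simp only: w_def g_def\<close>)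
    \<comment> \<open>Commutation at the transcendental exponent holds at all exponents. Exponent 0
      shows that g commutes with v, and exponent 1 then that it commutes with u; a nontrivial g
      would make u and v commute.\<close>
    have gv: "g oo v = v oo g" using eq[of 0] uv(1,2) by (simp add: rpow_0 subst_carrier)
    have "g \<otimes>\<^bsub>subst_group\<^esub> (u \<otimes>\<^bsub>subst_group\<^esub> v) = (u \<otimes>\<^bsub>subst_group\<^esub> v) \<otimes>\<^bsub>subst_group\<^esub> g"
      using eq[of 1] uv(1) by (simp add: rpow_1 subst_mult)
    also have "\<dots> = u \<otimes>\<^bsub>subst_group\<^esub> (g \<otimes>\<^bsub>subst_group\<^esub> v)"
      using SG.m_assoc[OF uv(1,2) g(1)] gv by (simp add: subst_mult)
    finally have "(g \<otimes>\<^bsub>subst_group\<^esub> u) \<otimes>\<^bsub>subst_group\<^esub> v = (u \<otimes>\<^bsub>subst_group\<^esub> g) \<otimes>\<^bsub>subst_group\<^esub> v"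
      using SG.m_assoc uv(1,2) g(1) by simp
    then have "g \<otimes>\<^bsub>subst_group\<^esub> u = u \<otimes>\<^bsub>subst_group\<^esub> g"
      using SG.right_cancel[OF uv(2)] uv g by simp
    then have gu: "u oo g = g oo u" by (simp add: subst_mult)
    show False using commuting_abelian[OF g(1) gX uv(1) gu uv(2) gv[symmetric]] nc by simp
  qed
  have C: "{\<one>\<^bsub>G\<^esub>} = {x \<in> carrier G. r x oo w = w oo r x}"
  proof -
    have w0: "fps_nth w 0 = 0" using K wK by (auto simp: bp_set_def subst_carrier dest: subgroup.mem_carrier)
    show ?thesis using cw w0 by (auto simp: r1)
  qed
  have rT: "r ` carrier G \<subseteq> fps_over (adjoin S s)"
    using rS fps_over_mono[OF adjoin_superset[OF S]] by blast
  have CF: "{\<one>\<^bsub>G\<^esub>} \<subseteq> F" by simp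
  note emb = amalgam_embedding[OF G F r T K rK rT wK wX wS C CF t]
  show "BP_group (amalgam G (G\<lparr>carrier := F\<rparr>) {\<one>\<^bsub>G\<^esub>})" by (rule emb(1))
  show "\<exists>\<psi> \<in> mon (amalgam G (G\<lparr>carrier := F\<rparr>) {\<one>\<^bsub>G\<^esub>}) subst_group.
       (\<forall>A \<in> carrier (amalgam G (G\<lparr>carrier := F\<rparr>) {\<one>\<^bsub>G\<^esub>}). \<psi> A \<in> fps_over (adjoin (adjoin S s) t)) \<and>
       (\<forall>g \<in> carrier G. \<psi> (amalgam_incl G (G\<lparr>carrier := F\<rparr>) {\<one>\<^bsub>G\<^esub>} g) = r g)"
    by (rule emb(2))
qed

definition abelian_on :: "('a, 'b) monoid_scheme \<Rightarrow> bool" where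
  "abelian_on G \<longleftrightarrow> (\<forall>x\<in>carrier G. \<forall>y\<in>carrier G. x \<otimes>\<^bsub>G\<^esub> y = y \<otimes>\<^bsub>G\<^esub> x)"

lemma free_product_embedding_abelian:
  fixes G :: "'a monoid"
  assumes G: "group G" and F: "subgroup F G" and r: "r \<in> mon G subst_group" and S: "qsubring S"
    and rS: "r ` carrier G \<subseteq> fps_over S" and mob: "\<And>x. x \<in> carrier G \<Longrightarrow> \<exists>l. r x = mob l"
    and s: "transc S s" and t: "transc (adjoin S s) t"
  shows "BP_group (amalgam G (G\<lparr>carrier := F\<rparr>) {\<one>\<^bsub>G\<^esub>})"
    "\<exists>\<psi> \<in> mon (amalgam G (G\<lparr>carrier := F\<rparr>) {\<one>\<^bsub>G\<^esub>}) subst_group.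
       (\<forall>A \<in> carrier (amalgam G (G\<lparr>carrier := F\<rparr>) {\<one>\<^bsub>G\<^esub>}). \<psi> A \<in> fps_over (adjoin (adjoin S s) t)) \<and>
       (\<forall>g \<in> carrier G. \<psi> (amalgam_incl G (G\<lparr>carrier := F\<rparr>) {\<one>\<^bsub>G\<^esub>} g) = r g)"
proof -
  \<comment> \<open>The sign undoes the one in \<open>mob\<close>, whose second coefficient is
    -l.\<close>
  define lam where "lam x = - fps_nth (r x) 2" for x
  have rh: "r \<in> hom G subst_group" and rinj: "inj_on r (carrier G)" using r by (auto simp: mon_def)
  have rl: "r x = mob (lam x)" if "x \<in> carrier G" for x
    using mob[OF that] by (auto simp: lam_def mob_nth)
  have "abelian_double G F lam"
  proof (rule abelian_double.intro)
    show "lam (x \<otimes>\<^bsub>G\<^esub> y) = lam x + lam y" if "x \<in> carrier G" "y \<in> carrier G" for x y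
    proof -
      have "r (x \<otimes>\<^bsub>G\<^esub> y) = mob (lam x + lam y)"
        unfolding hom_mult[OF rh that] subst_mult rl[OF that(1)] rl[OF that(2)] mob_compose ..
      then show ?thesis unfolding lam_def[of "x \<otimes>\<^bsub>G\<^esub> y"] by (simp add: mob_nth)
    qed
    show "inj_on lam (carrier G)"
      by (rule inj_onI) (metis rl inj_onD[OF rinj])
  qed (fact G F)+
  then interpret abelian_double G F lam .
  have lS: "lam ` carrier G \<subseteq> S" using rS qsubringD(4)[OF S] by (auto simp: lam_def fps_over_def)
  show "BP_group (amalgam G (G\<lparr>carrier := F\<rparr>) {\<one>\<^bsub>G\<^esub>})" by (rule BP_free_product)
  show "\<exists>\<psi> \<in> mon (amalgam G (G\<lparr>carrier := F\<rparr>) {\<one>\<^bsub>G\<^esub>}) subst_group.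
       (\<forall>A \<in> carrier (amalgam G (G\<lparr>carrier := F\<rparr>) {\<one>\<^bsub>G\<^esub>}). \<psi> A \<in> fps_over (adjoin (adjoin S s) t)) \<and>
       (\<forall>g \<in> carrier G. \<psi> (amalgam_incl G (G\<lparr>carrier := F\<rparr>) {\<one>\<^bsub>G\<^esub>} g) = r g)"
    using Psi_embedding[OF S lS s t] Psi(2) rl by (intro bexI[of _ "Psi s t"]) auto
qed

lemma transport_embedding:
  assumes X: "BP_group X" and H: "group H" and \<psi>: "\<psi> \<in> iso X H"
    and \<rho>: "\<rho> \<in> mon X subst_group" "\<And>A. A \<in> carrier X \<Longrightarrow> \<rho> A \<in> fps_over T"
    and \<iota>: "\<And>g. g \<in> A \<Longrightarrow> \<iota> g \<in> carrier X" "\<And>g. g \<in> A \<Longrightarrow> \<psi> (\<iota> g) = g"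
  shows "\<exists>r'\<in>mon H subst_group. r' ` carrier H \<subseteq> fps_over T \<and> (\<forall>g\<in>A. r' g = \<rho> (\<iota> g)) \<and> BP_group H"
proof -
  have gX: "group X" using X by (simp add: BP_group_def)
  define \<eta> where "\<eta> = inv_into (carrier X) \<psi>"
  have \<eta>: "\<eta> \<in> iso H X" unfolding \<eta>_def by (rule group.iso_set_sym[OF gX \<psi>])
  then have \<eta>h: "\<eta> \<in> hom H X" and \<eta>b: "bij_betw \<eta> (carrier H) (carrier X)" by (auto simp: iso_def)
  have \<rho>h: "\<rho> \<in> hom X subst_group" "inj_on \<rho> (carrier X)" using \<rho>(1) by (auto simp: mon_def)
  have c: "\<eta> y \<in> carrier X" if "y \<in> carrier H" for y using \<eta>b that by (rule bij_betwE[rule_format])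
  have m: "\<rho> \<circ> \<eta> \<in> mon H subst_group"
    unfolding mon_def mem_Collect_eq
  proof
    show "\<rho> \<circ> \<eta> \<in> hom H subst_group" by (rule hom_compose[OF \<eta>h \<rho>h(1)])
    show "inj_on (\<rho> \<circ> \<eta>) (carrier H)"
      using \<eta>b \<rho>h(2) by (intro comp_inj_on) (auto simp: bij_betw_def)
  qed
  have over: "(\<rho> \<circ> \<eta>) ` carrier H \<subseteq> fps_over T" using c \<rho>(2) by auto
  have inv: "(\<rho> \<circ> \<eta>) g = \<rho> (\<iota> g)" if "g \<in> A" for g
  proof -
    have "inj_on \<psi> (carrier X)" using \<psi> by (auto simp: iso_def bij_betw_def)
    then have "\<eta> (\<psi> (\<iota> g)) = \<iota> g" unfolding \<eta>_def using \<iota>(1)[OF that] by (rule inv_into_f_f)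
    then show ?thesis using \<iota>(2)[OF that] by simp
  qed
  have BP: "BP_group H"
  proof (rule BP_group_mon[OF H gX])
    show "bp_set X (carrier X)"
      using bp_set_image[OF X gX, of "\<lambda>x. x"] by (simp add: mon_def hom_def)
    show "\<eta> \<in> mon H X" using \<eta>h \<eta>b by (auto simp: mon_def bij_betw_def)
    show "\<eta> ` carrier H \<subseteq> carrier X" using c by auto
  qed
  show ?thesis using m over inv BP by blast
qed

text \<open>In an abelian \<open>H\<close> every image commutes with the nontrivial series
  \<open>mob l\<close>. A series in this centralizer is determined by its second coefficient, and
  the Moebius series realize all values.\<close>

lemma mob_extend:
  assumes H: "group H" and GH: "is_subgroup_of G H" and r': "r' \<in> mon H subst_group"
    and mob: "\<And>x. x \<in> carrier G \<Longrightarrow> \<exists>l. r' x = mob l" and ab: "abelian_on H"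
    and u: "u \<in> carrier G" "r' u \<noteq> fps_X" and y: "y \<in> carrier H"
  shows "\<exists>l. r' y = mob l"
proof -
  have rh: "r' \<in> hom H subst_group" using r' by (auto simp: mon_def)
  have uH: "u \<in> carrier H" using GH u by (auto simp: is_subgroup_of_def)
  obtain l where l: "r' u = mob l" using mob[OF u(1)] by blast
  have l0: "l \<noteq> 0" using u(2) l mob_0 by auto
  have fl: "flat 2 (mob l)" by (simp add: flat_def mob_carrier)
  have c: "r' y \<in> carrier subst_group" using rh y by (auto simp: hom_def)
  have "r' (y \<otimes>\<^bsub>H\<^esub> u) = r' (u \<otimes>\<^bsub>H\<^esub> y)" using ab y uH by (simp add: abelian_on_def)
  then have cm: "r' y oo mob l = mob l oo r' y"
    using hom_mult[OF rh y uH] hom_mult[OF rh uH y] by (simp add: subst_mult l)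
  have "r' y = mob (- fps_nth (r' y) 2)"
    by (rule commuting_inj[OF fl _ _ c cm mob_carrier]) (use l0 in \<open>simp_all add: mob_nth mob_compose add.commute\<close>)
  then show ?thesis by blast
qed

text \<open>A single statement for all kinds of steps, over the ring with both new numbers; the
  kinds that consume only \<open>s\<close> are included in it by monotonicity. If \<open>H\<close>
  is abelian, as for a centralizer extension of an abelian \<open>G\<close>,
  \<open>mob_extend\<close> restores the Moebius form.\<close>

lemma successor_embedding:
  fixes G H :: "'a monoid"
  assumes BP: "BP_group G" and r: "r \<in> mon G subst_group" and S: "qsubring S"
    and rS: "r ` carrier G \<subseteq> fps_over S" and s: "transc S s" and t: "transc (adjoin S s) t"
    and mob: "\<And>x. abelian_on G \<Longrightarrow> x \<in> carrier G \<Longrightarrow> \<exists>l. r x = mob l"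
    and GH: "is_subgroup_of G H"
    and ext: "(\<exists>F C. subgroup F G \<and> F \<noteq> {\<one>\<^bsub>G\<^esub>} \<and>
         (C = {\<one>\<^bsub>G\<^esub>} \<or>
          (\<exists>u\<in>F - {\<one>\<^bsub>G\<^esub>}. C = centralizer G u \<and> C = centralizer (G\<lparr>carrier := F\<rparr>) u)) \<and>
         is_amalgam H G (G\<lparr>carrier := F\<rparr>) C)
      \<or> is_centr_ext H G"
  shows "\<exists>r'\<in>mon H subst_group. r' ` carrier H \<subseteq> fps_over (adjoin (adjoin S s) t) \<and> (\<forall>g\<in>carrier G. r' g = r g) \<and>
    BP_group H \<and> (abelian_on H \<longrightarrow> (\<forall>x\<in>carrier H. \<exists>l. r' x = mob l))"
proof -
  have G: "group G" and H: "group H" using GH by (auto simp: is_subgroup_of_def)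
  interpret G: group G by (rule G)
  have rh: "r \<in> hom G subst_group" and rinj: "inj_on r (carrier G)" using r by (auto simp: mon_def)
  have r1: "r \<one>\<^bsub>G\<^esub> = fps_X" using hom_one[OF rh G subst_group_is_group] by (simp add: subst_one)
  let ?T = "adjoin (adjoin S s) t"
  have up: "fps_over (adjoin S s) \<subseteq> fps_over ?T"
    using fps_over_mono[OF adjoin_superset[OF qsubring_adjoin[OF S]]] by blast
  have "\<exists>r'\<in>mon H subst_group. r' ` carrier H \<subseteq> fps_over ?T \<and> (\<forall>g\<in>carrier G. r' g = r g) \<and> BP_group H"
  proof -
    from ext consider
      (free) F where "subgroup F G" "is_amalgam H G (G\<lparr>carrier := F\<rparr>) {\<one>\<^bsub>G\<^esub>}"
      | (amal) F C u where "subgroup F G" "u \<in> F" "u \<noteq> \<one>\<^bsub>G\<^esub>" "C = centralizer G u" "C = centralizer (G\<lparr>carrier := F\<rparr>) u"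
          "is_amalgam H G (G\<lparr>carrier := F\<rparr>) C"
      | (centr) "is_centr_ext H G" by blast
    then show ?thesis
    proof cases
      case free
      let ?X = "amalgam G (G\<lparr>carrier := F\<rparr>) {\<one>\<^bsub>G\<^esub>}"
      let ?i = "amalgam_incl G (G\<lparr>carrier := F\<rparr>) {\<one>\<^bsub>G\<^esub>}"
      have X: "BP_group ?X" "\<exists>\<psi> \<in> mon ?X subst_group. (\<forall>A \<in> carrier ?X. \<psi> A \<in> fps_over ?T) \<and> (\<forall>g \<in> carrier G. \<psi> (?i g) = r g)"
      proof -
        consider (ab) "abelian_on G" | (nonab) a b where "a \<in> carrier G" "b \<in> carrier G" "a \<otimes>\<^bsub>G\<^esub> b \<noteq> b \<otimes>\<^bsub>G\<^esub> a"
          by (auto simp: abelian_on_def)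
        then have "BP_group ?X \<and> (\<exists>\<psi> \<in> mon ?X subst_group. (\<forall>A \<in> carrier ?X. \<psi> A \<in> fps_over ?T) \<and> (\<forall>g \<in> carrier G. \<psi> (?i g) = r g))"
        proof cases
          case ab
          then have m: "\<And>x. x \<in> carrier G \<Longrightarrow> \<exists>l. r x = mob l" using mob by blast
          show ?thesis by (rule conjI[OF free_product_embedding_abelian[OF G free(1) r S rS m s t]])
        next
          case nonab
          show ?thesis by (rule conjI[OF free_product_embedding_nonabelian[OF BP free(1) r S rS nonab s t]])
        qed
        then show "BP_group ?X" "\<exists>\<psi> \<in> mon ?X subst_group. (\<forall>A \<in> carrier ?X. \<psi> A \<in> fps_over ?T) \<and> (\<forall>g \<in> carrier G. \<psi> (?i g) = r g)"
          by simp_all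
      qed
      then obtain \<rho> where \<rho>: "\<rho> \<in> mon ?X subst_group" "\<And>A. A \<in> carrier ?X \<Longrightarrow> \<rho> A \<in> fps_over ?T"
        "\<And>g. g \<in> carrier G \<Longrightarrow> \<rho> (?i g) = r g" by blast
      obtain \<psi> where \<psi>: "\<psi> \<in> iso ?X H" "\<And>g. g \<in> carrier G \<Longrightarrow> \<psi> (?i g) = g"
        using free(2) unfolding is_amalgam_def by blast
      have ic: "\<And>g. g \<in> carrier G \<Longrightarrow> ?i g \<in> carrier ?X" using hom_in_carrier[OF amalgam_incl_hom[OF G]] .
      obtain r' where "r'\<in>mon H subst_group" "r' ` carrier H \<subseteq> fps_over ?T" "\<forall>g\<in>carrier G. r' g = \<rho> (?i g)" "BP_group H"
        using transport_embedding[OF X(1) H \<psi>(1) \<rho>(1,2) ic \<psi>(2)] by blast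
      then show ?thesis using \<rho>(3) by (intro bexI[of _ r'] conjI ballI) auto
    next
      case amal
      let ?X = "amalgam G (G\<lparr>carrier := F\<rparr>) C"
      let ?i = "amalgam_incl G (G\<lparr>carrier := F\<rparr>) C"
      interpret F: subgroup F G by (rule amal(1))
      have uG: "u \<in> carrier G" using amal(2) by simp
      define K where "K = r ` carrier G"
      have K: "bp_set subst_group K" unfolding K_def by (rule bp_set_image[OF BP subst_group_is_group r])
      have w: "r u \<in> K" "r u \<noteq> fps_X" "r u \<in> fps_over S"
        using uG rS inj_onD[OF rinj _ uG G.one_closed] r1 amal(3) by (auto simp: K_def)
      have C: "C = {x \<in> carrier G. r x oo r u = r u oo r x}"
      proof -
        have "x \<otimes>\<^bsub>G\<^esub> u = u \<otimes>\<^bsub>G\<^esub> x \<longleftrightarrow> r x oo r u = r u oo r x" if "x \<in> carrier G" for x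
          using inj_on_eq_iff[OF rinj, of "x \<otimes>\<^bsub>G\<^esub> u" "u \<otimes>\<^bsub>G\<^esub> x"] that uG
            hom_mult[OF rh that uG] hom_mult[OF rh uG that] by (simp add: subst_mult)
        then show ?thesis unfolding amal(4) centralizer_def by blast
      qed
      have CF: "C \<subseteq> F" unfolding amal(5) by (auto simp: centralizer_def)
      have rK: "r ` carrier G \<subseteq> K" by (simp add: K_def)
      note emb = amalgam_embedding[OF G amal(1) r S K rK rS w C CF s]
      obtain \<rho> where \<rho>: "\<rho> \<in> mon ?X subst_group" "\<And>A. A \<in> carrier ?X \<Longrightarrow> \<rho> A \<in> fps_over (adjoin S s)"
        "\<And>g. g \<in> carrier G \<Longrightarrow> \<rho> (?i g) = r g" using emb(2) by blast
      obtain \<psi> where \<psi>: "\<psi> \<in> iso ?X H" "\<And>g. g \<in> carrier G \<Longrightarrow> \<psi> (?i g) = g"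
        using amal(6) unfolding is_amalgam_def by blast
      have ic: "\<And>g. g \<in> carrier G \<Longrightarrow> ?i g \<in> carrier ?X" using hom_in_carrier[OF amalgam_incl_hom[OF G]] .
      obtain r' where "r'\<in>mon H subst_group" "r' ` carrier H \<subseteq> fps_over (adjoin S s)" "\<forall>g\<in>carrier G. r' g = \<rho> (?i g)" "BP_group H"
        using transport_embedding[OF emb(1) H \<psi>(1) \<rho>(1,2) ic \<psi>(2)] by blast
      then show ?thesis using \<rho>(3) up by (intro bexI[of _ r'] conjI ballI) auto
    next
      case centr
      obtain u \<psi> where u: "u \<in> carrier G" "u \<noteq> \<one>\<^bsub>G\<^esub>" and
        \<psi>: "\<psi> \<in> iso (centr_ext G u) H" "\<And>g. g \<in> carrier G \<Longrightarrow> \<psi> (centr_ext_incl G u g) = g"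
        using centr unfolding is_centr_ext_def by blast
      note emb = centr_ext_embedding[OF BP r S rS u s]
      obtain \<rho> where \<rho>: "\<rho> \<in> mon (centr_ext G u) subst_group" "\<And>A. A \<in> carrier (centr_ext G u) \<Longrightarrow> \<rho> A \<in> fps_over (adjoin S s)"
        "\<And>g. g \<in> carrier G \<Longrightarrow> \<rho> (centr_ext_incl G u g) = r g" using emb(2) by blast
      have ic: "\<And>g. g \<in> carrier G \<Longrightarrow> centr_ext_incl G u g \<in> carrier (centr_ext G u)"
        using hom_in_carrier[OF centr_ext_incl_hom[OF G]] .
      obtain r' where "r'\<in>mon H subst_group" "r' ` carrier H \<subseteq> fps_over (adjoin S s)" "\<forall>g\<in>carrier G. r' g = \<rho> (centr_ext_incl G u g)" "BP_group H"
        using transport_embedding[OF emb(1) H \<psi>(1) \<rho>(1,2) ic \<psi>(2)] by blast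
      then show ?thesis using \<rho>(3) up by (intro bexI[of _ r'] conjI ballI) auto
    qed
  qed
  then obtain r' where r': "r'\<in>mon H subst_group" "r' ` carrier H \<subseteq> fps_over ?T" "\<And>g. g \<in> carrier G \<Longrightarrow> r' g = r g" "BP_group H"
    by blast
  \<comment> \<open>The anchor for \<open>mob_extend\<close>: a nontrivial subgroup F, or the
    element whose centralizer is extended, provides it.\<close>
  have "\<exists>u\<in>carrier G. u \<noteq> \<one>\<^bsub>G\<^esub>"
    using ext
  proof
    assume "\<exists>F C. subgroup F G \<and> F \<noteq> {\<one>\<^bsub>G\<^esub>} \<and>
         (C = {\<one>\<^bsub>G\<^esub>} \<or> (\<exists>u\<in>F - {\<one>\<^bsub>G\<^esub>}. C = centralizer G u \<and> C = centralizer (G\<lparr>carrier := F\<rparr>) u)) \<and>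
         is_amalgam H G (G\<lparr>carrier := F\<rparr>) C"
    then obtain F where F: "subgroup F G" "F \<noteq> {\<one>\<^bsub>G\<^esub>}" by blast
    then show ?thesis using subgroup.subset[OF F(1)] subgroup.one_closed[OF F(1)] by blast
  qed (auto simp: is_centr_ext_def)
  then obtain u where u: "u \<in> carrier G" "u \<noteq> \<one>\<^bsub>G\<^esub>" by blast
  have ru: "r' u \<noteq> fps_X" using inj_onD[OF rinj _ u(1) G.one_closed] u r1 r'(3) by auto
  have "\<exists>l. r' y = mob l" if ab: "abelian_on H" and y: "y \<in> carrier H" for y
  proof -
    have sub: "carrier G \<subseteq> carrier H" "\<And>x y. x \<in> carrier G \<Longrightarrow> y \<in> carrier G \<Longrightarrow> x \<otimes>\<^bsub>G\<^esub> y = x \<otimes>\<^bsub>H\<^esub> y"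
      using GH unfolding is_subgroup_of_def by auto
    have "abelian_on G" unfolding abelian_on_def
      using ab sub by (auto simp: abelian_on_def)
    then have "\<exists>l. r' x = mob l" if "x \<in> carrier G" for x using mob that r'(3) by simp
    then show ?thesis by (rule mob_extend[OF H GH r'(1) _ ab u(1) ru y])
  qed
  then show ?thesis using r' by blast
qed

text \<open>All images commute with that of a nontrivial \<open>u\<close>, so the coefficient at the
  order of the latter is an injective additive invariant. It becomes the parameter of a Moebius
  series, which replaces the original embedding.\<close>

lemma abelian_mob_embedding:
  assumes G: "group G" and r: "r \<in> mon G subst_group"
  shows "\<exists>r'\<in>mon G subst_group. abelian_on G \<longrightarrow> (\<forall>x\<in>carrier G. \<exists>l. r' x = mob l)"
proof (cases "abelian_on G \<and> (\<exists>u\<in>carrier G. u \<noteq> \<one>\<^bsub>G\<^esub>)")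
  case True
  then obtain u where ab: "abelian_on G" and u: "u \<in> carrier G" "u \<noteq> \<one>\<^bsub>G\<^esub>" by blast
  interpret G: group G by (rule G)
  have rh: "r \<in> hom G subst_group" and rinj: "inj_on r (carrier G)" using r by (auto simp: mon_def)
  have r1: "r \<one>\<^bsub>G\<^esub> = fps_X" using hom_one[OF rh G subst_group_is_group] by (simp add: subst_one)
  have rc: "r x \<in> carrier subst_group" if "x \<in> carrier G" for x using hom_in_carrier[OF rh that] .
  have rm: "r (x \<otimes>\<^bsub>G\<^esub> y) = r x oo r y" if "x \<in> carrier G" "y \<in> carrier G" for x y
    using hom_mult[OF rh that] by (simp add: subst_mult)
  have "r u \<noteq> fps_X" using inj_onD[OF rinj _ u(1) G.one_closed] u r1 by auto
  then obtain n where n: "2 \<le> n" "flat n (r u)" "fps_nth (r u) n \<noteq> 0" using flat_obtain[OF rc[OF u(1)]] by blast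
  have comm: "r x oo r u = r u oo r x" if "x \<in> carrier G" for x
  proof -
    have "x \<otimes>\<^bsub>G\<^esub> u = u \<otimes>\<^bsub>G\<^esub> x" using ab that u(1) unfolding abelian_on_def by blast
    then show ?thesis by (simp only: rm[OF that u(1), symmetric] rm[OF u(1) that, symmetric])
  qed
  define r' where "r' x = mob (fps_nth (r x) n)" for x
  have "r' \<in> mon G subst_group"
    unfolding mon_def mem_Collect_eq
  proof
    show "r' \<in> hom G subst_group"
    proof (rule homI)
      show "r' x \<in> carrier subst_group" for x by (simp add: r'_def mob_carrier)
      show "r' (x \<otimes>\<^bsub>G\<^esub> y) = r' x \<otimes>\<^bsub>subst_group\<^esub> r' y" if "x \<in> carrier G" "y \<in> carrier G" for x y
        using commuting_add[OF n(2,1,3) rc[OF that(1)] comm[OF that(1)] rc[OF that(2)] comm[OF that(2)]]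
        by (simp add: r'_def rm that subst_mult mob_compose)
    qed
    show "inj_on r' (carrier G)"
    proof (rule inj_onI)
      fix x y assume xy: "x \<in> carrier G" "y \<in> carrier G" "r' x = r' y"
      then have "fps_nth (r' x) 2 = fps_nth (r' y) 2" by (simp only:)
      then have "fps_nth (r x) n = fps_nth (r y) n" by (simp only: r'_def mob_nth neg_equal_iff_equal)
      then have "r x = r y"
        by (rule commuting_inj[OF n(2,1,3) rc[OF xy(1)] comm[OF xy(1)] rc[OF xy(2)] comm[OF xy(2)]])
      then show "x = y" using inj_onD[OF rinj] xy by blast
    qed
  qed
  then show ?thesis by (intro bexI[of _ r']) (auto simp: r'_def)
next
  case False
  have r1: "r \<one>\<^bsub>G\<^esub> = mob 0"
    using hom_one[of r G subst_group] r G subst_group_is_group by (simp add: subst_one mob_0 mon_def)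
  show ?thesis
  proof (intro bexI[of _ r] impI ballI)
    fix x assume "abelian_on G" "x \<in> carrier G"
    then have "x = \<one>\<^bsub>G\<^esub>" using False by blast
    then show "\<exists>l. r x = mob l" using r1 by blast
  qed (rule r)
qed

text \<open>There are countably many coefficients per element: the total is countable for finite
  \<open>A\<close>, and no larger than \<open>A\<close> for infinite \<open>A\<close>.\<close>

lemma coefficients_lesspoll:
  assumes "A \<prec> (UNIV :: real set)"
  shows "(\<lambda>(x, n). fps_nth (r x :: real fps) n) ` (A \<times> UNIV) \<prec> (UNIV :: real set)"
proof (cases "finite A")
  case True
  let ?K = "(\<lambda>(x, n). fps_nth (r x) n) ` (A \<times> UNIV)"
  have K: "countable ?K" using countable_finite[OF True] by (intro countable_image countable_SIGMA) auto
  have "?K \<lesssim> (UNIV :: real set)" by (rule countable_lepoll_infinite[OF K infinite_UNIV_char_0])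
  moreover have "\<not> (UNIV :: real set) \<lesssim> ?K" using countable_lepoll[OF K] uncountable_UNIV_real by blast
  ultimately show ?thesis by (simp add: lesspoll_iff_not)
next
  case False
  have N: "(UNIV :: nat set) \<lesssim> A" by (rule countable_lepoll_infinite[OF _ False]) simp
  have "(\<lambda>(x, n). fps_nth (r x) n) ` (A \<times> UNIV) \<lesssim> A \<times> (UNIV :: nat set)" by (rule image_lepoll)
  also have "\<dots> \<lesssim> A" by (rule Times_lepoll_infinite[OF False lepoll_refl N])
  also have "\<dots> \<prec> (UNIV :: real set)" by (rule assms)
  finally show ?thesis .
qed

section \<open>Transfinite recursion along the chain\<close>

lemma subgroup_inclusion_mon: "is_subgroup_of A B \<Longrightarrow> (\<lambda>x. x) \<in> mon A B"
  by (auto simp: is_subgroup_of_def mon_def hom_def)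

lemma ord_zero_le: "ord_zero \<le> (\<beta> :: 'i::wellorder)"
  unfolding ord_zero_def by (rule Least_le) simp

text \<open>The clause on Moebius maps keeps the abelian groups of the chain inside a one-parameter group.\<close>

definition good_embedding :: "'a monoid \<Rightarrow> real set \<Rightarrow> ('a \<Rightarrow> real fps) \<Rightarrow> bool" where
  "good_embedding G S r \<longleftrightarrow> r \<in> mon G subst_group \<and> r ` carrier G \<subseteq> fps_over S \<and> BP_group G \<and>
     (abelian_on G \<longrightarrow> (\<forall>x\<in>carrier G. \<exists>l. r x = mob l))"

text \<open>Finitely many elements of the union lie in one member of the chain. Multiplicativity,
  injectivity and the big powers condition each concern finitely many elements at a time, so they
  are inherited.\<close>

lemma good_embedding_union:
  fixes G :: "'i::wellorder \<Rightarrow> 'a monoid"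
  assumes H: "group H" and I: "I \<noteq> {}"
    and sub: "\<And>\<alpha>. \<alpha> \<in> I \<Longrightarrow> is_subgroup_of (G \<alpha>) H" "carrier H = (\<Union>\<alpha>\<in>I. carrier (G \<alpha>))"
    and mono: "\<And>\<alpha> \<beta>. \<alpha> \<in> I \<Longrightarrow> \<beta> \<in> I \<Longrightarrow> \<alpha> \<le> \<beta> \<Longrightarrow> carrier (G \<alpha>) \<subseteq> carrier (G \<beta>)"
    and f: "\<And>\<alpha>. \<alpha> \<in> I \<Longrightarrow> good_embedding (G \<alpha>) S (f \<alpha>)"
    and coh: "\<And>\<alpha> \<beta> x. \<alpha> \<in> I \<Longrightarrow> \<beta> \<in> I \<Longrightarrow> \<alpha> \<le> \<beta> \<Longrightarrow> x \<in> carrier (G \<alpha>) \<Longrightarrow> f \<beta> x = f \<alpha> x"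
  shows "\<exists>r. good_embedding H S r \<and> (\<forall>\<alpha>\<in>I. \<forall>x\<in>carrier (G \<alpha>). r x = f \<alpha> x)"
proof -
  define r where "r x = f (SOME \<alpha>. \<alpha> \<in> I \<and> x \<in> carrier (G \<alpha>)) x" for x
  have rf: "r x = f \<alpha> x" if x: "\<alpha> \<in> I" "x \<in> carrier (G \<alpha>)" for \<alpha> x
  proof -
    define \<beta> where "\<beta> = (SOME \<alpha>. \<alpha> \<in> I \<and> x \<in> carrier (G \<alpha>))"
    have \<beta>: "\<beta> \<in> I \<and> x \<in> carrier (G \<beta>)" unfolding \<beta>_def
      by (rule someI[of "\<lambda>\<alpha>. \<alpha> \<in> I \<and> x \<in> carrier (G \<alpha>)"]) (use x in blast)
    have "r x = f \<beta> x" by (simp add: r_def \<beta>_def)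
    also have "\<dots> = f \<alpha> x"
      using coh[of \<alpha> \<beta> x] coh[of \<beta> \<alpha> x] \<beta> x linear[of \<alpha> \<beta>] by metis
    finally show ?thesis .
  qed
  have common: "\<exists>\<alpha>\<in>I. set xs \<subseteq> carrier (G \<alpha>)" if "set xs \<subseteq> carrier H" for xs
    using that
  proof (induction xs)
    case Nil
    then show ?case using I by auto
  next
    case (Cons x xs)
    then obtain \<alpha> where \<alpha>: "\<alpha> \<in> I" "set xs \<subseteq> carrier (G \<alpha>)" by auto
    obtain \<beta> where \<beta>: "\<beta> \<in> I" "x \<in> carrier (G \<beta>)" using Cons.prems sub(2) by auto
    have "max \<alpha> \<beta> \<in> I" using \<alpha> \<beta> by (simp add: max_def)
    moreover have "carrier (G \<alpha>) \<subseteq> carrier (G (max \<alpha> \<beta>))" "carrier (G \<beta>) \<subseteq> carrier (G (max \<alpha> \<beta>))"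
      by (rule mono[OF _ \<open>max \<alpha> \<beta> \<in> I\<close>]; simp add: \<alpha> \<beta>)+
    ultimately show ?case using \<alpha> \<beta> by (intro bexI[of _ "max \<alpha> \<beta>"]) auto
  qed
  have common2: "\<exists>\<alpha>\<in>I. x \<in> carrier (G \<alpha>) \<and> y \<in> carrier (G \<alpha>)" if "x \<in> carrier H" "y \<in> carrier H" for x y
    using common[of "[x, y]"] that by simp
  have m: "x \<otimes>\<^bsub>H\<^esub> y = x \<otimes>\<^bsub>G \<alpha>\<^esub> y" "x \<otimes>\<^bsub>H\<^esub> y \<in> carrier (G \<alpha>)"
    if "\<alpha> \<in> I" "x \<in> carrier (G \<alpha>)" "y \<in> carrier (G \<alpha>)" for \<alpha> x y
  proof -
    have s: "is_subgroup_of (G \<alpha>) H" by (rule sub(1)[OF that(1)])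
    then show "x \<otimes>\<^bsub>H\<^esub> y = x \<otimes>\<^bsub>G \<alpha>\<^esub> y" using that by (simp add: is_subgroup_of_def)
    moreover have "group (G \<alpha>)" using s by (simp add: is_subgroup_of_def)
    then have "x \<otimes>\<^bsub>G \<alpha>\<^esub> y \<in> carrier (G \<alpha>)" using that by (simp add: group.is_monoid monoid.m_closed)
    ultimately show "x \<otimes>\<^bsub>H\<^esub> y \<in> carrier (G \<alpha>)" by simp
  qed
  have fm: "f \<alpha> \<in> hom (G \<alpha>) subst_group" "inj_on (f \<alpha>) (carrier (G \<alpha>))" "f \<alpha> ` carrier (G \<alpha>) \<subseteq> fps_over S"
    "BP_group (G \<alpha>)" "abelian_on (G \<alpha>) \<Longrightarrow> \<forall>x\<in>carrier (G \<alpha>). \<exists>l. f \<alpha> x = mob l" if "\<alpha> \<in> I" for \<alpha>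
    using f[OF that] by (auto simp: good_embedding_def mon_def)
  have "r \<in> mon H subst_group" unfolding mon_def mem_Collect_eq
  proof
    show "r \<in> hom H subst_group"
    proof (rule homI)
      fix x assume "x \<in> carrier H"
      then obtain \<alpha> where "\<alpha> \<in> I" "x \<in> carrier (G \<alpha>)" using sub(2) by auto
      then show "r x \<in> carrier subst_group" using hom_in_carrier[OF fm(1)] rf by simp
    next
      fix x y assume "x \<in> carrier H" "y \<in> carrier H"
      then obtain \<alpha> where \<alpha>: "\<alpha> \<in> I" "x \<in> carrier (G \<alpha>)" "y \<in> carrier (G \<alpha>)" using common2 by blast
      show "r (x \<otimes>\<^bsub>H\<^esub> y) = r x \<otimes>\<^bsub>subst_group\<^esub> r y"
        using hom_mult[OF fm(1)[OF \<alpha>(1)] \<alpha>(2,3)] rf[OF \<alpha>(1) m(2)[OF \<alpha>]] m(1)[OF \<alpha>] rf[OF \<alpha>(1,2)] rf[OF \<alpha>(1,3)] by simp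
    qed
    show "inj_on r (carrier H)"
    proof (rule inj_onI)
      fix x y assume xy: "x \<in> carrier H" "y \<in> carrier H" "r x = r y"
      then obtain \<alpha> where \<alpha>: "\<alpha> \<in> I" "x \<in> carrier (G \<alpha>)" "y \<in> carrier (G \<alpha>)" using common2 by blast
      then show "x = y" using inj_onD[OF fm(2)[OF \<alpha>(1)] _ \<alpha>(2,3)] xy(3) rf by simp
    qed
  qed
  moreover have "r ` carrier H \<subseteq> fps_over S"
  proof
    fix z assume "z \<in> r ` carrier H"
    then obtain x \<alpha> where x: "z = r x" "\<alpha> \<in> I" "x \<in> carrier (G \<alpha>)" using sub(2) by auto
    then show "z \<in> fps_over S" using fm(3)[OF x(2)] rf by auto
  qed
  moreover have "BP_group H" unfolding BP_group_def
  proof (intro conjI allI impI H)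
    fix us assume nt: "nontrivial_tuple H us" and cf: "commutation_free H us"
    then obtain \<alpha> where \<alpha>: "\<alpha> \<in> I" "set us \<subseteq> carrier (G \<alpha>)"
      using common[of us] by (auto simp: nontrivial_tuple_def)
    have "bp_set H ((\<lambda>x. x) ` carrier (G \<alpha>))"
      by (rule bp_set_image[OF fm(4)[OF \<alpha>(1)] H subgroup_inclusion_mon[OF sub(1)[OF \<alpha>(1)]]])
    then show "independent_tuple H us"
      using \<alpha>(2) nt cf by (auto simp: bp_set_def nontrivial_tuple_def)
  qed
  moreover have "\<exists>l. r x = mob l" if ab: "abelian_on H" and x: "x \<in> carrier H" for x
  proof -
    obtain \<alpha> where \<alpha>: "\<alpha> \<in> I" "x \<in> carrier (G \<alpha>)" using x sub(2) by auto
    have "abelian_on (G \<alpha>)" unfolding abelian_on_def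
    proof (intro ballI)
      fix a b assume ab': "a \<in> carrier (G \<alpha>)" "b \<in> carrier (G \<alpha>)"
      have "a \<otimes>\<^bsub>H\<^esub> b = b \<otimes>\<^bsub>H\<^esub> a" using ab ab' \<alpha>(1) sub(2) unfolding abelian_on_def by blast
      then show "a \<otimes>\<^bsub>G \<alpha>\<^esub> b = b \<otimes>\<^bsub>G \<alpha>\<^esub> a" by (simp only: m(1)[OF \<alpha>(1) ab'] m(1)[OF \<alpha>(1) ab'(2,1)])
    qed
    then show ?thesis using fm(5)[OF \<alpha>(1)] \<alpha>(2) rf[OF \<alpha>] by simp
  qed
  ultimately have "good_embedding H S r" by (simp add: good_embedding_def)
  then show ?thesis using rf by blast
qed

lemma good_embedding_mono: "S \<subseteq> T \<Longrightarrow> good_embedding G S r \<Longrightarrow> good_embedding G T r"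
  using fps_over_mono[of S T] unfolding good_embedding_def by blast

theorem theorem1p5:
  fixes \<delta> :: "'i::wellorder"
    and G :: "'i \<Rightarrow> 'a monoid"
  assumes card_delta: "{..<\<delta>} \<lesssim> (UNIV :: real set)"
    and groups: "\<And>\<alpha>. \<alpha> \<le> \<delta> \<Longrightarrow> group (G \<alpha>)"
    and chain: "\<And>\<alpha> \<beta>. \<alpha> \<le> \<beta> \<Longrightarrow> \<beta> \<le> \<delta> \<Longrightarrow> is_subgroup_of (G \<alpha>) (G \<beta>)"
    and limit: "\<And>\<beta>. ord_limit \<beta> \<Longrightarrow> \<beta> \<le> \<delta> \<Longrightarrow> carrier (G \<beta>) = (\<Union>\<alpha>\<in>{..<\<beta>}. carrier (G \<alpha>))"
    and succ: "\<And>\<alpha> \<beta>. ord_succ \<alpha> \<beta> \<Longrightarrow> \<beta> \<le> \<delta> \<Longrightarrow>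
      (\<exists>F C. subgroup F (G \<alpha>) \<and> F \<noteq> {\<one>\<^bsub>G \<alpha>\<^esub>} \<and>
         (C = {\<one>\<^bsub>G \<alpha>\<^esub>} \<or>
          (\<exists>u\<in>F - {\<one>\<^bsub>G \<alpha>\<^esub>}. C = centralizer (G \<alpha>) u \<and> C = centralizer ((G \<alpha>)\<lparr>carrier := F\<rparr>) u)) \<and>
         is_amalgam (G \<beta>) (G \<alpha>) ((G \<alpha>)\<lparr>carrier := F\<rparr>) C)
      \<or> is_centr_ext (G \<beta>) (G \<alpha>)"
    and card_G0: "carrier (G ord_zero) \<prec> (UNIV :: real set)"
  shows "BP_group (G \<delta>) \<and> embeddable (G \<delta>) subst_group \<longleftrightarrow>
         BP_group (G ord_zero) \<and> embeddable (G ord_zero) subst_group"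
proof
  \<comment> \<open>Both properties pass to subgroups, and the first group of the chain is a
    subgroup of the last.\<close>
  assume "BP_group (G \<delta>) \<and> embeddable (G \<delta>) subst_group"
  then obtain h where h: "BP_group (G \<delta>)" "h \<in> mon (G \<delta>) subst_group" by (auto simp: embeddable_def)
  have s: "is_subgroup_of (G ord_zero) (G \<delta>)" by (rule chain[OF ord_zero_le order_refl])
  then have g: "group (G ord_zero)" "group (G \<delta>)" "carrier (G ord_zero) \<subseteq> carrier (G \<delta>)" by (auto simp: is_subgroup_of_def)
  note i = subgroup_inclusion_mon[OF s]
  have bp: "bp_set (G \<delta>) (carrier (G \<delta>))"
    using bp_set_image[OF h(1) g(2), of "\<lambda>x. x"] by (simp add: mon_def hom_def)
  have "BP_group (G ord_zero)" by (rule BP_group_mon[OF g(1,2) bp i]) (use g(3) in simp)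
  moreover have "h \<circ> (\<lambda>x. x) \<in> mon (G ord_zero) subst_group"
    using i h(2) g(3) unfolding mon_def mem_Collect_eq
    by (intro conjI hom_compose[of _ _ "G \<delta>"] comp_inj_on) (auto intro: inj_on_subset)
  ultimately show "BP_group (G ord_zero) \<and> embeddable (G ord_zero) subst_group" by (auto simp: embeddable_def)
next
  assume "BP_group (G ord_zero) \<and> embeddable (G ord_zero) subst_group"
  then have BP0: "BP_group (G ord_zero)" and "\<exists>h. h \<in> mon (G ord_zero) subst_group" by (auto simp: embeddable_def)
  then obtain r0 where r0: "r0 \<in> mon (G ord_zero) subst_group"
      "abelian_on (G ord_zero) \<longrightarrow> (\<forall>x\<in>carrier (G ord_zero). \<exists>l. r0 x = mob l)"
    using abelian_mob_embedding by (metis BP_group_def)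
  define K where "K = (\<lambda>(x, n). fps_nth (r0 x) n) ` (carrier (G ord_zero) \<times> UNIV)"
  \<comment> \<open>Two indices for each step below \<delta>. The product with \<open>bool\<close>
    still injects into the reals.\<close>
  define I where "I = {..<\<delta>} \<times> (UNIV :: bool set)"
  have "I \<lesssim> (UNIV :: real set)" unfolding I_def
    by (rule Times_lepoll_infinite[OF infinite_UNIV_char_0 card_delta countable_lepoll_infinite[OF _ infinite_UNIV_char_0]]) simp
  then obtain e :: "'i \<times> bool \<Rightarrow> real" where e: "\<And>i. i \<in> I \<Longrightarrow> e i \<notin> acl (K \<union> e ` (I - {i}))"
    using transcendental_family[OF coefficients_lesspoll[OF card_G0, of r0]] unfolding K_def by blast
  define A where "A \<beta> = K \<union> e ` ({..<\<beta>} \<times> UNIV)" for \<beta>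
  have A_mono: "A \<alpha> \<subseteq> A \<beta>" if "\<alpha> \<le> \<beta>" for \<alpha> \<beta> using that by (auto simp: A_def)
  have start: "good_embedding (G ord_zero) (rg (A ord_zero)) r0"
    using r0 BP0 unfolding good_embedding_def
    by (auto simp: fps_over_def A_def K_def intro!: rg_base)
  \<comment> \<open>Coherence with all earlier stages is part of the invariant, since limit stages
    glue the previous embeddings. The recursion runs over the whole index type, so beyond \<delta>
    the condition is void.\<close>
  define P where "P f \<beta> r \<longleftrightarrow> (\<beta> \<le> \<delta> \<longrightarrow> good_embedding (G \<beta>) (rg (A \<beta>)) r \<and>
      (\<forall>\<gamma><\<beta>. \<forall>x\<in>carrier (G \<gamma>). r x = f \<gamma> x))" for f :: "'i \<Rightarrow> 'a \<Rightarrow> real fps" and \<beta> r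
  have "\<exists>f. \<forall>\<beta>. P f \<beta> (f \<beta>)"
  proof (rule dependent_wellorder_choice)
    show "P f \<beta> r = P g \<beta> r" if "\<And>\<gamma>. \<gamma> < \<beta> \<Longrightarrow> f \<gamma> = g \<gamma>" for f g \<beta> r
      using that by (simp add: P_def)
  next
    fix \<beta> f assume IH: "\<And>\<gamma>. \<gamma> < \<beta> \<Longrightarrow> P f \<gamma> (f \<gamma>)"
    show "\<exists>r. P f \<beta> r"
    proof (cases "\<beta> \<le> \<delta>")
      case le: True
      have good: "good_embedding (G \<gamma>) (rg (A \<gamma>)) (f \<gamma>)" if "\<gamma> < \<beta>" for \<gamma>
        using IH[OF that] that le by (auto simp: P_def)
      have coh: "f \<gamma> x = f \<gamma>' x" if "\<gamma> < \<beta>" "\<gamma>' \<le> \<gamma>" "x \<in> carrier (G \<gamma>')" for \<gamma> \<gamma>' x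
        using IH[OF that(1)] that le by (cases "\<gamma>' = \<gamma>") (auto simp: P_def)
      consider (zero) "\<beta> = ord_zero" | (succ) \<alpha> where "ord_succ \<alpha> \<beta>" | (limit) "ord_limit \<beta>"
        unfolding ord_limit_def by blast
      then show ?thesis
      proof cases
        case zero
        have "\<not> \<gamma> < \<beta>" for \<gamma> using ord_zero_le[of \<gamma>] by (simp add: zero)
        then show ?thesis using start zero by (intro exI[of _ r0]) (simp add: P_def)
      next
        case (succ \<alpha>)
        have \<alpha>: "\<alpha> < \<beta>" "\<And>\<gamma>. \<gamma> < \<beta> \<Longrightarrow> \<gamma> \<le> \<alpha>" using succ by (auto simp: ord_succ_def not_le[symmetric])
        have \<alpha>\<delta>: "\<alpha> < \<delta>" using \<alpha>(1) le by simp
        have g: "f \<alpha> \<in> mon (G \<alpha>) subst_group" "f \<alpha> ` carrier (G \<alpha>) \<subseteq> fps_over (rg (A \<alpha>))" "BP_group (G \<alpha>)"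
          and gm: "abelian_on (G \<alpha>) \<longrightarrow> (\<forall>x\<in>carrier (G \<alpha>). \<exists>l. f \<alpha> x = mob l)"
          using good[OF \<alpha>(1)] unfolding good_embedding_def by simp_all
        \<comment> \<open>Each reserved number is independent of the coefficients of the first group
          and of all other reserved numbers. In particular it is transcendental over the ring of the
          current stage, and the second number of the step remains so after the first is
          adjoined.\<close>
        have sub: "A \<alpha> \<subseteq> K \<union> e ` (I - {(\<alpha>, False)})" "insert (e (\<alpha>, False)) (A \<alpha>) \<subseteq> K \<union> e ` (I - {(\<alpha>, True)})"
          using \<alpha>\<delta> by (auto simp: A_def I_def)
        have "e (\<alpha>, False) \<notin> acl (A \<alpha>)" "e (\<alpha>, True) \<notin> acl (insert (e (\<alpha>, False)) (A \<alpha>))"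
          using e[of "(\<alpha>, False)"] e[of "(\<alpha>, True)"] \<alpha>\<delta> acl_mono[OF sub(1)] acl_mono[OF sub(2)] by (auto simp: I_def)
        then have tr: "transc (rg (A \<alpha>)) (e (\<alpha>, False))" "transc (adjoin (rg (A \<alpha>)) (e (\<alpha>, False))) (e (\<alpha>, True))"
          by (simp_all add: acl_def rg_insert)
        have lt: "{..<\<beta>} = insert \<alpha> {..<\<alpha>}" using \<alpha> by (force simp: le_less)
        have "A \<beta> = insert (e (\<alpha>, True)) (insert (e (\<alpha>, False)) (A \<alpha>))"
          unfolding A_def lt by (auto simp: image_iff UNIV_bool)
        then have AB: "rg (A \<beta>) = adjoin (adjoin (rg (A \<alpha>)) (e (\<alpha>, False))) (e (\<alpha>, True))"
          by (simp only: rg_insert)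
        obtain r where r: "r\<in>mon (G \<beta>) subst_group" "r ` carrier (G \<beta>) \<subseteq> fps_over (rg (A \<beta>))" "\<forall>g\<in>carrier (G \<alpha>). r g = f \<alpha> g"
          "BP_group (G \<beta>)" "abelian_on (G \<beta>) \<longrightarrow> (\<forall>x\<in>carrier (G \<beta>). \<exists>l. r x = mob l)"
        proof -
          have "\<exists>r'\<in>mon (G \<beta>) subst_group. r' ` carrier (G \<beta>) \<subseteq> fps_over (rg (A \<beta>)) \<and> (\<forall>g\<in>carrier (G \<alpha>). r' g = f \<alpha> g) \<and>
            BP_group (G \<beta>) \<and> (abelian_on (G \<beta>) \<longrightarrow> (\<forall>x\<in>carrier (G \<beta>). \<exists>l. r' x = mob l))"
            unfolding AB
            by (rule successor_embedding[OF g(3,1) qsubring_rg g(2) tr _ chain[OF less_imp_le[OF \<alpha>(1)] le] assms(5)[OF succ le]])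
               (use gm in blast)
          then show ?thesis by (elim bexE conjE) (rule that)
        qed
        have "r x = f \<gamma> x" if "\<gamma> < \<beta>" "x \<in> carrier (G \<gamma>)" for \<gamma> x
        proof -
          have "carrier (G \<gamma>) \<subseteq> carrier (G \<alpha>)"
            using chain[OF \<alpha>(2)[OF that(1)] less_imp_le[OF \<alpha>\<delta>]] by (simp add: is_subgroup_of_def)
          then have "r x = f \<alpha> x" using r(3) that(2) by blast
          also have "\<dots> = f \<gamma> x" by (rule coh[OF \<alpha>(1) \<alpha>(2)[OF that(1)] that(2)])
          finally show ?thesis .
        qed
        then show ?thesis using r by (intro exI[of _ r]) (simp add: P_def good_embedding_def)
      next
        case limit
        have "ord_zero \<noteq> \<beta>" using limit by (auto simp: ord_limit_def)
        then have "ord_zero < \<beta>" using ord_zero_le[of \<beta>] by (rule le_neq_trans[rotated])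
        then have ne: "{..<\<beta>} \<noteq> {}" by blast
        have "\<exists>r. good_embedding (G \<beta>) (rg (A \<beta>)) r \<and> (\<forall>\<alpha>\<in>{..<\<beta>}. \<forall>x\<in>carrier (G \<alpha>). r x = f \<alpha> x)"
        proof (rule good_embedding_union[OF groups[OF le] ne])
          show "carrier (G \<beta>) = (\<Union>\<alpha>\<in>{..<\<beta>}. carrier (G \<alpha>))" by (rule assms(4)[OF limit le])
          fix \<alpha> assume \<alpha>: "\<alpha> \<in> {..<\<beta>}"
          show "is_subgroup_of (G \<alpha>) (G \<beta>)" by (rule chain[OF _ le]) (use \<alpha> in simp)
          \<comment> \<open>The rings of the earlier stages are all contained in the ring of the
            limit stage, which serves as common coefficient ring for the union.\<close>
          show "good_embedding (G \<alpha>) (rg (A \<beta>)) (f \<alpha>)"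
            using \<alpha> by (intro good_embedding_mono[OF rg_mono[OF A_mono] good]) auto
          fix \<gamma> assume \<gamma>: "\<gamma> \<in> {..<\<beta>}" "\<alpha> \<le> \<gamma>"
          show "carrier (G \<alpha>) \<subseteq> carrier (G \<gamma>)"
            using chain[of \<alpha> \<gamma>] \<gamma> le by (simp add: is_subgroup_of_def)
          show "f \<gamma> x = f \<alpha> x" if "x \<in> carrier (G \<alpha>)" for x using coh \<gamma> that by simp
        qed
        then show ?thesis by (auto simp: P_def)
      qed
    qed (simp add: P_def)
  qed
  then obtain f where "\<forall>\<beta>. P f \<beta> (f \<beta>)" ..
  then have "good_embedding (G \<delta>) (rg (A \<delta>)) (f \<delta>)" by (simp add: P_def)
  then show "BP_group (G \<delta>) \<and> embeddable (G \<delta>) subst_group"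
    by (auto simp: good_embedding_def embeddable_def)
qed

end
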